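(* Let $k$ be a field of characteristic $2$ and let $E/k$ be an elliptic curve in $\mathbf{Z}/4\mathbf{Z}$-normal form $$(X_0+X_1+X_2+X_3)^2=c\,X_0X_2=c\,X_1X_3,\qquad \mathrm{O}=(1:0:0:1),$$ let $T=(1:1:0:0)$, and let $\mu:E\times E\to E$ be the addition morphism. Bases for the spaces of bilinear addition law projections for $\pi_1\circ\mu$ and $\pi_2\circ\mu$ are, respectively, $$\left\{\begin{array}{l}(X_0Y_3+X_2Y_1,\ X_1Y_0+X_3Y_2),\\(X_1Y_2+X_3Y_0,\ X_0Y_1+X_2Y_3)\end{array}\right\}\quad\text{and}\quad\left\{\begin{array}{l}(X_0Y_0+X_2Y_2,\ X_1Y_1+X_3Y_3),\\(X_1Y_3+X_3Y_1,\ X_0Y_2+X_2Y_0)\end{array}\right\}.$$ Addition laws of bidegree $(2,2)$ are recovered by composition with the skew-Segre embedding $$s((U_0:U_1),(V_0:V_1))=(U_0V_0:U_1V_0:U_1V_1:U_0V_1).$$ Each of the four basis elements above has an exceptional divisor of the form $2\Delta_{nT}$ for some $0\le n\le 3$.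
   Context: $X_i$ and $Y_i$ denote the coordinates on the first and second factor of $E\times E\subset\mathbb{P}^3\times\mathbb{P}^3$. The morphisms $\pi_1,\pi_2:E\to\mathbb{P}^1$ are $\pi_1(X_0:X_1:X_2:X_3)=(X_0:X_1)=(X_3:X_2)$ and $\pi_2(X_0:X_1:X_2:X_3)=(X_0:X_3)=(X_1:X_2)$ (each expression used where it is defined); $\pi_1\times\pi_2$ embeds $E$ in $\mathbb{P}^1\times\mathbb{P}^1$ with inverse the restriction of $s$. A bilinear addition law projection for $\pi_i\circ\mu$ is a pair $(p_0,p_1)$ of polynomials of bidegree $(1,1)$ in $(X_j),(Y_j)$, taken modulo the bihomogeneous ideal of $E\times E$, such that $(p_0:p_1)$ equals $\pi_i\circ\mu$ on the (nonempty open) complement of the common zeros of $p_0,p_1$; together with the zero pair these form a $k$-vector space. An addition law of bidegree $(2,2)$ is likewise a tuple $(p_0,\dots,p_3)$ of polynomials of bidegree $(2,2)$ modulo this ideal such that $(p_0:\dots:p_3)$ equals $\mu$ off its common zeros. The exceptional divisor of such a tuple is the divisor on $E\times E$ of common zeros of its entries. For a point $P$, $\Delta_P=\{(P+Q,Q)\mid Q\in E\}\subset E\times E$. *)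

theory Defs
  imports
    "HOL-Algebra.Algebraic_Closure_Type"
    "HOL-Library.Poly_Mapping"
    "HOL-Library.Numeral_Type"
    "HOL-Library.FuncSet"
begin

section \<open>Polynomials in finitely many variables\<close>

type_synonym ('v, 'a) mpol = "('v \<Rightarrow>\<^sub>0 nat) \<Rightarrow>\<^sub>0 'a"

definition indet :: "'v \<Rightarrow> ('v, 'a::comm_ring_1) mpol" where
  "indet v = Poly_Mapping.single (Poly_Mapping.single v 1) 1"

definition scalar :: "'a \<Rightarrow> ('v, 'a::comm_ring_1) mpol" where
  "scalar a = Poly_Mapping.single 0 a"

definition peval :: "('v::finite, 'a::comm_ring_1) mpol \<Rightarrow> ('v \<Rightarrow> 'a) \<Rightarrow> 'a" where
  "peval p x = (\<Sum>m\<in>Poly_Mapping.keys p.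
     Poly_Mapping.lookup p m * (\<Prod>v\<in>UNIV. x v ^ Poly_Mapping.lookup m v))"

definition partial :: "'v \<Rightarrow> ('v, 'a::comm_ring_1) mpol \<Rightarrow> ('v, 'a) mpol" where
  "partial v p = (\<Sum>m\<in>Poly_Mapping.keys p.
     Poly_Mapping.single (m - Poly_Mapping.single v 1)
       (of_nat (Poly_Mapping.lookup m v) * Poly_Mapping.lookup p m))"

definition base_change :: "('v, 'k::field) mpol \<Rightarrow> ('v, 'k alg_closure) mpol" where
  "base_change p = Poly_Mapping.map to_ac p"

definition homogeneous :: "nat \<Rightarrow> ('v::finite, 'a::comm_ring_1) mpol \<Rightarrow> bool" where
  "homogeneous d p \<longleftrightarrow>
     (\<forall>m\<in>Poly_Mapping.keys p. (\<Sum>v\<in>UNIV. Poly_Mapping.lookup m v) = d)"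

text \<open>
  The coordinate ring of \<open>\<P>\<^sup>3 \<times> \<P>\<^sup>3\<close> has the variables
  \<open>X\<^sub>i\<close> (index \<open>Inl i\<close>) and \<open>Y\<^sub>i\<close> (index \<open>Inr i\<close>),
  where \<open>i\<close> ranges over the type \<open>4\<close>, whose elements are \<open>0, 1, 2, 3\<close>.
\<close>

definition bihomogeneous :: "nat \<Rightarrow> nat \<Rightarrow> (4 + 4, 'a::comm_ring_1) mpol \<Rightarrow> bool" where
  "bihomogeneous a b p \<longleftrightarrow>
     (\<forall>m\<in>Poly_Mapping.keys p.
        (\<Sum>i\<in>UNIV. Poly_Mapping.lookup m (Inl i)) = a \<and>
        (\<Sum>i\<in>UNIV. Poly_Mapping.lookup m (Inr i)) = b)"

definition XX :: "4 \<Rightarrow> (4 + 4, 'a::comm_ring_1) mpol" where "XX i = indet (Inl i)"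
definition YY :: "4 \<Rightarrow> (4 + 4, 'a::comm_ring_1) mpol" where "YY i = indet (Inr i)"

definition pair :: "'b \<Rightarrow> 'b \<Rightarrow> 2 \<Rightarrow> 'b" where
  "pair a b = (\<lambda>i. if i = 0 then a else b)"

definition quadruple :: "'b \<Rightarrow> 'b \<Rightarrow> 'b \<Rightarrow> 'b \<Rightarrow> 4 \<Rightarrow> 'b" where
  "quadruple a b c d =
     (\<lambda>i. if i = 0 then a else if i = 1 then b else if i = 2 then c else d)"


section \<open>Ideals and local conditions\<close>

definition vanishing_ideal ::
    "('v::finite \<Rightarrow> 'a::comm_ring_1) set \<Rightarrow> ('v, 'a) mpol set" where
  "vanishing_ideal S = {p. \<forall>x\<in>S. peval p x = 0}"

definition ideal_gen :: "'r::comm_ring_1 set \<Rightarrow> 'r set" where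
  "ideal_gen G = module.span (*) G"

primrec ideal_power :: "'r::comm_ring_1 set \<Rightarrow> nat \<Rightarrow> 'r set" where
  "ideal_power J 0 = UNIV"
| "ideal_power J (Suc n) = ideal_gen {f * g | f g. f \<in> J \<and> g \<in> ideal_power J n}"

text \<open>
  \<open>germ x J\<close> is the preimage in the polynomial ring of the extension of the ideal \<open>J\<close>
  to the local ring at \<open>x\<close>. Two ideals have the same extension iff these preimages agree.
\<close>

definition germ ::
    "('v::finite \<Rightarrow> 'a::comm_ring_1) \<Rightarrow> ('v, 'a) mpol set \<Rightarrow> ('v, 'a) mpol set" where
  "germ x J = {f. \<exists>h. peval h x \<noteq> 0 \<and> h * f \<in> J}"


section \<open>The curve\<close>

text \<open>
  Points of projective space over the algebraic closure are represented by nonzero coordinate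
  vectors; \<open>proj_eq\<close> is equality of projective points.
\<close>

definition proj_eq :: "('i \<Rightarrow> 'a::field) \<Rightarrow> ('i \<Rightarrow> 'a) \<Rightarrow> bool" where
  "proj_eq x y \<longleftrightarrow> (\<exists>l. l \<noteq> 0 \<and> (\<forall>i. y i = l * x i))"

definition eqn1 :: "'k::field \<Rightarrow> (4, 'k) mpol" where
  "eqn1 c = (indet 0 + indet 1 + indet 2 + indet 3)\<^sup>2 - scalar c * indet 0 * indet 2"

definition eqn2 :: "'k::field \<Rightarrow> (4, 'k) mpol" where
  "eqn2 c = scalar c * indet 0 * indet 2 - scalar c * indet 1 * indet 3"

definition curve :: "'k::field \<Rightarrow> (4 \<Rightarrow> 'k alg_closure) set" where
  "curve c = {x. x \<noteq> (\<lambda>_. 0) \<and>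
     peval (base_change (eqn1 c)) x = 0 \<and> peval (base_change (eqn2 c)) x = 0}"

definition pt_O :: "4 \<Rightarrow> 'a::field" where "pt_O = quadruple 1 0 0 1"
definition pt_T :: "4 \<Rightarrow> 'a::field" where "pt_T = quadruple 1 1 0 0"

text \<open>
  The Jacobian criterion at all geometric points. A smooth complete intersection of two quadrics
  in \<open>\<P>\<^sup>3\<close> is a curve of genus 1, so together with the rational point \<open>O\<close>
  this says that the equations define an elliptic curve.
\<close>

definition elliptic :: "'k::field \<Rightarrow> bool" where
  "elliptic c \<longleftrightarrow> pt_O \<in> curve c \<and>
     (\<forall>x\<in>curve c. \<forall>a b.
        (\<forall>i. a * peval (partial i (base_change (eqn1 c))) x
           + b * peval (partial i (base_change (eqn2 c))) x = 0) \<longrightarrow> a = 0 \<and> b = 0)"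


section \<open>The group law\<close>

text \<open>
  Order of vanishing at the point \<open>x\<close> of the curve, read off from the powers of the maximal
  ideal of the local ring at \<open>x\<close>. Only meant for \<open>f\<close> not vanishing on the whole curve.
\<close>

definition ord_at ::
    "'k::field \<Rightarrow> (4 \<Rightarrow> 'k alg_closure) \<Rightarrow> (4, 'k alg_closure) mpol \<Rightarrow> nat" where
  "ord_at c x f = (GREATEST m.
     f \<in> germ x (ideal_gen (ideal_power (vanishing_ideal {y. proj_eq x y}) m
                             \<union> vanishing_ideal (curve c))))"

definition point_divisor ::
    "(4 \<Rightarrow> 'a::field) \<Rightarrow> (4 \<Rightarrow> 'a) \<Rightarrow> int" where
  "point_divisor P = (\<lambda>S. if proj_eq P S then 1 else 0)"

text \<open>
  Linear equivalence: \<open>D - D'\<close> is the divisor of a rational function \<open>f / g\<close>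
  with \<open>f\<close> and \<open>g\<close> forms of equal degree.
\<close>

definition lin_equiv ::
    "'k::field \<Rightarrow> ((4 \<Rightarrow> 'k alg_closure) \<Rightarrow> int) \<Rightarrow> ((4 \<Rightarrow> 'k alg_closure) \<Rightarrow> int) \<Rightarrow> bool"
  where
  "lin_equiv c D D' \<longleftrightarrow> (\<exists>d f g. homogeneous d f \<and> homogeneous d g \<and>
     f \<notin> vanishing_ideal (curve c) \<and> g \<notin> vanishing_ideal (curve c) \<and>
     (\<forall>S\<in>curve c. D S - D' S = int (ord_at c S f) - int (ord_at c S g)))"

text \<open>
  \<open>P + Q = R\<close> in the group law with neutral element \<open>O\<close> iff the divisors
  \<open>(P) + (Q)\<close> and \<open>(R) + (O)\<close> are linearly equivalent. Coordinates of \<open>R\<close>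
  are unique up to a scalar only, hence \<open>SOME\<close>.
\<close>

definition mu :: "'k::field \<Rightarrow> (4 \<Rightarrow> 'k alg_closure) \<Rightarrow> (4 \<Rightarrow> 'k alg_closure)
    \<Rightarrow> (4 \<Rightarrow> 'k alg_closure)" where
  "mu c P Q = (SOME R. R \<in> curve c \<and>
     lin_equiv c (\<lambda>S. point_divisor P S + point_divisor Q S)
                 (\<lambda>S. point_divisor R S + point_divisor pt_O S))"

definition pi1 :: "(4 \<Rightarrow> 'a::field) \<Rightarrow> 2 \<Rightarrow> 'a" where
  "pi1 x = (if x 0 \<noteq> 0 \<or> x 1 \<noteq> 0 then pair (x 0) (x 1) else pair (x 3) (x 2))"

definition pi2 :: "(4 \<Rightarrow> 'a::field) \<Rightarrow> 2 \<Rightarrow> 'a" where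
  "pi2 x = (if x 0 \<noteq> 0 \<or> x 3 \<noteq> 0 then pair (x 0) (x 3) else pair (x 1) (x 2))"


section \<open>Addition laws\<close>

definition ideal_EE :: "'k::field \<Rightarrow> (4 + 4, 'k alg_closure) mpol set" where
  "ideal_EE c = vanishing_ideal {case_sum x y | x y. x \<in> curve c \<and> y \<in> curve c}"

definition ideal_EE_rat :: "'k::field \<Rightarrow> (4 + 4, 'k) mpol set" where
  "ideal_EE_rat c = {p. base_change p \<in> ideal_EE c}"

definition zero_tuple :: "'k::field \<Rightarrow> ('i \<Rightarrow> (4 + 4, 'k) mpol) \<Rightarrow> bool" where
  "zero_tuple c p \<longleftrightarrow> (\<forall>i. p i \<in> ideal_EE_rat c)"

definition eval_tuple :: "('i \<Rightarrow> (4 + 4, 'k::field) mpol)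
    \<Rightarrow> (4 \<Rightarrow> 'k alg_closure) \<Rightarrow> (4 \<Rightarrow> 'k alg_closure) \<Rightarrow> ('i \<Rightarrow> 'k alg_closure)" where
  "eval_tuple p x y = (\<lambda>i. peval (base_change (p i)) (case_sum x y))"

text \<open>
  Addition laws of bidegree \<open>(d, d)\<close> for a map \<open>\<phi>\<close> on \<open>E \<times> E\<close> with values in
  projective space; tuples are representatives modulo the ideal of \<open>E \<times> E\<close>.
\<close>

definition addition_law :: "'k::field \<Rightarrow> nat
    \<Rightarrow> ((4 \<Rightarrow> 'k alg_closure) \<Rightarrow> (4 \<Rightarrow> 'k alg_closure) \<Rightarrow> ('i \<Rightarrow> 'k alg_closure))
    \<Rightarrow> ('i \<Rightarrow> (4 + 4, 'k) mpol) \<Rightarrow> bool" where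
  "addition_law c d \<phi> p \<longleftrightarrow>
     (\<forall>i. bihomogeneous d d (p i)) \<and> \<not> zero_tuple c p \<and>
     (\<forall>x\<in>curve c. \<forall>y\<in>curve c.
        (\<exists>i. eval_tuple p x y i \<noteq> 0) \<longrightarrow> proj_eq (eval_tuple p x y) (\<phi> x y))"

definition law_space :: "'k::field \<Rightarrow> nat
    \<Rightarrow> ((4 \<Rightarrow> 'k alg_closure) \<Rightarrow> (4 \<Rightarrow> 'k alg_closure) \<Rightarrow> ('i \<Rightarrow> 'k alg_closure))
    \<Rightarrow> ('i \<Rightarrow> (4 + 4, 'k) mpol) set" where
  "law_space c d \<phi> = {p. (\<forall>i. bihomogeneous d d (p i)) \<and>
     (zero_tuple c p \<or> addition_law c d \<phi> p)}"

definition lin_comb :: "(nat \<Rightarrow> 'k::field) \<Rightarrow> ('i \<Rightarrow> (4 + 4, 'k) mpol) list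
    \<Rightarrow> 'i \<Rightarrow> (4 + 4, 'k) mpol" where
  "lin_comb a B = (\<lambda>i. \<Sum>j<length B. scalar (a j) * (B ! j) i)"

definition spans_mod :: "'k::field \<Rightarrow> ('i \<Rightarrow> (4 + 4, 'k) mpol) set
    \<Rightarrow> ('i \<Rightarrow> (4 + 4, 'k) mpol) list \<Rightarrow> bool" where
  "spans_mod c V B \<longleftrightarrow> (\<forall>a. lin_comb a B \<in> V) \<and>
     (\<forall>p\<in>V. \<exists>a. zero_tuple c (\<lambda>i. p i - lin_comb a B i))"

definition basis_mod :: "'k::field \<Rightarrow> ('i \<Rightarrow> (4 + 4, 'k) mpol) set
    \<Rightarrow> ('i \<Rightarrow> (4 + 4, 'k) mpol) list \<Rightarrow> bool" where
  "basis_mod c V B \<longleftrightarrow> spans_mod c V B \<and>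
     (\<forall>a. zero_tuple c (lin_comb a B) \<longrightarrow> (\<forall>j<length B. a j = 0))"

definition skew_segre :: "(2 \<Rightarrow> 'r::comm_ring_1) \<Rightarrow> (2 \<Rightarrow> 'r) \<Rightarrow> 4 \<Rightarrow> 'r" where
  "skew_segre U V = quadruple (U 0 * V 0) (U 1 * V 0) (U 1 * V 1) (U 0 * V 1)"


section \<open>Exceptional divisors\<close>

text \<open>
  Effective divisors on the smooth surface \<open>E \<times> E\<close> over the algebraic closure are identified
  with the closed subschemes they define (the ideal sheaf of \<open>\<Sum> n\<^sub>Z Z\<close> being the product
  of the powers \<open>I\<^sub>Z ^ n\<^sub>Z\<close>), and a closed subscheme is given by the stalks of its
  ideal sheaf at the closed points. In particular multiplicities are recorded.
\<close>

definition subscheme :: "'k::field \<Rightarrow> (4 + 4, 'k alg_closure) mpol set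
    \<Rightarrow> (4 \<Rightarrow> 'k alg_closure) \<times> (4 \<Rightarrow> 'k alg_closure) \<Rightarrow> (4 + 4, 'k alg_closure) mpol set" where
  "subscheme c J = (\<lambda>z\<in>curve c \<times> curve c.
     germ (case_sum (fst z) (snd z)) (ideal_gen (J \<union> ideal_EE c)))"

definition exceptional_divisor :: "'k::field \<Rightarrow> ('i \<Rightarrow> (4 + 4, 'k) mpol)
    \<Rightarrow> (4 \<Rightarrow> 'k alg_closure) \<times> (4 \<Rightarrow> 'k alg_closure) \<Rightarrow> (4 + 4, 'k alg_closure) mpol set" where
  "exceptional_divisor c p = subscheme c (range (\<lambda>i. base_change (p i)))"

definition Delta_ideal :: "'k::field \<Rightarrow> (4 \<Rightarrow> 'k alg_closure)
    \<Rightarrow> (4 + 4, 'k alg_closure) mpol set" where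
  "Delta_ideal c P = vanishing_ideal {case_sum x y | x y.
     x \<in> curve c \<and> y \<in> curve c \<and> proj_eq x (mu c P y)}"

definition multiple_Delta :: "'k::field \<Rightarrow> nat \<Rightarrow> (4 \<Rightarrow> 'k alg_closure)
    \<Rightarrow> (4 \<Rightarrow> 'k alg_closure) \<times> (4 \<Rightarrow> 'k alg_closure) \<Rightarrow> (4 + 4, 'k alg_closure) mpol set" where
  "multiple_Delta c m P = subscheme c (ideal_power (Delta_ideal c P) m)"

definition times_T :: "'k::field \<Rightarrow> nat \<Rightarrow> 4 \<Rightarrow> 'k alg_closure" where
  "times_T c n = (mu c pt_T ^^ n) pt_O"

end

theory Submission
  imports Defs "HOL-Computational_Algebra.Formal_Laurent_Series"
begin

text \<open>
  On a point with coordinates \<open>(1 : u : u v : v)\<close> the curve is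
  \<open>(1 + u\<^sup>2) (1 + v\<^sup>2) + c u v = 0\<close>; negation reverses the coordinates and translation by \<open>T\<close>
  rotates them cyclically. The two candidate laws for each projection agree on the curve, and they
  vanish simultaneously nowhere, so together they define an operation \<open>z = x + y\<close>. It is the group
  law: the function \<open>u - u(w)\<close>, divided by \<open>u\<close>, has divisor \<open>(w) + (- w) - 2 (O)\<close>, and pulling it
  back along \<open>P \<mapsto> P - y\<close> shows that \<open>P \<mapsto> (P) - (O)\<close> satisfies Jensen's functional equation up to
  principal divisors; every point can be halved, so the map is additive. It is injective, because
  a function with a single simple zero would be injective, while translation by \<open>T\<close> has no fixed
  point. When \<open>u(w)\<close> is infinite, \<open>u - u(w)\<close> stands for a linear form in
  \<open>X\<^sub>0\<close>, \<open>X\<^sub>1\<close>.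

  A law of bidegree \<open>(d, d)\<close> is determined by its restriction to \<open>E \<times> O\<close>, since on each translate
  of the diagonal its quotient by a law without zeros is constant. Restricted to \<open>E \<times> O\<close>, a law
  consists of linear (or quadratic) forms proportional to the coordinates, which leaves a space of
  dimension at most 2 (or 4), spanned by the given laws.

  For the exceptional divisors let \<open>z = y + n T\<close>. The entries of the law are the minors
  \<open>x\<^sub>1 z\<^sub>3 - x\<^sub>3 z\<^sub>1\<close> and \<open>x\<^sub>0 z\<^sub>2 - x\<^sub>2 z\<^sub>0\<close>. With \<open>p\<close>, \<open>q\<close> the minors
  \<open>x\<^sub>0 z\<^sub>1 - x\<^sub>1 z\<^sub>0\<close> and \<open>x\<^sub>0 z\<^sub>3 - x\<^sub>3 z\<^sub>0\<close>, which generate the ideal of the diagonal locally,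
  the equation of the curve shows that the entries generate the ideal of \<open>p\<^sup>2\<close>, \<open>p q\<close>, \<open>q\<^sup>2\<close>.
\<close>

section \<open>Evaluation of polynomials\<close>

text \<open>\<open>mu\<close> is chosen through linear equivalence, so before any formula can be
  compared with it, orders of vanishing have to be computed in local rings of the affine cone. The
  device for this is \<open>arc\<close>: a tuple of power series through a point along which
  \<open>ord_at\<close> of a form becomes \<open>subdegree\<close>. One arc is written down at
  \<open>pt_O\<close> and translations carry it to every other point. The second tool stands in for
  the degree of a divisor: a form times its conjugate under negation is, up to known factors, a
  polynomial in u. Comparing such norms (\<open>degree_lemma\<close>) shows that if f vanishes
  everywhere at least as much as g, both of the same degree, then equally much. This one statement
  serves the injectivity of P \<mapsto> (P) - (O), the constancy of functions without poles and the
  uniqueness of laws. Characteristic 2 shapes the computations: squares are additive and have no odd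
  coefficients, and u has even order at \<open>pt_O\<close>. Ellipticity enters through c \<noteq>
  0. Laws are compared over the closure, but their coefficients are read off from restrictions whose
  coefficients lie in k; this gives bases over k.\<close>

definition ring_hom_map :: "('a::comm_ring_1 \<Rightarrow> 'b::comm_ring_1) \<Rightarrow> bool" where
  "ring_hom_map h \<longleftrightarrow> h 0 = 0 \<and> h 1 = 1 \<and> (\<forall>a b. h (a + b) = h a + h b) \<and> (\<forall>a b. h (a * b) = h a * h b)"

lemma ring_hom_map_simps:
  assumes "ring_hom_map h"
  shows "h 0 = 0" "h 1 = 1" "h (a + b) = h a + h b" "h (a * b) = h a * h b"
    "h (- a) = - h a" "h (a - b) = h a - h b" "h (a ^ n) = h a ^ n"
proof -
  show *: "h 0 = 0" "h 1 = 1" "h (a + b) = h a + h b" "h (a * b) = h a * h b" for a b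
    using assms by (auto simp: ring_hom_map_def)
  show m: "h (- a) = - h a" for a
    using *(1) *(3)[of a "-a"] by (simp add: eq_neg_iff_add_eq_0 add.commute)
  show "h (a - b) = h a - h b"
    using *(3)[of a "-b"] m by simp
  show "h (a ^ n) = h a ^ n"
    by (induction n) (simp_all add: *)
qed

lemma ring_hom_map_sum: "ring_hom_map h \<Longrightarrow> h (sum f A) = (\<Sum>x\<in>A. h (f x))"
  by (induction A rule: infinite_finite_induct) (auto simp: ring_hom_map_simps)

lemma ring_hom_map_comp: "ring_hom_map g \<Longrightarrow> ring_hom_map h \<Longrightarrow> ring_hom_map (\<lambda>x. g (h x))"
  by (simp add: ring_hom_map_def)

lemma ring_hom_map_id: "ring_hom_map (\<lambda>x. x)"
  by (simp add: ring_hom_map_def)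

lemma ring_hom_map_to_ac: "ring_hom_map to_ac"
  by (simp add: ring_hom_map_def)

lemma ring_hom_map_fps_const: "ring_hom_map fps_const"
  by (simp add: ring_hom_map_def)

lemma ring_hom_map_scalar: "ring_hom_map scalar"
  by (auto simp: ring_hom_map_def scalar_def single_add mult_single)

definition monom_val :: "('v::finite \<Rightarrow> 'b::comm_ring_1) \<Rightarrow> ('v \<Rightarrow>\<^sub>0 nat) \<Rightarrow> 'b" where
  "monom_val x m = (\<Prod>v\<in>UNIV. x v ^ Poly_Mapping.lookup m v)"

text \<open>One evaluation for all purposes: with \<open>h\<close> the identity it is
  \<open>peval\<close>, with \<open>scalar\<close> it is substitution of polynomials, with
  \<open>to_ac\<close> it evaluates over the closure, and with \<open>fps_const\<close> or
  \<open>fls_const\<close> it evaluates along a formal curve.\<close>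

definition evh :: "('a::comm_ring_1 \<Rightarrow> 'b::comm_ring_1) \<Rightarrow> ('v::finite \<Rightarrow> 'b) \<Rightarrow> ('v, 'a) mpol \<Rightarrow> 'b" where
  "evh h x p = (\<Sum>m\<in>Poly_Mapping.keys p. h (Poly_Mapping.lookup p m) * monom_val x m)"

lemma monom_val_0 [simp]: "monom_val x 0 = 1"
  by (simp add: monom_val_def)

lemma monom_val_add: "monom_val x (m + n) = monom_val x m * monom_val x n"
  by (simp add: monom_val_def lookup_add power_add prod.distrib)

lemma monom_val_single: "monom_val x (Poly_Mapping.single v n) = x v ^ n"
proof -
  have "monom_val x (Poly_Mapping.single v n) = (\<Prod>w\<in>UNIV. if w = v then x v ^ n else 1)"
    unfolding monom_val_def by (rule prod.cong) (auto simp: lookup_single when_def)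
  then show ?thesis by simp
qed

lemma peval_eq_evh: "peval p x = evh (\<lambda>a. a) x p"
  by (simp add: peval_def evh_def monom_val_def)

lemma mpol_sum_single: "(p :: ('v, 'a::comm_ring_1) mpol) =
    (\<Sum>m\<in>Poly_Mapping.keys p. Poly_Mapping.single m (Poly_Mapping.lookup p m))"
proof (rule poly_mapping_eqI)
  fix k
  have "(\<Sum>m\<in>Poly_Mapping.keys p. Poly_Mapping.lookup p m when m = k) =
    (\<Sum>m\<in>Poly_Mapping.keys p. if m = k then Poly_Mapping.lookup p k else 0)"
    by (rule sum.cong) (auto simp: when_def)
  then show "Poly_Mapping.lookup p k = Poly_Mapping.lookup
      (\<Sum>m\<in>Poly_Mapping.keys p. Poly_Mapping.single m (Poly_Mapping.lookup p m)) k"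
    by (simp add: lookup_sum lookup_single in_keys_iff)
qed

context
  fixes h :: "'a::comm_ring_1 \<Rightarrow> 'b::comm_ring_1"
  assumes h: "ring_hom_map h"
begin

lemma evh_superset:
  assumes "finite A" "Poly_Mapping.keys p \<subseteq> A"
  shows "evh h x p = (\<Sum>m\<in>A. h (Poly_Mapping.lookup p m) * monom_val x m)"
  unfolding evh_def
  by (rule sum.mono_neutral_left) (use assms in \<open>auto simp: in_keys_iff ring_hom_map_simps[OF h]\<close>)

lemma evh_0 [simp]: "evh h x 0 = 0"
  by (simp add: evh_def)

lemma evh_add: "evh h x (p + q) = evh h x p + evh h x q"
proof -
  let ?A = "Poly_Mapping.keys p \<union> Poly_Mapping.keys q"
  have "evh h x (p + q) = (\<Sum>m\<in>?A. h (Poly_Mapping.lookup (p + q) m) * monom_val x m)"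
    by (rule evh_superset) (simp_all add: keys_add)
  also have "\<dots> = (\<Sum>m\<in>?A. h (Poly_Mapping.lookup p m) * monom_val x m)
      + (\<Sum>m\<in>?A. h (Poly_Mapping.lookup q m) * monom_val x m)"
    by (simp add: lookup_add ring_hom_map_simps[OF h] algebra_simps sum.distrib)
  also have "\<dots> = evh h x p + evh h x q"
    by (simp add: evh_superset[symmetric])
  finally show ?thesis .
qed

lemma evh_sum: "evh h x (sum f A) = (\<Sum>a\<in>A. evh h x (f a))"
  by (induction A rule: infinite_finite_induct) (auto simp: evh_add)

lemma evh_single: "evh h x (Poly_Mapping.single m a) = h a * monom_val x m"
  using evh_superset[of "{m}" "Poly_Mapping.single m a" x] by simp

lemma evh_mult: "evh h x (p * q) = evh h x p * evh h x q"
proof -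
  have "p * q = (\<Sum>m\<in>Poly_Mapping.keys p. \<Sum>n\<in>Poly_Mapping.keys q.
      Poly_Mapping.single (m + n) (Poly_Mapping.lookup p m * Poly_Mapping.lookup q n))"
    by (subst mpol_sum_single[of p], subst mpol_sum_single[of q])
      (simp only: sum_product mult_single)
  then have "evh h x (p * q) = (\<Sum>m\<in>Poly_Mapping.keys p. \<Sum>n\<in>Poly_Mapping.keys q.
      (h (Poly_Mapping.lookup p m) * monom_val x m) * (h (Poly_Mapping.lookup q n) * monom_val x n))"
    by (simp add: evh_sum evh_single monom_val_add ring_hom_map_simps[OF h] mult_ac)
  then show ?thesis
    by (simp add: evh_def sum_product)
qed

lemma evh_scalar: "evh h x (scalar a) = h a"
  by (simp add: scalar_def evh_single)

lemma evh_1: "evh h x 1 = 1"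
  using evh_scalar[of x 1] by (simp add: scalar_def ring_hom_map_simps[OF h])

lemma evh_indet: "evh h x (indet v) = x v"
  by (simp add: indet_def evh_single monom_val_single ring_hom_map_simps[OF h])

lemma ring_hom_map_evh: "ring_hom_map (evh h x)"
  by (simp add: ring_hom_map_def evh_add evh_mult evh_1)

lemmas evh_simps = evh_add evh_mult evh_scalar evh_1 evh_indet
  ring_hom_map_simps(5-7)[OF ring_hom_map_evh]

end

text \<open>Lets ring homomorphisms and membership statements be checked on constants and
  indeterminates instead of on supports.\<close>

lemma mpol_induct [case_names scalar indet add mult]:
  fixes p :: "('v::finite, 'a::comm_ring_1) mpol"
  assumes "\<And>a. P (scalar a)" "\<And>v. P (indet v)"
    "\<And>p q. P p \<Longrightarrow> P q \<Longrightarrow> P (p + q)" "\<And>p q. P p \<Longrightarrow> P q \<Longrightarrow> P (p * q)"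
  shows "P p"
proof -
  have one: "P 1" using assms(1)[of 1] by (simp add: scalar_def)
  have zero: "P 0" using assms(1)[of 0] by (simp add: scalar_def)
  have pow: "P (Poly_Mapping.single (Poly_Mapping.single v n) 1)" for v n
  proof (induction n)
    case (Suc n)
    have "Poly_Mapping.single (Poly_Mapping.single v (Suc n)) 1 =
        (indet v :: ('v, 'a) mpol) * Poly_Mapping.single (Poly_Mapping.single v n) 1"
      by (simp add: indet_def mult_single single_add[symmetric])
    then show ?case using assms(2,4) Suc by metis
  qed (use one in simp)
  have mon: "P (Poly_Mapping.single m 1)" for m :: "'v \<Rightarrow>\<^sub>0 nat"
  proof -
    have "P (Poly_Mapping.single (\<Sum>v\<in>A. Poly_Mapping.single v (Poly_Mapping.lookup m v)) 1)"
      if "finite A" for A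
      using that
    proof (induction A rule: finite_induct)
      case (insert v A)
      let ?S = "\<Sum>v\<in>A. Poly_Mapping.single v (Poly_Mapping.lookup m v)"
      have "P (Poly_Mapping.single (Poly_Mapping.single v (Poly_Mapping.lookup m v)) 1
          * (Poly_Mapping.single ?S 1 :: ('v, 'a) mpol))"
        by (rule assms(4)[OF pow insert.IH])
      then show ?case using insert.hyps by (simp add: mult_single)
    qed (use one in simp)
    from this[of UNIV] have "P (Poly_Mapping.single (\<Sum>v\<in>UNIV. Poly_Mapping.single v (Poly_Mapping.lookup m v)) 1)"
      by simp
    moreover have "(\<Sum>v\<in>UNIV. Poly_Mapping.single v (Poly_Mapping.lookup m v)) = m"
      by (rule poly_mapping_eqI) (simp add: lookup_sum lookup_single when_def)
    ultimately show ?thesis by simp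
  qed
  have sing: "P (Poly_Mapping.single m a)" for m a
  proof -
    have "Poly_Mapping.single m a = scalar a * Poly_Mapping.single m 1"
      by (simp add: scalar_def mult_single)
    then show ?thesis using assms(1,4) mon by metis
  qed
  have "P (\<Sum>m\<in>A. Poly_Mapping.single m (Poly_Mapping.lookup p m))" for A
    by (induction A rule: infinite_finite_induct) (use sing zero assms(3) in auto)
  from this[of "Poly_Mapping.keys p"] show ?thesis
    by (simp only: mpol_sum_single[symmetric])
qed

lemma evh_comp:
  assumes "ring_hom_map g" "ring_hom_map h"
  shows "g (evh h x p) = evh (\<lambda>a. g (h a)) (\<lambda>v. g (x v)) p"
  by (induction p rule: mpol_induct)
    (simp_all add: evh_simps assms ring_hom_map_comp ring_hom_map_simps[OF assms(1)])

lemma evh_subst: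
  assumes "ring_hom_map g"
  shows "evh g y (evh scalar P p) = evh g (\<lambda>v. evh g y (P v)) p"
  using evh_comp[OF ring_hom_map_evh[OF assms, of y] ring_hom_map_scalar, of P p]
  by (simp add: evh_scalar assms)

lemma base_change_eq_evh: "base_change p = evh (\<lambda>a. scalar (to_ac a)) indet p"
proof -
  have "base_change p = (\<Sum>m\<in>Poly_Mapping.keys p. Poly_Mapping.single m (to_ac (Poly_Mapping.lookup p m)))"
  proof (rule poly_mapping_eqI)
    fix k
    have "(\<Sum>m\<in>Poly_Mapping.keys p. to_ac (Poly_Mapping.lookup p m) when m = k) =
      (\<Sum>m\<in>Poly_Mapping.keys p. if m = k then to_ac (Poly_Mapping.lookup p k) else 0)"
      by (rule sum.cong) (auto simp: when_def)
    then show "Poly_Mapping.lookup (base_change p) k = Poly_Mapping.lookup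
      (\<Sum>m\<in>Poly_Mapping.keys p. Poly_Mapping.single m (to_ac (Poly_Mapping.lookup p m))) k"
      by (simp add: base_change_def Poly_Mapping.map.rep_eq lookup_sum lookup_single in_keys_iff when_def)
  qed
  moreover have "scalar a * monom_val indet m = Poly_Mapping.single m a"
    for a :: "'b alg_closure" and m :: "'a \<Rightarrow>\<^sub>0 nat"
  proof -
    have pow: "indet v ^ n = (Poly_Mapping.single (Poly_Mapping.single v n) 1 :: ('a, 'b alg_closure) mpol)" for v n
      by (induction n) (simp_all add: indet_def mult_single single_add[symmetric])
    have "(\<Prod>v\<in>A. indet v ^ Poly_Mapping.lookup m v) =
      (Poly_Mapping.single (\<Sum>v\<in>A. Poly_Mapping.single v (Poly_Mapping.lookup m v)) 1 :: ('a, 'b alg_closure) mpol)" for A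
      by (induction A rule: infinite_finite_induct) (simp_all add: pow mult_single)
    moreover have "(\<Sum>v\<in>UNIV. Poly_Mapping.single v (Poly_Mapping.lookup m v)) = m"
      by (rule poly_mapping_eqI) (simp add: lookup_sum lookup_single when_def)
    ultimately show ?thesis
      by (simp add: monom_val_def scalar_def mult_single)
  qed
  ultimately show ?thesis by (simp add: evh_def)
qed

lemma peval_base_change: "peval (base_change p) x = evh to_ac x p"
  using evh_comp[OF ring_hom_map_evh[OF ring_hom_map_id, of x]
      ring_hom_map_comp[OF ring_hom_map_scalar ring_hom_map_to_ac], of indet p]
  by (simp add: peval_eq_evh base_change_eq_evh evh_simps ring_hom_map_id)

lemma ring_hom_map_base_change:
  "ring_hom_map (base_change :: ('v::finite, 'k::field) mpol \<Rightarrow> _)"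
proof -
  have "(base_change :: ('v, 'k) mpol \<Rightarrow> _) = evh (\<lambda>a. scalar (to_ac a)) indet"
    by (rule ext) (rule base_change_eq_evh)
  then show ?thesis
    using ring_hom_map_evh[OF ring_hom_map_comp[OF ring_hom_map_scalar ring_hom_map_to_ac],
        of "indet :: 'v \<Rightarrow> ('v, 'k alg_closure) mpol"] by simp
qed

lemmas peval_simps = evh_simps[OF ring_hom_map_id, folded peval_eq_evh]
lemma ring_hom_map_peval: "ring_hom_map (\<lambda>p. peval p x)"
  unfolding peval_eq_evh by (rule ring_hom_map_evh[OF ring_hom_map_id])

lemma peval_0 [simp]: "peval 0 x = 0"
  by (simp add: peval_eq_evh evh_0 ring_hom_map_id)

lemma base_change_simps:
  fixes v :: "'v::finite" and a :: "'k::field"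
  shows "base_change (indet v :: ('v, 'k) mpol) = indet v" "base_change (scalar a :: ('v, 'k) mpol) = scalar (to_ac a)"
  by (simp_all only: base_change_eq_evh
      evh_simps[OF ring_hom_map_comp[OF ring_hom_map_scalar ring_hom_map_to_ac]])

subsection \<open>Homogeneous polynomials\<close>

lemma homogeneous_scale:
  assumes "homogeneous d p" and h: "ring_hom_map h"
  shows "evh h (\<lambda>v. l * x v) p = l ^ d * evh h x p"
proof -
  have "monom_val (\<lambda>v. l * x v) m = l ^ d * monom_val x m" if "m \<in> Poly_Mapping.keys p" for m
    using that assms(1)
    by (simp add: homogeneous_def monom_val_def power_mult_distrib prod.distrib power_sum[symmetric])
  then show ?thesis
    by (simp add: evh_def sum_distrib_left mult_ac)
qed

lemma homogeneous_add: "homogeneous d p \<Longrightarrow> homogeneous d q \<Longrightarrow> homogeneous d (p + q)"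
  using keys_add[of p q] by (force simp: homogeneous_def)

lemma homogeneous_mult: "homogeneous d p \<Longrightarrow> homogeneous e q \<Longrightarrow> homogeneous (d + e) (p * q)"
  using keys_mult[of p q] unfolding homogeneous_def
  by (fastforce simp: lookup_add sum.distrib)

lemma homogeneous_scalar: "homogeneous 0 (scalar a)"
  by (simp add: homogeneous_def scalar_def)

lemma homogeneous_indet: "homogeneous 1 (indet v)"
  by (simp add: homogeneous_def indet_def lookup_single when_def)

lemma homogeneous_scalar_mult: "homogeneous d p \<Longrightarrow> homogeneous d (scalar a * p)"
  using homogeneous_mult[OF homogeneous_scalar] by simp

lemma homogeneous_1: "homogeneous 0 1"
  using homogeneous_scalar[of 1] by (simp add: scalar_def)

lemma homogeneous_zero: "homogeneous d 0"
  by (simp add: homogeneous_def)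

lemma homogeneous_sum: "(\<And>a. a \<in> A \<Longrightarrow> homogeneous d (f a)) \<Longrightarrow> homogeneous d (sum f A)"
  by (induction A rule: infinite_finite_induct) (auto simp: homogeneous_zero homogeneous_add)

lemma homogeneous_prod:
  "finite A \<Longrightarrow> (\<And>a. a \<in> A \<Longrightarrow> homogeneous (e a) (f a)) \<Longrightarrow> homogeneous (sum e A) (prod f A)"
  by (induction A rule: finite_induct) (auto simp: homogeneous_1 homogeneous_mult)

lemma homogeneous_power: "homogeneous d p \<Longrightarrow> homogeneous (n * d) (p ^ n)"
  by (induction n) (auto simp: homogeneous_1 homogeneous_mult)

lemma homogeneous_subst:
  assumes "homogeneous d p" "\<And>v. homogeneous e (P v)"
  shows "homogeneous (d * e) (evh scalar P p)"
  unfolding evh_def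
proof (rule homogeneous_sum)
  fix m assume m: "m \<in> Poly_Mapping.keys p"
  have "homogeneous (\<Sum>v\<in>UNIV. Poly_Mapping.lookup m v * e) (monom_val P m)"
    unfolding monom_val_def by (rule homogeneous_prod) (auto intro: homogeneous_power assms)
  moreover have "(\<Sum>v\<in>UNIV. Poly_Mapping.lookup m v * e) = d * e"
    using m assms(1) by (simp add: homogeneous_def sum_distrib_right[symmetric])
  ultimately show "homogeneous (d * e) (scalar (Poly_Mapping.lookup p m) * monom_val P m)"
    by (simp add: homogeneous_scalar_mult)
qed

section \<open>Ideals\<close>

definition is_ideal :: "'r::comm_ring_1 set \<Rightarrow> bool" where
  "is_ideal J \<longleftrightarrow> 0 \<in> J \<and> (\<forall>a\<in>J. \<forall>b\<in>J. a + b \<in> J) \<and> (\<forall>r. \<forall>a\<in>J. r * a \<in> J)"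

lemma is_idealD:
  assumes "is_ideal J"
  shows "0 \<in> J" "a \<in> J \<Longrightarrow> b \<in> J \<Longrightarrow> a + b \<in> J" "a \<in> J \<Longrightarrow> r * a \<in> J" "a \<in> J \<Longrightarrow> a * r \<in> J"
    "a \<in> J \<Longrightarrow> - a \<in> J" "a \<in> J \<Longrightarrow> b \<in> J \<Longrightarrow> a - b \<in> J"
proof -
  show *: "0 \<in> J" "a \<in> J \<Longrightarrow> b \<in> J \<Longrightarrow> a + b \<in> J" "a \<in> J \<Longrightarrow> r * a \<in> J" for a b r
    using assms by (auto simp: is_ideal_def)
  show "a \<in> J \<Longrightarrow> a * r \<in> J" using *(3)[of a r] by (simp add: mult.commute)
  show m: "a \<in> J \<Longrightarrow> - a \<in> J" for a using *(3)[of a "-1"] by simp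
  show "a \<in> J \<Longrightarrow> b \<in> J \<Longrightarrow> a - b \<in> J" using *(2)[of a "-b"] m by simp
qed

lemma module_times: "Modules.module ((*) :: 'r::comm_ring_1 \<Rightarrow> 'r \<Rightarrow> 'r)"
  by unfold_locales (simp_all add: algebra_simps)

lemma is_ideal_ideal_gen: "is_ideal (ideal_gen G)"
  using module.span_zero[OF module_times] module.span_add[OF module_times] module.span_scale[OF module_times]
  by (auto simp: is_ideal_def ideal_gen_def)

lemma ideal_gen_superset: "G \<subseteq> ideal_gen G"
  using module.span_superset[OF module_times] by (simp add: ideal_gen_def)

lemma ideal_gen_base: "g \<in> G \<Longrightarrow> g \<in> ideal_gen G"
  using ideal_gen_superset by blast

lemma ideal_gen_minimal: "is_ideal J \<Longrightarrow> G \<subseteq> J \<Longrightarrow> ideal_gen G \<subseteq> J"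
  unfolding ideal_gen_def is_ideal_def
  by (intro module.span_minimal[OF module_times]) (auto simp: module.subspace_def[OF module_times])

lemma is_ideal_ideal_power: "is_ideal (ideal_power J n)"
  by (cases n) (simp_all add: is_ideal_ideal_gen, simp add: is_ideal_def)

lemma ideal_power_Suc_I: "f \<in> J \<Longrightarrow> g \<in> ideal_power J n \<Longrightarrow> f * g \<in> ideal_power J (Suc n)"
  by (auto intro!: ideal_gen_base)

lemma ideal_power_Suc_minimal:
  assumes "is_ideal K" "\<And>f g. f \<in> J \<Longrightarrow> g \<in> ideal_power J n \<Longrightarrow> f * g \<in> K"
  shows "ideal_power J (Suc n) \<subseteq> K"
  unfolding ideal_power.simps
proof (rule ideal_gen_minimal[OF assms(1)], rule subsetI)
  fix t assume "t \<in> {f * g |f g. f \<in> J \<and> g \<in> ideal_power J n}"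
  then obtain f g where "t = f * g" "f \<in> J" "g \<in> ideal_power J n" by blast
  then show "t \<in> K" using assms(2) by simp
qed

lemma is_ideal_vanishing_ideal: "is_ideal (vanishing_ideal S)"
  by (auto simp: is_ideal_def vanishing_ideal_def peval_simps)

lemma is_ideal_vimage:
  assumes "ring_hom_map h" "is_ideal J"
  shows "is_ideal (h -` J)"
  using is_idealD[OF assms(2)] by (auto simp: is_ideal_def ring_hom_map_simps[OF assms(1)])

lemma is_ideal_germ:
  fixes x :: "'v::finite \<Rightarrow> 'a::field"
  assumes J: "is_ideal J"
  shows "is_ideal (germ x J)"
proof -
  have "0 \<in> germ x J"
    using is_idealD(1)[OF J] by (auto simp: germ_def peval_simps intro!: exI[of _ 1])
  moreover have "a + b \<in> germ x J" if ab: "a \<in> germ x J" "b \<in> germ x J" for a b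
  proof -
    obtain h k where "peval h x \<noteq> 0" "h * a \<in> J" "peval k x \<noteq> 0" "k * b \<in> J"
      using ab by (auto simp: germ_def)
    then have "peval (h * k) x \<noteq> 0" "k * (h * a) + h * (k * b) \<in> J"
      using is_idealD[OF J] by (auto simp: peval_simps)
    then show ?thesis
      by (auto simp: germ_def algebra_simps intro!: exI[of _ "h * k"])
  qed
  moreover have "r * a \<in> germ x J" if "a \<in> germ x J" for a r
  proof -
    obtain h where "peval h x \<noteq> 0" "h * a \<in> J" using \<open>a \<in> germ x J\<close> unfolding germ_def by blast
    then have "h * (r * a) \<in> J" using is_idealD(3)[OF J, of "h * a" r] by (simp add: mult_ac)
    with \<open>peval h x \<noteq> 0\<close> show ?thesis by (auto simp: germ_def)
  qed
  ultimately show ?thesis by (auto simp: is_ideal_def)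
qed

lemma germ_superset:
  fixes x :: "'v::finite \<Rightarrow> 'a::field"
  shows "J \<subseteq> germ x J"
  by (auto simp: germ_def peval_simps intro!: exI[of _ 1])

lemma germ_mono: "J \<subseteq> K \<Longrightarrow> germ x J \<subseteq> germ x K"
  by (auto simp: germ_def)

text \<open>Polynomials that do not vanish at \<open>x\<close> are units of the local ring. This
  removes the auxiliary factors that are introduced to clear denominators.\<close>

lemma germ_cancel:
  fixes x :: "'v::finite \<Rightarrow> 'a::field"
  assumes "peval h x \<noteq> 0" "h * f \<in> germ x J"
  shows "f \<in> germ x J"
proof -
  obtain k where "peval k x \<noteq> 0" "k * (h * f) \<in> J" using assms(2) by (auto simp: germ_def)
  then show ?thesis using assms(1)
    by (auto simp: germ_def peval_simps mult.assoc intro!: exI[of _ "k * h"])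
qed

lemma germ_germ:
  fixes x :: "'v::finite \<Rightarrow> 'a::field"
  shows "germ x (germ x J) = germ x J"
  using germ_superset[of "germ x J" x] germ_cancel[of _ x _ J] by (auto simp: germ_def[of x "germ x J"])

lemma germ_UNIV:
  assumes "is_ideal J" "h \<in> J" "peval h x \<noteq> 0"
  shows "germ x J = UNIV"
  using assms is_idealD(4)[OF assms(1,2)] by (auto simp: germ_def)

section \<open>Points and the addition laws\<close>

lemma all4: "(\<forall>i::4. P i) \<longleftrightarrow> P 0 \<and> P 1 \<and> P 2 \<and> P 3"
proof -
  have "i = 0 \<or> i = 1 \<or> i = 2 \<or> i = 3" for i :: 4
  proof (cases i)
    case (of_int z)
    then have "z = 0 \<or> z = 1 \<or> z = 2 \<or> z = 3" by auto
    then show ?thesis using of_int by auto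
  qed
  then show ?thesis by metis
qed

lemma all2: "(\<forall>i::2. P i) \<longleftrightarrow> P 0 \<and> P 1"
proof -
  have "i = 0 \<or> i = 1" for i :: 2
  proof (cases i)
    case (of_int z)
    then have "z = 0 \<or> z = 1" by auto
    then show ?thesis using of_int by auto
  qed
  then show ?thesis by metis
qed

lemma fun4_eq: "x = y \<longleftrightarrow> x 0 = y 0 \<and> x 1 = y 1 \<and> x 2 = y 2 \<and> x (3::4) = y 3"
  by (simp add: fun_eq_iff all4)

lemma fun2_eq: "x = y \<longleftrightarrow> x 0 = y 0 \<and> x (1::2) = y 1"
  by (simp add: fun_eq_iff all2)

lemma UNIV4: "(UNIV :: 4 set) = {0, 1, 2, 3}"
  using all4[of "\<lambda>i. i \<in> {0, 1, 2, 3}"] by auto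

lemma sum4: "(\<Sum>i\<in>UNIV. f i) = f 0 + f 1 + f 2 + f (3::4)"
  unfolding UNIV4 by (simp add: add.assoc)

lemma quadruple_simps [simp]:
  "quadruple a b c d 0 = a" "quadruple a b c d 1 = b" "quadruple a b c d 2 = c" "quadruple a b c d 3 = d"
  by (simp_all add: quadruple_def)

lemma pair_simps [simp]: "pair a b 0 = a" "pair a b 1 = b"
  by (simp_all add: pair_def)

lemma skew_segre_simps [simp]:
  "skew_segre U V 0 = U 0 * V 0" "skew_segre U V 1 = U 1 * V 0"
  "skew_segre U V 2 = U 1 * V 1" "skew_segre U V 3 = U 0 * V 1"
  by (simp_all add: skew_segre_def)

section \<open>Calculation in characteristic 2\<close>

lemma char2_rules:
  assumes "(2::'b::comm_ring_1) = 0"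
  shows "x + x = (0::'b)" "x + (x + y) = (y::'b)" "- x = x" "x - y = x + (y::'b)"
proof -
  show 1: "x + x = 0" for x :: 'b using assms by (metis mult_2 mult_zero_left)
  then show "x + (x + y) = y" by (simp add: add.assoc[symmetric])
  show 2: "- x = x" for x::'b using 1[of x] by (simp add: eq_neg_iff_add_eq_0 minus_equation_iff)
  show "x - y = x + y" using 2[of y] by (metis diff_conv_add_uminus)
qed

lemma char2_eq_iff: "(2::'b::comm_ring_1) = 0 \<Longrightarrow> (x::'b) = y \<longleftrightarrow> x + y = 0"
  by (metis char2_rules(4) right_minus_eq)

lemma char2_sum0: "(2::'b::comm_ring_1) = 0 \<Longrightarrow> (x::'b) + y = 0 \<longleftrightarrow> x = y"
  using char2_eq_iff by blast

lemma char2_square_add: "(2::'b::comm_ring_1) = 0 \<Longrightarrow> (x + y)\<^sup>2 = x\<^sup>2 + (y\<^sup>2::'b)"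
  by (simp add: power2_sum)

text \<open>Distributing and sorting puts equal monomials next to each other, where
  \<open>x + x = 0\<close> and \<open>x + (x + y) = y\<close> delete them. With the rules of
  characteristic 2 this proves polynomial identities by normalisation.\<close>

lemmas expand = distrib_left distrib_right mult_ac add_ac
  mult_zero_left mult_zero_right add_0_left add_0_right

text \<open>\<open>U\<close> and \<open>V\<close> stand for the two projections, \<open>a\<close>
  and \<open>b\<close> for the first and second basis element. The arbitrary coefficient ring lets
  the same formula act on points, polynomials and power series.\<close>

definition Ua :: "(4 \<Rightarrow> 'r::comm_ring_1) \<Rightarrow> (4 \<Rightarrow> 'r) \<Rightarrow> 2 \<Rightarrow> 'r" where
  "Ua x y = pair (x 0 * y 3 + x 2 * y 1) (x 1 * y 0 + x 3 * y 2)"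
definition Ub :: "(4 \<Rightarrow> 'r::comm_ring_1) \<Rightarrow> (4 \<Rightarrow> 'r) \<Rightarrow> 2 \<Rightarrow> 'r" where
  "Ub x y = pair (x 1 * y 2 + x 3 * y 0) (x 0 * y 1 + x 2 * y 3)"
definition Va :: "(4 \<Rightarrow> 'r::comm_ring_1) \<Rightarrow> (4 \<Rightarrow> 'r) \<Rightarrow> 2 \<Rightarrow> 'r" where
  "Va x y = pair (x 0 * y 0 + x 2 * y 2) (x 1 * y 1 + x 3 * y 3)"
definition Vb :: "(4 \<Rightarrow> 'r::comm_ring_1) \<Rightarrow> (4 \<Rightarrow> 'r) \<Rightarrow> 2 \<Rightarrow> 'r" where
  "Vb x y = pair (x 1 * y 3 + x 3 * y 1) (x 0 * y 2 + x 2 * y 0)"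

lemmas law_defs = Ua_def Ub_def Va_def Vb_def

definition neg :: "(4 \<Rightarrow> 'r) \<Rightarrow> 4 \<Rightarrow> 'r" where
  "neg x = quadruple (x 3) (x 2) (x 1) (x 0)"
definition rot :: "(4 \<Rightarrow> 'r) \<Rightarrow> 4 \<Rightarrow> 'r" where
  "rot x = quadruple (x 3) (x 0) (x 1) (x 2)"

lemma neg_simps [simp]: "neg x 0 = x 3" "neg x 1 = x 2" "neg x 2 = x 1" "neg x 3 = x 0" "neg (neg x) = x"
  by (simp_all add: neg_def fun4_eq)
lemma rot_simps [simp]: "rot x 0 = x 3" "rot x 1 = x 0" "rot x 2 = x 1" "rot x 3 = x 2"
  "rot (rot (rot (rot x))) = x"
  by (simp_all add: rot_def fun4_eq)

text \<open>Here x = s(p, q) and y = s(r, s), \<open>F\<close> and \<open>G\<close> are the curve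
  equation in Segre coordinates, and (u, v) is the sum computed by the first law of each projection.
  Every lemma below displays explicit cofactors that put its left side into the ideal generated by
  the two equations.\<close>

context
  fixes c p0 p1 q0 q1 r0 r1 s0 s1 :: "'b::comm_ring_1"
    and x0 x1 x2 x3 y0 y1 y2 y3 u0 u1 v0 v1 :: 'b
  assumes two: "(2::'b) = 0"
    and F: "(p0*p0+p1*p1)*(q0*q0+q1*q1) + c*p0*p1*q0*q1 = 0"
    and G: "(r0*r0+r1*r1)*(s0*s0+s1*s1) + c*r0*r1*s0*s1 = 0"
  defines "x0 \<equiv> p0*q0" and "x1 \<equiv> p1*q0" and "x2 \<equiv> p1*q1" and "x3 \<equiv> p0*q1"
    and "y0 \<equiv> r0*s0" and "y1 \<equiv> r1*s0" and "y2 \<equiv> r1*s1" and "y3 \<equiv> r0*s1"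
    and "u0 \<equiv> x0*y3+x2*y1" and "u1 \<equiv> x1*y0+x3*y2" and "v0 \<equiv> x0*y0+x2*y2" and "v1 \<equiv> x1*y1+x3*y3"
begin

lemmas coord_defs = x0_def x1_def x2_def x3_def y0_def y1_def y2_def y3_def u0_def u1_def v0_def v1_def

lemma law_on_curve: "(u0*u0+u1*u1)*(v0*v0+v1*v1) + c*u0*u1*v0*v1 = 0"
proof -
  have "(u0*u0+u1*u1)*(v0*v0+v1*v1) + c*u0*u1*v0*v1 =
    ((p0*p0+p1*p1)*(q0*q0+q1*q1) + c*p0*p1*q0*q1) *
      (p0*p0*q0*q0*r0*r0*r0*r0*s0*s0*s1*s1 +
       p0*p0*q1*q1*r0*r0*r1*r1*s1*s1*s1*s1 +
       p0*p1*q0*q1*r0*r0*r0*r1*s0*s0*s0*s1 +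
       p0*p1*q0*q1*r0*r0*r0*r1*s0*s1*s1*s1 +
       p0*p1*q0*q1*r0*r1*r1*r1*s0*s0*s0*s1 +
       p0*p1*q0*q1*r0*r1*r1*r1*s0*s1*s1*s1 +
       p1*p1*q0*q0*r0*r0*r1*r1*s0*s0*s0*s0 +
       p1*p1*q1*q1*r1*r1*r1*r1*s0*s0*s1*s1) +
    ((r0*r0+r1*r1)*(s0*s0+s1*s1) + c*r0*r1*s0*s1) *
      (p0*p0*p0*p0*q0*q0*q1*q1*r0*r0*s1*s1 +
       p0*p0*p0*p1*q0*q0*q0*q1*r0*r1*s0*s1 +
       p0*p0*p0*p1*q0*q1*q1*q1*r0*r1*s0*s1 +
       p0*p0*p1*p1*q0*q0*q0*q0*r0*r0*s0*s0 +
       p0*p0*p1*p1*q1*q1*q1*q1*r1*r1*s1*s1 +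
       p0*p1*p1*p1*q0*q0*q0*q1*r0*r1*s0*s1 +
       p0*p1*p1*p1*q0*q1*q1*q1*r0*r1*s0*s1 +
       p1*p1*p1*p1*q0*q0*q1*q1*r1*r1*s0*s0)"
    unfolding coord_defs by (simp only: expand char2_rules[OF two])
  then show ?thesis by (simp only: F G mult_zero_left add_0_left)
qed

text \<open>The left side is the cross product of \<open>Ua z (neg y)\<close> with (p0, p1), where z
  = s(u, v). The four \<open>law_inverse\<close> identities say that each law, applied to z and -y,
  is proportional to the corresponding projection of x.\<close>

lemma law_inverse_Ua: "(u0*v0*y0+u1*v1*y2)*p1 + (u1*v0*y3+u0*v1*y1)*p0 = 0"
proof -
  have "(u0*v0*y0+u1*v1*y2)*p1 + (u1*v0*y3+u0*v1*y1)*p0 =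
    ((p0*p0+p1*p1)*(q0*q0+q1*q1) + c*p0*p1*q0*q1) *
      (p1*r0*r1*r1*s0*s0*s1) +
    ((r0*r0+r1*r1)*(s0*s0+s1*s1) + c*r0*r1*s0*s1) *
      (p0*p1*p1*q0*q1*r1*s0)"
    unfolding coord_defs by (simp only: expand char2_rules[OF two])
  then show ?thesis by (simp only: F G mult_zero_left add_0_left)
qed

lemma law_inverse_Ub: "(u1*v0*y1+u0*v1*y3)*p1 + (u0*v0*y2+u1*v1*y0)*p0 = 0"
proof -
  have "(u1*v0*y1+u0*v1*y3)*p1 + (u0*v0*y2+u1*v1*y0)*p0 =
    ((p0*p0+p1*p1)*(q0*q0+q1*q1) + c*p0*p1*q0*q1) *
      (p0*r0*r0*r1*s0*s1*s1) +
    ((r0*r0+r1*r1)*(s0*s0+s1*s1) + c*r0*r1*s0*s1) *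
      (p0*p0*p1*q0*q1*r0*s1)"
    unfolding coord_defs by (simp only: expand char2_rules[OF two])
  then show ?thesis by (simp only: F G mult_zero_left add_0_left)
qed

lemma law_inverse_Va: "(u0*v0*y3+u1*v1*y1)*q1 + (u1*v0*y2+u0*v1*y0)*q0 = 0"
proof -
  have "(u0*v0*y3+u1*v1*y1)*q1 + (u1*v0*y2+u0*v1*y0)*q0 =
    ((p0*p0+p1*p1)*(q0*q0+q1*q1) + c*p0*p1*q0*q1) *
      (q1*r0*r1*r1*s0*s1*s1) +
    ((r0*r0+r1*r1)*(s0*s0+s1*s1) + c*r0*r1*s0*s1) *
      (p0*p1*q0*q1*q1*r1*s1)"
    unfolding coord_defs by (simp only: expand char2_rules[OF two])
  then show ?thesis by (simp only: F G mult_zero_left add_0_left)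
qed

lemma law_inverse_Vb: "(u1*v0*y0+u0*v1*y2)*q1 + (u0*v0*y1+u1*v1*y3)*q0 = 0"
proof -
  have "(u1*v0*y0+u0*v1*y2)*q1 + (u0*v0*y1+u1*v1*y3)*q0 =
    ((p0*p0+p1*p1)*(q0*q0+q1*q1) + c*p0*p1*q0*q1) *
      (q0*r0*r0*r1*s0*s0*s1) +
    ((r0*r0+r1*r1)*(s0*s0+s1*s1) + c*r0*r1*s0*s1) *
      (p0*p1*q0*q0*q1*r0*s0)"
    unfolding coord_defs by (simp only: expand char2_rules[OF two])
  then show ?thesis by (simp only: F G mult_zero_left add_0_left)
qed

end

section \<open>Projective equality and the relation x + y = z\<close>

lemma proj_eq_refl: "proj_eq x x"
  by (auto simp: proj_eq_def intro!: exI[of _ 1])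
lemma proj_eq_sym: "proj_eq x y \<Longrightarrow> proj_eq y (x :: _ \<Rightarrow> 'a::field)"
proof -
  assume "proj_eq x y"
  then obtain l where "l \<noteq> 0" "\<forall>i. y i = l * x i" by (auto simp: proj_eq_def)
  then have "inverse l \<noteq> 0" "\<forall>i. x i = inverse l * y i" by simp_all
  then show ?thesis unfolding proj_eq_def by blast
qed
lemma proj_eq_trans: "proj_eq x y \<Longrightarrow> proj_eq y z \<Longrightarrow> proj_eq x (z :: _ \<Rightarrow> 'a::field)"
  unfolding proj_eq_def by (metis mult.assoc no_zero_divisors)

text \<open>Proportionality without nonvanishing: a polynomial condition that also holds for the
  zero tuple, so common zeros of a law need no separate treatment. It is transitive only through a
  nonzero middle term.\<close>

definition par :: "('i \<Rightarrow> 'a::comm_ring_1) \<Rightarrow> ('i \<Rightarrow> 'a) \<Rightarrow> bool" where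
  "par x y \<longleftrightarrow> (\<forall>i j. x i * y j = x j * y i)"

lemma par_sym: "par x y \<Longrightarrow> par y x"
  by (auto simp: par_def mult.commute)

lemma proj_eq_par: "proj_eq x y \<Longrightarrow> par x y"
  by (auto simp: par_def proj_eq_def)

lemma par_proj_eq:
  fixes x :: "'i \<Rightarrow> 'a::field"
  assumes "par x y" "x \<noteq> (\<lambda>_. 0)" "y \<noteq> (\<lambda>_. 0)"
  shows "proj_eq x y"
proof -
  obtain i where i: "x i \<noteq> 0" using assms(2) by fastforce
  have eq: "y j = (y i / x i) * x j" for j
  proof -
    have "x i * y j = x j * y i" using assms(1) by (simp add: par_def)
    then show ?thesis using i by (simp add: field_simps)
  qed
  have "y i \<noteq> 0"
  proof
    assume "y i = 0"
    then have "y j = 0" for j using eq[of j] by (metis div_0 mult_zero_left)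
    then have "y = (\<lambda>_. 0)" by (rule ext)
    then show False using assms(3) by simp
  qed
  then have "y i / x i \<noteq> 0" using i by simp
  then show ?thesis unfolding proj_eq_def
    by (intro exI[of _ "y i / x i"] conjI allI eq)
qed

lemma par_iff_proj_eq:
  "x \<noteq> (\<lambda>_. 0) \<Longrightarrow> y \<noteq> (\<lambda>_. 0) \<Longrightarrow> par x y \<longleftrightarrow> proj_eq x (y :: _ \<Rightarrow> 'a::field)"
  using par_proj_eq proj_eq_par by blast

definition on_curve :: "'b::comm_ring_1 \<Rightarrow> (4 \<Rightarrow> 'b) \<Rightarrow> bool" where
  "on_curve C x \<longleftrightarrow> (x 0 + x 1 + x 2 + x 3)\<^sup>2 = C * x 0 * x 2 \<and> x 0 * x 2 = x 1 * x 3"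

definition cv :: "'b::comm_ring_1 \<Rightarrow> (4 \<Rightarrow> 'b) set" where
  "cv C = {x. x \<noteq> (\<lambda>_. 0) \<and> on_curve C x}"

text \<open>Both expressions of each projection are demanded, (z0 : z1) and (z3 : z2), respectively
  (z0 : z3) and (z1 : z2), so that it never has to be decided which of them is defined.\<close>

definition law_eqs :: "(4 \<Rightarrow> 'b::comm_ring_1) \<Rightarrow> (4 \<Rightarrow> 'b) \<Rightarrow> (4 \<Rightarrow> 'b) \<Rightarrow> bool" where
  "law_eqs x y z \<longleftrightarrow>
     (\<forall>s\<in>{Ua x y, Ub x y}. s 0 * z 1 = s 1 * z 0 \<and> s 0 * z 2 = s 1 * z 3) \<and>
     (\<forall>t\<in>{Va x y, Vb x y}. t 0 * z 3 = t 1 * z 0 \<and> t 0 * z 2 = t 1 * z 1)"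

definition isadd :: "'b::comm_ring_1 \<Rightarrow> (4 \<Rightarrow> 'b) \<Rightarrow> (4 \<Rightarrow> 'b) \<Rightarrow> (4 \<Rightarrow> 'b) \<Rightarrow> bool" where
  "isadd C x y z \<longleftrightarrow> x \<in> cv C \<and> y \<in> cv C \<and> z \<in> cv C \<and> law_eqs x y z"

lemma segre_ne0: "skew_segre U V \<noteq> (\<lambda>_. 0) \<longleftrightarrow> U \<noteq> (\<lambda>_. 0) \<and> V \<noteq> (\<lambda>_. 0::'b::field)"
  by (auto simp: fun4_eq fun2_eq)

locale char2_curve =
  fixes C :: "'b::field"
  assumes two: "(2::'b) = 0" and C0: "C \<noteq> 0"
begin

lemmas char2 = char2_rules[OF two]

lemma square_sum0: "a * a + b * b = 0 \<longleftrightarrow> a = (b::'b)"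
proof -
  have "a * a + b * b = (a + b) * (a + b)" by (simp only: expand char2)
  then show ?thesis by (simp add: char2_sum0[OF two])
qed

lemma on_curveD:
  assumes "on_curve C x"
  shows "x 0 * x 0 + x 1 * x 1 + x 2 * x 2 + x 3 * x 3 = C * x 0 * x 2" "x 0 * x 2 = x 1 * x 3"
proof -
  have "(x 0 + x 1 + x 2 + x 3)\<^sup>2 = x 0 * x 0 + x 1 * x 1 + x 2 * x 2 + x 3 * x 3"
    by (simp only: power2_eq_square expand char2)
  then show "x 0 * x 0 + x 1 * x 1 + x 2 * x 2 + x 3 * x 3 = C * x 0 * x 2" "x 0 * x 2 = x 1 * x 3"
    using assms by (simp_all add: on_curve_def)
qed

lemma cvD:
  assumes "x \<in> cv C"
  shows "x 0 * x 0 + x 1 * x 1 + x 2 * x 2 + x 3 * x 3 = C * x 0 * x 2" "x 0 * x 2 = x 1 * x 3"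
    "\<not> (x 0 = 0 \<and> x 1 = 0 \<and> x 2 = 0 \<and> x 3 = 0)"
  using assms on_curveD[of x] by (simp_all add: cv_def fun4_eq)

lemma cv_neg: "neg x \<in> cv C \<longleftrightarrow> x \<in> cv C"
  by (auto simp: cv_def on_curve_def fun4_eq ac_simps)

lemma cv_rot: "rot x \<in> cv C \<longleftrightarrow> x \<in> cv C"
  by (auto simp: cv_def on_curve_def fun4_eq ac_simps)

lemma cv_proj_eq: "x \<in> cv C \<Longrightarrow> proj_eq x y \<Longrightarrow> y \<in> cv C"
proof -
  assume x: "x \<in> cv C" and "proj_eq x y"
  then obtain l where l: "l \<noteq> 0" "\<forall>i. y i = l * x i" by (auto simp: proj_eq_def)
  have "(l * x 0 + l * x 1 + l * x 2 + l * x 3)\<^sup>2 = l\<^sup>2 * (x 0 + x 1 + x 2 + x 3)\<^sup>2"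
    by (simp add: power_mult_distrib[symmetric] distrib_left)
  also have "\<dots> = C * (l * x 0) * (l * x 2)"
    using x by (simp add: cv_def on_curve_def power2_eq_square)
  finally show ?thesis using x l by (auto simp: cv_def on_curve_def fun_eq_iff)
qed

lemma segre_on_curve:
  "on_curve C (skew_segre P Q) \<longleftrightarrow>
    (P 0 * P 0 + P 1 * P 1) * (Q 0 * Q 0 + Q 1 * Q 1) + C * P 0 * P 1 * Q 0 * Q 1 = 0"
proof -
  have "(P 0 * Q 0 + P 1 * Q 0 + P 1 * Q 1 + P 0 * Q 1)\<^sup>2 =
      (P 0 * P 0 + P 1 * P 1) * (Q 0 * Q 0 + Q 1 * Q 1)"
    by (simp only: power2_eq_square expand char2)
  then have "on_curve C (skew_segre P Q) \<longleftrightarrow>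
      (P 0 * P 0 + P 1 * P 1) * (Q 0 * Q 0 + Q 1 * Q 1) = C * P 0 * P 1 * Q 0 * Q 1"
    by (simp add: on_curve_def mult_ac)
  then show ?thesis
    by (simp only: char2_sum0[OF two])
qed

lemma cv_param2:
  fixes z :: "4 \<Rightarrow> 'b"
  assumes "z 0 * z 2 = z 1 * z 3" "Q 0 * z 3 = Q 1 * z 0" "Q 0 * z 2 = Q 1 * z 1" "Q \<noteq> (\<lambda>_. 0)"
  shows "\<exists>P. z = skew_segre P Q"
proof (cases "Q 0 = 0")
  case False
  then show ?thesis
    using assms by (intro exI[of _ "pair (z 0 / Q 0) (z 1 / Q 0)"]) (auto simp: fun4_eq field_simps)
next
  case True
  then have "Q 1 \<noteq> 0" using assms(4) by (auto simp: fun2_eq)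
  then show ?thesis
    using assms True by (intro exI[of _ "pair (z 3 / Q 1) (z 2 / Q 1)"]) (auto simp: fun4_eq field_simps)
qed

lemma cv_param:
  assumes "x \<in> cv C"
  obtains P Q where "x = skew_segre P Q" "P \<noteq> (\<lambda>_. 0)" "Q \<noteq> (\<lambda>_. 0)"
    "(P 0 * P 0 + P 1 * P 1) * (Q 0 * Q 0 + Q 1 * Q 1) + C * P 0 * P 1 * Q 0 * Q 1 = 0"
proof -
  let ?Q = "if x 0 \<noteq> 0 \<or> x 3 \<noteq> 0 then pair (x 0) (x 3) else pair (x 1) (x 2)"
  have "\<exists>P. x = skew_segre P ?Q"
    using cvD(2,3)[OF assms] by (intro cv_param2) (auto simp: fun2_eq mult.commute)
  then obtain P Q where PQ: "x = skew_segre P Q" by blast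
  then have "skew_segre P Q \<noteq> (\<lambda>_. 0)" "on_curve C (skew_segre P Q)"
    using assms by (auto simp: cv_def)
  then show ?thesis using that PQ by (simp add: segre_ne0 segre_on_curve)
qed

text \<open>Each cross product regroups into (x0^2 + x1^2 + x2^2 + x3^2) y0 y2 + x0 x2 (y0^2 + y1^2
  + y2^2 + y3^2). On the curve both summands equal C x0 x2 y0 y2, so they cancel.\<close>

lemma law_par:
  assumes "x \<in> cv C" "y \<in> cv C"
  shows "Ua x y 0 * Ub x y 1 = Ua x y 1 * Ub x y 0" "Va x y 0 * Vb x y 1 = Va x y 1 * Vb x y 0"
proof -
  note x = cvD[OF assms(1)] and y = cvD[OF assms(2)]
  have "(x 0 * y 3 + x 2 * y 1) * (x 0 * y 1 + x 2 * y 3) + (x 1 * y 0 + x 3 * y 2) * (x 1 * y 2 + x 3 * y 0)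
    = (x 0 * x 0 + x 2 * x 2) * (y 1 * y 3) + (x 0 * x 2) * (y 1 * y 1 + y 3 * y 3)
      + (x 1 * x 1 + x 3 * x 3) * (y 0 * y 2) + (x 1 * x 3) * (y 0 * y 0 + y 2 * y 2)"
    by (simp only: expand)
  also have "\<dots> = (x 0 * x 0 + x 1 * x 1 + x 2 * x 2 + x 3 * x 3) * (y 0 * y 2)
      + (x 0 * x 2) * (y 0 * y 0 + y 1 * y 1 + y 2 * y 2 + y 3 * y 3)"
    unfolding x(2)[symmetric] y(2)[symmetric] by (simp only: expand)
  also have "\<dots> = 0" unfolding x(1) y(1) by (simp only: expand char2)
  finally show "Ua x y 0 * Ub x y 1 = Ua x y 1 * Ub x y 0"
    by (simp add: law_defs char2_sum0[OF two])
  have "(x 0 * y 0 + x 2 * y 2) * (x 0 * y 2 + x 2 * y 0) + (x 1 * y 1 + x 3 * y 3) * (x 1 * y 3 + x 3 * y 1)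
    = (x 0 * x 0 + x 2 * x 2) * (y 0 * y 2) + (x 0 * x 2) * (y 0 * y 0 + y 2 * y 2)
      + (x 1 * x 1 + x 3 * x 3) * (y 1 * y 3) + (x 1 * x 3) * (y 1 * y 1 + y 3 * y 3)"
    by (simp only: expand)
  also have "\<dots> = (x 0 * x 0 + x 1 * x 1 + x 2 * x 2 + x 3 * x 3) * (y 0 * y 2)
      + (x 0 * x 2) * (y 0 * y 0 + y 1 * y 1 + y 2 * y 2 + y 3 * y 3)"
    unfolding x(2)[symmetric] y(2)[symmetric] by (simp only: expand)
  also have "\<dots> = 0" unfolding x(1) y(1) by (simp only: expand char2)
  finally show "Va x y 0 * Vb x y 1 = Va x y 1 * Vb x y 0"
    by (simp add: law_defs char2_sum0[OF two])
qed

text \<open>For a fixed point the squares of the coordinates would agree, all four or in pairs, and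
  the left side of the equation would vanish in characteristic 2. As C is nonzero this gives x0 x2 =
  0, and then all coordinates vanish.\<close>

lemma rot_no_fixpoint:
  assumes "x \<in> cv C"
  shows "\<not> par x (rot x)" "\<not> par x (rot (rot x))" "\<not> par x (rot (rot (rot x)))"
proof -
  note x = cvD[OF assms]
  have 1: "\<not> par x (rot x)" if "x \<in> cv C" for x
  proof
    note x = cvD[OF that]
    assume "par x (rot x)"
    then have "x 0 * rot x 1 = x 1 * rot x 0" "x 1 * rot x 2 = x 2 * rot x 1"
      "x 2 * rot x 3 = x 3 * rot x 2" "x 3 * rot x 0 = x 0 * rot x 3"
      unfolding par_def by blast+
    then have sq: "x 0 * x 0 = x 0 * x 2" "x 1 * x 1 = x 0 * x 2" "x 2 * x 2 = x 0 * x 2" "x 3 * x 3 = x 0 * x 2"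
      using x(2) by (simp_all add: mult.commute)
    have "C * (x 0 * x 2) = 0"
      using x(1) unfolding sq by (simp add: char2 mult.assoc)
    then have "x 0 * x 2 = 0" using C0 by simp
    then have "x 0 * x 0 = 0" "x 1 * x 1 = 0" "x 2 * x 2 = 0" "x 3 * x 3 = 0" by (simp_all only: sq)
    then show False using x(3) by simp
  qed
  show "\<not> par x (rot x)" using 1[OF assms] .
  show "\<not> par x (rot (rot x))"
  proof
    assume "par x (rot (rot x))"
    then have "x 0 * rot (rot x) 2 = x 2 * rot (rot x) 0" "x 1 * rot (rot x) 3 = x 3 * rot (rot x) 1"
      unfolding par_def by blast+
    then have "x 0 * x 0 + x 2 * x 2 = 0" "x 1 * x 1 + x 3 * x 3 = 0" by (simp_all add: char2)
    then have eq: "x 0 = x 2" "x 1 = x 3" by (simp_all only: square_sum0)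
    then have "x 2 = 0" using x(1) C0 two by auto
    then show False using x(2,3) eq by simp
  qed
  show "\<not> par x (rot (rot (rot x)))"
  proof
    assume "par x (rot (rot (rot x)))"
    then have "x i * rot (rot (rot x)) j = x j * rot (rot (rot x)) i" for i j unfolding par_def by blast
    from this[of 0 1] this[of 0 2] this[of 0 3] this[of 1 2] this[of 1 3] this[of 2 3]
    have "par (rot x) x" unfolding par_def all4 rot_simps by (simp only: mult_ac simp_thms)
    then show False using 1[OF assms] par_sym by blast
  qed
qed

text \<open>In the chart \<open>x 0 = z 0 = 1\<close>, \<open>p\<close> and \<open>q\<close> are the differences of the two affine coordinates;
  the hypotheses give \<open>p q = 0\<close> and \<open>p + q = 0\<close> up to units.\<close>

lemma exceptional_aux:
  assumes x: "x \<in> cv C" and z: "z \<in> cv C" and "x 0 \<noteq> 0"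
    and a: "x 1 * z 3 = x 3 * z 1" and b: "x 0 * z 2 = x 2 * z 0"
  shows "par x z"
proof -
  note x' = cvD[OF x] and z' = cvD[OF z]
  have z0: "z 0 \<noteq> 0"
  proof
    assume "z 0 = 0"
    then have "z 2 = 0" using b \<open>x 0 \<noteq> 0\<close> by simp
    then have "z 1 * z 3 = 0" "z 1 * z 1 + z 3 * z 3 = 0" using z'(1,2) \<open>z 0 = 0\<close> by simp_all
    then show False using z'(3) \<open>z 0 = 0\<close> \<open>z 2 = 0\<close> by auto
  qed
  define p q where "p = x 0 * z 1 + x 1 * z 0" and "q = x 0 * z 3 + x 3 * z 0"
  have "p * q = x 0 * x 0 * (z 1 * z 3) + x 0 * z 0 * (x 1 * z 3 + x 3 * z 1) + (x 1 * x 3) * z 0 * z 0"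
    unfolding p_def q_def by (simp only: expand)
  also have "\<dots> = x 0 * z 0 * (x 0 * z 2 + x 2 * z 0 + x 1 * z 3 + x 3 * z 1)"
    unfolding x'(2)[symmetric] z'(2)[symmetric] by (simp only: expand)
  also have "\<dots> = 0" unfolding a b by (simp add: char2 add.assoc)
  finally have pq: "p * q = 0" .
  have "x 1 * q + x 3 * p = x 0 * (x 1 * z 3 + x 3 * z 1)"
    unfolding p_def q_def by (simp only: expand char2)
  then have l: "x 1 * q + x 3 * p = 0" unfolding a by (simp add: char2)
  have ze: "p = 0 \<and> q = 0"
  proof (rule ccontr)
    assume "\<not> (p = 0 \<and> q = 0)"
    then have "p = 0 \<and> q \<noteq> 0 \<and> x 1 = 0 \<or> q = 0 \<and> p \<noteq> 0 \<and> x 3 = 0"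
      using pq l by auto
    then show False
    proof
      assume *: "p = 0 \<and> q \<noteq> 0 \<and> x 1 = 0"
      then have "x 2 = 0" using x'(2) \<open>x 0 \<noteq> 0\<close> by simp
      then have "z 2 = 0" using b \<open>x 0 \<noteq> 0\<close> by simp
      moreover have "z 1 = 0" using conjunct1[OF *] conjunct2[OF conjunct2[OF *]] \<open>x 0 \<noteq> 0\<close> by (simp add: p_def)
      ultimately have "x 0 * x 0 + x 3 * x 3 = 0" "z 0 * z 0 + z 3 * z 3 = 0"
        using x'(1) z'(1) * \<open>x 2 = 0\<close> by simp_all
      then have "x 0 = x 3" "z 0 = z 3" by (simp_all only: square_sum0)
      then show False using * by (simp add: q_def char2)
    next
      assume *: "q = 0 \<and> p \<noteq> 0 \<and> x 3 = 0"
      then have "x 2 = 0" using x'(2) \<open>x 0 \<noteq> 0\<close> by simp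
      then have "z 2 = 0" using b \<open>x 0 \<noteq> 0\<close> by simp
      moreover have "z 3 = 0" using conjunct1[OF *] conjunct2[OF conjunct2[OF *]] \<open>x 0 \<noteq> 0\<close> by (simp add: q_def)
      ultimately have "x 0 * x 0 + x 1 * x 1 = 0" "z 0 * z 0 + z 1 * z 1 = 0"
        using x'(1) z'(1) * \<open>x 2 = 0\<close> by simp_all
      then have "x 0 = x 1" "z 0 = z 1" by (simp_all only: square_sum0)
      then show False using * by (simp add: p_def char2)
    qed
  qed
  have "proj_eq x z" unfolding proj_eq_def
  proof (intro exI conjI)
    show "z 0 / x 0 \<noteq> 0" using z0 \<open>x 0 \<noteq> 0\<close> by simp
    have "x 0 * z 1 = x 1 * z 0" "x 0 * z 3 = x 3 * z 0"
      using ze by (simp_all add: p_def q_def char2_sum0[OF two])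
    then show "\<forall>i. z i = (z 0 / x 0) * x i"
      using b \<open>x 0 \<noteq> 0\<close> unfolding all4 by (simp add: field_simps)
  qed
  then show ?thesis by (rule proj_eq_par)
qed

lemma par_rot: "par (rot x) (rot z) \<longleftrightarrow> par x z"
  unfolding par_def all4 by auto

text \<open>Rotating both points simultaneously only exchanges the two hypotheses, so any nonzero
  coordinate can be moved to position 0.\<close>

lemma exceptional:
  assumes x: "x \<in> cv C" and z: "z \<in> cv C"
    and a: "x 1 * z 3 = x 3 * z 1" and b: "x 0 * z 2 = x 2 * z 0"
  shows "par x z"
proof -
  consider "x 0 \<noteq> 0" | "x 3 \<noteq> 0" | "x 2 \<noteq> 0" | "x 1 \<noteq> 0" using cvD(3)[OF x] by blast
  then show ?thesis
  proof cases
    case 1 then show ?thesis using exceptional_aux assms by blast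
  next
    case 2
    then have "par (rot x) (rot z)" using a b by (intro exceptional_aux) (simp_all add: cv_rot x z mult.commute)
    then show ?thesis by (simp add: par_rot)
  next
    case 3
    then have "par (rot (rot x)) (rot (rot z))"
      using a b by (intro exceptional_aux) (simp_all add: cv_rot x z mult.commute)
    then show ?thesis by (simp add: par_rot)
  next
    case 4
    then have "par (rot (rot (rot x))) (rot (rot (rot z)))"
      using a b by (intro exceptional_aux) (simp_all add: cv_rot x z mult.commute)
    then show ?thesis by (simp add: par_rot)
  qed
qed

lemma law_zero:
  assumes "x \<in> cv C" "y \<in> cv C"
  shows "Ua x y = (\<lambda>_. 0) \<Longrightarrow> par x (rot (rot (rot y)))" "Ub x y = (\<lambda>_. 0) \<Longrightarrow> par x (rot y)"
    "Va x y = (\<lambda>_. 0) \<Longrightarrow> par x (rot (rot y))" "Vb x y = (\<lambda>_. 0) \<Longrightarrow> par x y"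
  using exceptional[OF assms(1)] assms(2)
  by (simp_all add: cv_rot fun2_eq law_defs char2_sum0[OF two] add.commute)

lemma cv_ne0: "x \<in> cv C \<Longrightarrow> x \<noteq> (\<lambda>_. 0)"
  by (simp add: cv_def)

lemma par_cv_trans:
  assumes "x \<in> cv C" "y \<in> cv C" "z \<in> cv C" "par x y" "par x z"
  shows "par y z"
proof -
  note n = cv_ne0[OF assms(1)] cv_ne0[OF assms(2)] cv_ne0[OF assms(3)]
  have "proj_eq x y" "proj_eq x z" using assms(4,5) n by (auto intro: par_proj_eq)
  then show ?thesis using proj_eq_trans[OF proj_eq_sym] proj_eq_par by blast
qed

lemma par_rot_distinct:
  assumes "x \<in> cv C" "y \<in> cv C"
  shows "\<not> (par x y \<and> par x (rot y))" "\<not> (par x y \<and> par x (rot (rot y)))"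
    "\<not> (par x y \<and> par x (rot (rot (rot y))))"
    "\<not> (par x (rot y) \<and> par x (rot (rot y)))" "\<not> (par x (rot y) \<and> par x (rot (rot (rot y))))"
    "\<not> (par x (rot (rot y)) \<and> par x (rot (rot (rot y))))"
proof -
  have r: "rot y \<in> cv C" "rot (rot y) \<in> cv C" "rot (rot (rot y)) \<in> cv C" using assms by (simp_all add: cv_rot)
  note n = rot_no_fixpoint
  show "\<not> (par x y \<and> par x (rot y))" "\<not> (par x y \<and> par x (rot (rot y)))"
    "\<not> (par x y \<and> par x (rot (rot (rot y))))"
    "\<not> (par x (rot y) \<and> par x (rot (rot y)))" "\<not> (par x (rot y) \<and> par x (rot (rot (rot y))))"
    "\<not> (par x (rot (rot y)) \<and> par x (rot (rot (rot y))))"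
    using par_cv_trans[OF assms(1)] assms r n[OF assms(2)] n[OF r(1)] n[OF r(2)] by blast+
qed

lemma U_law_nonzero: "x \<in> cv C \<Longrightarrow> y \<in> cv C \<Longrightarrow> Ua x y \<noteq> (\<lambda>_. 0) \<or> Ub x y \<noteq> (\<lambda>_. 0)"
  using law_zero(1,2)[of x y] par_rot_distinct(5)[of x y] by blast
lemma V_law_nonzero: "x \<in> cv C \<Longrightarrow> y \<in> cv C \<Longrightarrow> Va x y \<noteq> (\<lambda>_. 0) \<or> Vb x y \<noteq> (\<lambda>_. 0)"
  using law_zero(3,4)[of x y] par_rot_distinct(2)[of x y] by blast

lemma law_rot:
  "Ua (rot x) y 0 = Va x y 1" "Ua (rot x) y 1 = Va x y 0"
  "Ub (rot x) y 0 = Vb x y 1" "Ub (rot x) y 1 = Vb x y 0"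
  "Va (rot x) y = Ub x y" "Vb (rot x) y = Ua x y"
  by (simp_all add: law_defs fun2_eq add.commute)

lemma isadd_rot: "isadd C (rot x) y (rot z) \<longleftrightarrow> isadd C x y z"
  unfolding isadd_def cv_rot law_eqs_def by (auto simp: law_rot)

lemma isadd_commute: "isadd C x y z \<Longrightarrow> isadd C y x z"
proof -
  have "Ua y x = Ub x y" "Ub y x = Ua x y" "Va y x = Va x y" "Vb y x = Vb x y"
    by (simp_all add: law_defs fun2_eq ac_simps)
  then show "isadd C x y z \<Longrightarrow> isadd C y x z"
    by (auto simp: isadd_def law_eqs_def)
qed

lemma isadd_neg: "isadd C x y z \<Longrightarrow> isadd C (neg x) (neg y) (neg z)"
proof -
  have *: "Ua (neg x) (neg y) = Ub x y" "Ub (neg x) (neg y) = Ua x y"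
    "Va (neg x) (neg y) 0 = Va x y 1" "Vb (neg x) (neg y) 0 = Vb x y 1"
    "Va (neg x) (neg y) 1 = Va x y 0" "Vb (neg x) (neg y) 1 = Vb x y 0"
    by (simp_all add: law_defs fun2_eq ac_simps)
  show "isadd C x y z \<Longrightarrow> isadd C (neg x) (neg y) (neg z)"
    unfolding isadd_def cv_neg law_eqs_def by (auto simp: *)
qed

lemma pt_O_cv: "pt_O \<in> cv C"
  by (auto simp: cv_def on_curve_def pt_O_def fun4_eq two)

lemma isadd_O: "x \<in> cv C \<Longrightarrow> isadd C x pt_O x"
  using cvD(2)[of x] pt_O_cv
  by (auto simp: isadd_def law_eqs_def law_defs pt_O_def mult.commute)

lemma isadd_neg_self: "x \<in> cv C \<Longrightarrow> isadd C x (neg x) pt_O"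
  using cvD(2)[of x] pt_O_cv
  by (auto simp: isadd_def law_eqs_def law_defs pt_O_def cv_neg ac_simps char2)

lemma segre_aux:
  fixes s0 s1 t0 t1 z0 z1 z2 z3 :: 'b
  assumes "s0 * z1 = s1 * z0" "s0 * z2 = s1 * z3" "t0 * z3 = t1 * z0" "t0 * z2 = t1 * z1"
  shows "s0 * t0 * z1 = s1 * t0 * z0" "s0 * t0 * z2 = s1 * t1 * z0" "s0 * t0 * z3 = s0 * t1 * z0"
    "s1 * t0 * z2 = s1 * t1 * z1" "s1 * t0 * z3 = s0 * t1 * z1" "s1 * t1 * z3 = s0 * t1 * z2"
  subgoal using arg_cong[OF assms(1), of "(*) t0"] by (simp only: mult_ac)
  subgoal using arg_cong[OF assms(4), of "(*) s0"] arg_cong[OF assms(1), of "(*) t1"] by (simp only: mult_ac)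
  subgoal using arg_cong[OF assms(3), of "(*) s0"] by (simp only: mult_ac)
  subgoal using arg_cong[OF assms(4), of "(*) s1"] by (simp only: mult_ac)
  subgoal using arg_cong[OF assms(3), of "(*) s1"] arg_cong[OF assms(1), of "(*) t1"] by (simp only: mult_ac)
  subgoal using arg_cong[OF assms(2), of "(*) t1"] by (simp only: mult_ac)
  done

lemma isadd_segre_par:
  assumes "isadd C x y z" "s \<in> {Ua x y, Ub x y}" "t \<in> {Va x y, Vb x y}"
  shows "par (skew_segre s t) z"
proof -
  have s: "s 0 * z 1 = s 1 * z 0" "s 0 * z 2 = s 1 * z 3"
    and t: "t 0 * z 3 = t 1 * z 0" "t 0 * z 2 = t 1 * z 1"
    using assms by (auto simp: isadd_def law_eqs_def)
  show ?thesis unfolding par_def all4 skew_segre_simps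
    by (intro conjI refl; rule segre_aux[OF s t] segre_aux[OF s t, symmetric])
qed

lemma isadd_segre:
  assumes "isadd C x y z" "s \<in> {Ua x y, Ub x y}" "t \<in> {Va x y, Vb x y}"
    "s \<noteq> (\<lambda>_. 0)" "t \<noteq> (\<lambda>_. 0)"
  shows "proj_eq (skew_segre s t) z"
  using par_proj_eq[OF isadd_segre_par[OF assms(1-3)]] assms(1,4,5) cv_ne0
  by (simp add: segre_ne0 isadd_def)

lemma isadd_unique:
  assumes "isadd C x y z" "isadd C x y z'"
  shows "proj_eq z z'"
proof -
  have "x \<in> cv C" "y \<in> cv C" using assms by (auto simp: isadd_def)
  from U_law_nonzero[OF this] V_law_nonzero[OF this]
  have "\<exists>s\<in>{Ua x y, Ub x y}. s \<noteq> (\<lambda>_. 0)" "\<exists>t\<in>{Va x y, Vb x y}. t \<noteq> (\<lambda>_. 0)"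
    by blast+
  then obtain s t where "s \<in> {Ua x y, Ub x y}" "t \<in> {Va x y, Vb x y}" "s \<noteq> (\<lambda>_. 0)" "t \<noteq> (\<lambda>_. 0)"
    by blast
  then have "proj_eq (skew_segre s t) z" "proj_eq (skew_segre s t) z'"
    using isadd_segre[OF assms(1)] isadd_segre[OF assms(2)] by blast+
  then show ?thesis using proj_eq_sym proj_eq_trans by blast
qed

lemma isadd_proj_eq:
  assumes "isadd C x y z" "proj_eq x x'" "proj_eq y y'" "proj_eq z z'"
  shows "isadd C x' y' z'"
proof -
  obtain l m n where l: "\<And>i. x' i = l * x i" and m: "\<And>i. y' i = m * y i" and n: "\<And>i. z' i = n * z i"
    using assms(2-4) by (auto simp: proj_eq_def)
  have s: "Ua x' y' i = l * m * Ua x y i" "Ub x' y' i = l * m * Ub x y i"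
    "Va x' y' i = l * m * Va x y i" "Vb x' y' i = l * m * Vb x y i" for i
    unfolding law_defs pair_def by (simp_all add: l m algebra_simps)
  have "law_eqs x' y' z'"
    using assms(1) unfolding isadd_def law_eqs_def by (simp add: s n mult_ac)
  then show ?thesis using assms cv_proj_eq by (auto simp: isadd_def)
qed

lemma isadd_base:
  assumes x: "x \<in> cv C" and y: "y \<in> cv C" and "Ua x y \<noteq> (\<lambda>_. 0)" "Va x y \<noteq> (\<lambda>_. 0)"
  defines "z \<equiv> skew_segre (Ua x y) (Va x y)"
  shows "isadd C x y z" "isadd C z (neg y) x"
proof -
  obtain P Q where PQ: "x = skew_segre P Q"
    "(P 0 * P 0 + P 1 * P 1) * (Q 0 * Q 0 + Q 1 * Q 1) + C * P 0 * P 1 * Q 0 * Q 1 = 0"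
    using cv_param[OF x] by metis
  obtain R S where RS: "y = skew_segre R S"
    "(R 0 * R 0 + R 1 * R 1) * (S 0 * S 0 + S 1 * S 1) + C * R 0 * R 1 * S 0 * S 1 = 0"
    using cv_param[OF y] by metis
  note ids = law_on_curve[OF two PQ(2) RS(2)] law_inverse_Ua[OF two PQ(2) RS(2)]
    law_inverse_Ub[OF two PQ(2) RS(2)] law_inverse_Va[OF two PQ(2) RS(2)] law_inverse_Vb[OF two PQ(2) RS(2)]
  have z: "z \<in> cv C"
    using assms(3,4) ids(1) unfolding cv_def z_def
    by (simp add: segre_ne0 segre_on_curve law_defs PQ(1) RS(1))
  show "isadd C x y z"
    using law_par[OF x y] x y z unfolding isadd_def law_eqs_def z_def
    by (auto simp: mult_ac)
  have 1: "Ua z (neg y) 0 * P 1 = Ua z (neg y) 1 * P 0" "Ub z (neg y) 0 * P 1 = Ub z (neg y) 1 * P 0"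
    "Va z (neg y) 0 * Q 1 = Va z (neg y) 1 * Q 0" "Vb z (neg y) 0 * Q 1 = Vb z (neg y) 1 * Q 0"
    unfolding char2_eq_iff[OF two, of "_ * (_::'b)"]
    using ids(2-5) unfolding z_def by (simp_all add: law_defs PQ(1) RS(1))
  show "isadd C z (neg y) x"
  proof -
    have l: "a * (p * r) = b * (q * r)" "a * (r * p) = b * (r * q)" if "a * p = b * q" for a b p q r :: 'b
      using that by (metis mult.assoc, metis mult.left_commute)
    show ?thesis using x y z l[OF 1(1)] l[OF 1(2)] l[OF 1(3)] l[OF 1(4)]
      unfolding isadd_def law_eqs_def cv_neg by (simp add: PQ(1))
  qed
qed

text \<open>\<open>isadd_base\<close> needs both first laws to be nonzero. Rotating x permutes the
  four laws (\<open>law_rot\<close>), and since they vanish on different translates of the diagonal,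
  at most two rotations reach that case.\<close>

lemma isadd_rot_base:
  assumes x: "x \<in> cv C" and y: "y \<in> cv C"
  obtains k z where "isadd C ((rot ^^ k) x) y z" "isadd C z (neg y) ((rot ^^ k) x)" "k < 3"
proof -
  have r: "rot x \<in> cv C" "rot (rot x) \<in> cv C" using x by (simp_all add: cv_rot)
  consider "Ua x y \<noteq> (\<lambda>_. 0)" "Va x y \<noteq> (\<lambda>_. 0)" | "Ua x y = (\<lambda>_. 0)" | "Va x y = (\<lambda>_. 0)" by blast
  then show ?thesis
  proof cases
    case 1
    then show ?thesis using isadd_base[OF x y] that[of 0] by simp
  next
    case 2
    then have "Va x y \<noteq> (\<lambda>_. 0)" "Ub x y \<noteq> (\<lambda>_. 0)"
      using law_zero[OF x y] par_rot_distinct[OF x y] by blast+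
    then have "Ua (rot x) y \<noteq> (\<lambda>_. 0)" "Va (rot x) y \<noteq> (\<lambda>_. 0)"
      by (auto simp: fun2_eq law_rot)
    then show ?thesis using isadd_base[OF r(1) y] that[of 1] by simp
  next
    case 3
    then have "Ub x y \<noteq> (\<lambda>_. 0)" "Vb x y \<noteq> (\<lambda>_. 0)"
      using law_zero[OF x y] par_rot_distinct[OF x y] by blast+
    then have "Ua (rot (rot x)) y \<noteq> (\<lambda>_. 0)" "Va (rot (rot x)) y \<noteq> (\<lambda>_. 0)"
      by (auto simp: fun2_eq law_rot)
    then show ?thesis using isadd_base[OF r(2) y] that[of 2] by (simp add: numeral_2_eq_2)
  qed
qed

lemma isadd_rot_pow: "isadd C ((rot ^^ k) x) y ((rot ^^ k) z) \<longleftrightarrow> isadd C x y z"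
  by (induction k) (simp_all add: isadd_rot)

lemma isadd_exists:
  assumes "x \<in> cv C" "y \<in> cv C"
  obtains z where "isadd C x y z"
proof -
  obtain k z where "isadd C ((rot ^^ k) x) y z" using isadd_rot_base[OF assms] by metis
  \<comment> \<open>\<open>rot\<close> has order 4, so 3 k further rotations undo k of them.\<close>
  moreover have "z = (rot ^^ k) ((rot ^^ (3 * k)) z)"
  proof -
    have "(rot :: (4 \<Rightarrow> 'b) \<Rightarrow> _) ^^ 4 = id" by (simp add: fun_eq_iff eval_nat_numeral)
    then have "(rot ^^ (4 * k)) z = z"
      by (metis funpow_mult id_apply id_funpow)
    moreover have "(rot ^^ (4 * k)) z = (rot ^^ k) ((rot ^^ (3 * k)) z)"
      using fun_cong[OF funpow_add[of k "3 * k" rot], of z] by simp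
    ultimately show ?thesis by simp
  qed
  ultimately show ?thesis using that isadd_rot_pow by metis
qed

lemma isadd_diff:
  assumes "isadd C x y z"
  shows "isadd C z (neg y) x"
proof -
  have "x \<in> cv C" "y \<in> cv C" using assms by (auto simp: isadd_def)
  then obtain k w where w: "isadd C ((rot ^^ k) x) y w" "isadd C w (neg y) ((rot ^^ k) x)"
    using isadd_rot_base by metis
  have "isadd C ((rot ^^ k) x) y ((rot ^^ k) z)" using assms by (simp add: isadd_rot_pow)
  then have "proj_eq w ((rot ^^ k) z)" using isadd_unique w(1) by blast
  then have "isadd C ((rot ^^ k) z) (neg y) ((rot ^^ k) x)"
    using isadd_proj_eq[OF w(2)] proj_eq_refl by blast
  then show ?thesis by (simp add: isadd_rot_pow)
qed

lemma isadd_T: "y \<in> cv C \<Longrightarrow> isadd C pt_T y (rot y)"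
proof -
  assume "y \<in> cv C"
  then have "isadd C (rot pt_O) y (rot y)" using isadd_O isadd_commute isadd_rot by blast
  moreover have "rot pt_O = (pt_T :: 4 \<Rightarrow> 'b)" by (simp add: fun4_eq pt_O_def pt_T_def)
  ultimately show ?thesis by simp
qed

end

section \<open>Halving points over an algebraically closed field\<close>

lemma alg_closed_quadratic_root:
  fixes b c :: "'a::alg_closed_field"
  shows "\<exists>t. t * t + b * t + c = 0"
proof -
  have "\<exists>t. poly [:c, b, 1:] t = 0" by (rule alg_closed_imp_poly_has_root) auto
  then show ?thesis by (auto simp: algebra_simps)
qed

locale char2_curve_ac = char2_curve C for C :: "'b::alg_closed_field"
begin

text \<open>\<open>Va w w\<close> consists of the squares of w0 + w2 and w1 + w3, so these sums must
  be square roots of the entries of Q. The equation of the curve then fixes the common product m =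
  w0 w2 = w1 w3, and the coordinates of w are roots of two quadratic equations. This achieves the
  second projection of 2 w = x; the first is correct up to exchanging its entries.\<close>

lemma halving:
  assumes x: "x \<in> cv C"
  obtains w where "isadd C w w x"
proof -
  obtain P Q where PQ: "x = skew_segre P Q" "P \<noteq> (\<lambda>_. 0)" "Q \<noteq> (\<lambda>_. 0)"
    "(P 0 * P 0 + P 1 * P 1) * (Q 0 * Q 0 + Q 1 * Q 1) + C * P 0 * P 1 * Q 0 * Q 1 = 0"
    using cv_param[OF x] by metis
  have "\<exists>t. t * t = Q i" for i
    using alg_closed_quadratic_root[of 0 "Q i"] by (simp add: char2_sum0[OF two])
  then obtain \<sigma> where \<sigma>: "\<And>i. \<sigma> i * \<sigma> i = Q i" by metis
  define m where "m = (\<sigma> 0 + \<sigma> 1)\<^sup>2 / C"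
  obtain w0 where w0: "w0 * w0 + \<sigma> 0 * w0 + m = 0" using alg_closed_quadratic_root by blast
  obtain w1 where w1: "w1 * w1 + \<sigma> 1 * w1 + m = 0" using alg_closed_quadratic_root by blast
  define w where "w = quadruple w0 w1 (w0 + \<sigma> 0) (w1 + \<sigma> 1)"
  have m: "w0 * (w0 + \<sigma> 0) = m" "w1 * (w1 + \<sigma> 1) = m"
    using w0 w1 char2_sum0[OF two, of "w0 * w0 + \<sigma> 0 * w0" m] char2_sum0[OF two, of "w1 * w1 + \<sigma> 1 * w1" m]
    by (simp_all add: algebra_simps)
  have "w 0 + w 1 + w 2 + w 3 = \<sigma> 0 + \<sigma> 1"
    unfolding w_def quadruple_simps by (simp only: expand char2)
  moreover have "w 0 * w 2 = m" "w 1 * w 3 = m" using m by (simp_all add: w_def)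
  moreover have "C * m = (\<sigma> 0 + \<sigma> 1)\<^sup>2" using C0 by (simp add: m_def)
  ultimately have on: "on_curve C w"
    by (simp add: on_curve_def mult.assoc)
  have "w \<noteq> (\<lambda>_. 0)"
  proof
    assume "w = (\<lambda>_. 0)"
    then have "\<sigma> 0 = 0" "\<sigma> 1 = 0" by (auto simp: w_def fun4_eq)
    then show False using \<sigma>[of 0] \<sigma>[of 1] PQ(3) by (simp add: fun2_eq)
  qed
  then have w: "w \<in> cv C" using on by (simp add: cv_def)
  \<comment> \<open>Exchanging the coordinates 1 and 3 of w keeps \<open>Va w w\<close> and swaps
    the entries of the U laws, so the double changes only by exchanging the entries of its first
    projection.\<close>
  define w' where "w' = quadruple (w 0) (w 3) (w 2) (w 1)"
  have w': "w' \<in> cv C"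
    using w by (auto simp: w'_def cv_def on_curve_def fun4_eq ac_simps)
  have Va: "Va w w = Q"
  proof -
    have "w0 * w0 + (w0 + \<sigma> 0) * (w0 + \<sigma> 0) = \<sigma> 0 * \<sigma> 0" "w1 * w1 + (w1 + \<sigma> 1) * (w1 + \<sigma> 1) = \<sigma> 1 * \<sigma> 1"
      by (simp_all only: expand char2)
    then show ?thesis by (simp add: fun2_eq law_defs w_def \<sigma>)
  qed
  obtain z where z: "isadd C w w z" using isadd_exists[OF w w] .
  then have zc: "z \<in> cv C" by (simp add: isadd_def)
  have "\<exists>R. z = skew_segre R Q"
    using z cvD(2)[OF zc] PQ(3) by (intro cv_param2) (auto simp: isadd_def law_eqs_def Va[symmetric])
  then obtain R where R: "z = skew_segre R Q" by blast
  then have R': "R \<noteq> (\<lambda>_. 0)"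
    "(R 0 * R 0 + R 1 * R 1) * (Q 0 * Q 0 + Q 1 * Q 1) + C * R 0 * R 1 * Q 0 * Q 1 = 0"
    using zc by (auto simp: cv_def segre_ne0 segre_on_curve)
  define z' where "z' = quadruple (z 1) (z 0) (z 3) (z 2)"
  have z': "isadd C w' w' z'"
  proof -
    have *: "Ua w' w' 0 = Ua w w 1" "Ua w' w' 1 = Ua w w 0" "Ub w' w' 0 = Ub w w 1" "Ub w' w' 1 = Ub w w 0"
      "Va w' w' = Va w w" "Vb w' w' = Vb w w"
      by (simp_all add: law_defs w'_def ac_simps fun2_eq)
    have "z' \<in> cv C" using zc by (auto simp: z'_def cv_def on_curve_def fun4_eq ac_simps)
    then show ?thesis using w' z unfolding isadd_def law_eqs_def by (auto simp: * z'_def)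
  qed
  \<comment> \<open>P and R solve the curve equation for the same Q. It is quadratic in the ratio of
    the entries and its two roots are inverse to each other, so R is P or P with its entries
    exchanged.\<close>
  have "(R 0 * P 1 + R 1 * P 0) * (R 0 * P 0 + R 1 * P 1) = 0"
  proof (cases "Q 0 * Q 1 = 0")
    case False
    have "(R 0 * P 1 + R 1 * P 0) * (R 0 * P 0 + R 1 * P 1) * (C * (Q 0 * Q 1)) =
      (R 0 * R 0 + R 1 * R 1) * (C * P 0 * P 1 * Q 0 * Q 1) + (P 0 * P 0 + P 1 * P 1) * (C * R 0 * R 1 * Q 0 * Q 1)"
      by (simp only: expand)
    also have "\<dots> = (R 0 * R 0 + R 1 * R 1) * ((P 0 * P 0 + P 1 * P 1) * (Q 0 * Q 0 + Q 1 * Q 1))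
        + (P 0 * P 0 + P 1 * P 1) * ((R 0 * R 0 + R 1 * R 1) * (Q 0 * Q 0 + Q 1 * Q 1))"
      using PQ(4) R'(2) by (simp only: char2_eq_iff[OF two, symmetric])
    also have "\<dots> = 0" by (simp only: expand char2)
    finally show ?thesis using False C0 by simp
  next
    case True
    then have "Q 0 \<noteq> Q 1" using PQ(3) by (auto simp: fun2_eq)
    then have "Q 0 * Q 0 + Q 1 * Q 1 \<noteq> 0" by (simp only: square_sum0 not_False_eq_True)
    moreover have "C * P 0 * P 1 * Q 0 * Q 1 = 0" "C * R 0 * R 1 * Q 0 * Q 1 = 0" using True by auto
    ultimately have "P 0 * P 0 + P 1 * P 1 = 0" "R 0 * R 0 + R 1 * R 1 = 0"
      using PQ(4) R'(2) by auto
    then have "P 0 = P 1" "R 0 = R 1" by (simp_all only: square_sum0)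
    then show ?thesis by (simp add: char2)
  qed
  then have "R 0 * P 1 + R 1 * P 0 = 0 \<or> R 0 * P 0 + R 1 * P 1 = 0" by simp
  then have "par x z \<or> par x z'"
  proof
    have *: "skew_segre P Q i * skew_segre R Q j = skew_segre P Q j * skew_segre R Q i"
      if "R 0 * P 1 = R 1 * P 0" for P R i j
    proof -
      have "par (skew_segre P Q) (skew_segre R Q)"
        using that unfolding par_def all4 by (auto simp: mult_ac)
      then show ?thesis by (simp add: par_def)
    qed
    {
      assume "R 0 * P 1 + R 1 * P 0 = 0"
      then have "par x z" using *[of R P] unfolding par_def PQ(1) R by (simp add: char2_sum0[OF two])
    }
    then show "par x z \<or> par x z'" if "R 0 * P 1 + R 1 * P 0 = 0" using that by blast
    have "z' = skew_segre (pair (R 1) (R 0)) Q" by (simp add: z'_def R fun4_eq)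
    then show "par x z \<or> par x z'" if "R 0 * P 0 + R 1 * P 1 = 0"
      using *[of "pair (R 1) (R 0)" P] that unfolding par_def PQ(1)
      by (auto simp: char2_sum0[OF two] add.commute)
  qed
  then have "proj_eq z x \<or> proj_eq z' x"
    using x zc z' cv_ne0 by (auto simp: par_iff_proj_eq isadd_def intro: proj_eq_sym)
  then show ?thesis using z z' isadd_proj_eq proj_eq_refl that by metis
qed

end

section \<open>Univariate polynomials and series\<close>

definition pe :: "('a::comm_ring_1 \<Rightarrow> 'b::comm_ring_1) \<Rightarrow> 'a poly \<Rightarrow> 'b \<Rightarrow> 'b" where
  "pe h A u = poly (map_poly h A) u"

context
  fixes h :: "'a::comm_ring_1 \<Rightarrow> 'b::comm_ring_1"
  assumes h: "ring_hom_map h"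
begin

lemma pe_pCons: "pe h (pCons a A) u = h a + u * pe h A u"
proof (cases "a = 0 \<and> A = 0")
  case True then show ?thesis by (simp add: pe_def ring_hom_map_simps(1)[OF h])
next
  case False
  have "map_poly h (pCons a A) = pCons (h a) (map_poly h A)"
    by (rule map_poly_pCons) (simp add: ring_hom_map_simps(1)[OF h])
  then show ?thesis by (simp add: pe_def)
qed

lemma pe_0: "pe h 0 u = 0" by (simp add: pe_def)

lemma pe_add: "pe h (A + B) u = pe h A u + pe h B u"
  by (induction A B rule: poly_induct2) (simp_all add: pe_0 pe_pCons ring_hom_map_simps[OF h] algebra_simps)

lemma pe_smult: "pe h (smult a A) u = h a * pe h A u"
  by (induction A) (simp_all add: pe_0 pe_pCons ring_hom_map_simps[OF h] algebra_simps)

lemma pe_mult: "pe h (A * B) u = pe h A u * pe h B u"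
  by (induction A) (simp_all add: pe_0 pe_add pe_smult pe_pCons ring_hom_map_simps[OF h] algebra_simps)

lemma pe_1: "pe h 1 u = 1"
  by (simp add: one_pCons pe_pCons pe_0 ring_hom_map_simps[OF h])

lemma pe_power: "pe h (A ^ n) u = pe h A u ^ n"
  by (induction n) (simp_all add: pe_1 pe_mult)

lemmas pe_simps = pe_pCons pe_0 pe_add pe_smult pe_mult pe_1 pe_power

end

lemma pe_const:
  assumes "ring_hom_map h"
  shows "pe h A (h a) = h (poly A a)"
  by (induction A) (simp_all add: pe_simps[OF assms] ring_hom_map_simps[OF assms])

lemma pe_comp:
  assumes "ring_hom_map g" "ring_hom_map h"
  shows "g (pe h A u) = pe (\<lambda>a. g (h a)) A (g u)"
  by (induction A)
    (simp_all add: pe_simps[OF assms(2)] pe_simps[OF ring_hom_map_comp[OF assms]] ring_hom_map_simps[OF assms(1)])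

lemma pe_id: "pe (\<lambda>a. a) A u = poly A u"
  by (simp add: pe_def)

lemma ring_hom_map_fls_const: "ring_hom_map (fls_const :: 'a::comm_ring_1 \<Rightarrow> _)"
  by (simp add: ring_hom_map_def fls_plus_const fls_const_mult_const)

lemma ring_hom_map_fps_to_fls: "ring_hom_map (fps_to_fls :: 'a::comm_ring_1 fps \<Rightarrow> _)"
  by (simp add: ring_hom_map_def fls_times_fps_to_fls fps_to_fls_plus)

lemma ring_hom_map_fps_nth0: "ring_hom_map (\<lambda>f :: 'a::comm_ring_1 fps. f $ 0)"
  by (simp add: ring_hom_map_def)

lemma alg_closed_infinite: "infinite (UNIV :: 'a::alg_closed_field set)"
proof
  assume fin: "finite (UNIV :: 'a set)"
  define p where "p = (\<Prod>a\<in>(UNIV :: 'a set). [:-a, 1:]) + 1"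
  have deg: "degree (\<Prod>a\<in>(UNIV :: 'a set). [:-a, 1:]) = card (UNIV :: 'a set)"
    by (subst degree_prod_eq_sum_degree) auto
  have "0 < card (UNIV :: 'a set)" using fin by (simp add: card_gt_0_iff)
  then have "degree p = card (UNIV :: 'a set)"
    unfolding p_def using deg by (subst degree_add_eq_left) auto
  then have "degree p > 0" using \<open>0 < card (UNIV :: 'a set)\<close> by simp
  then obtain x where "poly p x = 0" using alg_closed_imp_poly_has_root by blast
  moreover have "poly (\<Prod>a\<in>(UNIV :: 'a set). [:-a, 1:]) x = 0"
    using fin by (auto simp: poly_prod prod_zero_iff)
  ultimately show False by (simp add: p_def)
qed

lemma poly_zero_cofinite:
  fixes p :: "'a::alg_closed_field poly"
  assumes "\<And>x. x \<notin> S \<Longrightarrow> poly p x = 0" "finite S"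
  shows "p = 0"
proof (rule ccontr)
  assume "p \<noteq> 0"
  then have "finite {x. poly p x = 0}" by (rule poly_roots_finite)
  moreover have "UNIV \<subseteq> S \<union> {x. poly p x = 0}" using assms(1) by blast
  ultimately show False using alg_closed_infinite assms(2) finite_subset by (metis finite_UnI)
qed

context char2_curve_ac
begin

abbreviation I :: "(4, 'b) mpol set" where "I \<equiv> vanishing_ideal (cv C)"

lemma I_iff: "f \<in> I \<longleftrightarrow> (\<forall>x\<in>cv C. peval f x = 0)"
  by (simp add: vanishing_ideal_def)

lemma is_ideal_I: "is_ideal I"
  by (rule is_ideal_vanishing_ideal)

section \<open>Normal form of a polynomial on the affine chart\<close>

definition chart :: "'r::comm_ring_1 \<Rightarrow> 'r \<Rightarrow> 4 \<Rightarrow> 'r" where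
  "chart u v = quadruple 1 u (u * v) v"

lemma chart_simps [simp]: "chart u v 0 = 1" "chart u v 1 = u" "chart u v 2 = u * v" "chart u v 3 = v"
  by (simp_all add: chart_def)

text \<open>Stated over Laurent series so that it covers constant points as well as formal curves
  through points with X0 = 0, along which u or v has a pole.\<close>

definition on_affine :: "'b fls \<Rightarrow> 'b fls \<Rightarrow> bool" where
  "on_affine u v \<longleftrightarrow> (1 + u * u) * (1 + v * v) + fls_const C * u * v = 0"

definition Wpoly :: "'b poly" where "Wpoly = [:1, 0, 1:]"

lemma two_fls: "(2 :: 'b fls) = 0"
proof -
  have "(2 :: 'b fls) = fls_const 1 + fls_const 1" by simp
  also have "\<dots> = fls_const (1 + 1)" by (simp only: fls_plus_const)
  also have "\<dots> = 0" using two by simp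
  finally show ?thesis .
qed

lemmas char2_fls = char2_rules[OF two_fls]

lemma pe_Wpoly: "pe fls_const Wpoly u = 1 + u * (u :: 'b fls)"
  by (simp add: Wpoly_def pe_simps[OF ring_hom_map_fls_const])

text \<open>Modulo the equation of the curve, \<open>v\<^sup>2\<close> becomes linear in \<open>v\<close> after multiplication by
  \<open>1 + u\<^sup>2\<close>.\<close>

lemma normal_form:
  fixes f :: "(4, 'b) mpol"
  shows "\<exists>N A B. \<forall>u v. on_affine u v \<longrightarrow>
    (1 + u * u) ^ N * evh fls_const (chart u v) f = pe fls_const A u + pe fls_const B u * v"
proof (induction f rule: mpol_induct)
  case (scalar a)
  show ?case
    by (rule exI[of _ 0], rule exI[of _ "[:a:]"], rule exI[of _ 0])
      (simp add: evh_simps ring_hom_map_fls_const pe_simps[OF ring_hom_map_fls_const])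
next
  case (indet i)
  have *: ?case if "\<And>u v. chart u v i = pe fls_const A u + pe fls_const B u * (v :: 'b fls)" for A B
    by (rule exI[of _ 0], rule exI[of _ A], rule exI[of _ B])
      (simp add: evh_simps ring_hom_map_fls_const that)
  have "i = 0 \<or> i = 1 \<or> i = 2 \<or> i = 3" using all4[of "\<lambda>i. i = 0 \<or> i = 1 \<or> i = 2 \<or> i = 3"] by simp
  then show ?case
    using *[of 1 0] *[of "[:0, 1:]" 0] *[of 0 "[:0, 1:]"] *[of 0 1]
    by (auto simp: pe_simps[OF ring_hom_map_fls_const])
next
  case (add f g)
  then obtain N A B N' A' B' where
    f: "\<And>u v. on_affine u v \<Longrightarrow> (1 + u * u) ^ N * evh fls_const (chart u v) f = pe fls_const A u + pe fls_const B u * v"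
    and g: "\<And>u v. on_affine u v \<Longrightarrow> (1 + u * u) ^ N' * evh fls_const (chart u v) g = pe fls_const A' u + pe fls_const B' u * v"
    by metis
  show ?case
  proof (intro exI allI impI)
    fix u v assume uv: "on_affine u v"
    have "(1 + u * u) ^ (N + N') * evh fls_const (chart u v) (f + g) =
      (1 + u * u) ^ N' * ((1 + u * u) ^ N * evh fls_const (chart u v) f) +
      (1 + u * u) ^ N * ((1 + u * u) ^ N' * evh fls_const (chart u v) g)"
      by (simp add: evh_simps ring_hom_map_fls_const power_add algebra_simps)
    also have "\<dots> = pe fls_const (Wpoly ^ N' * A + Wpoly ^ N * A') u + pe fls_const (Wpoly ^ N' * B + Wpoly ^ N * B') u * v"
      unfolding f[OF uv] g[OF uv] by (simp add: pe_simps[OF ring_hom_map_fls_const] pe_Wpoly algebra_simps)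
    finally show "(1 + u * u) ^ (N + N') * evh fls_const (chart u v) (f + g) =
      pe fls_const (Wpoly ^ N' * A + Wpoly ^ N * A') u + pe fls_const (Wpoly ^ N' * B + Wpoly ^ N * B') u * v" .
  qed
next
  case (mult f g)
  then obtain N A B N' A' B' where
    f: "\<And>u v. on_affine u v \<Longrightarrow> (1 + u * u) ^ N * evh fls_const (chart u v) f = pe fls_const A u + pe fls_const B u * v"
    and g: "\<And>u v. on_affine u v \<Longrightarrow> (1 + u * u) ^ N' * evh fls_const (chart u v) g = pe fls_const A' u + pe fls_const B' u * v"
    by metis
  \<comment> \<open>The product (a + b v) (a' + b' v) contains b b' v^2, and w v^2 = w + C u v for w
    = 1 + u^2 turns it into an expression linear in v.\<close>
  let ?A = "Wpoly * (A * A' + B * B')"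
  let ?B = "Wpoly * (A * B' + A' * B) + [:0, C:] * (B * B')"
  show ?case
  proof (intro exI allI impI)
    fix u v assume uv: "on_affine u v"
    define w a b a' b' where "w = 1 + u * u" and "a = pe fls_const A u" and "b = pe fls_const B u"
      and "a' = pe fls_const A' u" and "b' = pe fls_const B' u"
    have "w * (1 + v * v) + fls_const C * u * v = 0" using uv by (simp add: on_affine_def w_def)
    then have "w * (1 + v * v) = fls_const C * u * v" by (simp only: char2_sum0[OF two_fls])
    then have "w * (v * v) = w + fls_const C * u * v"
      by (metis char2_fls(2) distrib_left mult.right_neutral)
    then have v2: "w * (v * v) * t = (w + fls_const C * u * v) * t" for t by simp
    have "w ^ Suc (N + N') * evh fls_const (chart u v) (f * g) =
      w * ((w ^ N * evh fls_const (chart u v) f) * (w ^ N' * evh fls_const (chart u v) g))"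
      by (simp add: evh_simps ring_hom_map_fls_const power_add mult_ac)
    also have "\<dots> = w * ((a + b * v) * (a' + b' * v))"
      unfolding w_def f[OF uv] g[OF uv] a_def b_def a'_def b'_def ..
    also have "\<dots> = w * (a * a') + w * (a * b' + a' * b) * v + w * (v * v) * (b * b')"
      by (simp only: expand)
    also have "\<dots> = w * (a * a') + w * (a * b' + a' * b) * v + (w + fls_const C * u * v) * (b * b')"
      by (simp only: v2)
    also have "\<dots> = pe fls_const ?A u + pe fls_const ?B u * v"
      by (simp add: pe_simps[OF ring_hom_map_fls_const] pe_Wpoly w_def a_def b_def a'_def b'_def algebra_simps)
    finally show "(1 + u * u) ^ Suc (N + N') * evh fls_const (chart u v) (f * g) =
      pe fls_const ?A u + pe fls_const ?B u * v" by (simp only: w_def)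
  qed
qed

lemma evh_fls_const_peval: "evh fls_const (\<lambda>i. fls_const (x i)) f = fls_const (peval f x)"
  using evh_comp[OF ring_hom_map_fls_const ring_hom_map_id, of x f] by (simp add: peval_eq_evh)

lemma chart_fls_const: "chart (fls_const u) (fls_const v) = (\<lambda>i. fls_const (chart u v i))"
  by (simp add: fun4_eq fls_const_mult_const)

lemma on_affine_const: "on_affine (fls_const u) (fls_const v) \<longleftrightarrow> (1 + u * u) * (1 + v * v) + C * u * v = 0"
proof -
  have "(1 + fls_const u * fls_const u) * (1 + fls_const v * fls_const v) + fls_const C * fls_const u * fls_const v
    = fls_const ((1 + u * u) * (1 + v * v) + C * u * v)"
    by (simp only: ring_hom_map_simps(2-4)[OF ring_hom_map_fls_const])
  then show ?thesis by (simp add: on_affine_def)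
qed

lemma chart_cv: "chart u v \<in> cv C \<longleftrightarrow> (1 + u * u) * (1 + v * v) + C * u * v = 0"
proof -
  have "chart u v = skew_segre (pair 1 u) (pair 1 v)" by (simp add: fun4_eq)
  moreover have "chart u v \<noteq> (\<lambda>_. 0)" by (auto simp: fun4_eq)
  ultimately show ?thesis by (simp add: cv_def segre_on_curve mult_ac)
qed

lemma cv_chart:
  assumes "x \<in> cv C" "x 0 \<noteq> 0"
  shows "x i = x 0 * chart (x 1 / x 0) (x 3 / x 0) i" "chart (x 1 / x 0) (x 3 / x 0) \<in> cv C"
proof -
  have "\<forall>i. x i = x 0 * chart (x 1 / x 0) (x 3 / x 0) i"
    unfolding all4 using cvD(2)[OF assms(1)] assms(2) by (simp add: field_simps)
  then show "x i = x 0 * chart (x 1 / x 0) (x 3 / x 0) i" by blast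
  have "proj_eq (chart (x 1 / x 0) (x 3 / x 0)) x"
    unfolding proj_eq_def using assms(2) \<open>\<forall>i. _ i = _\<close> by blast
  then show "chart (x 1 / x 0) (x 3 / x 0) \<in> cv C" using cv_proj_eq assms(1) proj_eq_sym by blast
qed

text \<open>The equation is invariant under v \<mapsto> 1/v, and the two roots are distinct because
  their sum C u / (1 + u^2) is nonzero. They are the two points P and -P over u.\<close>

lemma affine_points:
  assumes "u \<noteq> 0" "u \<noteq> 1"
  obtains v where "v \<noteq> 0" "v \<noteq> 1 / v" "chart u v \<in> cv C" "chart u (1 / v) \<in> cv C"
proof -
  have w: "1 + u * u \<noteq> 0" using assms(2) square_sum0[of 1 u] by auto
  obtain v where v: "v * v + C * u / (1 + u * u) * v + 1 = 0" using alg_closed_quadratic_root by blast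
  have "(1 + u * u) * (1 + v * v) + C * u * v = (1 + u * u) * (v * v + C * u / (1 + u * u) * v + 1)"
    using w by (simp add: field_simps)
  then have 1: "(1 + u * u) * (1 + v * v) + C * u * v = 0" by (simp only: v mult_zero_right)
  have v0: "v \<noteq> 0" using v by auto
  have "(1 + u * u) * (1 + (1 / v) * (1 / v)) + C * u * (1 / v) = ((1 + u * u) * (1 + v * v) + C * u * v) / (v * v)"
    using v0 by (simp add: field_simps)
  then have 2: "(1 + u * u) * (1 + (1 / v) * (1 / v)) + C * u * (1 / v) = 0" by (simp add: 1)
  have "v \<noteq> 1 / v"
  proof
    assume "v = 1 / v"
    then have "v * v = 1" using v0 by (metis nonzero_eq_divide_eq)
    then have "C * u * v = 0" using 1 by (simp add: two)
    then show False using assms(1) v0 C0 by simp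
  qed
  then show ?thesis using that v0 1 2 by (simp add: chart_cv)
qed

text \<open>A(u) + B(u) v vanishes at both points over almost every u; as their v differ, A and B
  have infinitely many zeros.\<close>

lemma I_normal_form:
  assumes "\<And>u v. u \<notin> S \<Longrightarrow> chart u v \<in> cv C \<Longrightarrow> peval f (chart u v) = 0" and "finite S"
    and N: "\<And>u v. on_affine u v \<Longrightarrow>
    (1 + u * u) ^ N * evh fls_const (chart u v) f = pe fls_const A u + pe fls_const B u * v"
  shows "A = 0" "B = 0"
proof -
  have *: "poly A u = 0 \<and> poly B u = 0" if "u \<notin> S \<union> {0, 1}" for u
  proof -
    have u: "u \<noteq> 0" "u \<noteq> 1" "u \<notin> S" using that by auto
    obtain v where v: "v \<noteq> 0" "v \<noteq> 1 / v" "chart u v \<in> cv C" "chart u (1 / v) \<in> cv C"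
      using affine_points[OF u(1,2)] .
    have "poly A u + poly B u * v = 0" if "chart u v \<in> cv C" for v
    proof -
      have "fls_const (poly A u + poly B u * v) = pe fls_const A (fls_const u) + pe fls_const B (fls_const u) * fls_const v"
        by (simp only: pe_const[OF ring_hom_map_fls_const] ring_hom_map_simps(2-4)[OF ring_hom_map_fls_const])
      also have "\<dots> = (1 + fls_const u * fls_const u) ^ N * evh fls_const (chart (fls_const u) (fls_const v)) f"
        using N[of "fls_const u" "fls_const v"] that by (simp add: on_affine_const chart_cv)
      also have "\<dots> = 0"
        using assms(1)[OF u(3) that] by (simp add: chart_fls_const evh_fls_const_peval)
      finally show ?thesis by simp
    qed
    from this[OF v(3)] this[OF v(4)]
    have e: "poly A u + poly B u * v = 0" "poly A u + poly B u * (1 / v) = 0" .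
    then have "poly B u * (v - 1 / v) = 0" by (simp add: algebra_simps) (metis add_left_cancel)
    then have "poly B u = 0" using v(2) by simp
    then show ?thesis using e(1) by simp
  qed
  show "A = 0" using * by (intro poly_zero_cofinite[of "S \<union> {0, 1}"]) (auto simp: assms(2))
  show "B = 0" using * by (intro poly_zero_cofinite[of "S \<union> {0, 1}"]) (auto simp: assms(2))
qed

text \<open>The normal form is an identity over all Laurent series, and its coefficients vanish by
  \<open>I_normal_form\<close>. Thus vanishing at points of the curve carries over to formal
  points.\<close>

lemma I_vanishes_fls:
  assumes "f \<in> I" "on_affine u v" "1 + u * u \<noteq> 0"
  shows "evh fls_const (chart u v) f = 0"
proof -
  obtain N A B where N: "\<And>u v. on_affine u v \<Longrightarrow>
    (1 + u * u) ^ N * evh fls_const (chart u v) f = pe fls_const A u + pe fls_const B u * v"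
    using normal_form by metis
  have "A = 0" "B = 0" using I_normal_form[OF _ finite.emptyI N] assms(1) by (auto simp: I_iff)
  then show ?thesis using N[OF assms(2)] assms(3) by (simp add: pe_0[OF ring_hom_map_fls_const])
qed

section \<open>The formal branch at the neutral element\<close>

text \<open>With v = 1 + t the equation of the curve reads u / (1 + u^2) = t^2 / (C (1 + t)). The
  series solves it for u by composing the right side with the compositional inverse of t / (1 +
  t^2).\<close>

definition useries :: "'b fps" where
  "useries = fps_inv (fps_X * inverse (1 + fps_X * fps_X)) oo (fps_X * fps_X * inverse (fps_const C * (1 + fps_X)))"

definition vseries :: "'b fps" where "vseries = 1 + fps_X"

lemma useries_eq: "useries * (fps_const C * (1 + fps_X)) = fps_X * fps_X * (1 + useries * useries)"
  and useries_nth0: "useries $ 0 = 0"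
proof -
  define a :: "'b fps" where "a = fps_X * fps_X * inverse (fps_const C * (1 + fps_X))"
  define k :: "'b fps" where "k = fps_X * inverse (1 + fps_X * fps_X)"
  define g where "g = fps_inv k"
  have a0: "a $ 0 = 0" by (simp add: a_def)
  have k0: "k $ 0 = 0" "k $ 1 \<noteq> 0" by (simp_all add: k_def)
  have g0: "g $ 0 = 0" by (simp add: g_def fps_inv_def)
  have kg: "k oo g = fps_X" unfolding g_def by (rule fps_inv_right[OF k0])
  have "k * (1 + fps_X * fps_X) = fps_X"
    by (simp add: k_def mult.assoc inverse_mult_eq_1)
  then have "(k * (1 + fps_X * fps_X)) oo g = fps_X oo g" by simp
  then have "fps_X * (1 + g * g) = g"
    using g0 kg by (simp add: fps_compose_mult_distrib fps_compose_add_distrib)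
  then have "(fps_X * (1 + g * g)) oo a = g oo a" by simp
  then have u: "a * (1 + (g oo a) * (g oo a)) = g oo a"
    using a0 by (simp add: fps_compose_mult_distrib fps_compose_add_distrib)
  have ug: "useries = g oo a" by (simp add: useries_def g_def k_def a_def)
  have "inverse (fps_const C * (1 + fps_X)) * (fps_const C * (1 + fps_X)) = 1"
    using C0 by (intro inverse_mult_eq_1) simp
  then have aD: "a * (fps_const C * (1 + fps_X)) = fps_X * fps_X"
    by (simp add: a_def mult.assoc)
  have "a * (1 + (g oo a) * (g oo a)) * (fps_const C * (1 + fps_X)) =
      a * (fps_const C * (1 + fps_X)) * (1 + (g oo a) * (g oo a))"
    by (simp only: mult_ac)
  then show "useries * (fps_const C * (1 + fps_X)) = fps_X * fps_X * (1 + useries * useries)"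
    unfolding ug aD u .
  show "useries $ 0 = 0" by (simp add: ug g0)
qed

lemma two_fps: "(2 :: 'b fps) = 0"
proof -
  have "(2 :: 'b fps) = fps_const 1 + fps_const 1" by simp
  also have "\<dots> = fps_const (1 + 1)" by (simp only: fps_const_add)
  also have "\<dots> = 0" using two by simp
  finally show ?thesis .
qed

lemma subdegree_useries: "subdegree useries = 2" and useries_ne0: "useries \<noteq> 0"
proof -
  have n0: "(1 + useries * useries) $ 0 \<noteq> 0" "(fps_const C * (1 + fps_X)) $ 0 \<noteq> 0"
    using C0 by (simp_all add: useries_nth0)
  then have ne: "1 + useries * useries \<noteq> 0" "fps_const C * (1 + fps_X) \<noteq> 0" by (metis fps_zero_nth)+
  then show u0: "useries \<noteq> 0" using useries_eq by (metis mult_zero_left no_zero_divisors fps_X_neq_zero)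
  have "subdegree useries + subdegree (fps_const C * (1 + fps_X)) =
      subdegree (fps_X * fps_X :: 'b fps) + subdegree (1 + useries * useries)"
    using arg_cong[OF useries_eq, of subdegree] subdegree_mult[OF u0 ne(2)]
      subdegree_mult[OF _ ne(1), of "fps_X * fps_X"] by simp
  then show "subdegree useries = 2"
    using subdegree_eq_0[OF n0(1)] subdegree_eq_0[OF n0(2)] by simp
qed

lemma useries_on_affine: "on_affine (fps_to_fls useries) (fps_to_fls vseries)"
proof -
  have "vseries * vseries = 1 + fps_X * fps_X"
    unfolding vseries_def by (simp only: distrib_left distrib_right mult_1 mult_1_right add.assoc char2_rules[OF two_fps])
  then have "1 + vseries * vseries = fps_X * fps_X" by (simp only: char2_rules[OF two_fps])
  then have "(1 + useries * useries) * (1 + vseries * vseries) + fps_const C * useries * vseries = 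
    fps_X * fps_X * (1 + useries * useries) + useries * (fps_const C * (1 + fps_X))"
    by (simp only: vseries_def mult_ac)
  also have "\<dots> = 0" by (simp only: useries_eq char2_rules[OF two_fps])
  finally have "fps_to_fls ((1 + useries * useries) * (1 + vseries * vseries) + fps_const C * useries * vseries) = 0"
    by simp
  then show ?thesis
    by (simp only: on_affine_def ring_hom_map_simps[OF ring_hom_map_fps_to_fls] fps_const_to_fls)
qed

lemma subdegree_pe_useries:
  assumes "A \<noteq> 0"
  shows "pe fps_const A useries \<noteq> 0" "even (subdegree (pe fps_const A useries))"
proof -
  obtain q where q: "A = [:-0, 1:] ^ order 0 A * q" "\<not> [:-0, 1:] dvd q"
    using order_decomp[OF assms] by blast
  have "poly q 0 \<noteq> 0" using q(2) by (simp add: poly_eq_0_iff_dvd)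
  moreover have "pe fps_const q useries $ 0 = poly q 0"
    using pe_comp[OF ring_hom_map_fps_nth0 ring_hom_map_fps_const, of q useries]
    by (simp add: useries_nth0 pe_id)
  ultimately have 0: "pe fps_const q useries $ 0 \<noteq> 0" by simp
  then have ne: "pe fps_const q useries \<noteq> 0" by (metis fps_zero_nth)
  have eq: "pe fps_const A useries = useries ^ order 0 A * pe fps_const q useries"
    by (subst q(1)) (simp add: pe_simps[OF ring_hom_map_fps_const])
  show "pe fps_const A useries \<noteq> 0" using ne useries_ne0 by (simp add: eq)
  show "even (subdegree (pe fps_const A useries))"
    using ne useries_ne0 subdegree_eq_0[OF 0] by (simp add: eq subdegree_useries)
qed

text \<open>Since v = 1 + X, the relation reads (A + B)(u) = B(u) X. Polynomials in u have even
  order because u has order 2, so for nonzero B the orders would differ in parity.\<close>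

lemma useries_independent:
  assumes "pe fps_const A useries + pe fps_const B useries * vseries = 0"
  shows "A = 0" "B = 0"
proof -
  have "pe fps_const A useries + pe fps_const B useries * vseries =
      pe fps_const (A + B) useries + pe fps_const B useries * fps_X"
    by (simp add: pe_simps[OF ring_hom_map_fps_const] vseries_def algebra_simps)
  then have e: "pe fps_const (A + B) useries = pe fps_const B useries * fps_X"
    using assms char2_sum0[OF two_fps] by metis
  show B: "B = 0"
  proof (rule ccontr)
    assume "B \<noteq> 0"
    note b = subdegree_pe_useries[OF this]
    then have "pe fps_const (A + B) useries \<noteq> 0" by (simp add: e)
    then have "A + B \<noteq> 0" using pe_0[OF ring_hom_map_fps_const] by metis
    then have "even (subdegree (pe fps_const (A + B) useries))" by (rule subdegree_pe_useries)
    then show False using b by (simp add: e subdegree_mult)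
  qed
  show "A = 0"
  proof (rule ccontr)
    assume "A \<noteq> 0"
    then show False using subdegree_pe_useries(1)[of A] assms B by (simp add: pe_0[OF ring_hom_map_fps_const])
  qed
qed

definition branch_O :: "4 \<Rightarrow> 'b fps" where "branch_O = chart useries vseries"

abbreviation ev :: "(4 \<Rightarrow> 'b fps) \<Rightarrow> (4, 'b) mpol \<Rightarrow> 'b fps" where "ev \<equiv> evh fps_const"

lemmas ev_simps = evh_simps[OF ring_hom_map_fps_const]

lemma fps_to_fls_ev: "fps_to_fls (ev \<xi> f) = evh fls_const (\<lambda>i. fps_to_fls (\<xi> i)) f"
  using evh_comp[OF ring_hom_map_fps_to_fls ring_hom_map_fps_const, of \<xi> f] by (simp add: fps_const_to_fls)

lemma ev_nth0: "ev \<xi> f $ 0 = peval f (\<lambda>i. \<xi> i $ 0)"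
  using evh_comp[OF ring_hom_map_fps_nth0 ring_hom_map_fps_const, of \<xi> f] by (simp add: peval_eq_evh)

lemma fps_to_fls_chart: "(\<lambda>i. fps_to_fls (chart u v i)) = chart (fps_to_fls u) (fps_to_fls v)"
  by (simp add: fun4_eq fls_times_fps_to_fls)

lemma fps_to_fls_pe: "fps_to_fls (pe fps_const A u) = pe fls_const A (fps_to_fls u)"
  using pe_comp[OF ring_hom_map_fps_to_fls ring_hom_map_fps_const, of A u] by (simp add: fps_const_to_fls)

lemma one_plus_u_sq: "1 + fps_to_fls useries * fps_to_fls useries \<noteq> 0"
proof
  assume "1 + fps_to_fls useries * fps_to_fls useries = 0"
  then have "fps_to_fls (1 + useries * useries) = 0" by (simp add: fls_times_fps_to_fls)
  then have "1 + useries * useries = 0" by (simp only: fps_to_fls_eq_0_iff)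
  then have "(1 + useries * useries) $ 0 = 0" by simp
  then show False by (simp add: useries_nth0)
qed

lemma I_branch_O: "f \<in> I \<Longrightarrow> ev branch_O f = 0"
  using I_vanishes_fls[OF _ useries_on_affine one_plus_u_sq, of f]
  by (simp add: fps_to_fls_ev[symmetric] fps_to_fls_chart[symmetric] branch_O_def)

lemma branch_O_normal_form:
  assumes "ev branch_O f = 0"
    and N: "\<And>u v. on_affine u v \<Longrightarrow>
    (1 + u * u) ^ N * evh fls_const (chart u v) f = pe fls_const A u + pe fls_const B u * v"
  shows "A = 0" "B = 0"
proof -
  have "fps_to_fls (pe fps_const A useries + pe fps_const B useries * vseries) =
      pe fls_const A (fps_to_fls useries) + pe fls_const B (fps_to_fls useries) * fps_to_fls vseries"
    by (simp add: ring_hom_map_simps[OF ring_hom_map_fps_to_fls] fps_to_fls_pe)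
  also have "\<dots> = 0"
    using N[OF useries_on_affine] assms(1)
    by (simp add: fps_to_fls_chart[symmetric] fps_to_fls_ev[symmetric] branch_O_def)
  finally have "pe fps_const A useries + pe fps_const B useries * vseries = 0"
    by (simp only: fps_to_fls_eq_0_iff)
  from useries_independent[OF this] show "A = 0" "B = 0" .
qed

text \<open>The branch behaves like a generic point: vanishing along it makes the coefficients of
  the normal form zero, hence gives vanishing wherever 1 + u^2 can be cancelled.\<close>

lemma branch_O_vanish:
  assumes "ev branch_O f = 0" "chart u v \<in> cv C" "u \<noteq> 1"
  shows "peval f (chart u v) = 0"
proof -
  obtain N A B where N: "\<And>u v. on_affine u v \<Longrightarrow>
    (1 + u * u) ^ N * evh fls_const (chart u v) f = pe fls_const A u + pe fls_const B u * v"
    using normal_form by metis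
  have "on_affine (fls_const u) (fls_const v)" using assms(2) by (simp add: on_affine_const chart_cv)
  from N[OF this] branch_O_normal_form[OF assms(1) N]
  have "(1 + fls_const u * fls_const u) ^ N * fls_const (peval f (chart u v)) = 0"
    by (simp add: chart_fls_const evh_fls_const_peval pe_0[OF ring_hom_map_fls_const])
  then have "fls_const ((1 + u * u) ^ N * peval f (chart u v)) = 0"
    by (simp only: ring_hom_map_simps(2-4,7)[OF ring_hom_map_fls_const])
  moreover have "1 + u * u \<noteq> 0" using assms(3) square_sum0[of 1 u] by auto
  ultimately show ?thesis by simp
qed

definition rotm :: "(4, 'b) mpol \<Rightarrow> (4, 'b) mpol" where "rotm f = evh scalar (rot indet) f"

lemma peval_rotm: "peval (rotm f) x = peval f (rot x)"
proof -
  have "(\<lambda>v. evh (\<lambda>a. a) x (rot indet v)) = rot x"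
    by (simp add: fun4_eq evh_simps ring_hom_map_id)
  then show ?thesis
    unfolding peval_eq_evh rotm_def evh_subst[OF ring_hom_map_id] by simp
qed

lemma cofinite_vanish_branch_O:
  assumes "\<And>u v. u \<notin> S \<Longrightarrow> chart u v \<in> cv C \<Longrightarrow> peval f (chart u v) = 0" "finite S"
  shows "ev branch_O f = 0"
proof -
  obtain N A B where N: "\<And>u v. on_affine u v \<Longrightarrow>
    (1 + u * u) ^ N * evh fls_const (chart u v) f = pe fls_const A u + pe fls_const B u * v"
    using normal_form by metis
  have AB: "A = 0" "B = 0" using I_normal_form[OF assms N] by auto
  have "fps_to_fls (ev branch_O f) = evh fls_const (chart (fps_to_fls useries) (fps_to_fls vseries)) f"
    by (simp add: fps_to_fls_ev fps_to_fls_chart branch_O_def)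
  also have "\<dots> = 0" using N[OF useries_on_affine] one_plus_u_sq
    by (simp add: AB pe_0[OF ring_hom_map_fls_const])
  finally show ?thesis by simp
qed

lemma branch_O_nth0: "(\<lambda>i. branch_O i $ 0) = pt_O"
  by (simp add: fun4_eq branch_O_def useries_nth0 vseries_def pt_O_def)

text \<open>Points with X0 nonzero and u \<noteq> 1 are reached through the branch at O. The
  remaining ones are rotations of O; there the rotated form again vanishes at cofinitely many values
  of u, hence along the branch, in particular at its base point.\<close>

lemma homogeneous_cofinite_I:
  assumes hom: "homogeneous d f" and fin: "finite S"
    and van: "\<And>x. x \<in> cv C \<Longrightarrow> x 0 \<noteq> 0 \<Longrightarrow> x 1 / x 0 \<notin> S \<Longrightarrow> peval f x = 0"
  shows "f \<in> I"
  unfolding I_iff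
proof
  fix x assume x: "x \<in> cv C"
  show "peval f x = 0"
  proof (cases "x 0 \<noteq> 0 \<and> x 1 / x 0 \<noteq> 1")
    case True
    have "ev branch_O f = 0"
      by (rule cofinite_vanish_branch_O[OF _ fin]) (use van in auto)
    then have "peval f (chart (x 1 / x 0) (x 3 / x 0)) = 0"
      using branch_O_vanish cv_chart(2)[OF x] True by blast
    moreover have "x = (\<lambda>i. x 0 * chart (x 1 / x 0) (x 3 / x 0) i)"
      using cv_chart(1)[OF x] True by (intro ext) blast
    ultimately show ?thesis
      using homogeneous_scale[OF hom ring_hom_map_id] by (metis mult_zero_right peval_eq_evh)
  next
    case False
    have c0: "x 0 = 0 \<or> x 1 = x 0" using False by auto
    have "\<exists>k<4. proj_eq ((rot ^^ k) pt_O) x"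
    proof -
      note c = cvD[OF x]
      \<comment> \<open>For u = 1 the equation degenerates to C u v = 0 and forces v = 0.\<close>
      have z: "x 0 = 0 \<or> x 2 = 0 \<and> x 3 = 0"
      proof (rule ccontr)
        assume *: "\<not> ?thesis"
        then have "x 1 = x 0" "x 0 \<noteq> 0" using c0 by auto
        then have "x 2 = x 3" using c(2) by simp
        then have "C * x 0 * x 2 = 0" using c(1) \<open>x 1 = x 0\<close> by (simp add: char2 add.assoc)
        then show False using C0 * \<open>x 2 = x 3\<close> \<open>x 0 \<noteq> 0\<close> by simp
      qed
      then show ?thesis
      proof
        assume 0: "x 0 = 0"
        then have "x 1 = 0 \<or> x 3 = 0" using c(2) by simp
        then show ?thesis
        proof
          assume 1: "x 1 = 0"
          then have "x 2 = x 3" using c(1) 0 by (simp add: square_sum0)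
          then have "x 3 \<noteq> 0" using c(3) 0 1 by auto
          then have "proj_eq ((rot ^^ 3) pt_O) x"
            unfolding proj_eq_def all4 using 0 1 \<open>x 2 = x 3\<close>
            by (intro exI[of _ "x 3"]) (simp add: eval_nat_numeral pt_O_def)
          then show ?thesis by (intro exI[of _ 3]) simp
        next
          assume 1: "x 3 = 0"
          then have "x 1 = x 2" using c(1) 0 by (simp add: square_sum0)
          then have "x 2 \<noteq> 0" using c(3) 0 1 by auto
          then have "proj_eq ((rot ^^ 2) pt_O) x"
            unfolding proj_eq_def all4 using 0 1 \<open>x 1 = x 2\<close>
            by (intro exI[of _ "x 2"]) (simp add: eval_nat_numeral pt_O_def)
          then show ?thesis by (intro exI[of _ 2]) simp
        qed
      next
        assume 1: "x 2 = 0 \<and> x 3 = 0"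
        then have "x 0 = x 1" using c(1) by (simp add: square_sum0)
        then have "x 0 \<noteq> 0" using c(3) 1 by auto
        then have "proj_eq ((rot ^^ 1) pt_O) x"
          unfolding proj_eq_def all4 using 1 \<open>x 0 = x 1\<close>
          by (intro exI[of _ "x 0"]) (simp add: pt_O_def)
        then show ?thesis by (intro exI[of _ 1]) simp
      qed
    qed
    then obtain k where k: "proj_eq ((rot ^^ k) pt_O) x" by blast
    have pev: "peval ((rotm ^^ k) f) y = peval f ((rot ^^ k) y)" for y
      by (induction k arbitrary: y) (simp_all add: peval_rotm funpow_swap1[of rot])
    have "ev branch_O ((rotm ^^ k) f) = 0"
    proof (rule cofinite_vanish_branch_O)
      text \<open>The coordinate \<open>u\<close> of a rotated point is one of \<open>u\<close>, \<open>1 / v\<close>, \<open>1 / u\<close>, \<open>v\<close>,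
        and each value of \<open>v\<close> is taken for finitely many \<open>u\<close>.\<close>
      define S' where "S' = {u. u = 0 \<or> u = 1 \<or> u \<in> S \<or> 1 / u \<in> S \<or>
        (\<exists>s\<in>S. s \<noteq> 0 \<and> s \<noteq> 1 \<and> (poly [:1 + s * s, C * s, 1 + s * s:] u = 0))}"
      have "finite {u. 1 / u \<in> S}"
      proof -
        have "{u. 1 / u \<in> S} \<subseteq> (\<lambda>s. 1 / s) ` S" by (auto intro!: image_eqI)
        then show ?thesis using fin finite_surj by blast
      qed
      moreover have "finite (\<Union>s\<in>S - {0, 1}. {u. poly [:1 + s * s, C * s, 1 + s * s:] u = 0})"
        using fin C0 by (intro finite_UN_I poly_roots_finite) auto
      moreover have "S' = {0, 1} \<union> S \<union> {u. 1 / u \<in> S} \<union>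
        (\<Union>s\<in>S - {0, 1}. {u. poly [:1 + s * s, C * s, 1 + s * s:] u = 0})"
        unfolding S'_def by auto
      ultimately show "finite S'" using fin by simp
      fix u v assume u: "u \<notin> S'" and uv: "chart u v \<in> cv C"
      have u01: "u \<noteq> 0" "u \<noteq> 1" "u \<notin> S" "1 / u \<notin> S" using u by (auto simp: S'_def)
      have e: "(1 + u * u) * (1 + v * v) + C * u * v = 0" using uv by (simp add: chart_cv)
      have v01: "v \<noteq> 0" "v \<noteq> 1"
      proof -
        have w: "1 + u * u \<noteq> 0" using u01(2) square_sum0[of 1 u] by auto
        show "v \<noteq> 0" using e w by auto
        show "v \<noteq> 1" using e C0 u01(1) by (auto simp: two)
      qed
      have vS: "v \<notin> S"
      proof
        assume "v \<in> S"
        moreover have "poly [:1 + v * v, C * v, 1 + v * v:] u = 0" using e by (simp add: algebra_simps)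
        ultimately show False using u v01 by (auto simp: S'_def)
      qed
      have vS': "1 / v \<notin> S"
      proof
        assume *: "1 / v \<in> S"
        have "poly [:1 + (1/v) * (1/v), C * (1/v), 1 + (1/v) * (1/v):] u = ((1 + u * u) * (1 + v * v) + C * u * v) / (v * v)"
          using v01(1) by (simp add: field_simps)
        then have "poly [:1 + (1/v) * (1/v), C * (1/v), 1 + (1/v) * (1/v):] u = 0" by (simp add: e)
        moreover have "1 / v \<noteq> 0" "1 / v \<noteq> 1" using v01 by simp_all
        ultimately show False using u * unfolding S'_def by blast
      qed
      have r: "y \<in> cv C \<Longrightarrow> (rot ^^ k) y \<in> cv C" for y k
        by (induction k) (simp_all add: cv_rot)
      have "(rot ^^ k) (chart u v) 0 \<noteq> 0 \<and> (rot ^^ k) (chart u v) 1 / (rot ^^ k) (chart u v) 0 \<notin> S"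
      proof (induction k rule: less_induct)
        case (less k)
        show ?case
        proof (cases "k < 4")
          case True
          then have "k = 0 \<or> k = 1 \<or> k = 2 \<or> k = 3" by auto
          then show ?thesis using u01 v01 vS vS' by (auto simp: eval_nat_numeral)
        next
          case False
          then have "(rot ^^ k) (chart u v) = (rot ^^ (k - 4)) ((rot ^^ 4) (chart u v))"
            using fun_cong[OF funpow_add[of "k - 4" 4 rot]] by simp
          also have "(rot ^^ 4) (chart u v) = chart u v" by (simp add: eval_nat_numeral)
          finally show ?thesis using less[of "k - 4"] False by simp
        qed
      qed
      then show "peval ((rotm ^^ k) f) (chart u v) = 0"
        using van[OF r[OF uv]] by (simp add: pev)
    qed
    then have "peval ((rotm ^^ k) f) pt_O = 0"
      using ev_nth0[of branch_O "(rotm ^^ k) f"] by (simp add: branch_O_nth0)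
    then have "peval f ((rot ^^ k) pt_O) = 0" by (simp add: pev)
    moreover obtain l where "x = (\<lambda>i. l * (rot ^^ k) pt_O i)" using k by (auto simp: proj_eq_def)
    ultimately show ?thesis
      using homogeneous_scale[OF hom ring_hom_map_id] by (metis mult_zero_right peval_eq_evh)
  qed
qed

lemma branch_O_I:
  assumes "homogeneous d f" "ev branch_O f = 0"
  shows "f \<in> I"
proof (rule homogeneous_cofinite_I[OF assms(1), of "{1}"])
  fix x assume x: "x \<in> cv C" "x 0 \<noteq> 0" "x 1 / x 0 \<notin> {1}"
  have "peval f (chart (x 1 / x 0) (x 3 / x 0)) = 0"
    using branch_O_vanish[OF assms(2) cv_chart(2)[OF x(1,2)]] x(3) by simp
  moreover have "x = (\<lambda>i. x 0 * chart (x 1 / x 0) (x 3 / x 0) i)"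
    using cv_chart(1)[OF x(1,2)] by (intro ext) blast
  ultimately show "peval f x = 0"
    using homogeneous_scale[OF assms(1) ring_hom_map_id] by (metis mult_zero_right peval_eq_evh)
qed simp

text \<open>Irreducibility of the curve: power series form a domain, and a form that vanishes along
  the branch vanishes on the whole curve.\<close>

lemma I_prime:
  assumes "homogeneous d f" "homogeneous e g" "f * g \<in> I"
  shows "f \<in> I \<or> g \<in> I"
proof -
  have "ev branch_O f * ev branch_O g = 0" using I_branch_O[OF assms(3)] by (simp add: ev_simps)
  then show ?thesis using branch_O_I assms by auto
qed

end

text \<open>The zero series has to count as infinitely divisible, whereas its
  \<open>subdegree\<close> is 0 by convention.\<close>

definition vge :: "nat \<Rightarrow> 'a::field fps \<Rightarrow> bool" where
  "vge n s \<longleftrightarrow> s = 0 \<or> n \<le> subdegree s"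

lemma vge_add: "vge n s \<Longrightarrow> vge n t \<Longrightarrow> vge n (s + t)"
  using subdegree_add_ge'[of s t] by (cases "s = 0"; cases "t = 0"; cases "s + t = 0") (auto simp: vge_def)

lemma vge_mult: "vge m s \<Longrightarrow> vge n t \<Longrightarrow> vge (m + n) (s * t)"
  by (cases "s = 0"; cases "t = 0") (auto simp: vge_def)

lemma vge_nth: "vge n s \<Longrightarrow> k < n \<Longrightarrow> s $ k = 0"
  by (cases "s = 0") (auto simp: vge_def intro: nth_less_subdegree_zero)

lemma vge_0 [simp]: "vge 0 s" "vge n 0"
  by (simp_all add: vge_def)

lemma vge_1: "s $ 0 = 0 \<Longrightarrow> vge 1 s"
  using subdegree_eq_0_iff[of s] by (cases "s = 0") (auto simp: vge_def)

lemma vge_unit: "s $ 0 \<noteq> 0 \<Longrightarrow> vge n (s * t) \<Longrightarrow> vge n t"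
proof (cases "t = 0")
  case False
  assume s: "s $ 0 \<noteq> 0" "vge n (s * t)"
  then have "s \<noteq> 0" by auto
  then have "subdegree (s * t) = subdegree t" "s * t \<noteq> 0"
    using False s(1) by simp_all
  then show ?thesis using s(2) by (simp add: vge_def)
qed simp

lemma is_ideal_vge: "is_ideal {s. vge n s}"
  using vge_mult[of 0 _ n] by (auto simp: is_ideal_def vge_add)

lemma vge_shift: "vge (Suc n) (fps_X * s) \<Longrightarrow> vge n s"
  by (cases "s = 0") (auto simp: vge_def)

section \<open>Polynomial maps, and the laws as maps with one argument fixed\<close>

definition tcomp :: "('v::finite \<Rightarrow> ('w, 'a::comm_ring_1) mpol) \<Rightarrow> ('v, 'a) mpol \<Rightarrow> ('w, 'a) mpol" where
  "tcomp P f = evh scalar P f"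

definition pm :: "('v \<Rightarrow> ('w::finite, 'a::comm_ring_1) mpol) \<Rightarrow> ('w \<Rightarrow> 'a) \<Rightarrow> 'v \<Rightarrow> 'a" where
  "pm P x = (\<lambda>i. peval (P i) x)"

lemma peval_tcomp: "peval (tcomp P f) x = peval f (pm P x)"
  using evh_subst[OF ring_hom_map_id, of x P f] by (simp add: tcomp_def pm_def peval_eq_evh)

lemma ring_hom_map_tcomp: "ring_hom_map (tcomp P)"
  unfolding tcomp_def using ring_hom_map_evh[OF ring_hom_map_scalar] .

definition Ulaw :: "bool \<Rightarrow> (4 \<Rightarrow> 'r::comm_ring_1) \<Rightarrow> (4 \<Rightarrow> 'r) \<Rightarrow> 2 \<Rightarrow> 'r" where
  "Ulaw b = (if b then Ub else Ua)"
definition Vlaw :: "bool \<Rightarrow> (4 \<Rightarrow> 'r::comm_ring_1) \<Rightarrow> (4 \<Rightarrow> 'r) \<Rightarrow> 2 \<Rightarrow> 'r" where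
  "Vlaw b = (if b then Vb else Va)"

definition law :: "bool \<Rightarrow> bool \<Rightarrow> (4 \<Rightarrow> 'r::comm_ring_1) \<Rightarrow> (4 \<Rightarrow> 'r) \<Rightarrow> 4 \<Rightarrow> 'r" where
  "law b b' x y = skew_segre (Ulaw b x y) (Vlaw b' x y)"

lemma law_hom:
  assumes "ring_hom_map h"
  shows "h (Ulaw b x y j) = Ulaw b (\<lambda>i. h (x i)) (\<lambda>i. h (y i)) j"
    "h (Vlaw b x y j) = Vlaw b (\<lambda>i. h (x i)) (\<lambda>i. h (y i)) j"
    "h (law b b' x y i) = law b b' (\<lambda>i. h (x i)) (\<lambda>i. h (y i)) i"
proof -
  have "\<forall>j. h (Ulaw b x y j) = Ulaw b (\<lambda>i. h (x i)) (\<lambda>i. h (y i)) j"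
    "\<forall>j. h (Vlaw b' x y j) = Vlaw b' (\<lambda>i. h (x i)) (\<lambda>i. h (y i)) j" for b b'
    unfolding all2 by (auto simp: Ulaw_def Vlaw_def law_defs ring_hom_map_simps[OF assms])
  then show U: "h (Ulaw b x y j) = Ulaw b (\<lambda>i. h (x i)) (\<lambda>i. h (y i)) j"
    and V: "h (Vlaw b' x y j) = Vlaw b' (\<lambda>i. h (x i)) (\<lambda>i. h (y i)) j" for b b' j
    by blast+
  have "\<forall>i. h (law b b' x y i) = law b b' (\<lambda>i. h (x i)) (\<lambda>i. h (y i)) i"
    unfolding all4 law_def by (simp add: ring_hom_map_simps[OF assms] U V)
  then show "h (law b b' x y i) = law b b' (\<lambda>i. h (x i)) (\<lambda>i. h (y i)) i" by blast
qed

lemma law_zero_left: "law b b' (\<lambda>_. 0) y = (\<lambda>_. 0)"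
  by (auto simp: fun4_eq law_def Ulaw_def Vlaw_def law_defs)

text \<open>Translation by \<open>y\<close> as a quadratic map of the ambient space. It is undefined
  where the law vanishes, so different points may need different choices among the four
  laws.\<close>

definition lawmap :: "bool \<Rightarrow> bool \<Rightarrow> (4 \<Rightarrow> 'a::comm_ring_1) \<Rightarrow> 4 \<Rightarrow> (4, 'a) mpol" where
  "lawmap b b' y = law b b' indet (\<lambda>i. scalar (y i))"

lemma pm_lawmap: "pm (lawmap b b' y) x = law b b' x y"
  unfolding pm_def lawmap_def law_hom(3)[OF ring_hom_map_peval] by (simp add: peval_simps)

lemma homogeneous_lawmap: "homogeneous 2 (lawmap b b' y i)"
proof -
  have *: "homogeneous 1 (indet k * scalar a)" for k :: 4 and a :: 'a
    using homogeneous_mult[OF homogeneous_indet homogeneous_scalar] by simp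
  have "\<forall>j. homogeneous 1 (Ulaw b indet (\<lambda>i. scalar (y i)) j)"
    "\<forall>j. homogeneous 1 (Vlaw b' indet (\<lambda>i. scalar (y i)) j)"
    unfolding all2 by (auto simp: Ulaw_def Vlaw_def law_defs simp del: One_nat_def intro!: homogeneous_add *)
  then have "\<forall>i. homogeneous (1 + 1) (lawmap b b' y i)"
    unfolding all4 lawmap_def law_def skew_segre_simps by (intro conjI homogeneous_mult) blast+
  then show ?thesis by (simp add: numeral_2_eq_2)
qed

context char2_curve_ac
begin

section \<open>Orders of vanishing\<close>

abbreviation mx :: "(4 \<Rightarrow> 'b) \<Rightarrow> (4, 'b) mpol set" where
  "mx x \<equiv> vanishing_ideal {y. proj_eq x y}"

text \<open>\<open>mx x\<close> is the ideal of the line through \<open>x\<close> in the affine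
  cone. After localisation at \<open>x\<close> its powers measure vanishing transversally to that
  line, which is vanishing on the projective curve.\<close>

definition ordI :: "(4 \<Rightarrow> 'b) \<Rightarrow> nat \<Rightarrow> (4, 'b) mpol set" where
  "ordI x n = ideal_gen (ideal_power (mx x) n \<union> I)"

lemma is_ideal_ordI: "is_ideal (ordI x n)"
  by (simp add: ordI_def is_ideal_ideal_gen)

lemma is_ideal_germ_ordI: "is_ideal (germ x (ordI x n))"
  by (intro is_ideal_germ is_ideal_ordI)

lemma I_ordI: "f \<in> I \<Longrightarrow> f \<in> ordI x n"
  by (auto simp: ordI_def intro!: ideal_gen_base)

lemma I_germ: "f \<in> I \<Longrightarrow> f \<in> germ x (ordI x n)"
  using I_ordI germ_superset by blast

lemma germ_ordI_0: "germ x (ordI x 0) = UNIV"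
  using germ_superset[of "ordI x 0" x] by (auto simp: ordI_def intro!: ideal_gen_base)

lemma mult_germ_ordI:
  assumes "t \<in> mx x" "f \<in> germ x (ordI x n)"
  shows "t * f \<in> germ x (ordI x (Suc n))"
proof -
  obtain h where h: "peval h x \<noteq> 0" "h * f \<in> ordI x n" using assms(2) unfolding germ_def by blast
  define K where "K = {g. t * g \<in> ordI x (Suc n)}"
  have "is_ideal K"
    using is_idealD[OF is_ideal_ordI] unfolding K_def is_ideal_def
    by (auto simp: distrib_left mult.left_commute)
  moreover have "ideal_power (mx x) n \<union> I \<subseteq> K"
  proof
    fix g assume "g \<in> ideal_power (mx x) n \<union> I"
    then show "g \<in> K"
    proof
      assume "g \<in> ideal_power (mx x) n"
      then have "t * g \<in> ideal_power (mx x) (Suc n)" using assms(1) by (intro ideal_power_Suc_I)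
      then show "g \<in> K" unfolding K_def ordI_def by (auto intro!: ideal_gen_base)
    next
      assume "g \<in> I"
      then have "t * g \<in> I" by (rule is_idealD(3)[OF is_ideal_I])
      then show "g \<in> K" unfolding K_def by (simp add: I_ordI)
    qed
  qed
  ultimately have "ordI x n \<subseteq> K" unfolding ordI_def by (rule ideal_gen_minimal)
  then have "t * (h * f) \<in> ordI x (Suc n)" using h(2) K_def by blast
  then have "h * (t * f) \<in> ordI x (Suc n)" by (simp add: mult.left_commute)
  then show ?thesis using h(1) unfolding germ_def by blast
qed

lemma proj_eq_scale: "proj_eq x y \<Longrightarrow> l \<noteq> 0 \<Longrightarrow> proj_eq x (\<lambda>i. l * y i :: 'b)"
proof -
  assume "proj_eq x y" "l \<noteq> 0"
  then obtain k where "k \<noteq> 0" "\<forall>i. y i = k * x i" by (auto simp: proj_eq_def)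
  then show ?thesis using \<open>l \<noteq> 0\<close> unfolding proj_eq_def by (intro exI[of _ "l * k"]) simp
qed

lemma cv_scale: "x \<in> cv C \<Longrightarrow> l \<noteq> 0 \<Longrightarrow> (\<lambda>i. l * x i) \<in> cv C"
  using cv_proj_eq proj_eq_scale[OF proj_eq_refl] by blast

definition gmap :: "nat \<Rightarrow> (4 \<Rightarrow> (4, 'b) mpol) \<Rightarrow> bool" where
  "gmap e P \<longleftrightarrow> (\<forall>i. homogeneous e (P i)) \<and> (\<forall>x\<in>cv C. pm P x = (\<lambda>_. 0) \<or> pm P x \<in> cv C)"

lemma pm_scale: "gmap e P \<Longrightarrow> pm P (\<lambda>i. l * x i) = (\<lambda>i. l ^ e * pm P x i)"
  unfolding pm_def peval_eq_evh
  by (rule ext, rule homogeneous_scale[OF _ ring_hom_map_id]) (simp add: gmap_def)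

text \<open>A map defined at y pulls the ideal of the line through x back into that of the line
  through y, and \<open>I\<close> into \<open>I\<close> locally at y. Hence orders do not
  drop.\<close>

lemma pullback:
  assumes Q: "gmap e Q" and y: "y \<in> cv C" and x: "pm Q y = x" "x \<in> cv C"
    and f: "f \<in> germ x (ordI x n)"
  shows "tcomp Q f \<in> germ y (ordI y n)"
proof -
  let ?J = "germ y (ordI y n)"
  obtain j where j: "x j \<noteq> 0" using cv_ne0[OF x(2)] by fastforce
  \<comment> \<open>The factor \<open>Q j\<close> vanishes at the common zeros of Q, where the
    pullback of g is not controlled, and it is a unit at y.\<close>
  have I': "tcomp Q g \<in> ?J" if g: "g \<in> I" for g
  proof -
    have "peval (Q j * tcomp Q g) z = 0" if z: "z \<in> cv C" for z
    proof -
      have "pm Q z = (\<lambda>_. 0) \<or> pm Q z \<in> cv C" using Q z by (auto simp: gmap_def)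
      then show ?thesis
      proof
        assume "pm Q z = (\<lambda>_. 0)"
        then have "peval (Q j) z = 0" by (metis pm_def)
        then show ?thesis by (simp add: peval_simps)
      next
        assume "pm Q z \<in> cv C"
        then show ?thesis using g by (simp add: peval_simps peval_tcomp I_iff)
      qed
    qed
    then have "Q j * tcomp Q g \<in> ?J" by (intro I_germ) (simp add: I_iff)
    moreover have "peval (Q j) y \<noteq> 0" using j x(1) by (auto simp: pm_def)
    ultimately show ?thesis by (rule germ_cancel[rotated])
  qed
  have m: "tcomp Q g \<in> mx y" if g: "g \<in> mx x" for g
  proof -
    have "peval g (pm Q z) = 0" if z: "proj_eq y z" for z
    proof -
      obtain l where l: "l \<noteq> 0" "z = (\<lambda>i. l * y i)" using z by (auto simp: proj_eq_def)
      have "pm Q z = (\<lambda>i. l ^ e * x i)" using pm_scale[OF Q, of l y] by (simp add: l(2) x(1))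
      then have "proj_eq x (pm Q z)" using l(1) proj_eq_scale[OF proj_eq_refl, of "l ^ e" x] by simp
      then show ?thesis using g by (auto simp: vanishing_ideal_def)
    qed
    then show ?thesis by (simp add: vanishing_ideal_def peval_tcomp)
  qed
  have pow: "ideal_power (mx x) k \<subseteq> tcomp Q -` ideal_power (mx y) k" for k
  proof (induction k)
    case (Suc k)
    show ?case
    proof (rule ideal_power_Suc_minimal)
      show "is_ideal (tcomp Q -` ideal_power (mx y) (Suc k))"
        by (intro is_ideal_vimage ring_hom_map_tcomp is_ideal_ideal_power)
      fix f g assume "f \<in> mx x" "g \<in> ideal_power (mx x) k"
      then have "tcomp Q f * tcomp Q g \<in> ideal_power (mx y) (Suc k)"
        using m Suc by (intro ideal_power_Suc_I) blast+
      then show "f * g \<in> tcomp Q -` ideal_power (mx y) (Suc k)"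
        by (simp only: vimage_eq ring_hom_map_simps[OF ring_hom_map_tcomp])
    qed
  qed simp
  have "ordI x n \<subseteq> tcomp Q -` ?J"
    unfolding ordI_def
  proof (rule ideal_gen_minimal)
    show "is_ideal (tcomp Q -` germ y (ideal_gen (ideal_power (mx y) n \<union> I)))"
      by (intro is_ideal_vimage ring_hom_map_tcomp is_ideal_germ is_ideal_ideal_gen)
    have "ideal_power (mx y) n \<subseteq> ?J"
      using germ_superset[of "ordI y n" y] unfolding ordI_def by (auto intro!: ideal_gen_base)
    then show "ideal_power (mx x) n \<union> I \<subseteq> tcomp Q -` germ y (ideal_gen (ideal_power (mx y) n \<union> I))"
      using pow[of n] I' unfolding ordI_def by blast
  qed
  moreover obtain h where h: "peval h x \<noteq> 0" "h * f \<in> ordI x n" using f unfolding germ_def by blast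
  ultimately have "tcomp Q (h * f) \<in> ?J" by blast
  then have "tcomp Q h * tcomp Q f \<in> ?J" by (simp only: ring_hom_map_simps[OF ring_hom_map_tcomp])
  moreover have "peval (tcomp Q h) y \<noteq> 0" using h(1) by (simp add: peval_tcomp x(1))
  ultimately show ?thesis by (rule germ_cancel[rotated])
qed

text \<open>A formal parametrisation at \<open>x\<close> that is fine enough to compute orders:
  forms outside \<open>I\<close> do not vanish along it, and order n of the series forces order n in
  the local ring. The reverse bound is \<open>germ_vge\<close>. The last two clauses speak of forms
  only, since transport along maps rescales representatives.\<close>

definition arc :: "(4 \<Rightarrow> 'b) \<Rightarrow> (4 \<Rightarrow> 'b fps) \<Rightarrow> bool" where
  "arc x \<xi> \<longleftrightarrow> x \<in> cv C \<and> (\<forall>i. \<xi> i $ 0 = x i) \<and> (\<forall>f\<in>I. ev \<xi> f = 0) \<and>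
     (\<forall>f d. homogeneous d f \<longrightarrow> ev \<xi> f = 0 \<longrightarrow> f \<in> I) \<and>
     (\<forall>f d n. homogeneous d f \<longrightarrow> vge n (ev \<xi> f) \<longrightarrow> f \<in> germ x (ordI x n))"

text \<open>Functions vanishing on the line through x become series without constant term, so the
  n-th power of their ideal lands in order at least n; functions that are units at x become unit
  series.\<close>

lemma germ_vge:
  assumes x: "\<And>i. \<xi> i $ 0 = x i" and I0: "\<And>f. f \<in> I \<Longrightarrow> ev \<xi> f = 0" and f: "f \<in> germ x (ordI x n)"
  shows "vge n (ev \<xi> f)"
proof -
  let ?Z = "\<lambda>n. ev \<xi> -` {s. vge n s}"
  have Z: "is_ideal (?Z n)" for n
    by (intro is_ideal_vimage ring_hom_map_evh ring_hom_map_fps_const is_ideal_vge)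
  have n0: "ev \<xi> g $ 0 = peval g x" for g using x by (simp add: ev_nth0)
  have "ideal_power (mx x) k \<subseteq> ?Z k" for k
  proof (induction k)
    case (Suc k)
    show ?case
    proof (rule ideal_power_Suc_minimal[OF Z])
      fix f g assume f: "f \<in> mx x" and g: "g \<in> ideal_power (mx x) k"
      have "ev \<xi> f $ 0 = 0" using f proj_eq_refl[of x] by (auto simp: n0 vanishing_ideal_def)
      then have "vge (1 + k) (ev \<xi> f * ev \<xi> g)" using Suc g by (intro vge_mult vge_1) auto
      then show "f * g \<in> ?Z (Suc k)" by (simp add: ev_simps)
    qed
  qed simp
  then have "ordI x n \<subseteq> ?Z n"
    unfolding ordI_def using I0 by (intro ideal_gen_minimal[OF Z]) auto
  moreover obtain h where h: "peval h x \<noteq> 0" "h * f \<in> ordI x n" using f unfolding germ_def by blast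
  ultimately have "vge n (ev \<xi> h * ev \<xi> f)" by (auto simp: ev_simps)
  moreover have "ev \<xi> h $ 0 \<noteq> 0" using h(1) by (simp add: n0)
  ultimately show ?thesis by (rule vge_unit[rotated])
qed

lemma arc_germ_iff:
  assumes "arc x \<xi>" "homogeneous d f"
  shows "f \<in> germ x (ordI x n) \<longleftrightarrow> vge n (ev \<xi> f)"
  using assms germ_vge[of \<xi> x f n] unfolding arc_def by blast

definition ordv :: "(4 \<Rightarrow> 'b) \<Rightarrow> (4, 'b) mpol \<Rightarrow> nat" where
  "ordv x f = (GREATEST m. f \<in> germ x (ordI x m))"

lemma ordv_arc:
  assumes "arc x \<xi>" "homogeneous d f" "f \<notin> I"
  shows "ordv x f = subdegree (ev \<xi> f)" "ev \<xi> f \<noteq> 0"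
proof -
  show ne: "ev \<xi> f \<noteq> 0" using assms unfolding arc_def by blast
  show "ordv x f = subdegree (ev \<xi> f)"
    unfolding ordv_def arc_germ_iff[OF assms(1,2)]
    by (rule Greatest_equality) (auto simp: vge_def ne)
qed

text \<open>P o Q is the identity on the curve up to scalars. A lower bound for the order of f at y
  comes from f o P, whose order at x the given arc controls, and from \<open>pullback\<close> of f o
  P along Q, which agrees with f up to factors that are units at y.\<close>

lemma arc_transport:
  assumes \<xi>: "arc x \<xi>" and P: "gmap d P" and Q: "gmap e Q" and y: "pm P x = y" "y \<in> cv C"
    and Qy: "proj_eq (pm Q y) x" and PQ: "\<And>z. z \<in> cv C \<Longrightarrow> par (pm P (pm Q z)) z"
  shows "arc y (\<lambda>i. ev \<xi> (P i))"
proof -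
  have x: "x \<in> cv C" "\<And>i. \<xi> i $ 0 = x i" using \<xi> by (auto simp: arc_def)
  obtain l where l: "l \<noteq> 0" "x = (\<lambda>i. l * pm Q y i)" using Qy by (auto simp: proj_eq_def)
  \<comment> \<open>\<open>pullback\<close> works with exact coordinates, so Q is rescaled to send y
    to the representative x.\<close>
  define Q' where "Q' i = scalar l * Q i" for i
  have pmQ': "pm Q' z = (\<lambda>i. l * pm Q z i)" for z by (simp add: pm_def Q'_def peval_simps)
  have Q'y: "pm Q' y = x" by (simp add: pmQ' l(2))
  have gQ': "gmap e Q'"
    unfolding gmap_def
  proof (intro conjI allI ballI)
    show "homogeneous e (Q' i)" for i
      using Q by (auto simp: Q'_def gmap_def intro!: homogeneous_scalar_mult)
    fix z assume "z \<in> cv C"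
    then have "pm Q z = (\<lambda>_. 0) \<or> pm Q z \<in> cv C" using Q by (auto simp: gmap_def)
    then show "pm Q' z = (\<lambda>_. 0) \<or> pm Q' z \<in> cv C"
      using cv_scale[OF _ l(1)] by (auto simp: pmQ')
  qed
  have pmP_scale: "pm P (\<lambda>i. k * z i) = (\<lambda>i. k ^ d * pm P z i)" for k z using pm_scale[OF P] .
  have PQ': "par (pm P (pm Q' z)) z" if "z \<in> cv C" for z
    using PQ[OF that] unfolding pmQ' pmP_scale par_def by (simp add: mult.assoc)
  obtain j where j: "y j \<noteq> 0" using cv_ne0[OF y(2)] by fastforce
  define D where "D = tcomp Q' (P j)"
  have D: "peval D z = pm P (pm Q' z) j" for z by (simp add: D_def peval_tcomp) (simp add: pm_def)
  have Dy: "peval D y \<noteq> 0" using j by (simp add: D Q'y y(1))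
  have homD: "homogeneous (d * e) D" unfolding D_def tcomp_def
    by (rule homogeneous_subst) (use P gQ' in \<open>auto simp: gmap_def\<close>)
  \<comment> \<open>On the curve P(Q'(z)) is the multiple D(z) / z_j of z, which gives D^k f = z_j^k
    (f o P o Q') for forms of degree k. The spare factor D deals with the zeros of Q' when
    membership in \<open>I\<close> is checked below.\<close>
  have key: "D ^ Suc k * f - indet j ^ k * D * tcomp Q' (tcomp P f) \<in> I" if "homogeneous k f" for f k
  proof -
    have "peval D z ^ Suc k * peval f z = z j ^ k * peval D z * peval f (pm P (pm Q' z))" if z: "z \<in> cv C" for z
    proof -
      define w where "w = pm P (pm Q' z)"
      have "w j * z i = z j * w i" for i using PQ'[OF z] by (auto simp: par_def w_def mult.commute)
      then have "peval f (\<lambda>i. w j * z i) = peval f (\<lambda>i. z j * w i)" by simp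
      then have "w j ^ k * peval f z = z j ^ k * peval f w"
        using homogeneous_scale[OF \<open>homogeneous k f\<close> ring_hom_map_id] by (simp add: peval_eq_evh)
      then show ?thesis by (simp add: D w_def[symmetric])
    qed
    then show ?thesis by (simp add: I_iff peval_simps peval_tcomp)
  qed
  have evP: "ev (\<lambda>i. ev \<xi> (P i)) f = ev \<xi> (tcomp P f)" for f
    using evh_subst[OF ring_hom_map_fps_const, of \<xi> P f] by (simp add: tcomp_def)
  have homP: "homogeneous (k * d) (tcomp P f)" if "homogeneous k f" for k f
    unfolding tcomp_def by (rule homogeneous_subst[OF that]) (use P in \<open>auto simp: gmap_def\<close>)
  have 1: "ev \<xi> (P i) $ 0 = y i" for i
    using x(2) y(1) by (simp add: ev_nth0) (auto simp: pm_def)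
  have 2: "ev \<xi> (tcomp P f) = 0" if f: "f \<in> I" for f
  proof -
    have "P j * tcomp P f \<in> I"
      unfolding I_iff
    proof
      fix z assume "z \<in> cv C"
      then consider "pm P z = (\<lambda>_. 0)" | "pm P z \<in> cv C" using P by (auto simp: gmap_def)
      then show "peval (P j * tcomp P f) z = 0"
      proof cases
        case 1
        then have "peval (P j) z = 0" by (metis pm_def)
        then show ?thesis by (simp add: peval_simps)
      next
        case 2 then show ?thesis using f by (simp add: peval_simps peval_tcomp I_iff)
      qed
    qed
    then have "ev \<xi> (P j) * ev \<xi> (tcomp P f) = 0" using \<xi> unfolding arc_def ev_simps(2)[symmetric] by blast
    moreover have "ev \<xi> (P j) \<noteq> 0" using 1[of j] j by (metis fps_zero_nth)
    ultimately show ?thesis by simp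
  qed
  have 3: "f \<in> I" if f: "homogeneous k f" "ev \<xi> (tcomp P f) = 0" for f k
  proof -
    have "tcomp P f \<in> I" using \<xi> f homP[OF f(1)] unfolding arc_def by blast
    have "D * tcomp Q' (tcomp P f) \<in> I"
      unfolding I_iff
    proof
      fix z assume z: "z \<in> cv C"
      then consider "pm Q' z = (\<lambda>_. 0)" | "pm Q' z \<in> cv C" using gQ' by (auto simp: gmap_def)
      then show "peval (D * tcomp Q' (tcomp P f)) z = 0"
      proof cases
        case 1
        have "pm P (pm Q' z) = pm P (pm Q' (\<lambda>i. 0))" if "e = 0" 
          using pm_scale[OF gQ', of 0 z] that 1 by simp
        consider "peval D z = 0" | "d = 0" 
        proof (cases "d = 0")
          case False
          then have "pm P (\<lambda>i. 0 * z i) = (\<lambda>_. 0)" unfolding pmP_scale by (simp add: power_0_left)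
          then have "peval D z = 0" using 1 by (simp add: D)
          then show ?thesis using that by blast
        qed
        then show ?thesis
        proof cases
          case 1 then show ?thesis by (simp add: peval_simps)
        next
          case 2
          then have "pm P (\<lambda>i. 0 * x i) = pm P x" unfolding pmP_scale by simp
          then have "pm P (pm Q' z) = pm P x" using 1 by simp
          then have "peval (tcomp Q' (tcomp P f)) z = peval (tcomp P f) x" by (simp add: peval_tcomp)
          then show ?thesis using \<open>tcomp P f \<in> I\<close> x(1) by (simp add: peval_simps I_iff)
        qed
      next
        case 2
        then show ?thesis using \<open>tcomp P f \<in> I\<close> by (simp add: peval_simps peval_tcomp[of Q'] I_iff)
      qed
    qed
    then have "indet j ^ k * (D * tcomp Q' (tcomp P f)) \<in> I" by (rule is_idealD(3)[OF is_ideal_I])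
    then have "indet j ^ k * D * tcomp Q' (tcomp P f) \<in> I" by (simp only: mult.assoc)
    then have "D ^ Suc k * f \<in> I"
      using is_idealD(2)[OF is_ideal_I key[OF f(1)]] by (metis diff_add_cancel)
    then have "D ^ Suc k \<in> I \<or> f \<in> I" using I_prime homogeneous_power[OF homD] f(1) by blast
    moreover have "peval (D ^ Suc k) y \<noteq> 0" using Dy by (simp add: peval_simps)
    ultimately show ?thesis using y(2) by (auto simp: I_iff)
  qed
  have 4: "f \<in> germ y (ordI y n)" if f: "homogeneous k f" "vge n (ev \<xi> (tcomp P f))" for f k n
  proof -
    have "tcomp P f \<in> germ x (ordI x n)" using \<xi> f homP[OF f(1)] unfolding arc_def by blast
    then have "tcomp Q' (tcomp P f) \<in> germ y (ordI y n)"
      by (rule pullback[OF gQ' y(2) Q'y x(1)])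
    then have "indet j ^ k * D * tcomp Q' (tcomp P f) \<in> germ y (ordI y n)"
      by (rule is_idealD(3)[OF is_ideal_germ_ordI])
    then have "D ^ Suc k * f \<in> germ y (ordI y n)"
      using is_idealD(2)[OF is_ideal_germ_ordI I_germ[OF key[OF f(1)]]] by (metis diff_add_cancel)
    moreover have "peval (D ^ Suc k) y \<noteq> 0" using Dy by (simp add: peval_simps)
    ultimately show ?thesis by (rule germ_cancel[rotated])
  qed
  show ?thesis unfolding arc_def evP using y(2) 1 2 3 4 by blast
qed

text \<open>Division by the three linear forms that cut out the line through O; the remainder is a
  polynomial in the coordinate along that line.\<close>

lemma div_at_O:
  "\<exists>a b e (G :: 'b poly). f = a * indet 1 + b * indet 2 + e * (indet 0 + indet 3) + pe scalar G (indet 0 :: (4, 'b) mpol)"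
proof (induction f rule: mpol_induct)
  case (scalar a)
  show ?case by (intro exI[of _ 0] exI[of _ "[:a:]"]) (simp add: pe_simps[OF ring_hom_map_scalar])
next
  case (indet i)
  have "i = 0 \<or> i = 1 \<or> i = 2 \<or> i = 3" using all4[of "\<lambda>i. i = 0 \<or> i = 1 \<or> i = 2 \<or> i = 3"] by simp
  then consider "i = 0" | "i = 1" | "i = 2" | "i = 3" by blast
  then show ?case
  proof cases
    case 1 then show ?thesis
      by (intro exI[of _ 0] exI[of _ "[:0, 1:]"])
        (simp add: pe_simps[OF ring_hom_map_scalar] ring_hom_map_simps[OF ring_hom_map_scalar])
  next
    case 2 then show ?thesis
      by (intro exI[of _ 1] exI[of _ 0]) (simp add: pe_simps[OF ring_hom_map_scalar])
  next
    case 3 show ?thesis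
      by (rule exI[of _ 0], rule exI[of _ 1], rule exI[of _ 0], rule exI[of _ 0])
        (simp add: pe_simps[OF ring_hom_map_scalar] 3)
  next
    case 4 show ?thesis
      by (rule exI[of _ 0], rule exI[of _ 0], rule exI[of _ 1], rule exI[of _ "[:0, -1:]"])
        (simp add: pe_simps[OF ring_hom_map_scalar] ring_hom_map_simps[OF ring_hom_map_scalar] 4)
  qed
next
  case (add f g)
  then obtain a b e G a' b' e' G' where
    f: "f = a * indet 1 + b * indet 2 + e * (indet 0 + indet 3) + pe scalar G (indet 0 :: (4, 'b) mpol)"
    and g: "g = a' * indet 1 + b' * indet 2 + e' * (indet 0 + indet 3) + pe scalar G' (indet 0 :: (4, 'b) mpol)"
    by metis
  show ?case
    by (rule exI[of _ "a + a'"], rule exI[of _ "b + b'"], rule exI[of _ "e + e'"], rule exI[of _ "G + G'"])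
      (simp add: f g pe_simps[OF ring_hom_map_scalar] algebra_simps)
next
  case (mult f g)
  then obtain a b e G a' b' e' G' where
    f: "f = a * indet 1 + b * indet 2 + e * (indet 0 + indet 3) + pe scalar G (indet 0 :: (4, 'b) mpol)"
    and g: "g = a' * indet 1 + b' * indet 2 + e' * (indet 0 + indet 3) + pe scalar G' (indet 0 :: (4, 'b) mpol)"
    by metis
  let ?G = "pe scalar G (indet 0 :: (4, 'b) mpol)"
  have "f * g = a * g * indet 1 + b * g * indet 2 + e * g * (indet 0 + indet 3) + ?G * g"
    by (subst f) (simp only: distrib_left distrib_right mult_ac)
  also have "?G * g = ?G * a' * indet 1 + ?G * b' * indet 2 + ?G * e' * (indet 0 + indet 3)
      + pe scalar (G * G') (indet 0 :: (4, 'b) mpol)"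
    by (subst g) (simp only: pe_mult[OF ring_hom_map_scalar] distrib_left distrib_right mult_ac)
  finally have "f * g = (a * g + ?G * a') * indet 1 + (b * g + ?G * b') * indet 2
      + (e * g + ?G * e') * (indet 0 + indet 3) + pe scalar (G * G') (indet 0 :: (4, 'b) mpol)"
    by (simp only: distrib_right add_ac)
  then show ?case by blast
qed

lemma peval_pe_scalar: "peval (pe scalar G (indet i :: (4, 'b) mpol)) x = poly G (x i)"
proof -
  from pe_comp[OF ring_hom_map_peval ring_hom_map_scalar, of G "indet i"] show ?thesis
    by (simp add: peval_simps pe_id)
qed

lemma ev_scale_I:
  assumes "f \<in> I" "l \<noteq> 0"
  shows "ev (\<lambda>i. fps_const l * branch_O i) f = 0"
proof -
  define S where "S = (\<lambda>i. scalar l * indet i :: (4, 'b) mpol)"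
  have "pm S x = (\<lambda>i. l * x i)" for x by (simp add: pm_def S_def peval_simps)
  then have "tcomp S f \<in> I"
    using assms cv_scale by (simp add: I_iff peval_tcomp)
  then have "ev branch_O (tcomp S f) = 0" by (rule I_branch_O)
  then show ?thesis
    using evh_subst[OF ring_hom_map_fps_const, of branch_O S f] by (simp add: tcomp_def S_def ev_simps)
qed

lemma peval_poly_O: "(\<And>l. l \<noteq> 0 \<Longrightarrow> poly G l = 0) \<Longrightarrow> G = (0 :: 'b poly)"
  by (rule poly_zero_cofinite[of "{0}"]) auto

text \<open>\<open>X\<^sub>0 + X\<^sub>3\<close> is a uniformizer at \<open>O\<close>, and \<open>X\<^sub>1\<close>, \<open>X\<^sub>2\<close> are locally multiples
  of its square.\<close>

lemma germ_O:
  assumes "\<And>l. l \<noteq> 0 \<Longrightarrow> vge n (ev (\<lambda>i. fps_const l * branch_O i) f)"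
  shows "f \<in> germ pt_O (ordI pt_O n)"
  using assms
proof (induction n arbitrary: f)
  case 0
  then show ?case by (simp add: germ_ordI_0)
next
  case (Suc n)
  obtain a b e G where f: "f = a * indet 1 + b * indet 2 + e * (indet 0 + indet 3) + pe scalar G (indet 0 :: (4, 'b) mpol)"
    using div_at_O by blast
  let ?\<xi> = "\<lambda>l i. fps_const l * branch_O i"
  \<comment> \<open>The cofactors of the division need not be homogeneous, so vanishing is tested at
    every multiple of O. This is why the statement quantifies over all rescalings of the
    branch.\<close>
  have "poly G l = 0" if "l \<noteq> 0" for l
  proof -
    have "vge 1 (ev (?\<xi> l) f)" using Suc.prems[OF that] by (auto simp: vge_def)
    then have "ev (?\<xi> l) f $ 0 = 0" by (rule vge_nth) simp
    then have "peval f (\<lambda>i. l * pt_O i) = 0"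
      using fun_cong[OF branch_O_nth0] by (simp add: ev_nth0)
    then show ?thesis by (simp add: f peval_simps peval_pe_scalar pt_O_def char2)
  qed
  then have "G = 0" by (rule peval_poly_O)
  then have f: "f = a * indet 1 + b * indet 2 + e * (indet 0 + indet 3)"
    using f by (simp add: pe_0[OF ring_hom_map_scalar])
  define t :: "(4, 'b) mpol" where "t = indet 0 + indet 3"
  \<comment> \<open>On the curve X0^3 X2 C = (X0 + X3)^2 (X0 + X1)^2, and X1 X3 = X0 X2.
    Multiplication by h, a unit at O, therefore makes every term of f divisible by t.\<close>
  define h :: "(4, 'b) mpol" where "h = scalar C * indet 0 ^ 3 * indet 3"
  define q where "q = t * (indet 0 + indet 1)\<^sup>2 * (a * indet 0 + b * indet 3) + e * h"
  have hf: "h * f - t * q \<in> I"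
    unfolding I_iff
  proof
    fix x assume x: "x \<in> cv C"
    have on: "(x 0 + x 1 + x 2 + x 3)\<^sup>2 = C * x 0 * x 2" "x 0 * x 2 = x 1 * x 3"
      using x by (simp_all add: cv_def on_curve_def)
    have "x 0 * (x 0 + x 1 + x 2 + x 3) = (x 0 + x 1) * (x 0 + x 3)"
      using on(2) by (simp add: algebra_simps)
    then have "((x 0 + x 1) * (x 0 + x 3))\<^sup>2 = x 0 ^ 2 * (x 0 + x 1 + x 2 + x 3)\<^sup>2"
      by (metis power_mult_distrib)
    then have sq: "(x 0 + x 3) * (x 0 + x 3) * (x 0 + x 1)\<^sup>2 = C * x 0 ^ 3 * x 2"
      unfolding on(1) by (simp add: power2_eq_square power3_eq_cube mult_ac)
    have 3: "C * x 0 ^ 3 * x 3 * x 1 = x 0 * (C * x 0 ^ 3 * x 2)"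
      using on(2) by (simp add: power3_eq_cube mult_ac)
    have "peval (h * f) x = peval (t * q) x"
    proof -
      have "peval (h * f) x = peval a x * (C * x 0 ^ 3 * x 3 * x 1) + peval b x * x 3 * (C * x 0 ^ 3 * x 2)
        + (x 0 + x 3) * peval e x * (C * x 0 ^ 3 * x 3)"
        by (simp add: f h_def peval_simps algebra_simps)
      also have "\<dots> = (peval a x * x 0 + peval b x * x 3) * ((x 0 + x 3) * (x 0 + x 3) * (x 0 + x 1)\<^sup>2)
        + (x 0 + x 3) * peval e x * (C * x 0 ^ 3 * x 3)"
        unfolding 3 sq by (simp only: expand)
      also have "\<dots> = peval (t * q) x"
        by (simp only: t_def q_def h_def peval_simps expand)
      finally show ?thesis .
    qed
    then show "peval (h * f - t * q) x = 0" by (simp add: peval_simps)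
  qed
  have "q \<in> germ pt_O (ordI pt_O n)"
  proof (rule Suc.IH)
    fix l :: 'b assume l: "l \<noteq> 0"
    have "ev (?\<xi> l) (h * f) = ev (?\<xi> l) (t * q)"
      using ev_scale_I[OF hf l] by (simp add: ev_simps)
    moreover have "vge (0 + Suc n) (ev (?\<xi> l) h * ev (?\<xi> l) f)" by (intro vge_mult Suc.prems l) simp
    moreover have "ev (?\<xi> l) t = fps_const l * fps_X"
      by (simp add: t_def ev_simps branch_O_def vseries_def char2_rules[OF two_fps] distrib_left add.assoc[symmetric])
    ultimately have "vge (Suc n) (fps_const l * (fps_X * ev (?\<xi> l) q))" by (simp add: ev_simps mult.assoc)
    then have "vge (Suc n) (fps_X * ev (?\<xi> l) q)" by (rule vge_unit[rotated]) (simp add: l)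
    then show "vge n (ev (?\<xi> l) q)" by (rule vge_shift)
  qed
  moreover have "t \<in> mx pt_O"
    by (auto simp: vanishing_ideal_def proj_eq_def t_def peval_simps pt_O_def char2)
  ultimately have "t * q \<in> germ pt_O (ordI pt_O (Suc n))" by (intro mult_germ_ordI)
  then have "h * f \<in> germ pt_O (ordI pt_O (Suc n))"
    using is_idealD(2)[OF is_ideal_germ_ordI I_germ[OF hf]] by (metis diff_add_cancel)
  moreover have "peval h pt_O \<noteq> 0" using C0 by (simp add: h_def peval_simps pt_O_def)
  ultimately show ?case by (rule germ_cancel[rotated])
qed

lemma arc_O: "arc pt_O branch_O"
proof -
  have "f \<in> germ pt_O (ordI pt_O n)" if "homogeneous d f" "vge n (ev branch_O f)" for f d n
  proof (rule germ_O)
    fix l :: 'b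
    have "vge (0 + n) (fps_const l ^ d * ev branch_O f)" by (intro vge_mult that) simp
    then show "vge n (ev (\<lambda>i. fps_const l * branch_O i) f)"
      using homogeneous_scale[OF that(1) ring_hom_map_fps_const, of "fps_const l" branch_O] by simp
  qed
  then show ?thesis
    unfolding arc_def using pt_O_cv I_branch_O branch_O_I fun_cong[OF branch_O_nth0] by blast
qed

section \<open>Translations\<close>

lemma Ulaw_cases: "Ulaw b x y \<in> {Ua x y, Ub x y}" by (simp add: Ulaw_def)
lemma Vlaw_cases: "Vlaw b x y \<in> {Va x y, Vb x y}" by (simp add: Vlaw_def)

lemma isadd_law_par: "isadd C x y z \<Longrightarrow> par (law b b' x y) z"
  unfolding law_def using isadd_segre_par Ulaw_cases Vlaw_cases by blast

lemma isadd_law: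
  assumes "isadd C x y z" "law b b' x y \<noteq> (\<lambda>_. 0)"
  shows "proj_eq (law b b' x y) z"
  using par_proj_eq[OF isadd_law_par[OF assms(1)] assms(2)] assms(1) cv_ne0 by (auto simp: isadd_def)

lemma law_isadd:
  assumes "x \<in> cv C" "y \<in> cv C" "law b b' x y \<noteq> (\<lambda>_. 0)"
  shows "isadd C x y (law b b' x y)"
proof -
  obtain z where z: "isadd C x y z" using isadd_exists[OF assms(1,2)] .
  then show ?thesis using isadd_law[OF z assms(3)] isadd_proj_eq[OF z] proj_eq_refl proj_eq_sym by blast
qed

lemma law_exists:
  assumes "x \<in> cv C" "y \<in> cv C"
  obtains b b' where "law b b' x y \<noteq> (\<lambda>_. 0)"
proof -
  obtain b where b: "Ulaw b x y \<noteq> (\<lambda>_. 0)"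
  proof (cases "Ua x y = (\<lambda>_. 0)")
    case True
    then show ?thesis using U_law_nonzero[OF assms] that[of True] by (simp add: Ulaw_def)
  qed (use that[of False] in \<open>simp add: Ulaw_def\<close>)
  obtain b' where b': "Vlaw b' x y \<noteq> (\<lambda>_. 0)"
  proof (cases "Va x y = (\<lambda>_. 0)")
    case True
    then show ?thesis using V_law_nonzero[OF assms] that[of True] by (simp add: Vlaw_def)
  qed (use that[of False] in \<open>simp add: Vlaw_def\<close>)
  show ?thesis using that b b' unfolding law_def by (simp add: segre_ne0)
qed

lemma gmap_lawmap: "y \<in> cv C \<Longrightarrow> gmap 2 (lawmap b b' y)"
  unfolding gmap_def pm_lawmap
proof (intro conjI allI ballI)
  assume y: "y \<in> cv C"
  show "homogeneous 2 (lawmap b b' y i)" for i by (rule homogeneous_lawmap)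
  fix x assume "x \<in> cv C"
  then show "law b b' x y = (\<lambda>_. 0) \<or> law b b' x y \<in> cv C"
    using law_isadd[OF _ y, of x b b'] unfolding isadd_def by blast
qed

lemma lawmap_inverse:
  assumes "y \<in> cv C" "z \<in> cv C"
  shows "par (pm (lawmap b b' y) (pm (lawmap k k' (neg y)) z)) z"
proof (cases "law k k' z (neg y) = (\<lambda>_. 0)")
  case True
  then show ?thesis by (simp add: pm_lawmap law_zero_left par_def)
next
  case False
  then have "isadd C z (neg y) (law k k' z (neg y))"
    using assms by (intro law_isadd) (simp_all add: cv_neg)
  from isadd_diff[OF this] show ?thesis by (simp add: pm_lawmap isadd_law_par)
qed

lemma arc_scale:
  assumes "arc x \<xi>" "l \<noteq> 0"
  shows "arc (\<lambda>i. l * x i) (\<lambda>i. fps_const l * \<xi> i)"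
proof -
  define S where "S l = (\<lambda>i. scalar l * indet i :: (4, 'b) mpol)" for l
  have pmS: "pm (S l) x = (\<lambda>i. l * x i)" for l x by (simp add: pm_def S_def peval_simps)
  have gS: "gmap 1 (S l)" if "l \<noteq> 0" for l
    unfolding gmap_def pmS using cv_scale[OF _ that]
    by (auto simp: S_def simp del: One_nat_def intro!: homogeneous_scalar_mult homogeneous_indet)
  have x: "x \<in> cv C" using assms(1) by (simp add: arc_def)
  then have lx: "(\<lambda>i. l * x i) \<in> cv C" using assms(2) proj_eq_scale[OF proj_eq_refl] cv_proj_eq by blast
  have "arc (\<lambda>i. l * x i) (\<lambda>i. ev \<xi> (S l i))"
    by (rule arc_transport[OF assms(1) gS[OF assms(2)] gS[of 1]])
      (auto simp: pmS lx par_def mult_ac intro!: proj_eq_sym[OF proj_eq_scale[OF proj_eq_refl assms(2)]])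
  then show ?thesis by (simp add: S_def ev_simps)
qed

lemma arc_translate:
  assumes \<xi>: "arc x \<xi>" and y: "y \<in> cv C" and "law b b' x y \<noteq> (\<lambda>_. 0)"
  shows "arc (law b b' x y) (\<lambda>i. ev \<xi> (lawmap b b' y i))"
proof -
  let ?z = "law b b' x y"
  have x: "x \<in> cv C" using \<xi> by (simp add: arc_def)
  have a: "isadd C x y ?z" by (rule law_isadd[OF x y assms(3)])
  then have z: "?z \<in> cv C" by (simp add: isadd_def)
  obtain k k' where k: "law k k' ?z (neg y) \<noteq> (\<lambda>_. 0)"
    by (rule law_exists[OF z, of "neg y"]) (use y in \<open>simp_all add: cv_neg\<close>)
  have "proj_eq (law k k' ?z (neg y)) x" by (rule isadd_law[OF isadd_diff[OF a] k])
  then show ?thesis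
    using y z by (intro arc_transport[OF \<xi> gmap_lawmap[OF y] gmap_lawmap[of "neg y" k k']])
      (simp_all add: pm_lawmap cv_neg lawmap_inverse[unfolded pm_lawmap])
qed

lemma arc_exists:
  assumes "x \<in> cv C"
  obtains \<xi> where "arc x \<xi>"
proof -
  obtain b b' where b: "law b b' pt_O x \<noteq> (\<lambda>_. 0)" using law_exists[OF pt_O_cv assms] .
  have "proj_eq (law b b' pt_O x) x" using isadd_law[OF isadd_commute[OF isadd_O[OF assms]] b] .
  then obtain l where "l \<noteq> 0" "x = (\<lambda>i. l * law b b' pt_O x i)" by (auto simp: proj_eq_def)
  then show ?thesis using arc_scale[OF arc_translate[OF arc_O assms b]] that by metis
qed

subsection \<open>Properties of the order\<close>

lemma ordv_mult:
  assumes "x \<in> cv C" "homogeneous d f" "homogeneous e g" "f \<notin> I" "g \<notin> I"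
  shows "ordv x (f * g) = ordv x f + ordv x g" "f * g \<notin> I" "homogeneous (d + e) (f * g)"
proof -
  show fg: "f * g \<notin> I" using I_prime assms by blast
  show h: "homogeneous (d + e) (f * g)" using assms by (intro homogeneous_mult)
  obtain \<xi> where \<xi>: "arc x \<xi>" using arc_exists[OF assms(1)] .
  show "ordv x (f * g) = ordv x f + ordv x g"
    using ordv_arc[OF \<xi>] assms fg h by (simp add: ev_simps)
qed

lemma ordv_eq_0_iff:
  assumes "x \<in> cv C" "homogeneous d f" "f \<notin> I"
  shows "ordv x f = 0 \<longleftrightarrow> peval f x \<noteq> 0"
proof -
  obtain \<xi> where \<xi>: "arc x \<xi>" using arc_exists[OF assms(1)] .
  have "(\<lambda>i. \<xi> i $ 0) = x" using \<xi> by (auto simp: arc_def)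
  then have "ev \<xi> f $ 0 = peval f x" by (simp add: ev_nth0)
  then show ?thesis using ordv_arc[OF \<xi> assms(2,3)] by (simp add: subdegree_eq_0_iff)
qed

lemma ordv_proj_eq:
  assumes "x \<in> cv C" "proj_eq x y" "homogeneous d f" "f \<notin> I"
  shows "ordv y f = ordv x f"
proof -
  obtain \<xi> where \<xi>: "arc x \<xi>" using arc_exists[OF assms(1)] .
  obtain l where l: "l \<noteq> 0" "y = (\<lambda>i. l * x i)" using assms(2) by (auto simp: proj_eq_def)
  have "ev (\<lambda>i. fps_const l * \<xi> i) f = fps_const l ^ d * ev \<xi> f"
    by (rule homogeneous_scale[OF assms(3) ring_hom_map_fps_const])
  moreover have "subdegree (fps_const l ^ d) = 0" "fps_const l ^ d \<noteq> 0" using l(1) by simp_all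
  ultimately show ?thesis
    using ordv_arc[OF \<xi> assms(3,4)] ordv_arc[OF arc_scale[OF \<xi> l(1)] assms(3,4)] by (simp add: l(2))
qed

lemma arc_linear:
  assumes \<xi>: "arc x \<xi>" and "gmap 1 P" "gmap 1 Q" "\<And>x. x \<in> cv C \<Longrightarrow> pm P x \<in> cv C"
    "\<And>z. pm P (pm Q z) = z" "\<And>z. pm Q (pm P z) = z"
  shows "arc (pm P x) (\<lambda>i. ev \<xi> (P i))"
  using assms by (intro arc_transport[OF \<xi> assms(2,3) refl]) (auto simp: arc_def proj_eq_refl par_def mult.commute)

lemma gmap_perm:
  "gmap 1 (neg indet)" "gmap 1 (rot indet)" "gmap 1 (rot (rot (rot indet)))"
  "pm (neg indet) = neg" "pm (rot indet) = rot" "pm (rot (rot (rot indet))) = (\<lambda>x. rot (rot (rot x)))"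
proof -
  show *: "pm (neg indet) = neg" "pm (rot indet) = rot" "pm (rot (rot (rot indet))) = (\<lambda>x. rot (rot (rot x)))"
    by (rule ext, simp add: fun4_eq pm_def peval_simps)+
  show "gmap 1 (neg indet)" "gmap 1 (rot indet)" "gmap 1 (rot (rot (rot indet)))"
    unfolding gmap_def * all4 by (auto simp: cv_neg cv_rot simp del: One_nat_def intro: homogeneous_indet)
qed

lemma arc_neg: "arc x \<xi> \<Longrightarrow> arc (neg x) (neg \<xi>)"
proof -
  assume "arc x \<xi>"
  then have "arc (pm (neg indet) x) (\<lambda>i. ev \<xi> (neg indet i))"
    by (rule arc_linear[OF _ gmap_perm(1) gmap_perm(1)]) (simp_all add: gmap_perm cv_neg)
  moreover have "(\<lambda>i. ev \<xi> (neg indet i)) = neg \<xi>" by (simp add: fun4_eq ev_simps)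
  ultimately show ?thesis by (simp add: gmap_perm)
qed

lemma arc_rot: "arc x \<xi> \<Longrightarrow> arc (rot x) (rot \<xi>)"
proof -
  assume "arc x \<xi>"
  then have "arc (pm (rot indet) x) (\<lambda>i. ev \<xi> (rot indet i))"
    by (rule arc_linear[OF _ gmap_perm(2) gmap_perm(3)]) (simp_all add: gmap_perm cv_rot)
  moreover have "(\<lambda>i. ev \<xi> (rot indet i)) = rot \<xi>" by (simp add: fun4_eq ev_simps)
  ultimately show ?thesis by (simp add: gmap_perm)
qed

end

section \<open>Degrees\<close>

lemma order_le_imp_dvd:
  fixes p q :: "'a::alg_closed_field poly"
  assumes "p \<noteq> 0" "q \<noteq> 0" "\<And>a. order a p \<le> order a q"
  shows "p dvd q"
  using assms
proof (induction "degree p" arbitrary: p q)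
  case 0
  then obtain a where "p = [:a:]" "a \<noteq> 0" by (metis degree_eq_zeroE pCons_0_0)
  then have "q = p * smult (inverse a) q" by simp
  then show ?case by (rule dvdI)
next
  case (Suc n)
  then have "degree p > 0" by simp
  then obtain a where a: "poly p a = 0" using alg_closed_imp_poly_has_root by blast
  obtain p' where p': "p = [:-a, 1:] * p'" using a by (auto simp: poly_eq_0_iff_dvd elim: dvdE)
  have "order a p > 0" using a Suc.prems(1) by (simp add: order_root)
  then have "order a q > 0" using Suc.prems(3)[of a] by linarith
  then have "poly q a = 0" using order_root by fastforce
  then obtain q' where q': "q = [:-a, 1:] * q'" by (auto simp: poly_eq_0_iff_dvd elim: dvdE)
  have ne: "p' \<noteq> 0" "q' \<noteq> 0" using Suc.prems p' q' by auto
  have "degree p = Suc (degree p')" unfolding p' using ne by (subst degree_mult_eq) auto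
  then have deg: "n = degree p'" using Suc.hyps(2) by simp
  have "order b p' \<le> order b q'" for b
    using Suc.prems unfolding p' q' by (metis add_le_cancel_left order_mult)
  then have "p' dvd q'" by (rule Suc.hyps(1)[OF deg ne])
  then show ?case unfolding p' q' by (rule mult_dvd_mono[OF dvd_refl])
qed

lemma fls_val_mult: "f \<noteq> 0 \<Longrightarrow> g \<noteq> 0 \<Longrightarrow> fls_subdegree (f * g :: 'a::field fls) = fls_subdegree f + fls_subdegree g"
  by simp

lemma fls_val_power: "f \<noteq> 0 \<Longrightarrow> fls_subdegree (f ^ n :: 'a::field fls) = int n * fls_subdegree f"
  by (induction n) (simp_all add: algebra_simps)

context char2_curve_ac
begin

text \<open>If a is the constant term of u, then H(u) is a power of u - a times a unit, the exponent
  being the multiplicity of the root a.\<close>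

lemma pe_fls_val_regular:
  fixes H :: "'b poly"
  assumes "H \<noteq> 0" "fls_subdegree u \<ge> 0" "u \<noteq> fls_const (fls_nth u 0)"
  shows "pe fls_const H u \<noteq> 0"
    "fls_subdegree (pe fls_const H u) = int (order (fls_nth u 0) H) * fls_subdegree (u - fls_const (fls_nth u 0))"
proof -
  let ?a = "fls_nth u 0"
  obtain q where q: "H = [:-?a, 1:] ^ order ?a H * q" "\<not> [:-?a, 1:] dvd q"
    using order_decomp[OF assms(1)] by blast
  have q0: "poly q ?a \<noteq> 0" using q(2) by (simp add: poly_eq_0_iff_dvd)
  define s where "s = fls_regpart u"
  have us: "u = fps_to_fls s" using assms(2) by (simp add: s_def)
  have s0: "s $ 0 = ?a" by (simp add: s_def)
  have "pe fps_const q s $ 0 = poly q ?a"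
    using pe_comp[OF ring_hom_map_fps_nth0 ring_hom_map_fps_const, of q s] by (simp add: s0 pe_id)
  then have 0: "pe fps_const q s $ 0 \<noteq> 0" using q0 by simp
  then have ne: "pe fps_const q s \<noteq> 0" by (metis fps_zero_nth)
  have v0: "fls_subdegree (pe fls_const q u) = 0" "pe fls_const q u \<noteq> 0"
    unfolding us fps_to_fls_pe[symmetric] using ne subdegree_eq_0[OF 0]
    by (simp_all add: fls_subdegree_fls_to_fps)
  have "pe fls_const [:-?a, 1:] u = u - fls_const ?a"
    by (simp add: pe_simps[OF ring_hom_map_fls_const] ring_hom_map_simps[OF ring_hom_map_fls_const])
  then have eq: "pe fls_const H u = (u - fls_const ?a) ^ order ?a H * pe fls_const q u"
    by (subst q(1)) (simp add: pe_simps(5,7)[OF ring_hom_map_fls_const])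
  have n0: "u - fls_const ?a \<noteq> 0" using assms(3) by simp
  show "pe fls_const H u \<noteq> 0" unfolding eq using n0 v0 by simp
  show "fls_subdegree (pe fls_const H u) = int (order ?a H) * fls_subdegree (u - fls_const ?a)"
    unfolding eq fls_val_mult[OF power_not_zero[OF n0] v0(2)] fls_val_power[OF n0] by (simp add: v0)
qed

text \<open>At a pole of u the leading term of H dominates, so the order sees the degree.\<close>

lemma pe_fls_val_pole:
  fixes H :: "'b poly"
  assumes "H \<noteq> 0" "fls_subdegree u < 0"
  shows "pe fls_const H u \<noteq> 0 \<and> fls_subdegree (pe fls_const H u) = int (degree H) * fls_subdegree u"
  using assms(1)
proof (induction H)
  case (pCons a H)
  have u0: "u \<noteq> 0" using assms(2) by auto
  show ?case
  proof (cases "H = 0")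
    case True
    then show ?thesis using pCons by (simp add: pe_simps[OF ring_hom_map_fls_const])
  next
    case False
    then have IH: "pe fls_const H u \<noteq> 0" "fls_subdegree (pe fls_const H u) = int (degree H) * fls_subdegree u"
      using pCons by auto
    have v: "fls_subdegree (u * pe fls_const H u) = int (degree (pCons a H)) * fls_subdegree u"
      using fls_val_mult[OF u0 IH(1)] IH(2) False by (simp add: algebra_simps)
    have neg: "int (degree (pCons a H)) * fls_subdegree u < 0"
      using assms(2) False by (simp add: mult_less_0_iff)
    let ?n = "int (degree (pCons a H)) * fls_subdegree u"
    have nth: "fls_nth (fls_const a + u * pe fls_const H u) k = fls_nth (u * pe fls_const H u) k" if "k < 0" for k
      using that by simp
    have n0: "fls_nth (u * pe fls_const H u) ?n \<noteq> 0"
      using IH u0 unfolding v[symmetric] by (intro nth_fls_subdegree_nonzero) simp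
    have "fls_subdegree (fls_const a + u * pe fls_const H u) = ?n"
    proof (rule fls_subdegree_eqI)
      show "fls_nth (fls_const a + u * pe fls_const H u) ?n \<noteq> 0" using nth[OF neg] n0 by simp
      fix k assume "k < ?n"
      then show "fls_nth (fls_const a + u * pe fls_const H u) k = 0"
        using nth[of k] neg fls_eq0_below_subdegree[of k "u * pe fls_const H u"] by (simp add: v)
    qed
    moreover have "fls_const a + u * pe fls_const H u \<noteq> 0" using nth[OF neg] n0 by (metis fls_zero_nth)
    ultimately show ?thesis by (simp add: pe_pCons[OF ring_hom_map_fls_const])
  qed
qed simp

definition form :: "nat \<Rightarrow> (4, 'b) mpol \<Rightarrow> bool" where
  "form d f \<longleftrightarrow> homogeneous d f \<and> f \<notin> I"

lemma form_mult: "form d f \<Longrightarrow> form e g \<Longrightarrow> form (d + e) (f * g)"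
  unfolding form_def using I_prime homogeneous_mult by blast

lemma ordv_form_mult: "x \<in> cv C \<Longrightarrow> form d f \<Longrightarrow> form e g \<Longrightarrow> ordv x (f * g) = ordv x f + ordv x g"
  unfolding form_def using ordv_mult by blast

lemma form_indet: "form 1 (indet i)"
proof -
  have "indet i \<notin> I"
  proof
    assume "indet i \<in> I"
    then have *: "x i = 0" if "x \<in> cv C" for x using that by (auto simp: I_iff peval_simps)
    have "i = 0 \<or> i = 1 \<or> i = 2 \<or> i = 3" using all4[of "\<lambda>i. i = 0 \<or> i = 1 \<or> i = 2 \<or> i = 3"] by simp
    moreover have "rot pt_O \<in> cv C" "rot (rot pt_O) \<in> cv C" using pt_O_cv by (simp_all add: cv_rot)
    ultimately show False using *[of "rot pt_O"] *[of "rot (rot pt_O)"] *[OF pt_O_cv]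
      by (auto simp: pt_O_def)
  qed
  then show ?thesis using homogeneous_indet unfolding form_def by blast
qed

lemma form_linear:
  assumes "a \<noteq> 0 \<or> b \<noteq> 0"
  shows "form 1 (scalar a * indet 0 + scalar b * indet 1)"
proof -
  have "scalar a * indet 0 + scalar b * indet 1 \<notin> I"
  proof
    assume "scalar a * indet 0 + scalar b * indet 1 \<in> I"
    then have *: "a * x 0 + b * x 1 = 0" if "x \<in> cv C" for x using that by (auto simp: I_iff peval_simps)
    have "rot (rot pt_O) \<in> cv C" using pt_O_cv by (simp add: cv_rot)
    then show False using *[OF pt_O_cv] *[of "rot (rot pt_O)"] assms by (simp add: pt_O_def)
  qed
  then show ?thesis unfolding form_def
    using homogeneous_add[OF homogeneous_scalar_mult[OF homogeneous_indet] homogeneous_scalar_mult[OF homogeneous_indet]]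
    by blast
qed

lemma arc_on_curve:
  assumes "arc x \<xi>"
  shows "on_curve (fps_const C) \<xi>"
proof -
  have "(indet 0 + indet 1 + indet 2 + indet 3)\<^sup>2 - scalar C * indet 0 * indet 2 \<in> I"
    "indet 0 * indet 2 - indet 1 * indet 3 \<in> I"
    unfolding I_iff by (auto simp: peval_simps cv_def on_curve_def)
  then have "ev \<xi> ((indet 0 + indet 1 + indet 2 + indet 3)\<^sup>2 - scalar C * indet 0 * indet 2) = 0"
    "ev \<xi> (indet 0 * indet 2 - indet 1 * indet 3) = 0" using assms by (auto simp: arc_def)
  then show ?thesis by (simp add: on_curve_def ev_simps)
qed

text \<open>No coordinate vanishes identically along an arc, so over Laurent series every arc lies
  in the chart X0 \<noteq> 0, wherever its base point is. u is not constant because no nontrivial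
  linear form in X0, X1 vanishes on the curve.\<close>

lemma arc_affine:
  assumes "arc x \<xi>" and Z_def: "Z = (\<lambda>i. fps_to_fls (\<xi> i))"
    and u_def: "u = Z 1 / Z 0" and v_def: "v = Z 3 / Z 0"
  shows "Z 0 \<noteq> 0" "Z 3 \<noteq> 0" "on_affine u v" "on_affine u (1 / v)" "1 + u * u \<noteq> 0"
    "Z = (\<lambda>i. Z 0 * chart u v i)" "neg Z = (\<lambda>i. Z 3 * chart u (1 / v) i)" "u \<noteq> fls_const a"
proof -
  have ne: "ev \<xi> f \<noteq> 0" if "form d f" for f d
    using that assms(1) unfolding form_def arc_def by blast
  have i: "\<xi> i \<noteq> 0" for i using ne[OF form_indet, of i] by (simp add: ev_simps)
  then show Z: "Z 0 \<noteq> 0" "Z 3 \<noteq> 0" by (simp_all add: Z_def)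
  have on: "on_curve (fps_const C) \<xi>" by (rule arc_on_curve[OF assms(1)])
  have "fps_to_fls ((\<xi> 0 + \<xi> 1 + \<xi> 2 + \<xi> 3)\<^sup>2) = fps_to_fls (fps_const C * \<xi> 0 * \<xi> 2)"
    "fps_to_fls (\<xi> 0 * \<xi> 2) = fps_to_fls (\<xi> 1 * \<xi> 3)"
    using on unfolding on_curve_def by simp_all
  then have e: "(Z 0 + Z 1 + Z 2 + Z 3)\<^sup>2 = fls_const C * Z 0 * Z 2" "Z 0 * Z 2 = Z 1 * Z 3"
    unfolding Z_def power2_eq_square
    by (simp_all only: ring_hom_map_simps[OF ring_hom_map_fps_to_fls] fps_const_to_fls)
  have Z2: "Z 2 = Z 0 * (u * v)" using e(2) Z(1) by (simp add: u_def v_def field_simps)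
  have Z1: "Z 1 = Z 0 * u" and Z3: "Z 3 = Z 0 * v" using Z(1) by (simp_all add: u_def v_def)
  have "(Z 0 * ((1 + u) * (1 + v)))\<^sup>2 = fls_const C * Z 0 * (Z 0 * (u * v))"
    using e(1) unfolding Z1 Z2 Z3 by (simp add: algebra_simps)
  then have "Z 0 * Z 0 * (((1 + u) * (1 + v))\<^sup>2) = Z 0 * Z 0 * (fls_const C * u * v)"
    by (simp add: power2_eq_square mult_ac)
  then have "((1 + u) * (1 + v))\<^sup>2 = fls_const C * u * v" using Z(1) by simp
  moreover have "((1 + u) * (1 + v))\<^sup>2 = (1 + u * u) * (1 + v * v)"
    unfolding power_mult_distrib char2_square_add[OF two_fls] by (simp add: power2_eq_square)
  ultimately show on1: "on_affine u v" unfolding on_affine_def by (simp only: char2_sum0[OF two_fls])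
  have v0: "v \<noteq> 0" using Z by (simp add: v_def)
  have "(1 + u * u) * (1 + (1 / v) * (1 / v)) + fls_const C * u * (1 / v)
    = ((1 + u * u) * (1 + v * v) + fls_const C * u * v) / (v * v)"
    using v0 by (simp add: field_simps)
  then show "on_affine u (1 / v)" using on1 by (simp add: on_affine_def)
  show Z': "Z = (\<lambda>i. Z 0 * chart u v i)"
    unfolding fun4_eq chart_simps by (simp add: Z1[symmetric] Z2[symmetric] Z3[symmetric])
  have "neg Z = (\<lambda>i. Z 3 * chart u (1 / v) i)"
    unfolding fun4_eq chart_simps neg_simps Z3 Z2 using v0 by (simp add: Z1 field_simps)
  then show "neg Z = (\<lambda>i. Z 3 * chart u (1 / v) i)" .
  show uc: "u \<noteq> fls_const a" for a
  proof
    assume "u = fls_const a"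
    then have "fps_to_fls (fps_const a * \<xi> 0) = fps_to_fls (\<xi> 1)"
      using Z1 by (simp only: Z_def fls_times_fps_to_fls fps_const_to_fls mult.commute)
    then have "fps_const a * \<xi> 0 + fps_const 1 * \<xi> 1 = 0" by (simp add: char2_rules[OF two_fps])
    then show False using ne[OF form_linear[of a 1]] by (simp add: ev_simps)
  qed
  show "1 + u * u \<noteq> 0"
  proof
    assume "1 + u * u = 0"
    moreover have "1 + u * u = (1 + u) * (1 + u)" by (simp only: expand char2_fls mult_1 mult_1_right)
    ultimately have "1 + u = 0" by simp
    then have "u = fls_const 1" by (simp only: char2_sum0[OF two_fls] fls_const_1)
    then show False using uc by blast
  qed
qed

text \<open>The product of a form with its conjugate under \<open>v \<mapsto> 1 / v\<close>, that is, under negation, is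
  up to known factors a polynomial in \<open>u\<close>.\<close>

lemma norm_exists:
  assumes "form d f" "form d g"
  obtains N F G where
    "\<And>x \<xi> Z u. arc x \<xi> \<Longrightarrow> Z = (\<lambda>i. fps_to_fls (\<xi> i)) \<Longrightarrow> u = Z 1 / Z 0 \<Longrightarrow>
      (1 + u * u) ^ N * fps_to_fls (ev \<xi> f * ev (neg \<xi>) f) = (Z 0 * Z 3) ^ d * pe fls_const F u"
    "\<And>x \<xi> Z u. arc x \<xi> \<Longrightarrow> Z = (\<lambda>i. fps_to_fls (\<xi> i)) \<Longrightarrow> u = Z 1 / Z 0 \<Longrightarrow>
      (1 + u * u) ^ N * fps_to_fls (ev \<xi> g * ev (neg \<xi>) g) = (Z 0 * Z 3) ^ d * pe fls_const G u"
proof -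
  obtain N1 A1 B1 where N1: "\<And>u v. on_affine u v \<Longrightarrow>
    (1 + u * u) ^ N1 * evh fls_const (chart u v) f = pe fls_const A1 u + pe fls_const B1 u * v"
    using normal_form by metis
  obtain N2 A2 B2 where N2: "\<And>u v. on_affine u v \<Longrightarrow>
    (1 + u * u) ^ N2 * evh fls_const (chart u v) g = pe fls_const A2 u + pe fls_const B2 u * v"
    using normal_form by metis
  \<comment> \<open>A common exponent for f and g makes the auxiliary factors of both norms equal,
    so that they cancel when the norms are compared.\<close>
  define M where "M = N1 + N2"
  \<comment> \<open>(A + B v) (A + B / v) = A^2 + B^2 + A B (v + 1/v), and (1 + u^2) (v + 1/v) = C u
    on the curve.\<close>
  define Nf where "Nf A B = Wpoly * (A * A + B * B) + [:0, C:] * (A * B)" for A B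
  have *: "(1 + u * u) ^ Suc (M + M) * fps_to_fls (ev \<xi> f * ev (neg \<xi>) f) = (Z 0 * Z 3) ^ d * pe fls_const (Nf A B) u"
    if f: "form d f" and N: "\<And>u v. on_affine u v \<Longrightarrow>
        (1 + u * u) ^ M * evh fls_const (chart u v) f = pe fls_const A u + pe fls_const B u * v"
      and \<xi>: "arc x \<xi>" and Z: "Z = (\<lambda>i. fps_to_fls (\<xi> i))" and u: "u = Z 1 / Z 0" for f A B x \<xi> Z u
  proof -
    define v where "v = Z 3 / Z 0"
    note a = arc_affine[OF \<xi> Z u v_def]
    have hom: "homogeneous d f" using f by (simp add: form_def)
    have "fps_to_fls (ev \<xi> f) = evh fls_const Z f" by (simp add: fps_to_fls_ev Z)
    also have "\<dots> = Z 0 ^ d * evh fls_const (chart u v) f"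
      by (subst a(6)) (rule homogeneous_scale[OF hom ring_hom_map_fls_const])
    finally have 1: "fps_to_fls (ev \<xi> f) = Z 0 ^ d * evh fls_const (chart u v) f" .
    have nZ: "(\<lambda>i. fps_to_fls (neg \<xi> i)) = neg Z" by (simp add: fun4_eq Z)
    have "fps_to_fls (ev (neg \<xi>) f) = evh fls_const (neg Z) f" by (simp add: fps_to_fls_ev nZ)
    also have "\<dots> = Z 3 ^ d * evh fls_const (chart u (1 / v)) f"
      by (subst a(7)) (rule homogeneous_scale[OF hom ring_hom_map_fls_const])
    finally have 2: "fps_to_fls (ev (neg \<xi>) f) = Z 3 ^ d * evh fls_const (chart u (1 / v)) f" .
    define w p q where "w = 1 + u * u" and "p = pe fls_const A u" and "q = pe fls_const B u"
    have v0: "v \<noteq> 0" using a(1,2) by (simp add: v_def)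
    have "w * (1 + v * v) + fls_const C * u * v = 0" using a(3) by (simp add: on_affine_def w_def)
    then have "w * (1 + v * v) = fls_const C * u * v" by (simp only: char2_sum0[OF two_fls])
    then have wv: "w * (v + 1 / v) = fls_const C * u" using v0 by (simp add: field_simps)
    have "w ^ Suc (M + M) * fps_to_fls (ev \<xi> f * ev (neg \<xi>) f) =
      (Z 0 * Z 3) ^ d * (w * ((w ^ M * evh fls_const (chart u v) f) * (w ^ M * evh fls_const (chart u (1 / v)) f)))"
      by (simp add: fls_times_fps_to_fls 1 2 power_mult_distrib power_add mult_ac)
    also have "\<dots> = (Z 0 * Z 3) ^ d * (w * ((p + q * v) * (p + q * (1 / v))))"
      unfolding w_def N[OF a(3)] N[OF a(4)] p_def q_def ..
    also have "w * ((p + q * v) * (p + q * (1 / v))) = w * (p * p + q * q) + w * (v + 1 / v) * (p * q)"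
      using v0 by (simp add: algebra_simps)
    also have "\<dots> = pe fls_const (Nf A B) u"
      unfolding wv by (simp add: Nf_def pe_simps[OF ring_hom_map_fls_const] pe_Wpoly w_def p_def q_def algebra_simps)
    finally show ?thesis by (simp only: w_def)
  qed
  have raise: "(1 + u * u) ^ (a + b) * t = pe fls_const (Wpoly ^ b * A) u + pe fls_const (Wpoly ^ b * B) u * v"
    if "(1 + u * u) ^ a * t = pe fls_const A u + pe fls_const B u * v" for u v t :: "'b fls" and a b A B
  proof -
    have "(1 + u * u) ^ (a + b) * t = (1 + u * u) ^ b * ((1 + u * u) ^ a * t)" by (simp add: power_add mult_ac)
    then show ?thesis unfolding that by (simp add: pe_simps[OF ring_hom_map_fls_const] pe_Wpoly algebra_simps)
  qed
  have M1: "(1 + u * u) ^ M * evh fls_const (chart u v) f = pe fls_const (Wpoly ^ N2 * A1) u + pe fls_const (Wpoly ^ N2 * B1) u * v"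
    if "on_affine u v" for u v unfolding M_def by (rule raise[OF N1[OF that]])
  have M2: "(1 + u * u) ^ M * evh fls_const (chart u v) g = pe fls_const (Wpoly ^ N1 * A2) u + pe fls_const (Wpoly ^ N1 * B2) u * v"
    if "on_affine u v" for u v unfolding M_def add.commute[of N1] by (rule raise[OF N2[OF that]])
  show ?thesis
    by (rule that[OF *[OF assms(1) M1] *[OF assms(2) M2]])
qed

lemma arc_fls_ratio:
  assumes "arc x \<xi>" "x 0 \<noteq> 0"
  shows "fls_subdegree (fps_to_fls (\<xi> 1) / fps_to_fls (\<xi> 0)) \<ge> 0"
    "fls_nth (fps_to_fls (\<xi> 1) / fps_to_fls (\<xi> 0)) 0 = x 1 / x 0"
proof -
  have 0: "\<xi> i $ 0 = x i" for i using assms by (simp add: arc_def)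
  have "\<xi> 0 * inverse (\<xi> 0) = 1" using assms(2) by (simp add: 0 inverse_mult_eq_1')
  then have "fps_to_fls (\<xi> 0) * fps_to_fls (inverse (\<xi> 0)) = 1"
    by (metis fls_times_fps_to_fls fps_one_to_fls)
  then have "fps_to_fls (\<xi> 1) / fps_to_fls (\<xi> 0) = fps_to_fls (\<xi> 1 * inverse (\<xi> 0))"
    by (simp add: fls_times_fps_to_fls divide_inverse inverse_unique)
  then show "fls_subdegree (fps_to_fls (\<xi> 1) / fps_to_fls (\<xi> 0)) \<ge> 0"
    "fls_nth (fps_to_fls (\<xi> 1) / fps_to_fls (\<xi> 0)) 0 = x 1 / x 0"
    by (simp_all add: fls_subdegree_fls_to_fps 0 divide_inverse)
qed

lemma point_over:
  obtains x where "x \<in> cv C" "x 0 \<noteq> 0" "x 1 / x 0 = (u :: 'b)"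
proof (cases "u = 1")
  case True
  have "rot pt_O \<in> cv C" using pt_O_cv by (simp add: cv_rot)
  then show ?thesis using that[of "rot pt_O"] True by (simp add: pt_O_def)
next
  case False
  show ?thesis
  proof (cases "u = 0")
    case True
    then show ?thesis using that[OF pt_O_cv] by (simp add: pt_O_def)
  next
    case False
    then obtain v where "chart u v \<in> cv C" using affine_points[of u] \<open>u \<noteq> 1\<close> by metis
    then show ?thesis using that[of "chart u v"] by simp
  qed
qed

text \<open>Let F and G be the norms of f and g, polynomials in u. The hypothesis makes every root
  of G a root of F with at least the same multiplicity, so G divides F; at the pole of u it gives
  degree F \<le> degree G. Hence F is a constant multiple of G, and the nonnegative differences of
  orders at x and -x add up to 0.\<close>

theorem degree_lemma:
  assumes f: "form d f" and g: "form d g" and le: "\<And>x. x \<in> cv C \<Longrightarrow> ordv x g \<le> ordv x f"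
    and x: "x \<in> cv C"
  shows "ordv x f = ordv x g"
proof -
  obtain N F G where
    NF: "\<And>x \<xi> Z u. arc x \<xi> \<Longrightarrow> Z = (\<lambda>i. fps_to_fls (\<xi> i)) \<Longrightarrow> u = Z 1 / Z 0 \<Longrightarrow>
      (1 + u * u) ^ N * fps_to_fls (ev \<xi> f * ev (neg \<xi>) f) = (Z 0 * Z 3) ^ d * pe fls_const F u" and
    NG: "\<And>x \<xi> Z u. arc x \<xi> \<Longrightarrow> Z = (\<lambda>i. fps_to_fls (\<xi> i)) \<Longrightarrow> u = Z 1 / Z 0 \<Longrightarrow>
      (1 + u * u) ^ N * fps_to_fls (ev \<xi> g * ev (neg \<xi>) g) = (Z 0 * Z 3) ^ d * pe fls_const G u"
    using norm_exists[OF f g] by metis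
  have val: "pe fls_const H u \<noteq> 0" "fls_subdegree (pe fls_const H u) =
      int N * fls_subdegree (1 + u * u) + int (ordv x f) + int (ordv (neg x) f) - int d * fls_subdegree (Z 0 * Z 3)"
    if f: "form d f" and \<xi>: "arc x \<xi>" and Z: "Z = (\<lambda>i. fps_to_fls (\<xi> i))" and u: "u = Z 1 / Z 0"
      and eq: "(1 + u * u) ^ N * fps_to_fls (ev \<xi> f * ev (neg \<xi>) f) = (Z 0 * Z 3) ^ d * pe fls_const H u"
    for f H x \<xi> Z u
  proof -
    note a = arc_affine[OF \<xi> Z u refl]
    have f': "homogeneous d f" "f \<notin> I" using f by (simp_all add: form_def)
    note o = ordv_arc[OF \<xi> f'] ordv_arc[OF arc_neg[OF \<xi>] f']
    have Z0: "Z 0 * Z 3 \<noteq> 0" using a(1,2) by simp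
    have "(1 + u * u) ^ N * fps_to_fls (ev \<xi> f * ev (neg \<xi>) f) \<noteq> 0"
      using a(5) o(2,4) by simp
    then show ne: "pe fls_const H u \<noteq> 0" unfolding eq by auto
    have "fls_subdegree ((1 + u * u) ^ N * fps_to_fls (ev \<xi> f * ev (neg \<xi>) f)) =
      int N * fls_subdegree (1 + u * u) + (int (ordv x f) + int (ordv (neg x) f))"
      using a(5) o by (simp add: fls_val_power fls_subdegree_fls_to_fps)
    moreover have "fls_subdegree ((Z 0 * Z 3) ^ d * pe fls_const H u) =
      int d * fls_subdegree (Z 0 * Z 3) + fls_subdegree (pe fls_const H u)"
      unfolding fls_val_mult[OF power_not_zero[OF Z0] ne] fls_val_power[OF Z0] ..
    ultimately show "fls_subdegree (pe fls_const H u) =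
      int N * fls_subdegree (1 + u * u) + int (ordv x f) + int (ordv (neg x) f) - int d * fls_subdegree (Z 0 * Z 3)"
      using eq by simp
  qed
  have cmp: "fls_subdegree (pe fls_const F u) - fls_subdegree (pe fls_const G u) =
      (int (ordv x f) - int (ordv x g)) + (int (ordv (neg x) f) - int (ordv (neg x) g))"
    "pe fls_const F u \<noteq> 0" "pe fls_const G u \<noteq> 0"
    if \<xi>: "arc x \<xi>" and u: "u = fps_to_fls (\<xi> 1) / fps_to_fls (\<xi> 0)" for x \<xi> u
    using val[OF f \<xi> refl u NF[OF \<xi> refl u]] val[OF g \<xi> refl u NG[OF \<xi> refl u]] by simp_all
  have ge: "fls_subdegree (pe fls_const G u) \<le> fls_subdegree (pe fls_const F u)"
    if \<xi>: "arc x \<xi>" and u: "u = fps_to_fls (\<xi> 1) / fps_to_fls (\<xi> 0)" for x \<xi> u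
  proof -
    have "x \<in> cv C" using \<xi> by (simp add: arc_def)
    then show ?thesis using cmp(1)[OF that] le[of x] le[of "neg x"] by (simp add: cv_neg)
  qed
  obtain \<xi> where \<xi>: "arc x \<xi>" using arc_exists[OF x] .
  have FG: "F \<noteq> 0" "G \<noteq> 0" using cmp(2,3)[OF \<xi> refl] by (auto simp: pe_0[OF ring_hom_map_fls_const])
  have "order a G \<le> order a F" for a
  proof -
    obtain y where y: "y \<in> cv C" "y 0 \<noteq> 0" "y 1 / y 0 = a" using point_over .
    obtain \<eta> where \<eta>: "arc y \<eta>" using arc_exists[OF y(1)] .
    define u where "u = fps_to_fls (\<eta> 1) / fps_to_fls (\<eta> 0)"
    note r = arc_fls_ratio[OF \<eta> y(2), folded u_def]
    have nc: "u \<noteq> fls_const a" for a using arc_affine(8)[OF \<eta> refl refl refl] by (simp add: u_def)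
    have a: "fls_nth u 0 = a" using r y by simp
    have "0 < fls_subdegree (u - fls_const a)"
    proof -
      have "u - fls_const a \<noteq> 0" using nc by simp
      moreover have "fls_nth (u - fls_const a) 0 = 0" using a by simp
      moreover have "\<And>k. k < 0 \<Longrightarrow> fls_nth (u - fls_const a) k = 0" using r(1) by simp
      ultimately have "0 \<le> fls_subdegree (u - fls_const a)" "fls_subdegree (u - fls_const a) \<noteq> 0"
        using nth_fls_subdegree_nonzero[of "u - fls_const a"] by (metis not_le, metis)
      then show ?thesis by simp
    qed
    moreover have "int (order a G) * fls_subdegree (u - fls_const a) \<le> int (order a F) * fls_subdegree (u - fls_const a)"
      using ge[OF \<eta> u_def] pe_fls_val_regular(2)[OF FG(1) r(1) nc] pe_fls_val_regular(2)[OF FG(2) r(1) nc] a by simp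
    ultimately show ?thesis by simp
  qed
  then have dvd: "G dvd F" by (rule order_le_imp_dvd[OF FG(2,1)])
  have "degree F \<le> degree G"
  proof -
    \<comment> \<open>2 T = (0 : 1 : 1 : 0) is the point where u has its pole.\<close>
    have y: "rot (rot pt_O) \<in> cv C" using pt_O_cv by (simp add: cv_rot)
    obtain \<eta> where \<eta>: "arc (rot (rot pt_O)) \<eta>" using arc_exists[OF y] .
    define u where "u = fps_to_fls (\<eta> 1) / fps_to_fls (\<eta> 0)"
    have 0: "\<eta> 0 $ 0 = 0" "\<eta> 1 $ 0 = 1" using \<eta> by (simp_all add: arc_def pt_O_def)
    have "fps_to_fls (\<eta> 0) \<noteq> 0" using arc_affine(1)[OF \<eta> refl refl refl] .
    then have n0: "\<eta> 0 \<noteq> 0" by simp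
    have "subdegree (\<eta> 0) > 0" using 0(1) n0 subdegree_eq_0_iff[of "\<eta> 0"] by auto
    moreover have "subdegree (\<eta> 1) = 0" "\<eta> 1 \<noteq> 0" using 0(2) by auto
    ultimately have "fls_subdegree u < 0" unfolding u_def
      using n0 by (simp add: fls_divide_subdegree fls_subdegree_fls_to_fps)
    then have "int (degree G) * fls_subdegree u \<le> int (degree F) * fls_subdegree u"
      using ge[OF \<eta> u_def] pe_fls_val_pole[OF FG(1)] pe_fls_val_pole[OF FG(2)] by simp
    then show ?thesis using \<open>fls_subdegree u < 0\<close> by (simp add: mult_le_cancel_right)
  qed
  moreover obtain K where K: "F = G * K" using dvd by (auto elim: dvdE)
  ultimately have "degree K = 0" using FG by (simp add: degree_mult_eq)
  then obtain k where "K = [:k:]" by (metis degree_eq_zeroE)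
  then have Fk: "F = smult k G" "k \<noteq> 0" using K FG by auto
  have "fls_subdegree (pe fls_const F u) = fls_subdegree (pe fls_const G u)"
    if "pe fls_const G u \<noteq> 0" for u
    using that Fk by (simp add: pe_smult[OF ring_hom_map_fls_const])
  then have "(int (ordv x f) - int (ordv x g)) + (int (ordv (neg x) f) - int (ordv (neg x) g)) = 0"
    using cmp[OF \<xi> refl] by simp
  then show ?thesis using le[OF x] le[of "neg x"] x by (simp add: cv_neg)
qed

end

context char2_curve_ac
begin

section \<open>Orders of vanishing under translations\<close>

lemma ordv_transport:
  assumes "arc x \<xi>" "arc y (\<lambda>i. ev \<xi> (P i))" "\<And>i. homogeneous e (P i)" "form d f"
  shows "form (d * e) (tcomp P f)" "ordv x (tcomp P f) = ordv y f"
proof -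
  have evP: "ev (\<lambda>i. ev \<xi> (P i)) f = ev \<xi> (tcomp P f)"
    using evh_subst[OF ring_hom_map_fps_const, of \<xi> P f] by (simp add: tcomp_def)
  have f: "homogeneous d f" "f \<notin> I" using assms(4) by (simp_all add: form_def)
  have hom: "homogeneous (d * e) (tcomp P f)"
    unfolding tcomp_def by (rule homogeneous_subst[OF f(1) assms(3)])
  have "ev \<xi> (tcomp P f) \<noteq> 0" using ordv_arc(2)[OF assms(2) f] by (simp add: evP)
  then have nI: "tcomp P f \<notin> I" using assms(1) by (auto simp: arc_def)
  show "form (d * e) (tcomp P f)" using hom nI by (simp add: form_def)
  show "ordv x (tcomp P f) = ordv y f"
    using ordv_arc(1)[OF assms(1) hom nI] ordv_arc(1)[OF assms(2) f] by (simp add: evP)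
qed

lemma ordv_translate:
  assumes "x \<in> cv C" "y \<in> cv C" "law b b' x y \<noteq> (\<lambda>_. 0)" "form d f"
  shows "form (d * 2) (tcomp (lawmap b b' y) f)" "ordv x (tcomp (lawmap b b' y) f) = ordv (law b b' x y) f"
proof -
  obtain \<xi> where \<xi>: "arc x \<xi>" using arc_exists[OF assms(1)] .
  from ordv_transport[OF \<xi> arc_translate[OF \<xi> assms(2,3)] homogeneous_lawmap assms(4)]
  show "form (d * 2) (tcomp (lawmap b b' y) f)" "ordv x (tcomp (lawmap b b' y) f) = ordv (law b b' x y) f" .
qed

definition negm :: "(4, 'b) mpol \<Rightarrow> (4, 'b) mpol" where "negm f = tcomp (neg indet) f"

lemma ordv_negm:
  assumes "form d f"
  shows "form d (negm f)" "x \<in> cv C \<Longrightarrow> ordv x (negm f) = ordv (neg x) f"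
proof -
  have hom: "homogeneous 1 (neg (indet :: 4 \<Rightarrow> (4, 'b) mpol) i)" for i using gmap_perm(1) by (auto simp: gmap_def)
  have *: "form (d * 1) (negm f) \<and> ordv x (negm f) = ordv (neg x) f" if "x \<in> cv C" for x
  proof -
    obtain \<xi> where \<xi>: "arc x \<xi>" using arc_exists[OF \<open>x \<in> cv C\<close>] .
    have "(\<lambda>i. ev \<xi> (neg indet i)) = neg \<xi>" by (simp add: fun4_eq ev_simps)
    then have "arc (neg x) (\<lambda>i. ev \<xi> (neg indet i))" using arc_neg[OF \<xi>] by simp
    from ordv_transport[OF \<xi> this hom assms] show ?thesis unfolding negm_def by blast
  qed
  show "form d (negm f)" using *[OF pt_O_cv] by simp
  show "x \<in> cv C \<Longrightarrow> ordv x (negm f) = ordv (neg x) f" using * by blast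
qed

lemma ordv_rotm:
  assumes "form d f"
  shows "form d (rotm f)" "x \<in> cv C \<Longrightarrow> ordv x (rotm f) = ordv (rot x) f"
proof -
  have hom: "homogeneous 1 (rot (indet :: 4 \<Rightarrow> (4, 'b) mpol) i)" for i using gmap_perm(2) by (auto simp: gmap_def)
  have *: "form (d * 1) (rotm f) \<and> ordv x (rotm f) = ordv (rot x) f" if "x \<in> cv C" for x
  proof -
    obtain \<xi> where \<xi>: "arc x \<xi>" using arc_exists[OF \<open>x \<in> cv C\<close>] .
    have "(\<lambda>i. ev \<xi> (rot indet i)) = rot \<xi>" by (simp add: fun4_eq ev_simps)
    then have "arc (rot x) (\<lambda>i. ev \<xi> (rot indet i))" using arc_rot[OF \<xi>] by simp
    from ordv_transport[OF \<xi> this hom assms] show ?thesis unfolding rotm_def tcomp_def by blast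
  qed
  show "form d (rotm f)" using *[OF pt_O_cv] by simp
  show "x \<in> cv C \<Longrightarrow> ordv x (rotm f) = ordv (rot x) f" using * by blast
qed

lemma ordv_cong:
  assumes "f - g \<in> I"
  shows "ordv x f = ordv x g" "f \<in> I \<longleftrightarrow> g \<in> I"
proof -
  have gf: "g - f \<in> I" using is_idealD(5)[OF is_ideal_I assms] by simp
  have "f \<in> germ x (ordI x m) \<longleftrightarrow> g \<in> germ x (ordI x m)" for m
    using is_idealD(2)[OF is_ideal_germ_ordI I_germ[OF assms], of g]
      is_idealD(2)[OF is_ideal_germ_ordI I_germ[OF gf], of f] by auto
  then show "ordv x f = ordv x g" by (simp add: ordv_def)
  show "f \<in> I \<longleftrightarrow> g \<in> I"
    using is_idealD(2)[OF is_ideal_I assms, of g] is_idealD(2)[OF is_ideal_I gf, of f] by auto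
qed

section \<open>The even function \<open>u\<close>\<close>

lemma ordv_t_O: "ordv pt_O (indet 0 + indet 3) = 1" "form 1 (indet 0 + indet 3)"
proof -
  have hom: "homogeneous 1 (indet 0 + indet 3 :: (4, 'b) mpol)"
    by (intro homogeneous_add homogeneous_indet)
  have e: "ev branch_O (indet 0 + indet 3) = fps_X"
    by (simp add: ev_simps branch_O_def vseries_def char2_rules[OF two_fps] add.assoc[symmetric])
  have nI: "indet 0 + indet 3 \<notin> I" using I_branch_O e by force
  then show "form 1 (indet 0 + indet 3)" using hom by (simp add: form_def)
  show "ordv pt_O (indet 0 + indet 3) = 1" using ordv_arc(1)[OF arc_O hom nI] e by simp
qed

text \<open>The linear form is, up to a unit, the difference of u and its value at S; the claim is
  that u is unramified there.\<close>

lemma ordv_linear_unramified: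
  assumes S: "S \<in> cv C" "S 0 \<noteq> 0" "S 1 \<noteq> 0" and ab: "a \<noteq> 0 \<or> b \<noteq> 0" "a * S 0 + b * S 1 = 0"
  shows "ordv S (scalar a * indet 0 + scalar b * indet 1) = 1"
proof -
  obtain \<xi> where \<xi>: "arc S \<xi>" using arc_exists[OF S(1)] .
  have n0: "\<xi> i $ 0 = S i" for i using \<xi> by (simp add: arc_def)
  have on: "on_curve (fps_const C) \<xi>" by (rule arc_on_curve[OF \<xi>])
  define u v where "u = \<xi> 1 * inverse (\<xi> 0)" and "v = \<xi> 3 * inverse (\<xi> 0)"
  have inv: "\<xi> 0 * inverse (\<xi> 0) = 1" using S(2) by (simp add: n0 inverse_mult_eq_1')
  have x1: "\<xi> 1 = \<xi> 0 * u" and x3: "\<xi> 3 = \<xi> 0 * v"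
    using inv by (simp_all add: u_def v_def mult.left_commute)
  have "\<xi> 0 * \<xi> 2 = \<xi> 0 * (\<xi> 0 * (u * v))" using on by (simp add: on_curve_def x1 x3 mult_ac)
  moreover have \<xi>0: "\<xi> 0 \<noteq> 0" using S(2) n0[of 0] by auto
  ultimately have x2: "\<xi> 2 = \<xi> 0 * (u * v)" by simp
  have \<xi>': "\<xi> = (\<lambda>i. \<xi> 0 * chart u v i)"
    unfolding fun4_eq chart_simps by (simp add: x1[symmetric] x2[symmetric] x3[symmetric])
  have "\<xi> 0 * \<xi> 0 * (1 + u + u * v + v)\<^sup>2 = \<xi> 0 * \<xi> 0 * (fps_const C * (u * v))"
    using on unfolding on_curve_def x1 x2 x3 by (simp add: power2_eq_square algebra_simps)
  then have "(1 + u + u * v + v)\<^sup>2 = fps_const C * (u * v)" using \<xi>0 by simp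
  then have "(1 + u * u) * (1 + v * v) = fps_const C * (u * v)"
  proof -
    have "(1 + u + u * v + v)\<^sup>2 = (1 + u * u) * (1 + v * v)"
      by (simp only: power2_eq_square expand mult_1 mult_1_right char2_rules[OF two_fps])
    with \<open>(1 + u + u * v + v)\<^sup>2 = fps_const C * (u * v)\<close> show ?thesis by simp
  qed
  then have e1: "((1 + u * u) * (1 + v * v)) $ 1 = (fps_const C * (u * v)) $ 1" by simp
  have m1: "(f * g) $ 1 = f $ 0 * g $ 1 + f $ 1 * g $ 0" for f g :: "'b fps"
    by (simp add: fps_mult_nth)
  have sq1: "(f * f) $ 1 = 0" for f :: "'b fps" unfolding m1 by (simp add: mult.commute char2)
  have "((1 + u * u) * (1 + v * v)) $ 1 = 0" unfolding m1 fps_add_nth by (simp add: sq1[unfolded One_nat_def] two)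
  \<comment> \<open>Squares have no linear coefficient in characteristic 2, so of the equation only
    the linear coefficient of C u v survives.\<close>
  then have rel: "u $ 0 * v $ 1 + u $ 1 * v $ 0 = 0"
    using e1 C0 by (simp add: m1)
  have u0: "u $ 0 = S 1 / S 0" using S(2) by (simp add: u_def n0 divide_inverse)
  \<comment> \<open>If the linear coefficient of u vanished, so would that of v, and then no
    polynomial in the chart coordinates would have a linear term. But X0 + X3 has order 1 at O, and
    its pullback under translation by -S has order 1 at S.\<close>
  have u1: "u $ 1 \<noteq> 0"
  proof
    assume z: "u $ 1 = 0"
    then have z': "v $ 1 = 0" using rel u0 S(2,3) by simp
    have q: "ev (chart u v) f $ 1 = 0" for f
    proof (induction f rule: mpol_induct)
      case (indet i)
      have "\<forall>i. chart u v i $ 1 = 0" unfolding all4 chart_simps using rel by (auto simp: m1[of u v, unfolded One_nat_def] z[unfolded One_nat_def] z'[unfolded One_nat_def])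
      then show ?case by (simp add: ev_simps)
    next
      case (mult f g)
      then show ?case by (simp add: ev_simps m1[of "ev (chart u v) f"])
    qed (simp_all add: ev_simps)
    obtain k k' where k: "law k k' S (neg S) \<noteq> (\<lambda>_. 0)"
      by (rule law_exists[OF S(1), of "neg S"]) (use S(1) in \<open>simp_all add: cv_neg\<close>)
    have nS: "neg S \<in> cv C" using S(1) by (simp add: cv_neg)
    have O: "proj_eq pt_O (law k k' S (neg S))"
      by (rule proj_eq_sym[OF isadd_law[OF isadd_neg_self[OF S(1)] k]])
    define f where "f = tcomp (lawmap k k' (neg S)) (indet 0 + indet 3)"
    have "ordv (law k k' S (neg S)) (indet 0 + indet 3) = ordv pt_O (indet 0 + indet 3)"
      using ordv_t_O(2) unfolding form_def by (intro ordv_proj_eq[OF pt_O_cv O]) blast+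
    then have f: "form (1 * 2) f" "ordv S f = 1"
      unfolding f_def using ordv_translate[OF S(1) nS k ordv_t_O(2)] ordv_t_O(1) by simp_all
    then have f': "homogeneous 2 f" "f \<notin> I" by (simp_all add: form_def)
    note o = ordv_arc[OF \<xi> f']
    have ef: "ev \<xi> f = \<xi> 0 ^ 2 * ev (chart u v) f"
      by (subst \<xi>') (rule homogeneous_scale[OF f'(1) ring_hom_map_fps_const])
    have s1: "subdegree (ev \<xi> f) = 1" using o f(2) by simp
    then have "ev \<xi> f $ 1 \<noteq> 0" using o(2) nth_subdegree_nonzero[of "ev \<xi> f"] by simp
    moreover have "ev \<xi> f $ 0 = 0" using s1 by (intro nth_less_subdegree_zero) simp
    then have "ev (chart u v) f $ 0 = 0" using S(2) by (simp add: ef n0 power2_eq_square)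
    then have "ev \<xi> f $ 1 = 0" unfolding ef m1[of "\<xi> 0 ^ 2"] q by simp
    ultimately show False by simp
  qed
  have b: "b \<noteq> 0" using ab S(2) by auto
  have eq: "ev \<xi> (scalar a * indet 0 + scalar b * indet 1) = \<xi> 0 * (fps_const a + fps_const b * u)"
    by (simp add: ev_simps x1 algebra_simps)
  have c0: "(fps_const a + fps_const b * u) $ 0 = 0"
    using ab(2) S(2) by (simp add: u0 field_simps)
  have c1: "(fps_const a + fps_const b * u) $ 1 \<noteq> 0" using b u1 by simp
  have "subdegree (fps_const a + fps_const b * u) = 1"
    by (rule subdegreeI[OF c1]) (use c0 in simp)
  moreover have "fps_const a + fps_const b * u \<noteq> 0" using c1 by (metis fps_zero_nth)
  moreover have "subdegree (\<xi> 0) = 0" using S(2) by (simp add: n0)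
  ultimately have "subdegree (ev \<xi> (scalar a * indet 0 + scalar b * indet 1)) = 1"
    unfolding eq using \<xi>0 by simp
  moreover have "form 1 (scalar a * indet 0 + scalar b * indet 1)" by (rule form_linear[OF ab(1)])
  ultimately show ?thesis using ordv_arc(1)[OF \<xi>, of 1] by (simp add: form_def)
qed

text \<open>For P = O this is X1 up to a scalar, so for finite u(P) the quotient by
  \<open>uform pt_O\<close> is a constant times (u - u(P)) / u.\<close>

definition uform :: "(4 \<Rightarrow> 'b) \<Rightarrow> (4, 'b) mpol" where
  "uform P = scalar (pi1 P 1) * indet 0 + scalar (pi1 P 0) * indet 1"

lemma pi1_ne0: "P \<in> cv C \<Longrightarrow> pi1 P 0 \<noteq> 0 \<or> pi1 P 1 \<noteq> 0"
  using cvD(3)[of P] by (auto simp: pi1_def)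

lemma form_uform: "P \<in> cv C \<Longrightarrow> form 1 (uform P)"
  unfolding uform_def by (rule form_linear) (use pi1_ne0 in blast)

lemma pi1_segre:
  assumes "skew_segre A B \<in> cv C"
  obtains k where "k \<noteq> 0" "pi1 (skew_segre A B) = (\<lambda>i. k * A i)"
proof -
  have ne: "A \<noteq> (\<lambda>_. 0)" "B \<noteq> (\<lambda>_. 0)" using assms by (auto simp: cv_def segre_ne0)
  show ?thesis
  proof (cases "B 0 = 0")
    case True
    then have "B 1 \<noteq> 0" using ne(2) by (auto simp: fun2_eq)
    then show ?thesis using that[of "B 1"] True by (simp add: pi1_def fun2_eq mult.commute)
  next
    case False
    then show ?thesis using that[of "B 0"] ne(1) by (auto simp: pi1_def fun2_eq mult.commute)
  qed
qed

text \<open>For a fixed first projection the equation is quadratic in the second one and symmetric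
  in its two entries. Its roots are therefore interchanged by swapping the entries, and that is
  negation.\<close>

lemma same_u:
  assumes P: "P \<in> cv C" and S: "S \<in> cv C" and e: "pi1 P 1 * pi1 S 0 = pi1 P 0 * pi1 S 1"
  shows "proj_eq P S \<or> proj_eq (neg P) S"
proof -
  obtain A B where AB: "P = skew_segre A B" "A \<noteq> (\<lambda>_. 0)" "B \<noteq> (\<lambda>_. 0)"
    "(A 0 * A 0 + A 1 * A 1) * (B 0 * B 0 + B 1 * B 1) + C * A 0 * A 1 * B 0 * B 1 = 0"
    using cv_param[OF P] by metis
  obtain A' B' where AB': "S = skew_segre A' B'" "A' \<noteq> (\<lambda>_. 0)" "B' \<noteq> (\<lambda>_. 0)"
    "(A' 0 * A' 0 + A' 1 * A' 1) * (B' 0 * B' 0 + B' 1 * B' 1) + C * A' 0 * A' 1 * B' 0 * B' 1 = 0"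
    using cv_param[OF S] by metis
  obtain k where k: "k \<noteq> 0" "pi1 P = (\<lambda>i. k * A i)" using pi1_segre P AB(1) by metis
  obtain k' where k': "k' \<noteq> 0" "pi1 S = (\<lambda>i. k' * A' i)" using pi1_segre S AB'(1) by metis
  have "k * k' * (A 1 * A' 0) = k * k' * (A 0 * A' 1)" using e by (simp add: k(2) k'(2) mult_ac)
  then have "A 1 * A' 0 = A 0 * A' 1" using k(1) k'(1) by simp
  then have "par A A'" unfolding par_def all2 by (simp add: mult.commute)
  then have "proj_eq A A'" using AB(2) AB'(2) by (rule par_proj_eq)
  then obtain l where l: "l \<noteq> 0" "A' = (\<lambda>i. l * A i)" by (auto simp: proj_eq_def)
  have "l * l * ((A 0 * A 0 + A 1 * A 1) * (B' 0 * B' 0 + B' 1 * B' 1) + C * A 0 * A 1 * B' 0 * B' 1) = 0"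
    using AB'(4) by (simp add: l(2) algebra_simps)
  then have F': "(A 0 * A 0 + A 1 * A 1) * (B' 0 * B' 0 + B' 1 * B' 1) + C * A 0 * A 1 * B' 0 * B' 1 = 0"
    using l(1) by simp
  have "(B 0 * B' 1 + B 1 * B' 0) * (B 0 * B' 0 + B 1 * B' 1) = 0"
  proof (cases "A 0 * A 1 = 0")
    case False
    have "(B 0 * B' 1 + B 1 * B' 0) * (B 0 * B' 0 + B 1 * B' 1) * (C * (A 0 * A 1)) =
      (B 0 * B 0 + B 1 * B 1) * (C * A 0 * A 1 * B' 0 * B' 1) + (B' 0 * B' 0 + B' 1 * B' 1) * (C * A 0 * A 1 * B 0 * B 1)"
      by (simp only: expand)
    also have "\<dots> = (B 0 * B 0 + B 1 * B 1) * ((A 0 * A 0 + A 1 * A 1) * (B' 0 * B' 0 + B' 1 * B' 1))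
        + (B' 0 * B' 0 + B' 1 * B' 1) * ((A 0 * A 0 + A 1 * A 1) * (B 0 * B 0 + B 1 * B 1))"
      using AB(4) F' by (simp only: char2_sum0[OF two])
    also have "\<dots> = 0" by (simp only: expand char2)
    finally show ?thesis using False C0 by simp
  next
    case True
    then have "A 0 \<noteq> A 1" using AB(2) by (auto simp: fun2_eq)
    then have "A 0 * A 0 + A 1 * A 1 \<noteq> 0" by (simp only: square_sum0 not_False_eq_True)
    moreover have "C * A 0 * A 1 * B 0 * B 1 = 0" "C * A 0 * A 1 * B' 0 * B' 1 = 0" using True by auto
    ultimately have "B 0 * B 0 + B 1 * B 1 = 0" "B' 0 * B' 0 + B' 1 * B' 1 = 0"
      using AB(4) F' by auto
    then have "B 0 = B 1" "B' 0 = B' 1" by (simp_all only: square_sum0)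
    then show ?thesis by (simp add: char2)
  qed
  then have "B 0 * B' 1 + B 1 * B' 0 = 0 \<or> B 0 * B' 0 + B 1 * B' 1 = 0" by simp
  then have "B 0 * B' 1 = B 1 * B' 0 \<or> B 0 * B' 0 = B 1 * B' 1" by (simp only: char2_sum0[OF two])
  moreover have "par (skew_segre A B) (skew_segre A B')" if "B 0 * B' 1 = B 1 * B' 0" for B B' :: "2 \<Rightarrow> 'b"
    using that unfolding par_def all4 by (auto simp: mult_ac)
  moreover have "neg P = skew_segre A (pair (B 1) (B 0))" by (simp add: AB(1) fun4_eq)
  moreover have "par P S \<longleftrightarrow> par P (skew_segre A B')" "par (neg P) S \<longleftrightarrow> par (neg P) (skew_segre A B')"
  proof -
    have "S = (\<lambda>i. l * skew_segre A B' i)" by (simp add: AB'(1) fun4_eq l(2) mult_ac)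
    then show "par P S \<longleftrightarrow> par P (skew_segre A B')" "par (neg P) S \<longleftrightarrow> par (neg P) (skew_segre A B')"
      using l(1) by (auto simp: par_def mult.left_commute)
  qed
  ultimately have "par P S \<or> par (neg P) S" by (auto simp: AB(1))
  then show ?thesis using P S cv_ne0 by (auto simp: par_iff_proj_eq cv_neg)
qed

abbreviation pt :: "(4 \<Rightarrow> 'b) \<Rightarrow> (4 \<Rightarrow> 'b) \<Rightarrow> int" where "pt \<equiv> point_divisor"

lemma pt_eq: "proj_eq P S \<Longrightarrow> pt P S = 1" "\<not> proj_eq P S \<Longrightarrow> pt P S = 0"
  by (simp_all add: point_divisor_def)

lemma pt_ge0: "0 \<le> pt P S" by (simp add: point_divisor_def)

lemma proj_eq_neg: "proj_eq (neg P) (neg S) \<longleftrightarrow> proj_eq P (S :: 4 \<Rightarrow> 'b)"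
  unfolding proj_eq_def all4 by auto

lemma proj_eq_rot: "proj_eq (rot P) (rot S) \<longleftrightarrow> proj_eq P (S :: 4 \<Rightarrow> 'b)"
  unfolding proj_eq_def all4 by auto

lemma pt_neg: "pt P (neg S) = pt (neg P) S"
  using proj_eq_neg[of P "neg S"] by (simp add: point_divisor_def)

lemma neg_O: "neg pt_O = (pt_O :: 4 \<Rightarrow> 'b)" by (simp add: fun4_eq pt_O_def)

lemma peval_uform: "peval (uform P) S = pi1 P 1 * S 0 + pi1 P 0 * S 1"
  by (simp add: uform_def peval_simps)

lemma pi1_proj_eq:
  assumes "P \<in> cv C" "proj_eq P S"
  shows "pi1 P 1 * pi1 S 0 = pi1 P 0 * pi1 S 1"
proof -
  obtain l where "l \<noteq> 0" "S = (\<lambda>i. l * P i)" using assms(2) by (auto simp: proj_eq_def)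
  then have "pi1 S = (\<lambda>i. l * pi1 P i)" by (auto simp: pi1_def fun2_eq)
  then show ?thesis by simp
qed

lemma pi1_neg:
  assumes "P \<in> cv C"
  shows "pi1 P 1 * pi1 (neg P) 0 = pi1 P 0 * pi1 (neg P) 1"
  using cvD(2)[OF assms] by (auto simp: pi1_def mult_ac)

lemma pi1_O: "pi1 pt_O = pair (1 :: 'b) 0"
  by (simp add: pi1_def pt_O_def)

lemma uform_order_aux:
  assumes P: "P \<in> cv C" and S: "S \<in> cv C" and S01: "S 0 \<noteq> 0 \<or> S 1 \<noteq> 0"
  shows "int (ordv S (uform P)) - int (ordv S (uform pt_O)) = pt P S + pt (neg P) S - 2 * pt pt_O S"
proof -
  have S_pi1: "pi1 S = pair (S 0) (S 1)" using S01 by (auto simp: pi1_def)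
  have zero: "peval (uform P) S = 0 \<longleftrightarrow> proj_eq P S \<or> proj_eq (neg P) S" if P: "P \<in> cv C" for P
  proof
    assume "peval (uform P) S = 0"
    then have "pi1 P 1 * pi1 S 0 = pi1 P 0 * pi1 S 1"
      by (simp add: peval_uform S_pi1 char2_sum0[OF two])
    then show "proj_eq P S \<or> proj_eq (neg P) S" by (rule same_u[OF P S])
  next
    assume "proj_eq P S \<or> proj_eq (neg P) S"
    then have "pi1 P 1 * pi1 S 0 = pi1 P 0 * pi1 S 1"
    proof
      assume "proj_eq (neg P) S"
      have nP: "neg P \<in> cv C" using P by (simp add: cv_neg)
      have 1: "pi1 (neg P) 1 * pi1 S 0 = pi1 (neg P) 0 * pi1 S 1"
        by (rule pi1_proj_eq[OF nP \<open>proj_eq (neg P) S\<close>])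
      have 2: "pi1 P 1 * pi1 (neg P) 0 = pi1 P 0 * pi1 (neg P) 1" by (rule pi1_neg[OF P])
      show ?thesis
      proof (cases "pi1 (neg P) 0 = 0")
        case True
        then have "pi1 (neg P) 1 \<noteq> 0" using pi1_ne0[OF nP] by simp
        then show ?thesis using 1 2 True by simp
      next
        case False
        have "pi1 (neg P) 0 * (pi1 P 1 * pi1 S 0) = (pi1 P 1 * pi1 (neg P) 0) * pi1 S 0" by (simp only: mult_ac)
        also have "\<dots> = pi1 P 0 * (pi1 (neg P) 1 * pi1 S 0)" by (simp only: 2 mult_ac)
        also have "\<dots> = pi1 P 0 * (pi1 (neg P) 0 * pi1 S 1)" by (simp only: 1)
        also have "\<dots> = pi1 (neg P) 0 * (pi1 P 0 * pi1 S 1)" by (simp only: mult_ac)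
        finally have "pi1 (neg P) 0 * (pi1 P 1 * pi1 S 0) = pi1 (neg P) 0 * (pi1 P 0 * pi1 S 1)" .
        then show ?thesis using False by simp
      qed
    qed (rule pi1_proj_eq[OF P])
    then show "peval (uform P) S = 0" by (simp add: peval_uform S_pi1 char2)
  qed
  have o0: "ordv S (uform P) = 0 \<longleftrightarrow> \<not> (proj_eq P S \<or> proj_eq (neg P) S)" if "P \<in> cv C" for P
    using ordv_eq_0_iff[OF S, of 1 "uform P"] form_uform[OF that] zero[OF that] by (simp add: form_def)
  have fO: "homogeneous 1 (uform pt_O)" "uform pt_O \<notin> I"
    using form_uform[OF pt_O_cv] by (simp_all add: form_def)
  show ?thesis
  proof (cases "proj_eq pt_O S")
    case True
    have "uform pt_O = indet 1" by (simp add: uform_def pi1_def pt_O_def ring_hom_map_simps[OF ring_hom_map_scalar])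
    then have "ordv pt_O (uform pt_O) = 2"
      using ordv_arc(1)[OF arc_O fO] subdegree_useries by (simp add: ev_simps branch_O_def)
    then have 2: "ordv S (uform pt_O) = 2" using ordv_proj_eq[OF pt_O_cv True fO] by simp
    show ?thesis
    proof (cases "proj_eq P S")
      case True
      then have "proj_eq P pt_O" using \<open>proj_eq pt_O S\<close> proj_eq_sym proj_eq_trans by blast
      then have P': "proj_eq (neg P) pt_O" using proj_eq_neg[of P pt_O] by (simp add: neg_O)
      have "pi1 P 1 = 0"
        using pi1_proj_eq[OF P \<open>proj_eq P pt_O\<close>] by (simp add: pi1_O)
      then have "uform P = scalar (pi1 P 0) * uform pt_O" "pi1 P 0 \<noteq> 0"
        using pi1_ne0[OF P] \<open>uform pt_O = indet 1\<close>
        by (simp_all add: uform_def[of P] ring_hom_map_simps[OF ring_hom_map_scalar])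
      moreover have "form 0 (scalar k)" "ordv S (scalar k) = 0" if "k \<noteq> 0" for k
      proof -
        have "peval (scalar k) S \<noteq> 0" using that by (simp add: peval_simps)
        moreover from this have "scalar k \<notin> I" using S by (auto simp: I_iff)
        ultimately show "form 0 (scalar k)" "ordv S (scalar k) = 0"
          using ordv_eq_0_iff[OF S homogeneous_scalar] by (simp_all add: form_def homogeneous_scalar)
      qed
      ultimately have "ordv S (uform P) = 2"
        using ordv_form_mult[OF S _ form_uform[OF pt_O_cv], of 0 "scalar (pi1 P 0)"] 2 by simp
      then show ?thesis using 2 pt_eq(1)[OF True] pt_eq(1)[OF \<open>proj_eq pt_O S\<close>]
          pt_eq(1)[OF proj_eq_trans[OF P' \<open>proj_eq pt_O S\<close>]] by simp
    next
      case False
      then have False': "\<not> proj_eq (neg P) S"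
      proof -
        have "proj_eq (neg P) S \<Longrightarrow> proj_eq (neg P) pt_O" using True proj_eq_sym proj_eq_trans by blast
        then have "proj_eq (neg P) S \<Longrightarrow> proj_eq P pt_O" using proj_eq_neg[of P pt_O] by (simp add: neg_O)
        then show ?thesis using False True proj_eq_trans by blast
      qed
      then show ?thesis using o0[OF P] False 2 by (simp add: pt_eq True)
    qed
  next
    case False
    then have oO: "ordv S (uform pt_O) = 0" using o0[OF pt_O_cv] by (simp add: neg_O)
    have S1: "S 1 \<noteq> 0"
    proof
      assume "S 1 = 0"
      then have "peval (uform pt_O) S = 0" by (simp add: peval_uform pi1_def pt_O_def)
      then show False using zero[OF pt_O_cv] False by (simp add: neg_O)
    qed
    show ?thesis
    proof (cases "proj_eq P S \<or> proj_eq (neg P) S")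
      case no: False
      then show ?thesis using o0[OF P] oO False by (simp add: pt_eq)
    next
      case yes: True
      show ?thesis
      proof (cases "S 0 = 0")
        \<comment> \<open>This is S = 2 T, the point over u = \<infinity>. It is its own negative,
          so both point divisors contribute, and the rotated branch gives order 2.\<close>
        case True
        then have "S 3 = 0" "S 1 = S 2" using cvD[OF S] S1 by (auto simp: square_sum0)
        then have Sr: "proj_eq (rot (rot pt_O)) S"
          unfolding proj_eq_def all4 using True S1 by (intro exI[of _ "S 1"]) (simp add: pt_O_def)
        have both: "proj_eq P S" "proj_eq (neg P) S"
        proof -
          have "proj_eq (neg S) S"
            unfolding proj_eq_def all4 using True \<open>S 3 = 0\<close> \<open>S 1 = S 2\<close> by (intro exI[of _ 1]) simp
          then have "proj_eq P S \<longleftrightarrow> proj_eq (neg P) S"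
            using proj_eq_neg[of P S] proj_eq_neg[of "neg P" S] proj_eq_trans proj_eq_sym by (metis neg_simps(5))
          then show "proj_eq P S" "proj_eq (neg P) S" using yes by blast+
        qed
        have "pi1 P 1 * S 0 + pi1 P 0 * S 1 = 0" using zero[OF P] yes by (simp add: peval_uform)
        then have p0: "pi1 P 0 = 0" using True S1 by simp
        then have p1: "pi1 P 1 \<noteq> 0" using pi1_ne0[OF P] by simp
        have arc: "arc (rot (rot pt_O)) (rot (rot branch_O))" by (intro arc_rot arc_O)
        have uf: "homogeneous 1 (uform P)" "uform P \<notin> I" using form_uform[OF P] by (simp_all add: form_def)
        have v0: "vseries $ 0 \<noteq> 0" by (simp add: vseries_def)
        then have "vseries \<noteq> 0" "subdegree vseries = 0" by auto
        then have "subdegree (ev (rot (rot branch_O)) (uform P)) = 2"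
          using useries_ne0 subdegree_useries p1 by (simp add: uform_def p0 ev_simps branch_O_def)
        then have "ordv S (uform P) = 2"
          using ordv_arc(1)[OF arc uf] ordv_proj_eq[OF _ Sr uf] pt_O_cv by (simp add: cv_rot)
        then show ?thesis using oO both False by (simp add: pt_eq)
      next
        case S0: False
        have "ordv S (uform P) = 1"
          unfolding uform_def
        proof (rule ordv_linear_unramified[OF S S0 S1])
          show "pi1 P 1 \<noteq> 0 \<or> pi1 P 0 \<noteq> 0" using pi1_ne0[OF P] by blast
          show "pi1 P 1 * S 0 + pi1 P 0 * S 1 = 0" using zero[OF P] yes by (simp add: peval_uform)
        qed
        moreover have "\<not> (proj_eq P S \<and> proj_eq (neg P) S)"
        proof
          assume "proj_eq P S \<and> proj_eq (neg P) S"
          then have "proj_eq S (neg S)" using proj_eq_neg[of "neg P" S] proj_eq_sym proj_eq_trans by (metis neg_simps(5))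
          then obtain l where l: "l \<noteq> 0" "\<forall>i. neg S i = l * S i" by (auto simp: proj_eq_def)
          have e: "S 3 = l * S 0" "S 2 = l * S 1" "S 1 = l * S 2" "S 0 = l * S 3"
            using l(2) unfolding all4 neg_simps by blast+
          have "S 0 = l * (l * S 0)" unfolding e(1)[symmetric] by (rule e(4))
          then have "(l * l) * S 0 = 1 * S 0" by (simp only: mult.assoc mult_1)
          then have "l * l = 1" using S0 by (simp only: mult_cancel_right) simp
          then have "l * l + 1 * 1 = 0" using two by simp
          then have "l = 1" by (simp only: square_sum0)
          then have "S 3 = S 0" "S 2 = S 1" using e(1,2) by (simp_all only: mult_1)
          then have "C * S 0 * S 1 = S 0 * S 0 + S 0 * S 0 + (S 1 * S 1 + S 1 * S 1)"
            using cvD(1)[OF S] by (simp only: add_ac)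
          then have "C * S 0 * S 1 = 0" by (simp only: char2)
          then show False using C0 S0 S1 by simp
        qed
        ultimately show ?thesis using oO False yes by (auto simp: pt_eq)
      qed
    qed
  qed
qed

lemma uform_order:
  assumes P: "P \<in> cv C" and S: "S \<in> cv C"
  shows "int (ordv S (uform P)) - int (ordv S (uform pt_O)) = pt P S + pt (neg P) S - 2 * pt pt_O S"
proof (cases "S 0 \<noteq> 0 \<or> S 1 \<noteq> 0")
  case True then show ?thesis by (rule uform_order_aux[OF P S])
next
  case False
  \<comment> \<open>Points with X0 = X1 = 0 are replaced by their negatives. The resulting
    correction, the order of X0 minus that of X3, does not depend on P and cancels against the one
    for \<open>pt_O\<close>.\<close>
  have swap: "int (ordv S (uform P)) - int (ordv (neg S) (uform P)) = int (ordv S (indet 0)) - int (ordv S (indet 3))"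
    if P: "P \<in> cv C" for P
  proof -
    note f = form_uform[OF P]
    have "uform P * indet 3 - negm (uform P) * indet 0 \<in> I"
      unfolding I_iff
    proof
      fix x assume "x \<in> cv C"
      from cvD(2)[OF this] show "peval (uform P * indet 3 - negm (uform P) * indet 0) x = 0"
        by (simp add: peval_simps peval_uform negm_def peval_tcomp gmap_perm algebra_simps)
    qed
    from ordv_cong(1)[OF this, of S] have "ordv S (uform P * indet 3) = ordv S (negm (uform P) * indet 0)" .
    then have "ordv S (uform P) + ordv S (indet 3) = ordv (neg S) (uform P) + ordv S (indet 0)"
      using ordv_form_mult[OF S f form_indet] ordv_form_mult[OF S ordv_negm(1)[OF f] form_indet]
        ordv_negm(2)[OF f S] by simp
    then show ?thesis by simp
  qed
  have nS: "neg S \<in> cv C" using S by (simp add: cv_neg)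
  have "neg S 0 \<noteq> 0 \<or> neg S 1 \<noteq> 0" using False cvD(3)[OF S] by auto
  from uform_order_aux[OF P nS this]
  have "int (ordv (neg S) (uform P)) - int (ordv (neg S) (uform pt_O)) = pt (neg P) S + pt P S - 2 * pt pt_O S"
    by (simp add: pt_neg neg_O)
  then show ?thesis using swap[OF P] swap[OF pt_O_cv] by simp
qed

section \<open>Principal divisors\<close>

definition principal :: "((4 \<Rightarrow> 'b) \<Rightarrow> int) \<Rightarrow> bool" where
  "principal D \<longleftrightarrow> (\<exists>d f g. form d f \<and> form d g \<and> (\<forall>S\<in>cv C. D S = int (ordv S f) - int (ordv S g)))"

lemma principal_add: "principal D \<Longrightarrow> principal E \<Longrightarrow> principal (\<lambda>S. D S + E S)"
proof -
  assume "principal D" "principal E"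
  then obtain d f g e f' g' where "form d f" "form d g" "\<forall>S\<in>cv C. D S = int (ordv S f) - int (ordv S g)"
    "form e f'" "form e g'" "\<forall>S\<in>cv C. E S = int (ordv S f') - int (ordv S g')"
    unfolding principal_def by metis
  then show ?thesis unfolding principal_def
    by (intro exI[of _ "d + e"] exI[of _ "f * f'"] exI[of _ "g * g'"])
      (simp add: form_mult ordv_form_mult)
qed

lemma principal_uminus: "principal D \<Longrightarrow> principal (\<lambda>S. - D S)"
  unfolding principal_def by (metis minus_diff_eq)

lemma principal_diff: "principal D \<Longrightarrow> principal E \<Longrightarrow> principal (\<lambda>S. D S - E S)"
  using principal_add[OF _ principal_uminus, of D E] by simp

lemma principal_cong: "principal D \<Longrightarrow> (\<And>S. S \<in> cv C \<Longrightarrow> D S = E S) \<Longrightarrow> principal E"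
  unfolding principal_def by (metis)

lemma principal_U: "P \<in> cv C \<Longrightarrow> principal (\<lambda>S. pt P S + pt (neg P) S - 2 * pt pt_O S)"
  unfolding principal_def using form_uform pt_O_cv uform_order by metis

text \<open>A single law serves for the global pullback of f and g although it may vanish at some
  points. At each point S it is compared with a law Q that is defined there.\<close>

lemma principal_translate:
  assumes D: "principal D" and y: "y \<in> cv C" and E: "\<And>S R. isadd C S y R \<Longrightarrow> E S = D R"
  shows "principal E"
proof -
  obtain d f g where f: "form d f" and g: "form d g" and D: "\<And>S. S \<in> cv C \<Longrightarrow> D S = int (ordv S f) - int (ordv S g)"
    using D unfolding principal_def by metis
  obtain b b' where b: "law b b' pt_O y \<noteq> (\<lambda>_. 0)" using law_exists[OF pt_O_cv y] .
  define P where "P = lawmap b b' y"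
  have fP: "form (d * 2) (tcomp P f)" "form (d * 2) (tcomp P g)"
    unfolding P_def using ordv_translate(1)[OF pt_O_cv y b] f g by blast+
  have "E S = int (ordv S (tcomp P f)) - int (ordv S (tcomp P g))" if S: "S \<in> cv C" for S
  proof -
    obtain k k' where k: "law k k' S y \<noteq> (\<lambda>_. 0)" using law_exists[OF S y] .
    define Q where "Q = lawmap k k' y"
    have a: "isadd C S y (law k k' S y)" by (rule law_isadd[OF S y k])
    have o: "ordv S (tcomp Q h) = ordv (law k k' S y) h" "form (d * 2) (tcomp Q h)" if "form d h" for h
      unfolding Q_def using ordv_translate[OF S y k that] by blast+
    obtain j where j: "law k k' S y j \<noteq> 0" using k by fastforce
    have Qj: "peval (Q j) S \<noteq> 0" using j fun_cong[OF pm_lawmap[of k k' y S], of j] by (simp add: pm_def Q_def)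
    have hQ: "homogeneous (d * 2) (Q j ^ d)" and hP: "homogeneous (d * 2) (P j ^ d)"
      unfolding Q_def P_def by (intro homogeneous_power homogeneous_lawmap)+
    have Qd: "peval (Q j ^ d) S \<noteq> 0" using Qj by (simp add: peval_simps)
    then have QI: "Q j ^ d \<notin> I" using S by (auto simp: I_iff)
    have oQ: "ordv S (Q j ^ d) = 0" using ordv_eq_0_iff[OF S hQ QI] Qd by simp
    \<comment> \<open>Two laws for the same translation are proportional on the curve, so their
      pullbacks of a form of degree d differ by P_j^d / Q_j^d. This factor is the same for f and g
      and drops out of the difference of orders.\<close>
    have rel: "Q j ^ d * tcomp P h - P j ^ d * tcomp Q h \<in> I" if h: "homogeneous d h" for h
      unfolding I_iff
    proof
      fix x assume x: "x \<in> cv C"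
      obtain z where z: "isadd C x y z" using isadd_exists[OF x y] .
      have "par (law k k' x y) (law b b' x y)"
      proof (cases "law k k' x y = (\<lambda>_. 0)")
        case True then show ?thesis by (simp add: par_def)
      next
        case False
        have "isadd C x y (law k k' x y)" by (rule law_isadd[OF x y False])
        from isadd_law_par[OF this, of b b'] show ?thesis by (rule par_sym)
      qed
      then have pq: "(\<lambda>i. pm Q x j * pm P x i) = (\<lambda>i. pm P x j * pm Q x i)"
        by (auto simp: par_def P_def Q_def pm_lawmap mult.commute)
      have "pm Q x j ^ d * peval h (pm P x) = peval h (\<lambda>i. pm Q x j * pm P x i)"
        using homogeneous_scale[OF h ring_hom_map_id] by (simp add: peval_eq_evh)
      also have "\<dots> = pm P x j ^ d * peval h (pm Q x)"
        unfolding pq using homogeneous_scale[OF h ring_hom_map_id] by (simp add: peval_eq_evh)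
      finally show "peval (Q j ^ d * tcomp P h - P j ^ d * tcomp Q h) x = 0"
        by (simp add: peval_simps peval_tcomp) (simp add: pm_def)
    qed
    have key: "int (ordv S (tcomp P h)) = int (ordv S (P j ^ d)) + int (ordv (law k k' S y) h)"
      if h: "form d h" "form (d * 2) (tcomp P h)" for h
    proof -
      have "form (d * 2 + d * 2) (Q j ^ d * tcomp P h)"
        using hQ QI h(2) by (intro form_mult) (simp_all add: form_def)
      then have "P j ^ d * tcomp Q h \<notin> I"
        using ordv_cong(2)[OF rel, of h] h(1) by (simp add: form_def)
      then have "P j ^ d \<notin> I" using is_idealD(4)[OF is_ideal_I] by blast
      then have "ordv S (P j ^ d * tcomp Q h) = ordv S (P j ^ d) + ordv S (tcomp Q h)"
        using hP o(2)[OF h(1)] by (intro ordv_form_mult[OF S, of "d * 2" _ "d * 2"]) (simp_all add: form_def)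
      moreover have "ordv S (Q j ^ d * tcomp P h) = ordv S (Q j ^ d) + ordv S (tcomp P h)"
        using hQ QI h(2) by (intro ordv_form_mult[OF S, of "d * 2" _ "d * 2"]) (simp_all add: form_def)
      ultimately show ?thesis
        using ordv_cong(1)[OF rel, of h S] h(1) oQ o(1)[OF h(1)] by (simp add: form_def)
    qed
    have "E S = D (law k k' S y)" by (rule E[OF a])
    also have "\<dots> = int (ordv (law k k' S y) f) - int (ordv (law k k' S y) g)"
      using a by (intro D) (simp add: isadd_def)
    also have "\<dots> = int (ordv S (tcomp P f)) - int (ordv S (tcomp P g))"
      using key[OF f fP(1)] key[OF g fP(2)] by simp
    finally show ?thesis .
  qed
  then show ?thesis unfolding principal_def using fP by blast
qed

lemma pt_translate:
  assumes "isadd C a y b" "isadd C S (neg y) R"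
  shows "pt b S = pt a R"
proof -
  have SR: "isadd C R y S" using isadd_diff[OF assms(2)] by simp
  have "proj_eq a R \<Longrightarrow> proj_eq b S"
    using isadd_unique[OF isadd_proj_eq[OF assms(1) _ proj_eq_refl proj_eq_refl] SR] by blast
  moreover have "proj_eq b S \<Longrightarrow> proj_eq a R"
    using isadd_unique[OF isadd_proj_eq[OF isadd_diff[OF assms(1)] _ proj_eq_refl proj_eq_refl] assms(2)] by blast
  ultimately show ?thesis unfolding point_divisor_def by auto
qed

lemma jensen:
  assumes "isadd C a y b" "isadd C (neg a) y b'"
  shows "principal (\<lambda>S. pt b S + pt b' S - 2 * pt y S)"
proof -
  have a: "a \<in> cv C" "y \<in> cv C" using assms by (auto simp: isadd_def)
  have y: "isadd C pt_O y y" using isadd_O a(2) isadd_commute by blast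
  show ?thesis
  proof (rule principal_translate[OF principal_U[OF a(1)], of "neg y"])
    show "neg y \<in> cv C" using a by (simp add: cv_neg)
    fix S R assume "isadd C S (neg y) R"
    then show "pt b S + pt b' S - 2 * pt y S = pt a R + pt (neg a) R - 2 * pt pt_O R"
      using pt_translate assms y by simp
  qed
qed

text \<open>The map \<open>P \<mapsto> (P) - (O)\<close> to divisor classes satisfies Jensen's equation, and every point can
  be halved; hence the map is additive.\<close>

theorem isadd_principal:
  assumes "isadd C x y z"
  shows "principal (\<lambda>S. pt x S + pt y S - (pt z S + pt pt_O S))"
proof -
  have xy: "x \<in> cv C" "y \<in> cv C" using assms by (auto simp: isadd_def)
  obtain w where w: "isadd C w w x" using halving[OF xy(1)] .
  then have wc: "w \<in> cv C" "neg w \<in> cv C" by (auto simp: isadd_def cv_neg)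
  have nyc: "neg y \<in> cv C" using xy by (simp add: cv_neg)
  obtain m where m: "isadd C w y m" using isadd_exists[OF wc(1) xy(2)] .
  obtain n where n: "isadd C (neg w) y n" using isadd_exists[OF wc(2) xy(2)] .
  have wO: "isadd C (neg w) w pt_O" using isadd_commute[OF isadd_neg_self[OF wc(1)]] .
  have y: "isadd C pt_O y y" using isadd_O xy(2) isadd_commute by blast
  have 2: "principal (\<lambda>S. pt x S + pt pt_O S - 2 * pt w S)" by (rule jensen[OF w wO])
  \<comment> \<open>Fact \<open>2\<close> translated by y: 2 m is equivalent to z + y because m = w
    + y.\<close>
  have 3: "principal (\<lambda>S. pt z S + pt y S - 2 * pt m S)"
  proof (rule principal_translate[OF 2 nyc])
    fix S R assume "isadd C S (neg y) R"
    then show "pt z S + pt y S - 2 * pt m S = pt x R + pt pt_O R - 2 * pt w R"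
      using pt_translate assms y m by simp
  qed
  have 4: "principal (\<lambda>S. pt m S + pt n S - 2 * pt y S)" by (rule jensen[OF m n])
  have "isadd C (neg (neg w)) (neg y) (neg n)" using isadd_neg[OF n] .
  then have n': "isadd C (neg y) w (neg n)" by (simp add: isadd_commute)
  have 5: "principal (\<lambda>S. pt m S + pt (neg n) S - 2 * pt w S)"
    by (rule jensen[OF isadd_commute[OF m] n'])
  have "n \<in> cv C" using n by (simp add: isadd_def)
  then have 6: "principal (\<lambda>S. pt n S + pt (neg n) S - 2 * pt pt_O S)" by (rule principal_U)
  \<comment> \<open>With m = w + y, n = y - w and \<open>neg n\<close> = w - y, the terms in w, m
    and n cancel and (x) + (y) - (z) - (O) remains.\<close>
  have "principal (\<lambda>S. (((pt x S + pt pt_O S - 2 * pt w S) - (pt z S + pt y S - 2 * pt m S))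
    - (pt m S + pt n S - 2 * pt y S) - (pt m S + pt (neg n) S - 2 * pt w S)) + (pt n S + pt (neg n) S - 2 * pt pt_O S))"
    by (intro principal_add principal_diff 2 3 4 5 6)
  then show ?thesis by (rule principal_cong) simp
qed

text \<open>A function cannot have two zeros, counted with multiplicity, and only one simple pole.
  Multiplying by the conjugate under negation turns A, B, R into pairs (P) + (-P), which
  \<open>uform\<close> trades for 2 (O); what is left is an excess of 2 (O) between two forms of
  equal degree, against \<open>degree_lemma\<close>.\<close>

lemma degree_bound:
  assumes f: "form d f" and g: "form d g" and A: "A \<in> cv C" "B \<in> cv C" "R \<in> cv C"
    and ge: "\<And>S. S \<in> cv C \<Longrightarrow> pt A S + pt B S - pt R S \<le> int (ordv S f) - int (ordv S g)"
  shows False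
proof -
  define F where "F = (f * negm f) * (uform R * uform pt_O)"
  define G where "G = (g * negm g) * (uform A * uform B)"
  have o: "form (d + d + (1 + 1)) ((f * negm f) * (uform P * uform Q))"
    "S \<in> cv C \<Longrightarrow> int (ordv S ((f * negm f) * (uform P * uform Q))) =
      int (ordv S f) + int (ordv (neg S) f) + (int (ordv S (uform P)) + int (ordv S (uform Q)))"
    if "form d f" "P \<in> cv C" "Q \<in> cv C" for f P Q S
  proof -
    note a = form_mult[OF that(1) ordv_negm(1)[OF that(1)]] form_mult[OF form_uform[OF that(2)] form_uform[OF that(3)]]
    show "form (d + d + (1 + 1)) ((f * negm f) * (uform P * uform Q))" by (rule form_mult[OF a])
    assume S: "S \<in> cv C"
    show "int (ordv S ((f * negm f) * (uform P * uform Q))) =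
      int (ordv S f) + int (ordv (neg S) f) + (int (ordv S (uform P)) + int (ordv S (uform Q)))"
      unfolding ordv_form_mult[OF S a] ordv_form_mult[OF S that(1) ordv_negm(1)[OF that(1)]]
        ordv_form_mult[OF S form_uform[OF that(2)] form_uform[OF that(3)]] ordv_negm(2)[OF that(1) S] by simp
  qed
  have diff: "2 * pt pt_O S \<le> int (ordv S F) - int (ordv S G)" if S: "S \<in> cv C" for S
  proof -
    have nS: "neg S \<in> cv C" using S by (simp add: cv_neg)
    show ?thesis
      using ge[OF S] ge[OF nS] uform_order[OF A(1) S] uform_order[OF A(2) S] uform_order[OF A(3) S]
      unfolding F_def G_def o(2)[OF f A(3) pt_O_cv S] o(2)[OF g A(1,2) S] by (simp add: pt_neg)
  qed
  have "ordv S G \<le> ordv S F" if "S \<in> cv C" for S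
    using diff[OF that] pt_ge0[of pt_O S] by simp
  then have "ordv pt_O F = ordv pt_O G"
    using degree_lemma[OF o(1)[OF f A(3) pt_O_cv, folded F_def] o(1)[OF g A(1,2), folded G_def] _ pt_O_cv] by blast
  then show False using diff[OF pt_O_cv] pt_eq(1)[OF proj_eq_refl, of pt_O] by simp
qed

text \<open>If \<open>h = f / g\<close> had divisor \<open>(R) - (R')\<close> with \<open>R \<noteq> R'\<close>, it would be injective. But
  \<open>h\<close> and its translate by \<open>T\<close> take a common value somewhere, and translation by \<open>T\<close>
  has no fixed points.\<close>

theorem principal_unique:
  assumes R: "R \<in> cv C" "R' \<in> cv C" and "principal (\<lambda>S. pt R S - pt R' S)"
  shows "proj_eq R R'"
proof (rule ccontr)
  assume ne: "\<not> proj_eq R R'"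
  obtain d f g where f: "form d f" and g: "form d g"
    and D: "\<And>S. S \<in> cv C \<Longrightarrow> pt R S - pt R' S = int (ordv S f) - int (ordv S g)"
    using assms(3) unfolding principal_def by metis
  have excl: "\<not> (proj_eq R S \<and> proj_eq R' S)" for S using ne proj_eq_trans proj_eq_sym by metis
  note ft = ordv_rotm[OF f] and gt = ordv_rotm[OF g]
  have rc: "rot S \<in> cv C" if "S \<in> cv C" for S using that by (simp add: cv_rot)
  have nofix: "\<not> (proj_eq P S \<and> proj_eq P (rot S))" if "S \<in> cv C" for P S
  proof
    assume "proj_eq P S \<and> proj_eq P (rot S)"
    then have "proj_eq S (rot S)" using proj_eq_sym proj_eq_trans by blast
    then show False using rot_no_fixpoint(1)[OF that] proj_eq_par by blast
  qed
  \<comment> \<open>The numerator of h - h o \<open>rot\<close> over the common denominator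
    \<open>g * rotm g\<close>; the sign is plus in characteristic 2.\<close>
  define W where "W = f * rotm g + rotm f * g"
  have hfg: "homogeneous d f" "homogeneous d g" "homogeneous d (rotm f)" "homogeneous d (rotm g)"
    "f \<notin> I" "g \<notin> I" "rotm f \<notin> I" "rotm g \<notin> I"
    using f g ft(1) gt(1) by (simp_all add: form_def)
  have hW: "homogeneous (d + d) W" unfolding W_def using hfg by (intro homogeneous_add homogeneous_mult)
  have gg: "form (d + d) (g * rotm g)" by (rule form_mult[OF g gt(1)])
  have val: "int (ordv S f) = int (ordv S g) + pt R S - pt R' S"
    "int (ordv S (rotm f)) = int (ordv S (rotm g)) + pt R (rot S) - pt R' (rot S)"
    "ordv S (g * rotm g) = ordv S g + ordv S (rotm g)" if "S \<in> cv C" for S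
    using D[OF that] D[OF rc[OF that]] ft(2)[OF that] gt(2)[OF that] ordv_form_mult[OF that g gt(1)] by simp_all
  have WI: "W \<notin> I"
  proof
    assume "W \<in> I"
    then have "f * rotm g - rotm f * g \<in> I"
      by (simp add: W_def I_iff peval_simps char2_sum0[OF two])
    from ordv_cong(1)[OF this, of R]
    have "ordv R f + ordv R (rotm g) = ordv R (rotm f) + ordv R g"
      using ordv_form_mult[OF R(1) f gt(1)] ordv_form_mult[OF R(1) ft(1) g] by simp
    then have "pt R R - pt R' R = pt R (rot R) - pt R' (rot R)" using val[OF R(1)] by simp
    moreover have "pt R R = 1" "pt R' R = 0" "pt R (rot R) = 0"
      using excl[of R] nofix[OF R(1), of R] proj_eq_refl by (auto simp: pt_eq)
    ultimately show False using pt_ge0[of R' "rot R"] by simp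
  qed
  then have fW: "form (d + d) W" using hW by (simp add: form_def)
  \<comment> \<open>Otherwise W would nowhere vanish to higher order than \<open>g * rotm g\<close>.
    By \<open>degree_lemma\<close> the orders would then agree, contradicting the bound at the pole
    R'.\<close>
  have "\<exists>S\<in>cv C. int (ordv S W) > int (ordv S (g * rotm g)) - pt R' S - pt R' (rot S)"
  proof (rule ccontr)
    assume "\<not> ?thesis"
    then have le: "int (ordv S W) \<le> int (ordv S (g * rotm g)) - pt R' S - pt R' (rot S)" if "S \<in> cv C" for S
      using that by force
    then have "ordv S W \<le> ordv S (g * rotm g)" if "S \<in> cv C" for S
      using le[OF that] pt_ge0[of R' S] pt_ge0[of R' "rot S"] by simp
    then have "ordv R' (g * rotm g) = ordv R' W" by (rule degree_lemma[OF gg fW _ R(2)])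
    then show False using le[OF R(2)] pt_eq(1)[OF proj_eq_refl, of R'] pt_ge0[of R' "rot R'"] by simp
  qed
  then obtain S where S: "S \<in> cv C" and
    gtr: "int (ordv S W) > int (ordv S (g * rotm g)) - pt R' S - pt R' (rot S)" by blast
  obtain \<xi> where \<xi>: "arc S \<xi>" using arc_exists[OF S] .
  define F G F' G' where "F = ev \<xi> f" and "G = ev \<xi> g" and "F' = ev \<xi> (rotm f)" and "G' = ev \<xi> (rotm g)"
  have n0: "F \<noteq> 0" "G \<noteq> 0" "F' \<noteq> 0" "G' \<noteq> 0"
    and o: "ordv S f = subdegree F" "ordv S g = subdegree G" "ordv S (rotm f) = subdegree F'" "ordv S (rotm g) = subdegree G'"
    using ordv_arc[OF \<xi> hfg(1,5)] ordv_arc[OF \<xi> hfg(2,6)] ordv_arc[OF \<xi> hfg(3,7)] ordv_arc[OF \<xi> hfg(4,8)]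
    by (simp_all add: F_def G_def F'_def G'_def)
  have evW: "ev \<xi> W = F * G' + F' * G" by (simp add: W_def ev_simps F_def G_def F'_def G'_def)
  have oW: "ordv S W = subdegree (F * G' + F' * G)" "F * G' + F' * G \<noteq> 0"
    using ordv_arc[OF \<xi> hW WI] evW by simp_all
  have sFG: "subdegree (F * G') = subdegree F + subdegree G'" "subdegree (F' * G) = subdegree F' + subdegree G"
    using n0 by simp_all
  \<comment> \<open>At a pole of h or of h o \<open>rot\<close> the other one is regular, since a
    point and its translate differ. No cancellation occurs in W, so its order is too small for the
    choice of S.\<close>
  have p0: "\<not> proj_eq R' S" "\<not> proj_eq R' (rot S)"
  proof -
    have 1: False if "proj_eq R' S"
    proof -
      have "pt R' S = 1" "pt R S = 0" "pt R' (rot S) = 0"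
        using that excl[of S] nofix[OF S, of R'] by (auto simp: pt_eq)
      then have "subdegree (F * G') < subdegree (F' * G)" "int (ordv S W) > int (subdegree (F * G'))"
        using val[OF S] gtr pt_ge0[of R "rot S"] unfolding sFG o by simp_all
      then show False using subdegree_add_eq1[of "F * G'" "F' * G"] n0 oW by simp
    qed
    have 2: False if "proj_eq R' (rot S)"
    proof -
      have "pt R' (rot S) = 1" "pt R (rot S) = 0" "pt R' S = 0"
        using that excl[of "rot S"] nofix[OF S, of R'] by (auto simp: pt_eq)
      then have "subdegree (F' * G) < subdegree (F * G')" "int (ordv S W) > int (subdegree (F' * G))"
        using val[OF S] gtr pt_ge0[of R S] unfolding sFG o by simp_all
      then show False using subdegree_add_eq2[of "F' * G" "F * G'"] n0 oW by simp
    qed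
    show "\<not> proj_eq R' S" "\<not> proj_eq R' (rot S)" using 1 2 by blast+
  qed
  then have z: "pt R' S = 0" "pt R' (rot S) = 0" by (simp_all add: pt_eq)
  have "subdegree G \<le> subdegree F" "subdegree G' \<le> subdegree F'"
    using val[OF S] z pt_ge0[of R S] pt_ge0[of R "rot S"] by (simp_all add: o)
  then have "G dvd F" "G' dvd F'" using n0 by (simp_all add: fps_dvd_iff)
  then obtain h h' where h: "F = G * h" "F' = G' * h'" by (auto elim!: dvdE)
  have "F * G' + F' * G = (h + h') * (G * G')" by (simp add: h algebra_simps)
  then have "h + h' \<noteq> 0" "subdegree (F * G' + F' * G) = subdegree (h + h') + (subdegree G + subdegree G')"
    using oW(2) n0 by auto
  then have "subdegree (h + h') > 0" using gtr z val(3)[OF S] oW(1) o by simp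
  then have "(h + h') $ 0 = 0" by (rule nth_less_subdegree_zero)
  then have hh: "h $ 0 = h' $ 0" by (simp add: char2_sum0[OF two])
  \<comment> \<open>The common value of h at S and at S + T. Then k / g = h - l vanishes at these
    two different points and has at most the simple pole R', which \<open>degree_bound\<close>
    excludes.\<close>
  define l where "l = h $ 0"
  define k where "k = f + scalar l * g"
  have hk: "homogeneous d k" unfolding k_def by (intro homogeneous_add homogeneous_scalar_mult hfg)
  have ring_rotm: "rotm k = rotm f + scalar l * rotm g"
    by (simp add: k_def rotm_def evh_simps ring_hom_map_scalar)
  have kI: "k \<notin> I"
  proof
    assume k: "k \<in> I"
    show False
    proof (cases "l = 0")
      case True
      then show False using k hfg(5) by (simp add: k_def ring_hom_map_simps[OF ring_hom_map_scalar])
    next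
      case False
      have "f - scalar l * g \<in> I" using k by (simp add: k_def I_iff peval_simps char2_sum0[OF two])
      from ordv_cong(1)[OF this, of R] have e: "ordv R f = ordv R (scalar l * g)" .
      have lS: "peval (scalar l) R \<noteq> 0" using False by (simp add: peval_simps)
      then have lI: "scalar l \<notin> I" using R(1) by (auto simp: I_iff)
      have "ordv R (scalar l) = 0" using ordv_eq_0_iff[OF R(1) homogeneous_scalar lI] lS by simp
      moreover have "form 0 (scalar l)" using lI homogeneous_scalar by (simp add: form_def)
      ultimately have "ordv R f = ordv R g" using e ordv_form_mult[OF R(1) _ g] by simp
      then show False using val(1)[OF R(1)] excl[of R] proj_eq_refl[of R] by (simp add: pt_eq)
    qed
  qed
  have fk: "form d k" using hk kI by (simp add: form_def)
  have gain: "vge (Suc (subdegree s)) (s * (t + fps_const (t $ 0)))" if "s \<noteq> 0" for s t :: "'b fps"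
  proof -
    have "(t + fps_const (t $ 0)) $ 0 = 0" by (simp add: char2)
    then have "vge 1 (t + fps_const (t $ 0))" by (rule vge_1)
    moreover have "vge (subdegree s) s" by (simp add: vge_def)
    ultimately show ?thesis using vge_mult by fastforce
  qed
  have k1: "ordv S g < ordv S k"
  proof -
    have "ev \<xi> k = G * (h + fps_const (h $ 0))"
      using h by (simp add: k_def ev_simps F_def G_def l_def algebra_simps)
    then have "vge (Suc (subdegree G)) (ev \<xi> k)" using gain[OF n0(2)] by simp
    then show ?thesis using ordv_arc[OF \<xi> hk kI] o by (simp add: vge_def)
  qed
  have k2: "ordv (rot S) g < ordv (rot S) k"
  proof -
    note kt = ordv_rotm[OF fk]
    have "ev \<xi> (rotm k) = G' * (h' + fps_const (h' $ 0))"
      using h hh by (simp add: ring_rotm ev_simps F'_def G'_def l_def algebra_simps)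
    then have "vge (Suc (subdegree G')) (ev \<xi> (rotm k))" using gain[OF n0(4)] by simp
    then have "ordv S (rotm g) < ordv S (rotm k)"
      using ordv_arc[OF \<xi>, of d "rotm k"] kt(1) o by (simp add: vge_def form_def)
    then show ?thesis using kt(2)[OF S] gt(2)[OF S] by simp
  qed
  show False
  proof (rule degree_bound[OF fk g S rc[OF S] R(2)])
    fix P assume P: "P \<in> cv C"
    have base: "int (ordv P g) - pt R' P \<le> int (ordv P k)"
    proof -
      obtain \<eta> where \<eta>: "arc P \<eta>" using arc_exists[OF P] .
      have "ordv P g - nat (pt R' P) \<le> ordv P f" using val(1)[OF P] pt_ge0[of R P] by simp
      then have "vge (ordv P g - nat (pt R' P)) (ev \<eta> f)" "vge (ordv P g - nat (pt R' P)) (ev \<eta> g)"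
        using ordv_arc[OF \<eta> hfg(1,5)] ordv_arc[OF \<eta> hfg(2,6)] by (simp_all add: vge_def)
      then have "vge (ordv P g - nat (pt R' P)) (ev \<eta> f + fps_const l * ev \<eta> g)"
        using vge_mult[of 0 "fps_const l"] by (intro vge_add) auto
      then have "ordv P g - nat (pt R' P) \<le> ordv P k"
        using ordv_arc[OF \<eta> hk kI] by (simp add: k_def ev_simps vge_def)
      then show ?thesis using pt_ge0[of R' P] by simp
    qed
    consider "proj_eq S P" | "\<not> proj_eq S P" "proj_eq (rot S) P" | "\<not> proj_eq S P" "\<not> proj_eq (rot S) P" by blast
    then show "pt S P + pt (rot S) P - pt R' P \<le> int (ordv P k) - int (ordv P g)"
    proof cases
      case 1
      have "ordv P k = ordv S k" "ordv P g = ordv S g" using ordv_proj_eq[OF S 1] hk kI hfg by blast+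
      moreover have "\<not> proj_eq (rot S) P" using nofix[OF S, of P] 1 proj_eq_sym by blast
      ultimately show ?thesis using k1 1 pt_ge0[of R' P] by (simp add: pt_eq)
    next
      case 2
      have "ordv P k = ordv (rot S) k" "ordv P g = ordv (rot S) g"
        using ordv_proj_eq[OF rc[OF S] 2(2)] hk kI hfg by blast+
      then show ?thesis using k2 2 pt_ge0[of R' P] by (simp add: pt_eq)
    next
      case 3
      then show ?thesis using base by (simp add: pt_eq)
    qed
  qed
qed

end

section \<open>Bihomogeneous polynomials\<close>

lemma monom_val_case_sum:
  "monom_val (case_sum x y) m = (\<Prod>i\<in>UNIV. x i ^ Poly_Mapping.lookup m (Inl i)) *
    (\<Prod>i\<in>UNIV. y i ^ Poly_Mapping.lookup m (Inr i))"
  unfolding monom_val_def UNIV_Plus_UNIV[symmetric] by (subst prod.Plus) simp_all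

lemma bihomogeneous_scale:
  assumes "bihomogeneous a b p" "ring_hom_map h"
  shows "evh h (case_sum (\<lambda>i. l * x i) (\<lambda>i. m * y i)) p = l ^ a * m ^ b * evh h (case_sum x y) p"
proof -
  have "monom_val (case_sum (\<lambda>i. l * x i) (\<lambda>i. m * y i)) k = l ^ a * m ^ b * monom_val (case_sum x y) k"
    if "k \<in> Poly_Mapping.keys p" for k
    using that assms(1)
    by (simp add: bihomogeneous_def monom_val_case_sum power_mult_distrib prod.distrib power_sum[symmetric] mult_ac)
  then show ?thesis by (simp add: evh_def sum_distrib_left mult_ac)
qed

lemma bihomogeneous_subst:
  assumes p: "bihomogeneous a b p" and P: "\<And>i. homogeneous e (P i)" and Q: "\<And>i. homogeneous f (Q i)"
  shows "homogeneous (a * e + b * f) (evh scalar (case_sum P Q) p)"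
  unfolding evh_def
proof (rule homogeneous_sum)
  fix m assume m: "m \<in> Poly_Mapping.keys p"
  have "homogeneous (\<Sum>i\<in>UNIV. Poly_Mapping.lookup m (Inl i) * e) (\<Prod>i\<in>UNIV. P i ^ Poly_Mapping.lookup m (Inl i))"
    "homogeneous (\<Sum>i\<in>UNIV. Poly_Mapping.lookup m (Inr i) * f) (\<Prod>i\<in>UNIV. Q i ^ Poly_Mapping.lookup m (Inr i))"
    by (rule homogeneous_prod, simp, intro homogeneous_power P Q)+
  then have "homogeneous (a * e) (\<Prod>i\<in>UNIV. P i ^ Poly_Mapping.lookup m (Inl i))"
    "homogeneous (b * f) (\<Prod>i\<in>UNIV. Q i ^ Poly_Mapping.lookup m (Inr i))"
    using m p by (simp_all add: bihomogeneous_def sum_distrib_right[symmetric])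
  then show "homogeneous (a * e + b * f) (scalar (Poly_Mapping.lookup p m) * monom_val (case_sum P Q) m)"
    unfolding monom_val_case_sum by (intro homogeneous_scalar_mult homogeneous_mult)
qed

lemma bihomogeneous_add: "bihomogeneous a b p \<Longrightarrow> bihomogeneous a b q \<Longrightarrow> bihomogeneous a b (p + q)"
  using keys_add[of p q] by (force simp: bihomogeneous_def)

lemma bihomogeneous_uminus: "bihomogeneous a b p \<Longrightarrow> bihomogeneous a b (- p)"
  by (simp add: bihomogeneous_def)

lemma bihomogeneous_diff: "bihomogeneous a b p \<Longrightarrow> bihomogeneous a b q \<Longrightarrow> bihomogeneous a b (p - q)"
  using bihomogeneous_add[of a b p "- q"] by (simp add: bihomogeneous_uminus)

lemma bihomogeneous_mult:
  "bihomogeneous a b p \<Longrightarrow> bihomogeneous a' b' q \<Longrightarrow> bihomogeneous (a + a') (b + b') (p * q)"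
  using keys_mult[of p q] unfolding bihomogeneous_def
  by (fastforce simp: lookup_add sum.distrib)

lemma bihomogeneous_scalar: "bihomogeneous 0 0 (scalar a)"
  by (simp add: bihomogeneous_def scalar_def)

lemma bihomogeneous_0: "bihomogeneous a b 0"
  by (simp add: bihomogeneous_def)

lemma bihomogeneous_XX: "bihomogeneous 1 0 (XX i)"
  by (simp add: bihomogeneous_def XX_def indet_def lookup_single when_def)

lemma bihomogeneous_YY: "bihomogeneous 0 1 (YY i)"
  by (simp add: bihomogeneous_def YY_def indet_def lookup_single when_def)

lemma bihomogeneous_XY: "bihomogeneous 1 1 (XX i * YY j)"
  using bihomogeneous_mult[OF bihomogeneous_XX bihomogeneous_YY] by simp

lemma bihomogeneous_sum: "(\<And>a. a \<in> A \<Longrightarrow> bihomogeneous d e (f a)) \<Longrightarrow> bihomogeneous d e (sum f A)"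
  by (induction A rule: infinite_finite_induct) (auto simp: bihomogeneous_0 bihomogeneous_add)

lemma bihomogeneous_scalar_mult: "bihomogeneous a b p \<Longrightarrow> bihomogeneous a b (scalar t * p)"
  using bihomogeneous_mult[OF bihomogeneous_scalar] by fastforce

lemma bihomogeneous_base_change: "bihomogeneous a b p \<Longrightarrow> bihomogeneous a b (base_change p)"
proof -
  have "Poly_Mapping.keys (base_change p) \<subseteq> Poly_Mapping.keys p"
    by (auto simp: base_change_def in_keys_iff Poly_Mapping.map.rep_eq when_def)
  then show "bihomogeneous a b p \<Longrightarrow> bihomogeneous a b (base_change p)"
    by (auto simp: bihomogeneous_def)
qed

text \<open>Every monomial of positive degree is assigned one of its variables, and the monomials
  are grouped by that choice.\<close>

lemma homogeneous_Suc_decomp: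
  fixes q :: "('v::finite, 'a::comm_ring_1) mpol"
  assumes "homogeneous (Suc d) q"
  shows "\<exists>r. (\<forall>v. homogeneous d (r v)) \<and> q = (\<Sum>v\<in>UNIV. indet v * r v)"
proof -
  have "\<exists>v. Poly_Mapping.lookup m v \<noteq> 0" if "m \<in> Poly_Mapping.keys q" for m
  proof (rule ccontr)
    assume "\<nexists>v. Poly_Mapping.lookup m v \<noteq> 0"
    then have "(\<Sum>v\<in>UNIV. Poly_Mapping.lookup m v) = 0" by simp
    moreover have "(\<Sum>v\<in>UNIV. Poly_Mapping.lookup m v) = Suc d"
      using assms that unfolding homogeneous_def by blast
    ultimately show False by simp
  qed
  then obtain a where a: "\<And>m. m \<in> Poly_Mapping.keys q \<Longrightarrow> Poly_Mapping.lookup m (a m) \<noteq> 0" by metis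
  define r where "r v = (\<Sum>m\<in>{m \<in> Poly_Mapping.keys q. a m = v}.
    Poly_Mapping.single (m - Poly_Mapping.single v 1) (Poly_Mapping.lookup q m))" for v
  have split: "m = Poly_Mapping.single (a m) 1 + (m - Poly_Mapping.single (a m) 1)"
    if "m \<in> Poly_Mapping.keys q" for m
    by (rule poly_mapping_eqI) (use a[OF that] in \<open>auto simp: lookup_add lookup_minus lookup_single when_def\<close>)
  have hom: "homogeneous d (r v)" for v
    unfolding r_def
  proof (rule homogeneous_sum)
    fix m assume m: "m \<in> {m \<in> Poly_Mapping.keys q. a m = v}"
    have "(\<Sum>w\<in>UNIV. Poly_Mapping.lookup m w) = Suc d" using m assms by (simp add: homogeneous_def)
    moreover have "(\<Sum>w\<in>UNIV. Poly_Mapping.lookup m w) =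
        (\<Sum>w\<in>UNIV. Poly_Mapping.lookup (Poly_Mapping.single v 1) w) + (\<Sum>w\<in>UNIV. Poly_Mapping.lookup (m - Poly_Mapping.single v 1) w)"
      using split[of m] m unfolding sum.distrib[symmetric] lookup_add[symmetric] by simp
    moreover have "(\<Sum>w\<in>UNIV. Poly_Mapping.lookup (Poly_Mapping.single v (1::nat)) w) = 1"
      by (simp add: lookup_single when_def)
    ultimately have "(\<Sum>w\<in>UNIV. Poly_Mapping.lookup (m - Poly_Mapping.single v 1) w) = d" by simp
    then show "homogeneous d (Poly_Mapping.single (m - Poly_Mapping.single v 1) (Poly_Mapping.lookup q m))"
      by (simp add: homogeneous_def)
  qed
  have "q = (\<Sum>m\<in>Poly_Mapping.keys q. Poly_Mapping.single m (Poly_Mapping.lookup q m))"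
    by (rule mpol_sum_single)
  also have "\<dots> = (\<Sum>m\<in>Poly_Mapping.keys q. indet (a m) *
      Poly_Mapping.single (m - Poly_Mapping.single (a m) 1) (Poly_Mapping.lookup q m))"
    by (rule sum.cong) (simp_all add: indet_def mult_single split[symmetric] del: One_nat_def)
  also have "\<dots> = (\<Sum>v\<in>UNIV. \<Sum>m\<in>{m \<in> Poly_Mapping.keys q. a m = v}. indet (a m) *
      Poly_Mapping.single (m - Poly_Mapping.single (a m) 1) (Poly_Mapping.lookup q m))"
    by (rule sum.group[symmetric]) simp_all
  also have "\<dots> = (\<Sum>v\<in>UNIV. indet v * r v)"
    by (simp add: r_def sum_distrib_left)
  finally show ?thesis using hom by blast
qed

lemma homogeneous_0_scalar: "homogeneous 0 q \<Longrightarrow> q = scalar (Poly_Mapping.lookup q 0)"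
proof -
  assume "homogeneous 0 q"
  then have "Poly_Mapping.keys q \<subseteq> {0}"
    by (auto simp: homogeneous_def intro!: poly_mapping_eqI)
  then show ?thesis
    by (intro poly_mapping_eqI) (auto simp: scalar_def lookup_single when_def in_keys_iff)
qed

text \<open>The coefficients are chosen before \<open>h\<close>, so they lie in the ground field
  even when the form is evaluated in the closure.\<close>

lemma linear_form:
  fixes q :: "(4, 'a::comm_ring_1) mpol"
  assumes "homogeneous 1 q"
  obtains t :: "4 \<Rightarrow> 'a" where "\<And>(h :: 'a \<Rightarrow> 'b::comm_ring_1) x. ring_hom_map h \<Longrightarrow>
    evh h x q = h (t 0) * x 0 + h (t 1) * x 1 + h (t 2) * x 2 + h (t 3) * x 3"
proof -
  obtain r where r: "\<And>v. homogeneous 0 (r v)" "q = (\<Sum>v\<in>UNIV. indet v * r v)"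
    using homogeneous_Suc_decomp[of 0 q] assms by auto
  have "evh h x q = h (Poly_Mapping.lookup (r 0) 0) * x 0 + h (Poly_Mapping.lookup (r 1) 0) * x 1 +
      h (Poly_Mapping.lookup (r 2) 0) * x 2 + h (Poly_Mapping.lookup (r 3) 0) * x 3"
    if h: "ring_hom_map h" for h :: "'a \<Rightarrow> 'b" and x
  proof -
    have "evh h x (r v) = h (Poly_Mapping.lookup (r v) 0)" for v
      by (subst homogeneous_0_scalar[OF r(1)]) (rule evh_scalar[OF h])
    then show ?thesis by (simp add: r(2) sum4 evh_simps[OF h] mult.commute)
  qed
  then show ?thesis by (rule that[of "\<lambda>v. Poly_Mapping.lookup (r v) 0"])
qed

lemma quadratic_form:
  fixes q :: "(4, 'a::comm_ring_1) mpol"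
  assumes "homogeneous 2 q"
  obtains t :: "4 \<Rightarrow> 4 \<Rightarrow> 'a" where "\<And>(h :: 'a \<Rightarrow> 'b::comm_ring_1) x. ring_hom_map h \<Longrightarrow> evh h x q = (\<Sum>i\<in>UNIV. x i *
    (h (t i 0) * x 0 + h (t i 1) * x 1 + h (t i 2) * x 2 + h (t i 3) * x 3))"
proof -
  have "homogeneous (Suc 1) q" using assms by (simp add: numeral_2_eq_2)
  from homogeneous_Suc_decomp[OF this]
  obtain r where r: "\<And>v. homogeneous 1 (r v)" "q = (\<Sum>v\<in>UNIV. indet v * r v)" by blast
  have "\<exists>t :: 4 \<Rightarrow> 'a. \<forall>h :: 'a \<Rightarrow> 'b. \<forall>x. ring_hom_map h \<longrightarrow>
      evh h x (r v) = h (t 0) * x 0 + h (t 1) * x 1 + h (t 2) * x 2 + h (t 3) * x 3" for v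
    by (rule linear_form[OF r(1)[of v]]) blast
  then obtain t :: "4 \<Rightarrow> 4 \<Rightarrow> 'a" where "\<And>v (h :: 'a \<Rightarrow> 'b) x. ring_hom_map h \<Longrightarrow>
      evh h x (r v) = h (t v 0) * x 0 + h (t v 1) * x 1 + h (t v 2) * x 2 + h (t v 3) * x 3" by metis
  then show ?thesis by (intro that[of t]) (simp add: r(2) evh_sum evh_simps)
qed

context char2_curve_ac
begin

section \<open>Uniqueness of addition laws with prescribed restriction\<close>

text \<open>The difference of the two points is a multiple of T. These are the only pairs at which
  one of the laws can vanish.\<close>

abbreviation special :: "(4 \<Rightarrow> 'b) \<Rightarrow> (4 \<Rightarrow> 'b) \<Rightarrow> bool" where
  "special x y \<equiv> par x y \<or> par x (rot y) \<or> par x (rot (rot y)) \<or> par x (rot (rot (rot y)))"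

lemma isadd_special:
  assumes "isadd C w z x" "special x w"
  shows "special z pt_O"
proof -
  have c: "w \<in> cv C" "z \<in> cv C" "x \<in> cv C" using assms by (auto simp: isadd_def)
  have z: "isadd C x (neg w) z" using isadd_diff[OF isadd_commute[OF assms(1)]] .
  have w: "isadd C w (neg w) pt_O" by (rule isadd_neg_self[OF c(1)])
  have r: "isadd C (rot w) (neg w) (rot pt_O)" "isadd C (rot (rot w)) (neg w) (rot (rot pt_O))"
    "isadd C (rot (rot (rot w))) (neg w) (rot (rot (rot pt_O)))"
    using w by (simp_all add: isadd_rot)
  have *: "par z p" if "isadd C w' (neg w) p" "par x w'" for w' p
  proof -
    have "w' \<in> cv C" using that by (simp add: isadd_def)
    then have "proj_eq x w'" using that c cv_ne0 by (intro par_proj_eq) auto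
    then have "isadd C w' (neg w) z" using isadd_proj_eq[OF z _ proj_eq_refl proj_eq_refl] by blast
    then show ?thesis using isadd_unique that(1) proj_eq_par by blast
  qed
  show ?thesis using assms(2) *[OF w] *[OF r(1)] *[OF r(2)] *[OF r(3)] by blast
qed

lemma law_zero_special:
  assumes "x \<in> cv C" "y \<in> cv C" "law b b' x y = (\<lambda>_. 0)"
  shows "special x y"
proof -
  have "Ulaw b x y = (\<lambda>_. 0) \<or> Vlaw b' x y = (\<lambda>_. 0)"
    using assms(3) segre_ne0[of "Ulaw b x y" "Vlaw b' x y"] unfolding law_def by blast
  then show ?thesis
    unfolding Ulaw_def Vlaw_def using law_zero[OF assms(1,2)] by (cases b; cases b') auto
qed

lemma special_sym: "special x y \<Longrightarrow> special y x"
proof -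
  have "par x (rot y) \<Longrightarrow> par y (rot (rot (rot x)))" "par x (rot (rot y)) \<Longrightarrow> par y (rot (rot x))"
    "par x (rot (rot (rot y))) \<Longrightarrow> par y (rot x)"
    using par_sym par_rot[of "rot (rot (rot x))" y] par_rot[of "rot (rot x)" "y"] par_rot[of "rot x" y]
      par_rot[of x "rot y"] par_rot[of "rot x" "rot (rot y)"] par_rot[of "rot (rot x)" "rot (rot (rot y))"]
      par_rot[of x "rot (rot y)"] par_rot[of "rot x" "rot (rot (rot y))"] par_rot[of x "rot (rot (rot y))"]
    by (metis rot_simps(5))+
  then show "special x y \<Longrightarrow> special y x" using par_sym[of x y] by blast
qed

text \<open>On the curve of all \<open>(w + z, w)\<close> with \<open>z\<close> fixed, a law \<open>p\<close> differs from a nowhere vanishing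
  law \<open>e\<close> by a factor without poles, which is therefore constant, hence zero if it vanishes at
  \<open>(z, O)\<close>.\<close>

lemma law_vanishes:
  fixes p e :: "'i \<Rightarrow> (4 + 4, 'b) mpol"
  assumes d: "d > 0" and p: "\<And>i. bihomogeneous d d (p i)" and e: "\<And>i. bihomogeneous d d (e i)"
    and pe: "\<And>x y i j. x \<in> cv C \<Longrightarrow> y \<in> cv C \<Longrightarrow>
      peval (p i) (case_sum x y) * peval (e j) (case_sum x y) = peval (p j) (case_sum x y) * peval (e i) (case_sum x y)"
    and ne: "\<And>x y. x \<in> cv C \<Longrightarrow> y \<in> cv C \<Longrightarrow> \<not> special x y \<Longrightarrow> \<exists>i. peval (e i) (case_sum x y) \<noteq> 0"
    and p0: "\<And>z i. z \<in> cv C \<Longrightarrow> \<not> special z pt_O \<Longrightarrow> peval (p i) (case_sum z pt_O) = 0"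
    and x: "x \<in> cv C" and y: "y \<in> cv C"
  shows "peval (p i) (case_sum x y) = 0"
proof -
  \<comment> \<open>The pullback of f along w \<mapsto> (w + z, w), with w + z computed by one of
    the four laws. For bidegree (d, d) it is a form of degree 3 d in w.\<close>
  define P where "P f k k' z = evh scalar (case_sum (lawmap k k' z) indet) f" for f :: "(4 + 4, 'b) mpol" and k k' z
  have peP: "peval (P f k k' z) w = peval f (case_sum (law k k' w z) w)" for f k k' z w
  proof -
    have "(\<lambda>v. evh (\<lambda>a. a) w (case_sum (lawmap k k' z) indet v)) = case_sum (law k k' w z) w"
    proof
      fix v show "evh (\<lambda>a. a) w (case_sum (lawmap k k' z) indet v) = case_sum (law k k' w z) w v"
        using fun_cong[OF pm_lawmap[of k k' z w]]
        by (cases v) (simp_all add: peval_eq_evh[symmetric] pm_def peval_simps)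
    qed
    then show ?thesis unfolding P_def peval_eq_evh evh_subst[OF ring_hom_map_id] by simp
  qed
  have hP: "homogeneous (d * 2 + d * 1) (P f k k' z)" if "bihomogeneous d d f" for f k k' z
    unfolding P_def by (rule bihomogeneous_subst[OF that homogeneous_lawmap homogeneous_indet])
  have scale: "peval f (case_sum (\<lambda>i. l * x i) y) = l ^ d * peval f (case_sum x y)"
    if "bihomogeneous d d f" for f :: "(4 + 4, 'b) mpol" and l x y
    using bihomogeneous_scale[OF that ring_hom_map_id, of l x 1 y] by (simp add: peval_eq_evh)
  have scale0: "peval f (case_sum (\<lambda>_. 0) y) = 0" if "bihomogeneous d d f" for f :: "(4 + 4, 'b) mpol" and y
    using scale[OF that, of 0 x y] d by simp
  have main: "P (p i) k k' z \<in> I"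
    if z: "z \<in> cv C" "\<not> special z pt_O" and k: "law k k' pt_O z \<noteq> (\<lambda>_. 0)" for z k k' i
  proof (rule ccontr)
    assume ni: "P (p i) k k' z \<notin> I"
    have "isadd C pt_O z (law k k' pt_O z)" by (rule law_isadd[OF pt_O_cv z(1) k])
    then have lc: "law k k' pt_O z \<in> cv C" by (simp add: isadd_def)
    have ls: "\<not> special (law k k' pt_O z) pt_O"
      using isadd_special[OF \<open>isadd C pt_O z (law k k' pt_O z)\<close>] z(2) by blast
    obtain j where j: "peval (e j) (case_sum (law k k' pt_O z) pt_O) \<noteq> 0"
      using ne[OF lc pt_O_cv ls] by blast
    define f g where "f = P (p j) k k' z" and "g = P (e j) k k' z"
    have gO: "peval g pt_O \<noteq> 0" using j by (simp add: g_def peP)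
    then have gI: "g \<notin> I" using pt_O_cv by (auto simp: I_iff)
    have fg: "homogeneous (d * 2 + d * 1) f" "homogeneous (d * 2 + d * 1) g"
      unfolding f_def g_def by (intro hP p e)+
    have lawc: "law k k' w z = (\<lambda>_. 0) \<or> law k k' w z \<in> cv C" if "w \<in> cv C" for w k k'
      using law_isadd[OF that z(1)] by (auto simp: isadd_def)
    have pe': "peval (p a) (case_sum (law k k' w z) w) * peval (e b) (case_sum (law k k' w z) w) =
        peval (p b) (case_sum (law k k' w z) w) * peval (e a) (case_sum (law k k' w z) w)"
      if "w \<in> cv C" for w a b k k'
      using lawc[OF that, of k k'] pe[OF _ that] scale0[OF p] by (auto simp del: mult_eq_0_iff)
    have fI: "f \<notin> I"
    proof
      assume "f \<in> I"
      then have "P (p i) k k' z * g \<in> I"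
        using pe'[of _ i k k' j] by (auto simp: I_iff peval_simps peP f_def g_def)
      then show False using I_prime[OF hP[OF p] fg(2)] ni gI by blast
    qed
    \<comment> \<open>At S the law for w + z and the entry of e are chosen so as not to vanish. Then
      E' is a unit at S and E' f = P' g on the curve, so f / g has no pole at S.\<close>
    have le: "ordv S g \<le> ordv S f" if S: "S \<in> cv C" for S
    proof -
      obtain m m' where m: "law m m' S z \<noteq> (\<lambda>_. 0)" using law_exists[OF S z(1)] .
      have a: "isadd C S z (law m m' S z)" by (rule law_isadd[OF S z(1) m])
      then have c: "law m m' S z \<in> cv C" by (simp add: isadd_def)
      have "\<not> special (law m m' S z) S" using isadd_special[OF a] z(2) by blast
      then obtain b where b: "peval (e b) (case_sum (law m m' S z) S) \<noteq> 0" using ne[OF c S] by blast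
      define E' P' where "E' = P (e b) m m' z" and "P' = P (p b) m m' z"
      have E'S: "peval E' S \<noteq> 0" using b by (simp add: E'_def peP)
      then have E'I: "E' \<notin> I" using S by (auto simp: I_iff)
      have hE': "homogeneous (d * 2 + d * 1) E'" and hP': "homogeneous (d * 2 + d * 1) P'"
        unfolding E'_def P'_def by (intro hP p e)+
      have rel: "E' * f - P' * g \<in> I"
        unfolding I_iff
      proof
        fix w assume w: "w \<in> cv C"
        let ?s = "law k k' w z" and ?t = "law m m' w z"
        have "peval (e b) (case_sum ?t w) * peval (p j) (case_sum ?s w) =
          peval (p b) (case_sum ?t w) * peval (e j) (case_sum ?s w)"
        proof (cases "?s = (\<lambda>_. 0) \<or> ?t = (\<lambda>_. 0)")
          case True
          then show ?thesis using scale0[OF p] scale0[OF e] by auto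
        next
          case False
          then have s: "isadd C w z ?s" and t: "isadd C w z ?t" using law_isadd[OF w z(1)] by blast+
          obtain l where "l \<noteq> 0" "?t = (\<lambda>i. l * ?s i)" using isadd_unique[OF s t] by (auto simp: proj_eq_def)
          then show ?thesis using pe'[OF w, of j k k' b] scale[OF p] scale[OF e] by (simp add: mult_ac)
        qed
        then show "peval (E' * f - P' * g) w = 0"
          by (simp add: peval_simps E'_def P'_def f_def g_def peP)
      qed
      have F1: "form (d * 2 + d * 1) E'" "form (d * 2 + d * 1) f" "form (d * 2 + d * 1) g"
        using hE' E'I fg fI gI by (simp_all add: form_def)
      have "E' * f \<notin> I" using form_mult[OF F1(1,2)] by (simp add: form_def)
      then have "P' * g \<notin> I" using ordv_cong(2)[OF rel] by blast
      then have "P' \<notin> I" using is_idealD(4)[OF is_ideal_I] by blast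
      then have F2: "form (d * 2 + d * 1) P'" using hP' by (simp add: form_def)
      have "ordv S E' = 0" using ordv_eq_0_iff[OF S hE' E'I] E'S by simp
      then have "ordv S f = ordv S P' + ordv S g"
        using ordv_cong(1)[OF rel, of S] ordv_form_mult[OF S F1(1,2)] ordv_form_mult[OF S F2 F1(3)] by simp
      then show ?thesis by simp
    qed
    have "ordv pt_O f = ordv pt_O g"
      by (rule degree_lemma[of "d * 2 + d * 1", OF _ _ le pt_O_cv]) (use fg fI gI in \<open>simp_all add: form_def\<close>)
    moreover have "ordv pt_O g = 0" using ordv_eq_0_iff[OF pt_O_cv fg(2) gI] gO by simp
    moreover have "peval f pt_O = 0" using p0[OF lc ls] by (simp add: f_def peP)
    ultimately show False using ordv_eq_0_iff[OF pt_O_cv fg(1) fI] by simp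
  qed
  text \<open>This leaves finitely many \<open>x\<close> for each \<open>y\<close>.\<close>
  obtain D where D: "isadd C y y D" using isadd_exists[OF y y] .
  then have Dc: "D \<in> cv C" by (simp add: isadd_def)
  \<comment> \<open>\<open>D\<close> is 2 y. If x - y is not a multiple of T, then
    \<open>main\<close> applies to z = x - y; if x - 2 y is not one either, the law chosen at (O, z)
    is still nonzero at (y, z).\<close>
  have gen: "peval (p i) (case_sum x y) = 0" if x: "x \<in> cv C" and n1: "\<not> special x y" and n2: "\<not> special x D" for x
  proof -
    obtain z where z: "isadd C x (neg y) z" using isadd_exists[OF x] y cv_neg by metis
    then have zc: "z \<in> cv C" by (simp add: isadd_def)
    have a: "isadd C z y x" using isadd_diff[OF z] by simp
    have zO: "\<not> special z pt_O"
    proof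
      assume s: "special z pt_O"
      have "isadd C pt_O y y" using isadd_O[OF y] isadd_commute by blast
      then have r: "isadd C pt_O y y" "isadd C (rot pt_O) y (rot y)" "isadd C (rot (rot pt_O)) y (rot (rot y))"
        "isadd C (rot (rot (rot pt_O))) y (rot (rot (rot y)))" by (simp_all add: isadd_rot)
      have *: "par x q" if "isadd C q' y q" "par z q'" for q q'
      proof -
        have "q' \<in> cv C" using that by (simp add: isadd_def)
        then have "proj_eq z q'" using that zc cv_ne0 by (intro par_proj_eq) auto
        then have "isadd C q' y x" using isadd_proj_eq[OF a _ proj_eq_refl proj_eq_refl] by blast
        then show ?thesis using isadd_unique that(1) proj_eq_par by blast
      qed
      show False using s n1 *[OF r(1)] *[OF r(2)] *[OF r(3)] *[OF r(4)] by blast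
    qed
    obtain k k' where k: "law k k' pt_O z \<noteq> (\<lambda>_. 0)" using law_exists[OF pt_O_cv zc] .
    have "law k k' y z \<noteq> (\<lambda>_. 0)"
    proof
      assume "law k k' y z = (\<lambda>_. 0)"
      then have s: "special y z" by (rule law_zero_special[OF y zc])
      then have s: "special z y" by (rule special_sym)
      have r: "isadd C y y D" "isadd C (rot y) y (rot D)" "isadd C (rot (rot y)) y (rot (rot D))"
        "isadd C (rot (rot (rot y))) y (rot (rot (rot D)))" using D by (simp_all add: isadd_rot)
      have *: "par x q" if "isadd C q' y q" "par z q'" for q q'
      proof -
        have "q' \<in> cv C" using that by (simp add: isadd_def)
        then have "proj_eq z q'" using that zc cv_ne0 by (intro par_proj_eq) auto
        then have "isadd C q' y x" using isadd_proj_eq[OF a _ proj_eq_refl proj_eq_refl] by blast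
        then show ?thesis using isadd_unique that(1) proj_eq_par by blast
      qed
      show False using s n2 *[OF r(1)] *[OF r(2)] *[OF r(3)] *[OF r(4)] by blast
    qed
    then have "proj_eq (law k k' y z) x" using isadd_law[OF isadd_commute[OF a]] by blast
    then obtain l where l: "x = (\<lambda>i. l * law k k' y z i)" by (auto simp: proj_eq_def)
    have "peval (P (p i) k k' z) y = 0" using main[OF zc zO k] y by (auto simp: I_iff)
    then show ?thesis using scale[OF p] by (simp add: peP l)
  qed
  define q where "q = evh scalar (case_sum indet (\<lambda>j. scalar (y j))) (p i)"
  have pq: "peval q x = peval (p i) (case_sum x y)" for x
  proof -
    have "(\<lambda>v. evh (\<lambda>a. a) x (case_sum indet (\<lambda>j. scalar (y j)) v)) = case_sum x y"
    proof
      fix v show "evh (\<lambda>a. a) x (case_sum indet (\<lambda>j. scalar (y j)) v) = case_sum x y v"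
        by (cases v) (simp_all add: peval_eq_evh[symmetric] peval_simps)
    qed
    then show ?thesis unfolding q_def peval_eq_evh evh_subst[OF ring_hom_map_id] by simp
  qed
  have hq: "homogeneous (d * 1 + d * 0) q"
    unfolding q_def by (rule bihomogeneous_subst[OF p homogeneous_indet homogeneous_scalar])
  define S where "S = (\<lambda>q. q 1 / q 0) ` {y, rot y, rot (rot y), rot (rot (rot y)), D, rot D, rot (rot D), rot (rot (rot D))}"
  have "q \<in> I"
  proof (rule homogeneous_cofinite_I[OF hq, of S])
    show "finite S" by (simp add: S_def)
    fix x assume x: "x \<in> cv C" "x 0 \<noteq> 0" "x 1 / x 0 \<notin> S"
    have "\<not> par x q" if "q \<in> {y, rot y, rot (rot y), rot (rot (rot y)), D, rot D, rot (rot D), rot (rot (rot D))}" for q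
    proof
      assume "par x q"
      have "q \<in> cv C" using that y Dc by (auto simp: cv_rot)
      then obtain l where l: "l \<noteq> 0" "\<And>i. q i = l * x i"
        using par_proj_eq[OF \<open>par x q\<close>] cv_ne0 x(1) by (auto simp: proj_eq_def)
      then have "x 1 / x 0 = q 1 / q 0" by simp
      then show False using x(3) that unfolding S_def by blast
    qed
    then have "\<not> special x y" "\<not> special x D" by blast+
    then show "peval q x = 0" using gen[OF x(1)] by (simp add: pq)
  qed
  then show ?thesis using x by (simp add: I_iff pq[symmetric])
qed

section \<open>Restriction to \<open>E \<times> O\<close>\<close>

lemma v_independent:
  assumes "\<And>u v. chart u v \<in> cv C \<Longrightarrow> poly A u + poly B u * v = 0"
  shows "A = 0" "B = 0"
proof -
  have *: "poly A u = 0 \<and> poly B u = 0" if "u \<notin> {0, 1}" for u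
  proof -
    have u: "u \<noteq> 0" "u \<noteq> 1" using that by auto
    obtain v where v: "v \<noteq> 1 / v" "chart u v \<in> cv C" "chart u (1 / v) \<in> cv C"
      using affine_points[OF u] by metis
    from assms[OF v(2)] assms[OF v(3)]
    have e: "poly A u + poly B u * v = 0" "poly A u + poly B u * (1 / v) = 0" .
    then have "poly B u * (v - 1 / v) = 0" by (simp add: algebra_simps) (metis add_left_cancel)
    then have "poly B u = 0" using v(1) by simp
    then show ?thesis using e(1) by simp
  qed
  show "A = 0" using * by (intro poly_zero_cofinite[of "{0, 1}"]) auto
  show "B = 0" using * by (intro poly_zero_cofinite[of "{0, 1}"]) auto
qed

lemma chart_swap: "chart u v \<in> cv C \<longleftrightarrow> chart v u \<in> cv C"
  by (simp add: chart_cv mult_ac)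

text \<open>1 and v are independent over polynomials in u, so coefficients can be compared. The
  surviving pairs are the combinations of (1, u) and (v, u v), a space of dimension 2.\<close>

lemma linear_law_u:
  assumes "\<And>u v. chart u v \<in> cv C \<Longrightarrow>
    (a0 + a1 * u + a2 * (u * v) + a3 * v) * u = b0 + b1 * u + b2 * (u * v) + b3 * v"
  shows "a1 = 0" "a2 = 0" "b0 = 0" "b3 = 0" "b1 = a0" "b2 = a3"
proof -
  have "poly [:- b0, a0 - b1, a1:] u + poly [:- b3, a3 - b2, a2:] u * v = 0" if "chart u v \<in> cv C" for u v
    using assms[OF that] by (simp add: algebra_simps)
  from v_independent[OF this]
  show "a1 = 0" "a2 = 0" "b0 = 0" "b3 = 0" "b1 = a0" "b2 = a3" by simp_all
qed

text \<open>After multiplication by 1 + u^2 the square of v is eliminated by the equation. The two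
  conclusions are the top coefficients of the resulting relations A + D = 0 and (1 + u^2) B + C u D
  = 0.\<close>

lemma quadratic_law_u:
  assumes "\<And>u v. chart u v \<in> cv C \<Longrightarrow>
    (poly [:a0, a1, a2:] u + poly [:b0, b1, b2:] u * v + poly [:d0, d1, d2:] u * (v * v)) * u =
     poly [:a0', a1', a2':] u + poly [:b0', b1', b2':] u * v + poly [:d0', d1', d2':] u * (v * v)"
  shows "b2 = 0" "a2 = d2"
proof -
  define A B D where "A = [:- a0', a0 - a1', a1 - a2', a2:]"
    and "B = [:- b0', b0 - b1', b1 - b2', b2:]" and "D = [:- d0', d0 - d1', d1 - d2', d2:]"
  have z: "poly A u + poly B u * v + poly D u * (v * v) = 0" if "chart u v \<in> cv C" for u v
    using assms[OF that] by (simp add: A_def B_def D_def algebra_simps)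
  have "poly (Wpoly * (A + D)) u + poly (Wpoly * B + [:0, C:] * D) u * v = 0" if "chart u v \<in> cv C" for u v
  proof -
    have "(1 + u * u) * (1 + v * v) = C * u * v"
      using that by (simp only: chart_cv char2_sum0[OF two])
    then have "(1 + u * u) * (v * v) = (1 + u * u) + C * u * v"
      by (metis char2(2) distrib_left mult.right_neutral)
    then have w: "(1 + u * u) * (v * v) * t = ((1 + u * u) + C * u * v) * t" for t by simp
    have "poly (Wpoly * (A + D)) u + poly (Wpoly * B + [:0, C:] * D) u * v =
      (1 + u * u) * (poly A u + poly B u * v) + ((1 + u * u) + C * u * v) * poly D u"
      by (simp add: Wpoly_def algebra_simps)
    also have "\<dots> = (1 + u * u) * (poly A u + poly B u * v + poly D u * (v * v))"
      unfolding w[symmetric] by (simp add: algebra_simps)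
    finally show ?thesis by (simp add: z[OF that])
  qed
  from v_independent[OF this] have "Wpoly * (A + D) = 0" and BD: "Wpoly * B + [:0, C:] * D = 0" by blast+
  moreover have "Wpoly \<noteq> 0" by (simp add: Wpoly_def)
  ultimately have "A + D = 0" by simp
  then have "a2 + d2 = 0" by (simp add: A_def D_def)
  then show "a2 = d2" by (simp only: char2_sum0[OF two])
  show "b2 = 0" using BD by (simp add: Wpoly_def B_def D_def)
qed

text \<open>\<open>n j k\<close> is the coefficient of u^j v^k. Proportionality in both directions
  kills u^2 v and u v^2 and makes the coefficients of u^2, v^2 and u^2 v^2 equal. Since u^2 + v^2 +
  u^2 v^2 = 1 + C u v on the curve, four parameters remain.\<close>

lemma quadratic_law:
  fixes n m m' :: "nat \<Rightarrow> nat \<Rightarrow> 'b"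
  defines "q \<equiv> \<lambda>n u v. (n 0 0 + n 1 0 * u + n 2 0 * (u * u)) + (n 0 1 + n 1 1 * u + n 2 1 * (u * u)) * v
    + (n 0 2 + n 1 2 * u + n 2 2 * (u * u)) * (v * v)"
  assumes u: "\<And>u v. chart u v \<in> cv C \<Longrightarrow> q n u v * u = q m u v"
    and v: "\<And>u v. chart u v \<in> cv C \<Longrightarrow> q n u v * v = q m' u v"
    and uv: "chart u v \<in> cv C"
  shows "q n u v = (n 0 0 + n 2 2) + n 1 0 * u + (n 1 1 + C * n 2 2) * (u * v) + n 0 1 * v"
proof -
  have 1: "n 2 1 = 0" "n 2 0 = n 2 2"
    by (rule quadratic_law_u[of "n 0 0" "n 1 0" "n 2 0" "n 0 1" "n 1 1" "n 2 1" "n 0 2" "n 1 2" "n 2 2"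
          "m 0 0" "m 1 0" "m 2 0" "m 0 1" "m 1 1" "m 2 1" "m 0 2" "m 1 2" "m 2 2"];
        use u in \<open>simp add: q_def algebra_simps\<close>)+
  have v': "q n v u * u = q m' v u" if "chart u v \<in> cv C" for u v
    using that chart_swap v by blast
  have 2: "n 1 2 = 0" "n 0 2 = n 2 2"
    by (rule quadratic_law_u[of "n 0 0" "n 0 1" "n 0 2" "n 1 0" "n 1 1" "n 1 2" "n 2 0" "n 2 1" "n 2 2"
          "m' 0 0" "m' 0 1" "m' 0 2" "m' 1 0" "m' 1 1" "m' 1 2" "m' 2 0" "m' 2 1" "m' 2 2"];
        use v' in \<open>simp add: q_def algebra_simps\<close>)+
  have "(1 + u * u) * (1 + v * v) = C * u * v"
    using uv by (simp only: chart_cv char2_sum0[OF two])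
  then have "u * u + v * v + u * u * (v * v) = 1 + C * (u * v)"
    using char2(2)[of 1] by (simp add: algebra_simps) (metis add.left_commute char2(2))
  then have s: "n 2 2 * (u * u + v * v + u * u * (v * v)) = n 2 2 * (1 + C * (u * v))" by simp
  have "q n u v = n 0 0 + n 1 0 * u + n 0 1 * v + n 1 1 * (u * v) + n 2 2 * (u * u + v * v + u * u * (v * v))"
    by (simp add: q_def 1 2 algebra_simps del: One_nat_def)
  then show ?thesis unfolding s by (simp add: algebra_simps)
qed

lemma special_O:
  assumes "z \<in> cv C" "z 0 = 0"
  shows "special z pt_O"
proof -
  note c = cvD[OF assms(1)]
  have "z 1 * z 3 = 0" using c(2) assms(2) by simp
  then consider "z 1 = 0" | "z 3 = 0" by auto
  then show ?thesis
  proof cases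
    case 1
    then have "z 2 = z 3" using c(1) assms(2) by (simp add: square_sum0)
    then have "par z (rot (rot (rot pt_O)))"
      using 1 assms(2) unfolding par_def all4 by (simp add: pt_O_def)
    then show ?thesis by blast
  next
    case 2
    then have "z 1 = z 2" using c(1) assms(2) by (simp add: square_sum0)
    then have "par z (rot (rot pt_O))"
      using 2 assms(2) unfolding par_def all4 by (simp add: pt_O_def)
    then show ?thesis by blast
  qed
qed

end

section \<open>The group law\<close>

text \<open>For c = 0 the second equation is the zero polynomial, and its zero gradient at
  \<open>pt_O\<close> contradicts the Jacobian criterion.\<close>

lemma elliptic_nonzero:
  assumes "elliptic c"
  shows "c \<noteq> 0"
proof
  assume "c = 0"
  then have "eqn2 c = 0" by (simp add: eqn2_def scalar_def)
  then have "partial i (base_change (eqn2 c)) = 0" for i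
    by (simp add: ring_hom_map_simps(1)[OF ring_hom_map_base_change] partial_def)
  then show False using assms unfolding elliptic_def by (metis add.left_neutral mult_zero_left mult_zero_right peval_0 zero_neq_one)
qed

locale z4_curve =
  fixes c :: "'k::field"
  assumes char: "CHAR('k) = 2" and c0: "c \<noteq> 0"

sublocale z4_curve \<subseteq> char2_curve_ac "to_ac c"
proof
  have "of_nat CHAR('k alg_closure) = (0 :: 'k alg_closure)" by (rule of_nat_CHAR)
  then show "(2 :: 'k alg_closure) = 0" using char by simp
  show "to_ac c \<noteq> 0" using c0 by simp
qed

context z4_curve
begin

lemma curve_eq: "curve c = cv (to_ac c)"
proof -
  have "peval (base_change (eqn1 c)) x = (x 0 + x 1 + x 2 + x 3)\<^sup>2 - to_ac c * x 0 * x 2"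
    "peval (base_change (eqn2 c)) x = to_ac c * (x 0 * x 2 - x 1 * x 3)" for x
    unfolding peval_base_change eqn1_def eqn2_def
    by (simp_all only: evh_simps[OF ring_hom_map_to_ac] mult.assoc right_diff_distrib)
  then show ?thesis using c0 by (auto simp: curve_def cv_def on_curve_def)
qed

lemma ord_at_eq: "ord_at c x f = ordv x f"
  unfolding ord_at_def ordv_def ordI_def curve_eq ..

lemma lin_equiv_iff: "lin_equiv c D D' \<longleftrightarrow> principal (\<lambda>S. D S - D' S)"
  unfolding lin_equiv_def principal_def form_def ord_at_eq curve_eq by blast

text \<open>The operation given by the laws satisfies the linear equivalence
  (\<open>isadd_principal\<close>), and the equivalence determines its point
  (\<open>principal_unique\<close>). So whatever \<open>SOME\<close> picks is the same projective
  point.\<close>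

lemma mu_isadd:
  assumes x: "x \<in> curve c" and y: "y \<in> curve c"
  shows "isadd (to_ac c) x y (mu c x y)"
proof -
  define Q where "Q R \<longleftrightarrow> R \<in> curve c \<and> lin_equiv c (\<lambda>S. point_divisor x S + point_divisor y S)
    (\<lambda>S. point_divisor R S + point_divisor pt_O S)" for R
  obtain z where z: "isadd (to_ac c) x y z" using isadd_exists x y by (metis curve_eq)
  then have zc: "z \<in> cv (to_ac c)" by (simp add: isadd_def)
  have pz: "principal (\<lambda>S. pt x S + pt y S - (pt z S + pt pt_O S))" by (rule isadd_principal[OF z])
  then have "Q z" using zc by (simp add: Q_def lin_equiv_iff curve_eq)
  then have "Q (mu c x y)" unfolding mu_def Q_def[symmetric] by (metis someI)
  then have m: "mu c x y \<in> cv (to_ac c)"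
    and pm: "principal (\<lambda>S. pt x S + pt y S - (pt (mu c x y) S + pt pt_O S))"
    by (simp_all add: Q_def lin_equiv_iff curve_eq)
  have "principal (\<lambda>S. pt z S - pt (mu c x y) S)"
    by (rule principal_cong[OF principal_diff[OF pm pz]]) simp
  then have "proj_eq z (mu c x y)" by (rule principal_unique[OF zc m])
  then show ?thesis using isadd_proj_eq[OF z proj_eq_refl proj_eq_refl] by blast
qed

lemma mu_curve: "x \<in> curve c \<Longrightarrow> y \<in> curve c \<Longrightarrow> mu c x y \<in> curve c"
  using mu_isadd[of x y] by (auto simp: isadd_def curve_eq)

section \<open>Spaces of addition laws\<close>

lemma par_trans:
  fixes m :: "'i \<Rightarrow> 'a::field"
  assumes "par a m" "par b m" "m \<noteq> (\<lambda>_. 0)"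
  shows "par a b"
proof -
  obtain k where k: "m k \<noteq> 0" using assms(3) by fastforce
  have a: "a i = a k / m k * m i" and b: "b i = b k / m k * m i" for i
    using assms(1,2) k unfolding par_def by (simp_all add: field_simps)
  have "a i * b j = a j * b i" for i j
    unfolding a[of i] a[of j] b[of i] b[of j] by (simp add: mult_ac)
  then show ?thesis by (simp add: par_def)
qed

lemma eval_tuple_eq: "eval_tuple p x y i = evh to_ac (case_sum x y) (p i)"
  by (simp add: eval_tuple_def peval_base_change)

lemmas ev_to_ac = ring_hom_map_evh[OF ring_hom_map_to_ac]
lemmas ev_to_ac_simps = evh_simps[OF ring_hom_map_to_ac]

lemma eval_XX: "evh to_ac (case_sum x y) (XX i) = x i" "evh to_ac (case_sum x y) (YY i) = y i"
  by (simp_all add: XX_def YY_def ev_to_ac_simps)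

lemma eval_laws:
  "eval_tuple (Ulaw b XX YY) x y = Ulaw b x y" "eval_tuple (Vlaw b XX YY) x y = Vlaw b x y"
  "eval_tuple (law b b' XX YY) x y = law b b' x y"
  unfolding eval_tuple_eq law_hom[OF ev_to_ac] eval_XX by simp_all

lemma bihomogeneous_Ulaw: "bihomogeneous 1 1 (Ulaw b XX YY i)"
  and bihomogeneous_Vlaw: "bihomogeneous 1 1 (Vlaw b XX YY i)"
proof -
  have "\<forall>i. bihomogeneous 1 1 (Ulaw b XX YY i)" "\<forall>i. bihomogeneous 1 1 (Vlaw b XX YY i)"
    unfolding all2 Ulaw_def Vlaw_def law_defs
    by (auto simp del: One_nat_def intro!: bihomogeneous_add bihomogeneous_XY)
  then show "bihomogeneous 1 1 (Ulaw b XX YY i)" "bihomogeneous 1 1 (Vlaw b XX YY i)" by blast+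
qed

lemma zero_tuple_iff: "zero_tuple c p \<longleftrightarrow> (\<forall>x\<in>curve c. \<forall>y\<in>curve c. \<forall>i. eval_tuple p x y i = 0)"
  unfolding zero_tuple_def ideal_EE_rat_def ideal_EE_def vanishing_ideal_def eval_tuple_def by blast

definition nowhere_zero :: "((4 \<Rightarrow> 'k alg_closure) \<Rightarrow> (4 \<Rightarrow> 'k alg_closure) \<Rightarrow> 'i \<Rightarrow> 'k alg_closure) \<Rightarrow> bool" where
  "nowhere_zero \<phi> \<longleftrightarrow> (\<forall>x\<in>curve c. \<forall>y\<in>curve c. \<phi> x y \<noteq> (\<lambda>_. 0))"

lemma nowhere_zeroD: "nowhere_zero \<phi> \<Longrightarrow> x \<in> curve c \<Longrightarrow> y \<in> curve c \<Longrightarrow> \<phi> x y \<noteq> (\<lambda>_. 0)"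
  by (simp add: nowhere_zero_def)

text \<open>With \<open>par\<close> the zero tuple and genuine laws are described by one condition
  that is linear in the tuple, so closure under linear combinations becomes immediate.\<close>

lemma law_space_iff:
  assumes "nowhere_zero \<phi>"
  shows "p \<in> law_space c d \<phi> \<longleftrightarrow> (\<forall>i. bihomogeneous d d (p i)) \<and>
    (\<forall>x\<in>curve c. \<forall>y\<in>curve c. par (eval_tuple p x y) (\<phi> x y))"
proof -
  have "((\<exists>i. eval_tuple p x y i \<noteq> 0) \<longrightarrow> proj_eq (eval_tuple p x y) (\<phi> x y)) \<longleftrightarrow> par (eval_tuple p x y) (\<phi> x y)"
    if "x \<in> curve c" "y \<in> curve c" for x y
  proof (cases "eval_tuple p x y = (\<lambda>_. 0)")
    case True
    then show ?thesis by (simp add: par_def)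
  next
    case False
    then have "\<exists>i. eval_tuple p x y i \<noteq> 0" by (metis ext)
    then show ?thesis using par_iff_proj_eq[OF False nowhere_zeroD[OF assms that]] by simp
  qed
  then show ?thesis
    unfolding law_space_def addition_law_def zero_tuple_iff mem_Collect_eq by (metis)
qed

lemma law_space_par:
  assumes "p \<in> law_space c d \<phi>" "nowhere_zero \<phi>" "x \<in> curve c" "y \<in> curve c"
  shows "par (eval_tuple p x y) (\<phi> x y)"
proof -
  have "\<forall>x\<in>curve c. \<forall>y\<in>curve c. par (eval_tuple p x y) (\<phi> x y)"
    using assms(1) unfolding law_space_iff[OF assms(2)] by (rule conjunct2)
  then show ?thesis using assms(3,4) by blast
qed

lemma addition_law_iff:
  assumes "nowhere_zero \<phi>"
  shows "addition_law c d \<phi> p \<longleftrightarrow> p \<in> law_space c d \<phi> \<and> \<not> zero_tuple c p"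
  using assms unfolding law_space_def addition_law_def by blast

lemma par_pi1_iff:
  assumes "z \<in> curve c"
  shows "pi1 z \<noteq> (\<lambda>_. 0)" "par s (pi1 z) \<longleftrightarrow> s 0 * z 1 = s 1 * z 0 \<and> s 0 * z 2 = s 1 * z 3"
proof -
  have z: "z \<in> cv (to_ac c)" using assms by (simp add: curve_eq)
  note cz = cvD[OF z]
  show ne: "pi1 z \<noteq> (\<lambda>_. 0)" using pi1_ne0[OF z] by (auto simp: fun2_eq)
  have both: "par (pair (z 0) (z 1)) (pi1 z)" "par (pair (z 3) (z 2)) (pi1 z)"
    unfolding par_def all2 pi1_def using cz(2) by (auto simp: mult.commute)
  have p2: "par s (pair a b) \<longleftrightarrow> s 0 * b = s 1 * a" for a b
    unfolding par_def all2 by auto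
  show "par s (pi1 z) \<longleftrightarrow> s 0 * z 1 = s 1 * z 0 \<and> s 0 * z 2 = s 1 * z 3"
    unfolding p2[symmetric]
  proof
    assume "par s (pi1 z)"
    then show "par s (pair (z 0) (z 1)) \<and> par s (pair (z 3) (z 2))"
      using par_trans[OF _ both(1) ne] par_trans[OF _ both(2) ne] by blast
  next
    assume "par s (pair (z 0) (z 1)) \<and> par s (pair (z 3) (z 2))"
    then show "par s (pi1 z)" unfolding pi1_def by simp
  qed
qed

lemma par_pi2_iff:
  assumes "z \<in> curve c"
  shows "pi2 z \<noteq> (\<lambda>_. 0)" "par s (pi2 z) \<longleftrightarrow> s 0 * z 3 = s 1 * z 0 \<and> s 0 * z 2 = s 1 * z 1"
proof -
  have z: "z \<in> cv (to_ac c)" using assms by (simp add: curve_eq)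
  note cz = cvD[OF z]
  show ne: "pi2 z \<noteq> (\<lambda>_. 0)" using cz(3) by (auto simp: fun2_eq pi2_def)
  have both: "par (pair (z 0) (z 3)) (pi2 z)" "par (pair (z 1) (z 2)) (pi2 z)"
    unfolding par_def all2 pi2_def using cz(2) by (auto simp: mult.commute)
  have p2: "par s (pair a b) \<longleftrightarrow> s 0 * b = s 1 * a" for a b
    unfolding par_def all2 by auto
  show "par s (pi2 z) \<longleftrightarrow> s 0 * z 3 = s 1 * z 0 \<and> s 0 * z 2 = s 1 * z 1"
    unfolding p2[symmetric]
  proof
    assume "par s (pi2 z)"
    then show "par s (pair (z 0) (z 3)) \<and> par s (pair (z 1) (z 2))"
      using par_trans[OF _ both(1) ne] par_trans[OF _ both(2) ne] by blast
  next
    assume "par s (pair (z 0) (z 3)) \<and> par s (pair (z 1) (z 2))"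
    then show "par s (pi2 z)" unfolding pi2_def by simp
  qed
qed

lemma law_par_mu:
  assumes "x \<in> curve c" "y \<in> curve c"
  shows "par (Ulaw b x y) (pi1 (mu c x y))" "par (Vlaw b x y) (pi2 (mu c x y))"
    "par (law b b' x y) (mu c x y)"
proof -
  note m = mu_isadd[OF assms]
  show "par (Ulaw b x y) (pi1 (mu c x y))" "par (Vlaw b x y) (pi2 (mu c x y))"
    using m Ulaw_cases[of b x y] Vlaw_cases[of b x y]
    unfolding par_pi1_iff(2)[OF mu_curve[OF assms]] par_pi2_iff(2)[OF mu_curve[OF assms]] isadd_def law_eqs_def by blast+
  show "par (law b b' x y) (mu c x y)" by (rule isadd_law_par[OF m])
qed

lemma mu_ne0: "x \<in> curve c \<Longrightarrow> y \<in> curve c \<Longrightarrow> mu c x y \<noteq> (\<lambda>_. 0)"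
  using mu_curve[of x y] cv_ne0 by (simp add: curve_eq)

lemma mu_nz: "nowhere_zero (mu c)"
  by (simp add: nowhere_zero_def mu_ne0)

lemma O_curve: "pt_O \<in> curve c" using pt_O_cv by (simp add: curve_eq)

lemma law_at_O:
  "Ulaw False z pt_O = pair (z 0) (z 1)" "Ulaw True z pt_O = pair (z 3) (z 2)"
  "Vlaw False z pt_O = pair (z 0) (z 3)" "Vlaw True z pt_O = pair (z 1) (z 2)"
  by (simp_all add: Ulaw_def Vlaw_def law_defs pt_O_def fun2_eq)

lemma eval_lin_comb:
  "eval_tuple (lin_comb a B) x y i = (\<Sum>j<length B. to_ac (a j) * eval_tuple (B ! j) x y i)"
  unfolding eval_tuple_eq lin_comb_def ring_hom_map_sum[OF ev_to_ac] by (simp add: ev_to_ac_simps)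

lemma eval_diff: "eval_tuple (\<lambda>i. p i - q i) x y i = eval_tuple p x y i - eval_tuple q x y i"
  by (simp add: eval_tuple_eq ev_to_ac_simps)

lemma lin_comb_in_law_space:
  assumes ne: "nowhere_zero \<phi>"
    and B: "\<And>j. j < length B \<Longrightarrow> B ! j \<in> law_space c d \<phi>"
  shows "lin_comb a B \<in> law_space c d \<phi>"
  unfolding law_space_iff[OF ne]
proof (intro conjI allI ballI)
  have Bj: "bihomogeneous d d ((B ! j) i)" "x \<in> curve c \<Longrightarrow> y \<in> curve c \<Longrightarrow> par (eval_tuple (B ! j) x y) (\<phi> x y)"
    if "j < length B" for j i x y
    using B[OF that] unfolding law_space_iff[OF ne] by blast+
  show "bihomogeneous d d (lin_comb a B i)" for i
    unfolding lin_comb_def by (intro bihomogeneous_sum bihomogeneous_scalar_mult Bj(1)) simp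
  fix x y assume xy: "x \<in> curve c" "y \<in> curve c"
  have "(\<Sum>j<length B. to_ac (a j) * eval_tuple (B ! j) x y i) * \<phi> x y k =
      (\<Sum>j<length B. to_ac (a j) * eval_tuple (B ! j) x y k) * \<phi> x y i" for i k
    unfolding sum_distrib_right
    by (rule sum.cong[OF refl]) (use Bj(2)[OF _ xy] in \<open>simp add: par_def mult.assoc\<close>)
  then show "par (eval_tuple (lin_comb a B) x y) (\<phi> x y)" by (simp add: par_def eval_lin_comb)
qed

lemma diff_in_law_space:
  assumes ne: "nowhere_zero \<phi>"
    and "p \<in> law_space c d \<phi>" "q \<in> law_space c d \<phi>"
  shows "(\<lambda>i. p i - q i) \<in> law_space c d \<phi>"
  using assms(2,3) unfolding law_space_iff[OF ne]
  by (auto intro!: bihomogeneous_diff simp: par_def eval_diff left_diff_distrib)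

text \<open>Reduces the comparison of laws to E x O, and there to points with X0 nonzero: by
  \<open>special_O\<close> the other points of the curve are multiples of T.\<close>

lemma restriction_zero_imp_zero_tuple:
  assumes ne: "nowhere_zero \<phi>"
    and d: "d > 0" and p: "p \<in> law_space c d \<phi>" and e: "e \<in> law_space c d \<phi>"
    and e0: "\<And>x y. x \<in> curve c \<Longrightarrow> y \<in> curve c \<Longrightarrow> \<not> special x y \<Longrightarrow> eval_tuple e x y \<noteq> (\<lambda>_. 0)"
    and p0: "\<And>z i. z \<in> curve c \<Longrightarrow> z 0 \<noteq> 0 \<Longrightarrow> eval_tuple p z pt_O i = 0"
  shows "zero_tuple c p"
  unfolding zero_tuple_iff eval_tuple_def
proof (intro ballI allI)
  fix x y i assume "x \<in> curve c" "y \<in> curve c"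
  then have xy: "x \<in> cv (to_ac c)" "y \<in> cv (to_ac c)" by (simp_all add: curve_eq)
  note P = p[unfolded law_space_iff[OF ne]] and E = e[unfolded law_space_iff[OF ne]]
  show "peval (base_change (p i)) (case_sum x y) = 0"
  proof (rule law_vanishes[OF d, of "\<lambda>i. base_change (p i)" "\<lambda>i. base_change (e i)", OF _ _ _ _ _ xy])
    show "bihomogeneous d d (base_change (p i))" "bihomogeneous d d (base_change (e i))" for i
      using P E bihomogeneous_base_change by blast+
    show "peval (base_change (p i)) (case_sum x y) * peval (base_change (e j)) (case_sum x y) =
      peval (base_change (p j)) (case_sum x y) * peval (base_change (e i)) (case_sum x y)"
      if "x \<in> cv (to_ac c)" "y \<in> cv (to_ac c)" for x y i j
    proof -
      have "par (eval_tuple p x y) (eval_tuple e x y)"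
      proof (rule par_trans)
        have xy: "x \<in> curve c" "y \<in> curve c" using that by (simp_all add: curve_eq)
        show "par (eval_tuple p x y) (\<phi> x y)" by (rule law_space_par[OF p ne xy])
        show "par (eval_tuple e x y) (\<phi> x y)" by (rule law_space_par[OF e ne xy])
        show "\<phi> x y \<noteq> (\<lambda>_. 0)" by (rule nowhere_zeroD[OF ne xy])
      qed
      then show ?thesis by (simp add: par_def eval_tuple_def)
    qed
    show "\<exists>i. peval (base_change (e i)) (case_sum x y) \<noteq> 0"
      if "x \<in> cv (to_ac c)" "y \<in> cv (to_ac c)" "\<not> special x y" for x y
    proof (rule ccontr)
      assume "\<nexists>i. peval (base_change (e i)) (case_sum x y) \<noteq> 0"
      then have "eval_tuple e x y = (\<lambda>_. 0)" by (simp add: eval_tuple_def)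
      then show False using e0 that by (simp add: curve_eq)
    qed
    show "peval (base_change (p i)) (case_sum z pt_O) = 0" if "z \<in> cv (to_ac c)" "\<not> special z pt_O" for z i
      using p0[of z i] special_O[OF that(1)] that by (auto simp: curve_eq eval_tuple_def)
  qed
qed

text \<open>Restriction to the second argument O; the coefficients stay in the ground field.\<close>

definition at_O :: "(4 + 4, 'k) mpol \<Rightarrow> (4, 'k) mpol" where
  "at_O f = evh scalar (case_sum indet (\<lambda>j. scalar (pt_O j))) f"

lemma evh_at_O: "evh to_ac x (at_O f) = evh to_ac (case_sum x pt_O) f"
proof -
  have "(\<lambda>v. evh to_ac x (case_sum indet (\<lambda>j. scalar (pt_O j)) v)) = case_sum x pt_O"
  proof
    have O: "to_ac (pt_O j) = (pt_O j :: 'k alg_closure)" for j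
      by (simp add: pt_O_def quadruple_def)
    fix v show "evh to_ac x (case_sum indet (\<lambda>j. scalar (pt_O j)) v) = case_sum x pt_O v"
      by (cases v) (simp_all add: ev_to_ac_simps O)
  qed
  then show ?thesis unfolding at_O_def evh_subst[OF ring_hom_map_to_ac] by simp
qed

lemma homogeneous_at_O: "bihomogeneous d d f \<Longrightarrow> homogeneous d (at_O f)"
  unfolding at_O_def
  using bihomogeneous_subst[OF _ homogeneous_indet homogeneous_scalar, of d d f "\<lambda>i. i" "\<lambda>j. pt_O j"]
  by simp

abbreviation BU :: "(2 \<Rightarrow> (4 + 4, 'k) mpol) list" where "BU \<equiv> [Ulaw False XX YY, Ulaw True XX YY]"
abbreviation BV :: "(2 \<Rightarrow> (4 + 4, 'k) mpol) list" where "BV \<equiv> [Vlaw False XX YY, Vlaw True XX YY]"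
abbreviation SU where "SU \<equiv> law_space c 1 (\<lambda>P Q. pi1 (mu c P Q))"
abbreviation SV where "SV \<equiv> law_space c 1 (\<lambda>P Q. pi2 (mu c P Q))"

lemma neU: "nowhere_zero (\<lambda>P Q. pi1 (mu c P Q))"
  unfolding nowhere_zero_def using par_pi1_iff(1) mu_curve by blast

lemma neV: "nowhere_zero (\<lambda>P Q. pi2 (mu c P Q))"
  unfolding nowhere_zero_def using par_pi2_iff(1) mu_curve by blast

lemma Ulaw_SU: "Ulaw b XX YY \<in> SU"
  unfolding law_space_iff[OF neU] using bihomogeneous_Ulaw law_par_mu(1)
  by (auto simp: eval_laws)
lemma Vlaw_SV: "Vlaw b XX YY \<in> SV"
  unfolding law_space_iff[OF neV] using bihomogeneous_Vlaw law_par_mu(2)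
  by (auto simp: eval_laws)

lemma linear_at_O:
  assumes "bihomogeneous 1 1 f"
  obtains t :: "4 \<Rightarrow> 'k" where "\<And>x. evh to_ac (case_sum x pt_O) f =
    to_ac (t 0) * x 0 + to_ac (t 1) * x 1 + to_ac (t 2) * x 2 + to_ac (t 3) * x 3"
proof -
  obtain t :: "4 \<Rightarrow> 'k" where "\<And>(h :: 'k \<Rightarrow> 'k alg_closure) x. ring_hom_map h \<Longrightarrow>
    evh h x (at_O f) = h (t 0) * x 0 + h (t 1) * x 1 + h (t 2) * x 2 + h (t 3) * x 3"
    using linear_form[OF homogeneous_at_O[OF assms], where ?'b = "'k alg_closure"] by blast
  from this[OF ring_hom_map_to_ac, unfolded evh_at_O] show ?thesis by (rule that)
qed

lemma sum_upto_2: "(\<Sum>j<length [p, q]. f j) = f 0 + f (Suc 0)"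
  by (simp add: lessThan_Suc add.commute)

lemma spans_U: "spans_mod c SU BU"
  unfolding spans_mod_def
proof (intro conjI allI ballI)
  show lc: "lin_comb a BU \<in> SU" for a
    by (rule lin_comb_in_law_space[OF neU]) (auto simp: less_Suc_eq Ulaw_SU simp del: One_nat_def)
  fix p assume p: "p \<in> SU"
  note P = p[unfolded law_space_iff[OF neU]]
  have b: "bihomogeneous 1 1 (p i)" for i using P by blast
  obtain t0 :: "4 \<Rightarrow> 'k" where t0: "\<And>x. eval_tuple p x pt_O 0 =
    to_ac (t0 0) * x 0 + to_ac (t0 1) * x 1 + to_ac (t0 2) * x 2 + to_ac (t0 3) * x 3"
    unfolding eval_tuple_eq using linear_at_O[OF b[of 0]] by blast
  obtain t1 :: "4 \<Rightarrow> 'k" where t1: "\<And>x. eval_tuple p x pt_O 1 =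
    to_ac (t1 0) * x 0 + to_ac (t1 1) * x 1 + to_ac (t1 2) * x 2 + to_ac (t1 3) * x 3"
    unfolding eval_tuple_eq using linear_at_O[OF b[of 1]] by blast
  have pU: "eval_tuple p x pt_O 0 * x 1 = eval_tuple p x pt_O 1 * x 0" if x: "x \<in> curve c" for x
  proof -
    have "par (eval_tuple p x pt_O) (Ulaw False x pt_O)"
    proof (rule par_trans)
      show "par (eval_tuple p x pt_O) (pi1 (mu c x pt_O))" by (rule law_space_par[OF p neU x O_curve])
    qed (rule law_par_mu(1)[OF x O_curve] nowhere_zeroD[OF neU x O_curve])+
    then have "eval_tuple p x pt_O 0 * Ulaw False x pt_O 1 = eval_tuple p x pt_O 1 * Ulaw False x pt_O 0"
      unfolding par_def by blast
    then show ?thesis by (simp add: law_at_O)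
  qed
  have "(to_ac (t0 0) + to_ac (t0 1) * u + to_ac (t0 2) * (u * v) + to_ac (t0 3) * v) * u =
      to_ac (t1 0) + to_ac (t1 1) * u + to_ac (t1 2) * (u * v) + to_ac (t1 3) * v"
    if "chart u v \<in> cv (to_ac c)" for u v
    using pU[of "chart u v"] that by (simp add: t0 t1 curve_eq)
  from linear_law_u[OF this]
  have e: "t0 1 = 0" "t0 2 = 0" "t1 0 = 0" "t1 3 = 0" "t1 1 = t0 0" "t1 2 = t0 3" by simp_all
  \<comment> \<open>On E x O the basis elements restrict to (X0, X1) and (X3, X2), so their
    multipliers are the coefficients of X0 and X3 in the first entry.\<close>
  define a where "a j = (if j = (0::nat) then t0 0 else t0 3)" for j
  have "zero_tuple c (\<lambda>i. p i - lin_comb a BU i)"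
  proof (rule restriction_zero_imp_zero_tuple[OF neU, where d = 1 and e = "Ulaw False XX YY"])
    show "(\<lambda>i. p i - lin_comb a BU i) \<in> SU" by (rule diff_in_law_space[OF neU p lc])
    show "Ulaw False XX YY \<in> SU" by (rule Ulaw_SU)
    show "eval_tuple (Ulaw False XX YY) x y \<noteq> (\<lambda>_. 0)"
      if "x \<in> curve c" "y \<in> curve c" "\<not> special x y" for x y
      using law_zero(1)[of x y] that unfolding eval_laws by (auto simp: Ulaw_def curve_eq)
    show "eval_tuple (\<lambda>i. p i - lin_comb a BU i) z pt_O i = 0" for z i
    proof -
      have "\<forall>i. eval_tuple (\<lambda>i. p i - lin_comb a BU i) z pt_O i = 0"
        unfolding all2 eval_diff eval_lin_comb sum_upto_2 by (simp add: t0 t1 e eval_laws law_at_O a_def)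
      then show ?thesis by blast
    qed
  qed simp_all
  then show "\<exists>a. zero_tuple c (\<lambda>i. p i - lin_comb a BU i)" by blast
qed

lemma spans_V: "spans_mod c SV BV"
  unfolding spans_mod_def
proof (intro conjI allI ballI)
  show lc: "lin_comb a BV \<in> SV" for a
    by (rule lin_comb_in_law_space[OF neV]) (auto simp: less_Suc_eq Vlaw_SV simp del: One_nat_def)
  fix p assume p: "p \<in> SV"
  note P = p[unfolded law_space_iff[OF neV]]
  have b: "bihomogeneous 1 1 (p i)" for i using P by blast
  obtain t0 :: "4 \<Rightarrow> 'k" where t0: "\<And>x. eval_tuple p x pt_O 0 =
    to_ac (t0 0) * x 0 + to_ac (t0 1) * x 1 + to_ac (t0 2) * x 2 + to_ac (t0 3) * x 3"
    unfolding eval_tuple_eq using linear_at_O[OF b[of 0]] by blast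
  obtain t1 :: "4 \<Rightarrow> 'k" where t1: "\<And>x. eval_tuple p x pt_O 1 =
    to_ac (t1 0) * x 0 + to_ac (t1 1) * x 1 + to_ac (t1 2) * x 2 + to_ac (t1 3) * x 3"
    unfolding eval_tuple_eq using linear_at_O[OF b[of 1]] by blast
  have pV: "eval_tuple p x pt_O 0 * x 3 = eval_tuple p x pt_O 1 * x 0" if x: "x \<in> curve c" for x
  proof -
    have "par (eval_tuple p x pt_O) (Vlaw False x pt_O)"
    proof (rule par_trans)
      show "par (eval_tuple p x pt_O) (pi2 (mu c x pt_O))" by (rule law_space_par[OF p neV x O_curve])
    qed (rule law_par_mu(2)[OF x O_curve] nowhere_zeroD[OF neV x O_curve])+
    then have "eval_tuple p x pt_O 0 * Vlaw False x pt_O 1 = eval_tuple p x pt_O 1 * Vlaw False x pt_O 0"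
      unfolding par_def by blast
    then show ?thesis by (simp add: law_at_O)
  qed
  \<comment> \<open>Exchanging X1 and X3 exchanges u and v and turns the second projection into the
    first, so \<open>linear_law_u\<close> applies to the mirrored chart.\<close>
  have "(to_ac (t0 0) + to_ac (t0 3) * u + to_ac (t0 2) * (u * v) + to_ac (t0 1) * v) * u =
      to_ac (t1 0) + to_ac (t1 3) * u + to_ac (t1 2) * (u * v) + to_ac (t1 1) * v"
    if "chart u v \<in> cv (to_ac c)" for u v
  proof -
    have "chart v u \<in> curve c" using that chart_swap by (simp add: curve_eq)
    then show ?thesis using pV[of "chart v u"] by (simp add: t0 t1 algebra_simps)
  qed
  from linear_law_u[OF this]
  have e: "t0 3 = 0" "t0 2 = 0" "t1 0 = 0" "t1 1 = 0" "t1 3 = t0 0" "t1 2 = t0 1" by simp_all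
  define a where "a j = (if j = (0::nat) then t0 0 else t0 1)" for j
  have "zero_tuple c (\<lambda>i. p i - lin_comb a BV i)"
  proof (rule restriction_zero_imp_zero_tuple[OF neV, where d = 1 and e = "Vlaw False XX YY"])
    show "(\<lambda>i. p i - lin_comb a BV i) \<in> SV" by (rule diff_in_law_space[OF neV p lc])
    show "Vlaw False XX YY \<in> SV" by (rule Vlaw_SV)
    show "eval_tuple (Vlaw False XX YY) x y \<noteq> (\<lambda>_. 0)"
      if "x \<in> curve c" "y \<in> curve c" "\<not> special x y" for x y
      using law_zero(3)[of x y] that unfolding eval_laws by (auto simp: Vlaw_def curve_eq)
    show "eval_tuple (\<lambda>i. p i - lin_comb a BV i) z pt_O i = 0" for z i
    proof -
      have "\<forall>i. eval_tuple (\<lambda>i. p i - lin_comb a BV i) z pt_O i = 0"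
        unfolding all2 eval_diff eval_lin_comb sum_upto_2 by (simp add: t0 t1 e eval_laws law_at_O a_def)
      then show ?thesis by blast
    qed
  qed simp_all
  then show "\<exists>a. zero_tuple c (\<lambda>i. p i - lin_comb a BV i)" by blast
qed

lemma rot_O_curve: "rot pt_O \<in> curve c" "rot (rot pt_O) \<in> curve c" "rot (rot (rot pt_O)) \<in> curve c"
  using pt_O_cv by (simp_all add: curve_eq cv_rot)

lemma basis_U: "basis_mod c SU BU"
  unfolding basis_mod_def
proof (intro conjI allI impI)
  fix a j assume z: "zero_tuple c (lin_comb a BU)" and j: "j < length BU"
  have *: "to_ac (a 0) * x 0 + to_ac (a (Suc 0)) * x 3 = 0" if "x \<in> curve c" for x
  proof -
    have "eval_tuple (lin_comb a BU) x pt_O 0 = 0" using z that O_curve unfolding zero_tuple_iff by blast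
    then show ?thesis unfolding eval_lin_comb sum_upto_2 by (simp add: eval_laws law_at_O)
  qed
  \<comment> \<open>T and 3 T are tested because exactly one of X0, X3 vanishes at each of
    them.\<close>
  have "a 0 = 0" using *[OF rot_O_curve(1)] by (simp add: pt_O_def)
  moreover have "a (Suc 0) = 0" using *[OF rot_O_curve(3)] by (simp add: pt_O_def)
  ultimately show "a j = 0" using j by (auto simp: less_Suc_eq)
qed (rule spans_U)

lemma basis_V: "basis_mod c SV BV"
  unfolding basis_mod_def
proof (intro conjI allI impI)
  fix a j assume z: "zero_tuple c (lin_comb a BV)" and j: "j < length BV"
  have *: "to_ac (a 0) * x 0 + to_ac (a (Suc 0)) * x 1 = 0" if "x \<in> curve c" for x
  proof -
    have "eval_tuple (lin_comb a BV) x pt_O 0 = 0" using z that O_curve unfolding zero_tuple_iff by blast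
    then show ?thesis unfolding eval_lin_comb sum_upto_2 by (simp add: eval_laws law_at_O)
  qed
  have "a 0 = 0" using *[OF O_curve] by (simp add: pt_O_def)
  moreover have "a (Suc 0) = 0" using *[OF rot_O_curve(2)] by (simp add: pt_O_def)
  ultimately show "a j = 0" using j by (auto simp: less_Suc_eq)
qed (rule spans_V)

lemma eval_skew_segre: "eval_tuple (skew_segre p q) x y = skew_segre (eval_tuple p x y) (eval_tuple q x y)"
  by (simp add: fun4_eq eval_tuple_eq ev_to_ac_simps)

lemma bihomogeneous_skew_segre:
  assumes "\<And>i. bihomogeneous 1 1 (p i)" "\<And>i. bihomogeneous 1 1 (q i)"
  shows "bihomogeneous 2 2 (skew_segre p q i)"
proof -
  have "\<forall>i. bihomogeneous (1 + 1) (1 + 1) (skew_segre p q i)"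
    unfolding all4 skew_segre_simps by (intro conjI bihomogeneous_mult assms)
  then show ?thesis by (simp add: numeral_2_eq_2)
qed

lemma skew_segre_law_space:
  assumes "p \<in> SU" "q \<in> SV"
  shows "skew_segre p q \<in> law_space c 2 (mu c)"
  unfolding law_space_iff[OF mu_nz]
proof (intro conjI allI ballI)
  note P = assms(1)[unfolded law_space_iff[OF neU]]
    and Q = assms(2)[unfolded law_space_iff[OF neV]]
  show "bihomogeneous 2 2 (skew_segre p q i)" for i
    using P Q by (intro bihomogeneous_skew_segre) simp_all
  fix x y assume xy: "x \<in> curve c" "y \<in> curve c"
  have "par (eval_tuple p x y) (pi1 (mu c x y))" "par (eval_tuple q x y) (pi2 (mu c x y))"
    using P Q xy by blast+
  then have s: "eval_tuple p x y 0 * mu c x y 1 = eval_tuple p x y 1 * mu c x y 0"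
    "eval_tuple p x y 0 * mu c x y 2 = eval_tuple p x y 1 * mu c x y 3"
    and t: "eval_tuple q x y 0 * mu c x y 3 = eval_tuple q x y 1 * mu c x y 0"
    "eval_tuple q x y 0 * mu c x y 2 = eval_tuple q x y 1 * mu c x y 1"
    using par_pi1_iff(2)[OF mu_curve[OF xy]] par_pi2_iff(2)[OF mu_curve[OF xy]] by blast+
  show "par (eval_tuple (skew_segre p q) x y) (mu c x y)"
    unfolding eval_skew_segre par_def all4 skew_segre_simps
    by (intro conjI refl; rule segre_aux[OF s t] segre_aux[OF s t, symmetric])
qed

text \<open>Irreducibility of E x E from that of E: \<open>I_prime\<close> first provides a common
  second argument, and then a common first one.\<close>

lemma product_nonvanishing:
  assumes f: "bihomogeneous a b f" "x \<in> curve c" "y \<in> curve c" "peval f (case_sum x y) \<noteq> 0"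
    and g: "bihomogeneous a' b' g" "x' \<in> curve c" "y' \<in> curve c" "peval g (case_sum x' y') \<noteq> 0"
  obtains X' Y' where "X' \<in> curve c" "Y' \<in> curve c" "peval f (case_sum X' Y') \<noteq> 0" "peval g (case_sum X' Y') \<noteq> 0"
proof -
  define L where "L f x = evh scalar (case_sum (\<lambda>j. scalar (x j)) indet) f" for f :: "(4 + 4, 'k alg_closure) mpol" and x
  define R where "R f y = evh scalar (case_sum indet (\<lambda>j. scalar (y j))) f" for f :: "(4 + 4, 'k alg_closure) mpol" and y
  have L: "peval (L f x) y = peval f (case_sum x y)" and R: "peval (R f y) x = peval f (case_sum x y)" for f x y
  proof -
    have "(\<lambda>v. evh (\<lambda>a. a) y (case_sum (\<lambda>j. scalar (x j)) indet v)) = case_sum x y"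
      "(\<lambda>v. evh (\<lambda>a. a) x (case_sum indet (\<lambda>j. scalar (y j)) v)) = case_sum x y"
      by (rule ext, simp add: peval_eq_evh[symmetric] peval_simps split: sum.split)+
    then show "peval (L f x) y = peval f (case_sum x y)" "peval (R f y) x = peval f (case_sum x y)"
      unfolding L_def R_def peval_eq_evh evh_subst[OF ring_hom_map_id] by simp_all
  qed
  have hL: "homogeneous (a * 0 + b * 1) (L f x)" and hR: "homogeneous (a * 1 + b * 0) (R f y)"
    if "bihomogeneous a b f" for a b f x y
    unfolding L_def R_def by (rule bihomogeneous_subst[OF that homogeneous_scalar homogeneous_indet],
        rule bihomogeneous_subst[OF that homogeneous_indet homogeneous_scalar])
  have nI: "h \<notin> I" if "peval h w \<noteq> 0" "w \<in> curve c" for h w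
    using that by (auto simp: I_iff curve_eq)
  have "L f x * L g x' \<notin> I"
    using I_prime[OF hL[OF f(1)] hL[OF g(1)]] nI[of "L f x" y] nI[of "L g x'" y'] f g by (auto simp: L)
  then obtain w where w: "w \<in> curve c" "peval f (case_sum x w) \<noteq> 0" "peval g (case_sum x' w) \<noteq> 0"
    by (auto simp: I_iff peval_simps L curve_eq)
  have "R f w * R g w \<notin> I"
    using I_prime[OF hR[OF f(1)] hR[OF g(1)]] nI[of "R f w" x] nI[of "R g w" x'] f g w by (auto simp: R)
  then obtain v where "v \<in> curve c" "peval f (case_sum v w) \<noteq> 0" "peval g (case_sum v w) \<noteq> 0"
    by (auto simp: I_iff peval_simps R curve_eq)
  then show ?thesis using that w(1) by blast
qed

lemma skew_segre_addition_law:
  assumes p: "p \<in> SU" "\<not> zero_tuple c p" and q: "q \<in> SV" "\<not> zero_tuple c q"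
  shows "addition_law c 2 (mu c) (skew_segre p q)"
  unfolding addition_law_iff[OF mu_nz]
proof
  show "skew_segre p q \<in> law_space c 2 (mu c)" by (rule skew_segre_law_space[OF p(1) q(1)])
  obtain x y i where i: "x \<in> curve c" "y \<in> curve c" "peval (base_change (p i)) (case_sum x y) \<noteq> 0"
    using p(2) unfolding zero_tuple_iff eval_tuple_def by blast
  obtain x' y' j where j: "x' \<in> curve c" "y' \<in> curve c" "peval (base_change (q j)) (case_sum x' y') \<noteq> 0"
    using q(2) unfolding zero_tuple_iff eval_tuple_def by blast
  have b: "bihomogeneous 1 1 (base_change (p i))" "bihomogeneous 1 1 (base_change (q j))"
    using p(1) q(1) bihomogeneous_base_change
    unfolding law_space_iff[OF neU] law_space_iff[OF neV] by blast+
  obtain v w where vw: "v \<in> curve c" "w \<in> curve c" "eval_tuple p v w i \<noteq> 0" "eval_tuple q v w j \<noteq> 0"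
    unfolding eval_tuple_def using product_nonvanishing[OF b(1) i b(2) j] .
  have "\<exists>k. skew_segre (eval_tuple p v w) (eval_tuple q v w) k \<noteq> 0"
  proof -
    have "eval_tuple p v w \<noteq> (\<lambda>_. 0)" "eval_tuple q v w \<noteq> (\<lambda>_. 0)" using vw by metis+
    then have "skew_segre (eval_tuple p v w) (eval_tuple q v w) \<noteq> (\<lambda>_. 0)" by (simp add: segre_ne0)
    then show ?thesis by (metis ext)
  qed
  then show "\<not> zero_tuple c (skew_segre p q)"
    unfolding zero_tuple_iff using vw(1,2) by (metis eval_skew_segre)
qed

lemma spans_law2:
  "spans_mod c (law_space c 2 (mu c))
    [law False False XX YY, law False True XX YY, law True False XX YY, law True True XX YY]"
    (is "spans_mod c ?S ?B")
  unfolding spans_mod_def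
proof (intro conjI allI ballI)
  have l: "law b b' XX YY \<in> ?S" for b b'
    unfolding law_def using skew_segre_law_space[OF Ulaw_SU Vlaw_SV] .
  show lc: "lin_comb a ?B \<in> ?S" for a
    by (rule lin_comb_in_law_space[OF mu_nz]) (auto simp: less_Suc_eq l)
  fix p assume p: "p \<in> ?S"
  note P = p[unfolded law_space_iff[OF mu_nz]]
  have pO: "par (eval_tuple q x pt_O) x" if "q \<in> ?S" and x: "x \<in> curve c" for q x
  proof -
    have "isadd (to_ac c) x pt_O x" using isadd_O x by (simp add: curve_eq)
    then have "proj_eq (mu c x pt_O) x" using isadd_unique[OF mu_isadd[OF x O_curve]] by blast
    then have "par x (mu c x pt_O)" using proj_eq_par par_sym by blast
    moreover have "par (eval_tuple q x pt_O) (mu c x pt_O)"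
      using \<open>q \<in> ?S\<close> x O_curve unfolding law_space_iff[OF mu_nz] by blast
    ultimately show ?thesis using par_trans mu_ne0[OF x O_curve] by blast
  qed
  define F where "F h t x = (\<Sum>k\<in>UNIV. x k * (h (t k 0) * x 0 + h (t k 1) * x 1 + h (t k 2) * x 2 + h (t k 3) * x 3))"
    for h :: "'k \<Rightarrow> 'k alg_closure" and t :: "4 \<Rightarrow> 4 \<Rightarrow> 'k" and x
  have "\<exists>t. \<forall>x. eval_tuple p x pt_O i = F to_ac t x" for i
  proof -
    have "homogeneous 2 (at_O (p i))" using P by (intro homogeneous_at_O) simp
    then obtain t where "\<And>h x. ring_hom_map h \<Longrightarrow> evh h x (at_O (p i)) = F h t x"
      unfolding F_def using quadratic_form[where ?'b = "'k alg_closure"] by blast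
    then show ?thesis using ring_hom_map_to_ac unfolding eval_tuple_eq evh_at_O[symmetric] by blast
  qed
  then obtain t where "\<And>i x. eval_tuple p x pt_O i = F to_ac (t i) x" by metis
  note t = this[unfolded F_def]
  \<comment> \<open>Row j, column k collects the coefficient of u^j v^k after substituting the chart
    coordinates (1, u, u v, v) into the quadratic form.\<close>
  define N where "N i = [[t i 0 0, t i 0 3 + t i 3 0, t i 3 3],
    [t i 0 1 + t i 1 0, t i 0 2 + t i 2 0 + t i 1 3 + t i 3 1, t i 2 3 + t i 3 2],
    [t i 1 1, t i 1 2 + t i 2 1, t i 2 2]]" for i
  define n where "n i = (\<lambda>j k. to_ac (N i ! j ! k))" for i
  define q where "q \<equiv> \<lambda>(n :: nat \<Rightarrow> nat \<Rightarrow> 'k alg_closure) u v. (n 0 0 + n 1 0 * u + n 2 0 * (u * u)) + (n 0 1 + n 1 1 * u + n 2 1 * (u * u)) * v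
    + (n 0 2 + n 1 2 * u + n 2 2 * (u * u)) * (v * v)"
  have ev: "eval_tuple p (chart u v) pt_O i = q (n i) u v" for u v i
    unfolding t sum4 q_def n_def N_def by (simp add: algebra_simps)
  have par: "eval_tuple p (chart u v) pt_O 0 * chart u v j = eval_tuple p (chart u v) pt_O j * chart u v 0"
    if "chart u v \<in> cv (to_ac c)" for u v j
    using pO[OF p, of "chart u v"] that unfolding curve_eq par_def by (elim meta_impE) (assumption, blast)
  have lin: "q (n 0) u v = (n 0 0 0 + n 0 2 2) + n 0 1 0 * u + (n 0 1 1 + to_ac c * n 0 2 2) * (u * v) + n 0 0 1 * v"
    if "chart u v \<in> cv (to_ac c)" for u v
  proof -
    have "q (n 0) u v * u = q (n 1) u v" "q (n 0) u v * v = q (n 3) u v"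
      if "chart u v \<in> cv (to_ac c)" for u v
      using par[OF that, of 1] par[OF that, of 3] by (simp_all add: ev)
    note e = this[unfolded q_def]
    show ?thesis
      unfolding q_def by (rule quadratic_law[where n = "n 0" and m = "n 1" and m' = "n 3", OF e that])
  qed
  define l0 l1 l2 l3 where "l0 = N 0 ! 0 ! 0 + N 0 ! 2 ! 2" and "l1 = N 0 ! 1 ! 0"
    and "l2 = N 0 ! 1 ! 1 + c * N 0 ! 2 ! 2" and "l3 = N 0 ! 0 ! 1"
  \<comment> \<open>On E x O the first entries of the four laws are z0 z0, z0 z1, z0 z3, z0 z2 in
    the order of the list; hence \<open>l3\<close> precedes \<open>l2\<close>.\<close>
  define a where "a j = [l0, l1, l3, l2] ! j" for j
  define p' where "p' = (\<lambda>i. p i - lin_comb a ?B i)"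
  have p': "p' \<in> ?S" unfolding p'_def by (rule diff_in_law_space[OF mu_nz p lc])
  have "zero_tuple c p'"
  proof (rule restriction_zero_imp_zero_tuple[OF mu_nz _ p' l[of False False]])
    show "eval_tuple (law False False XX YY) x y \<noteq> (\<lambda>_. 0)"
      if "x \<in> curve c" "y \<in> curve c" "\<not> special x y" for x y
      using law_zero_special[of x y False False] that by (auto simp: eval_laws curve_eq)
    fix z i assume z: "z \<in> curve c" "z 0 \<noteq> 0"
    have zc: "z \<in> cv (to_ac c)" using z by (simp add: curve_eq)
    have zz: "z = (\<lambda>i. z 0 * chart (z 1 / z 0) (z 3 / z 0) i)"
      using cv_chart(1)[OF zc z(2)] by (intro ext) blast
    have ch: "chart (z 1 / z 0) (z 3 / z 0) \<in> cv (to_ac c)" by (rule cv_chart(2)[OF zc z(2)])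
    have bp: "bihomogeneous 2 2 (p 0)" using P by blast
    have "(\<lambda>i. 1 * pt_O i) = (pt_O :: 4 \<Rightarrow> 'k alg_closure)" by simp
    then have "eval_tuple p z pt_O 0 = z 0 ^ 2 * eval_tuple p (chart (z 1 / z 0) (z 3 / z 0)) pt_O 0"
      unfolding eval_tuple_eq
      using bihomogeneous_scale[OF bp ring_hom_map_to_ac, of "z 0" "chart (z 1 / z 0) (z 3 / z 0)" 1 pt_O] zz
      by simp
    also have "\<dots> = z 0 * (to_ac l0 * z 0 + to_ac l1 * z 1 + to_ac l2 * (z 0 * ((z 1 / z 0) * (z 3 / z 0))) + to_ac l3 * z 3)"
      unfolding ev lin[OF ch] using z(2)
      by (simp add: n_def l0_def l1_def l2_def l3_def power2_eq_square algebra_simps)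
    also have "z 0 * ((z 1 / z 0) * (z 3 / z 0)) = z 2" using cvD(2)[OF zc] z(2) by (simp add: field_simps)
    finally have e0: "eval_tuple p z pt_O 0 = z 0 * (to_ac l0 * z 0 + to_ac l1 * z 1 + to_ac l2 * z 2 + to_ac l3 * z 3)" .
    have s4: "(\<Sum>j<length [b0, b1, b2, b3]. f j) = f 0 + f 1 + f 2 + f 3" for f :: "nat \<Rightarrow> 'k alg_closure" and b0 b1 b2 b3 :: 'z
      by (simp add: eval_nat_numeral lessThan_Suc add_ac)
    have at: "law False False z pt_O 0 = z 0 * z 0" "law False True z pt_O 0 = z 1 * z 0"
      "law True False z pt_O 0 = z 3 * z 0" "law True True z pt_O 0 = z 2 * z 0"
      using cvD(2)[OF zc] by (simp_all add: law_def law_at_O mult.commute)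
    have "eval_tuple (lin_comb a ?B) z pt_O 0 = eval_tuple p z pt_O 0"
      unfolding eval_lin_comb s4 e0 by (simp add: eval_laws at a_def algebra_simps)
    then have 0: "eval_tuple p' z pt_O 0 = 0" unfolding p'_def eval_diff by simp
    \<comment> \<open>On E x O a law is proportional to z, so for nonzero z0 its first entry decides
      about all of them.\<close>
    have "eval_tuple p' z pt_O 0 * z i = eval_tuple p' z pt_O i * z 0"
      using pO[OF p' z(1)] unfolding par_def by blast
    then show "eval_tuple p' z pt_O i = 0" using 0 z(2) by simp
  qed simp
  then show "\<exists>a. zero_tuple c (\<lambda>i. p i - lin_comb a ?B i)" unfolding p'_def by blast
qed

end

section \<open>Exceptional divisors\<close>

context z4_curve
begin

abbreviation E where "E \<equiv> ideal_EE c"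

lemma E_iff: "f \<in> E \<longleftrightarrow> (\<forall>x\<in>cv (to_ac c). \<forall>y\<in>cv (to_ac c). peval f (case_sum x y) = 0)"
  unfolding ideal_EE_def vanishing_ideal_def curve_eq by blast

definition diagonal_ideal :: "nat \<Rightarrow> (4 + 4, 'k alg_closure) mpol set" where
  "diagonal_ideal n = vanishing_ideal {case_sum x y | x y. x \<in> cv (to_ac c) \<and> y \<in> cv (to_ac c) \<and> par x ((rot ^^ n) y)}"

abbreviation "D \<equiv> diagonal_ideal"

lemma D_iff: "f \<in> D n \<longleftrightarrow>
  (\<forall>x\<in>cv (to_ac c). \<forall>y\<in>cv (to_ac c). par x ((rot ^^ n) y) \<longrightarrow> peval f (case_sum x y) = 0)"
  unfolding diagonal_ideal_def vanishing_ideal_def by blast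

lemma is_ideal_E: "is_ideal E" and is_ideal_D: "is_ideal (D n)"
  unfolding ideal_EE_def diagonal_ideal_def by (rule is_ideal_vanishing_ideal)+

lemma mpol_char2: "(2 :: ('v::finite, 'k alg_closure) mpol) = 0"
proof -
  have "(2 :: ('v, 'k alg_closure) mpol) = scalar 1 + scalar 1" by (simp add: ring_hom_map_simps[OF ring_hom_map_scalar])
  also have "\<dots> = scalar (1 + 1)" by (simp only: ring_hom_map_simps[OF ring_hom_map_scalar])
  finally show ?thesis by (simp add: two ring_hom_map_simps[OF ring_hom_map_scalar])
qed

lemmas mpol_char2_rules = char2_rules[OF mpol_char2]

lemma cv_rot_pow: "(rot ^^ k) x \<in> cv (to_ac c) \<longleftrightarrow> x \<in> cv (to_ac c)"
  by (induction k) (simp_all add: cv_rot)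

lemma rot_pow_hom: "((rot ^^ k) (\<lambda>i. h (F i))) = (\<lambda>i. h ((rot ^^ k) F i))"
  by (induction k) (simp_all add: fun4_eq)

lemma peval_rot:
  "peval ((rot ^^ k) XX i) (case_sum x y) = (rot ^^ k) x i"
  "peval ((rot ^^ k) YY i) (case_sum x y) = (rot ^^ k) y i"
proof -
  have "(\<lambda>i. peval (XX i) (case_sum x y)) = x" "(\<lambda>i. peval (YY i) (case_sum x y)) = y"
    by (simp_all add: XX_def YY_def peval_simps)
  then show "peval ((rot ^^ k) XX i) (case_sum x y) = (rot ^^ k) x i"
    "peval ((rot ^^ k) YY i) (case_sum x y) = (rot ^^ k) y i"
    using rot_pow_hom[of k "\<lambda>p. peval p (case_sum x y)" XX] rot_pow_hom[of k "\<lambda>p. peval p (case_sum x y)" YY]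
    by (simp_all add: fun_eq_iff)
qed

lemma rot_pow_scale: "(rot ^^ k) (\<lambda>i. l * x i) = (\<lambda>i. l * (rot ^^ k) x i)"
  by (rule rot_pow_hom)

lemma par_rot_pow: "par ((rot ^^ k) x) ((rot ^^ k) z) \<longleftrightarrow> par x z"
  by (induction k) (simp_all add: par_rot)

lemma rot_pow_surj: "\<exists>j. z i = (rot ^^ m) z j"
proof (induction m arbitrary: i)
  case (Suc m)
  have "\<forall>i. \<exists>j. w i = rot w j" for w :: "4 \<Rightarrow> 'z"
    unfolding all4 by (metis rot_simps(1-4))
  then show ?case using Suc by (metis funpow.simps(2) comp_apply)
qed auto

lemma rot_pow_4: "(rot ^^ (4 * k)) x = x"
proof -
  have "(rot :: (4 \<Rightarrow> 'z) \<Rightarrow> _) ^^ 4 = id" by (simp add: fun_eq_iff eval_nat_numeral)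
  then show ?thesis by (metis funpow_mult id_apply id_funpow)
qed

text \<open>The homogenised form of ((1 + u) (1 + v))^2 = c u v.\<close>

lemma chart_equation:
  assumes "x \<in> cv (to_ac c)"
  shows "((x 0 + x 1) * (x 0 + x 3)) ^ 2 = to_ac c * (x 0 ^ 3 * x 2)"
proof -
  note x = cvD[OF assms]
  have "(x 0 + x 1) * (x 0 + x 3) = x 0 * x 0 + x 0 * x 3 + x 0 * x 1 + x 1 * x 3"
    by (simp only: expand)
  also have "\<dots> = x 0 * (x 0 + x 1 + x 2 + x 3)" by (simp only: x(2)[symmetric] expand)
  finally have "((x 0 + x 1) * (x 0 + x 3)) ^ 2 = x 0 * x 0 * (x 0 * x 0 + x 1 * x 1 + x 2 * x 2 + x 3 * x 3)"
    unfolding power2_eq_square by (simp only: expand char2)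
  then show ?thesis unfolding x(1) power3_eq_cube by (simp only: mult_ac)
qed

text \<open>In affine terms let the second point be (u + p, v + q), and s = 1 + u, t = 1 + v.
  Subtracting the curve equations at the two points leaves s^2 q^2 + t^2 p^2 + p^2 q^2 on one side
  and c times the difference of the products u v on the other, which is the minor of the indices 0
  and 2.\<close>

lemma diagonal_equation:
  assumes x: "x \<in> cv (to_ac c)" and z: "z \<in> cv (to_ac c)"
  defines "p \<equiv> x 0 * z 1 + x 1 * z 0" and "q \<equiv> x 0 * z 3 + x 3 * z 0"
  shows "p * q = x 0 * z 0 * ((x 1 * z 3 + x 3 * z 1) + (x 0 * z 2 + x 2 * z 0))"
    and "z 0 * z 0 * ((x 0 + x 1) * (x 0 + x 1) * (q * q) + (x 0 + x 3) * (x 0 + x 3) * (p * p)) + (p * q) * (p * q) =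
      to_ac c * (x 0 ^ 3 * z 0 ^ 3) * (x 0 * z 2 + x 2 * z 0)"
proof -
  have "p * q = x 0 * x 0 * (z 1 * z 3) + x 0 * z 0 * (x 1 * z 3 + x 3 * z 1) + (x 1 * x 3) * (z 0 * z 0)"
    unfolding p_def q_def by (simp only: expand)
  also have "\<dots> = x 0 * z 0 * ((x 1 * z 3 + x 3 * z 1) + (x 0 * z 2 + x 2 * z 0))"
    unfolding cvD(2)[OF x, symmetric] cvD(2)[OF z, symmetric] by (simp only: expand)
  finally show "p * q = x 0 * z 0 * ((x 1 * z 3 + x 3 * z 1) + (x 0 * z 2 + x 2 * z 0))" .
  define s t where "s = x 0 + x 1" and "t = x 0 + x 3"
  have st: "x 0 * (z 0 + z 1) = z 0 * s + p" "x 0 * (z 0 + z 3) = z 0 * t + q"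
    unfolding s_def t_def p_def q_def by (simp_all only: expand char2)
  have "z 0 * z 0 * (s * s * (q * q) + t * t * (p * p)) + (p * q) * (p * q)
      = ((z 0 * s + p) * (z 0 * t + q)) ^ 2 + z 0 ^ 4 * (s * t) ^ 2"
    unfolding power2_eq_square power4_eq_xxxx by (simp only: expand char2)
  also have "\<dots> = x 0 ^ 4 * ((z 0 + z 1) * (z 0 + z 3)) ^ 2 + z 0 ^ 4 * (s * t) ^ 2"
    unfolding st[symmetric] by (simp only: power2_eq_square power4_eq_xxxx mult_ac)
  also have "\<dots> = to_ac c * (x 0 ^ 3 * z 0 ^ 3) * (x 0 * z 2 + x 2 * z 0)"
    unfolding s_def t_def chart_equation[OF x] chart_equation[OF z]
    by (simp only: power3_eq_cube power4_eq_xxxx expand)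
  finally show "z 0 * z 0 * ((x 0 + x 1) * (x 0 + x 1) * (q * q) + (x 0 + x 3) * (x 0 + x 3) * (p * p)) + (p * q) * (p * q) =
      to_ac c * (x 0 ^ 3 * z 0 ^ 3) * (x 0 * z 2 + x 2 * z 0)" unfolding s_def t_def .
qed

lemma ideal_mult_gen:
  fixes N :: "'r::comm_ring_1 set"
  assumes N: "is_ideal N" and G: "\<And>a b. a \<in> G \<Longrightarrow> b \<in> G \<Longrightarrow> a * b \<in> N"
    and f: "f \<in> ideal_gen G" and g: "g \<in> ideal_gen G"
  shows "f * g \<in> N"
proof -
  have V: "is_ideal {a. a * b \<in> N}" for b
    using is_idealD[OF N] by (auto simp: is_ideal_def distrib_right mult.assoc)
  have 1: "a * b \<in> N" if "a \<in> ideal_gen G" "b \<in> G" for a b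
    using ideal_gen_minimal[OF V[of b], of G] G that by blast
  have "ideal_gen G \<subseteq> {b. b * f \<in> N}"
    using 1[OF f] by (intro ideal_gen_minimal V) (auto simp: mult.commute)
  then show ?thesis using g by (auto simp: mult.commute)
qed

lemma E_subset_D: "E \<subseteq> D n"
  by (auto simp: E_iff D_iff)

text \<open>All coordinates are rotated k times so that coordinate 0 is nonzero at the point
  considered, and the second point is first translated by n T. Then \<open>mp\<close> and
  \<open>mq\<close> are, up to units, the differences of the affine coordinates, while
  \<open>ma\<close> and \<open>mb\<close> are the entries of the law.\<close>

context
  fixes k n :: nat and x y :: "4 \<Rightarrow> 'k alg_closure"
begin

definition F :: "4 \<Rightarrow> (4 + 4, 'k alg_closure) mpol" where "F = (rot ^^ k) XX"
definition G :: "4 \<Rightarrow> (4 + 4, 'k alg_closure) mpol" where "G = (rot ^^ (k + n)) YY"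
definition P where "P = case_sum x y"

definition mp where "mp = F 0 * G 1 + F 1 * G 0"
definition mq where "mq = F 0 * G 3 + F 3 * G 0"
definition ma where "ma = F 1 * G 3 + F 3 * G 1"
definition mb where "mb = F 0 * G 2 + F 2 * G 0"

lemmas minor_defs = mp_def mq_def ma_def mb_def

context
  assumes x: "x \<in> cv (to_ac c)" and y: "y \<in> cv (to_ac c)" and xy: "par x ((rot ^^ n) y)"
    and x0: "(rot ^^ k) x 0 \<noteq> 0"
begin

lemma peval_FG: "peval (F i) (case_sum u v) = (rot ^^ k) u i" "peval (G i) (case_sum u v) = (rot ^^ (k + n)) v i"
  unfolding F_def G_def by (rule peval_rot)+

lemma F0_ne: "peval (F 0) P \<noteq> 0"
  unfolding P_def peval_FG by (rule x0)

lemma FG_on_diagonal: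
  assumes "par u ((rot ^^ n) v)"
  shows "peval (F i) (case_sum u v) * peval (G j) (case_sum u v) = peval (F j) (case_sum u v) * peval (G i) (case_sum u v)"
proof -
  have "par ((rot ^^ k) u) ((rot ^^ (k + n)) v)" using assms by (simp add: funpow_add par_rot_pow)
  then show ?thesis unfolding peval_FG by (simp add: par_def)
qed

lemma minors_D: "F i * G j + F j * G i \<in> D n"
  unfolding D_iff
proof (intro ballI impI)
  fix u v :: "4 \<Rightarrow> 'k alg_closure" assume "par u ((rot ^^ n) v)"
  then show "peval (F i * G j + F j * G i) (case_sum u v) = 0"
    using FG_on_diagonal[of u v i j] by (simp only: peval_simps char2_sum0[OF two])
qed

lemma G0_ne: "peval (G 0) P \<noteq> 0"
proof
  assume 0: "peval (G 0) P = 0"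
  have "(rot ^^ (k + n)) y j = 0" for j
  proof -
    have "peval (F 0) P * peval (G j) P = 0"
      using FG_on_diagonal[OF xy, of 0 j] 0 by (simp add: P_def)
    then show ?thesis using F0_ne by (simp add: P_def peval_FG)
  qed
  moreover have "(rot ^^ (k + n)) y \<in> cv (to_ac c)" using y by (simp add: cv_rot_pow)
  ultimately show False using cv_ne0 by blast
qed

lemma relations:
  "mp * mq + F 0 * G 0 * (ma + mb) \<in> E"
  "G 0 * G 0 * ((F 0 + F 1) * (F 0 + F 1) * (mq * mq) + (F 0 + F 3) * (F 0 + F 3) * (mp * mp)) + (mp * mq) * (mp * mq)
    + scalar (to_ac c) * (F 0 ^ 3 * G 0 ^ 3) * mb \<in> E"
  unfolding E_iff
proof (safe)
  fix u v assume "u \<in> cv (to_ac c)" "v \<in> cv (to_ac c)"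
  then have c: "(rot ^^ k) u \<in> cv (to_ac c)" "(rot ^^ (k + n)) v \<in> cv (to_ac c)" by (simp_all add: cv_rot_pow)
  show "peval (mp * mq + F 0 * G 0 * (ma + mb)) (case_sum u v) = 0"
    unfolding minor_defs peval_simps peval_FG diagonal_equation(1)[OF c] by (simp only: char2)
  show "peval (G 0 * G 0 * ((F 0 + F 1) * (F 0 + F 1) * (mq * mq) + (F 0 + F 3) * (F 0 + F 3) * (mp * mp)) + (mp * mq) * (mp * mq)
    + scalar (to_ac c) * (F 0 ^ 3 * G 0 ^ 3) * mb) (case_sum u v) = 0"
    unfolding minor_defs peval_simps peval_FG diagonal_equation(2)[OF c] by (simp only: char2)
qed

lemma F0_ma: "F 0 * ma = F 1 * mq + F 3 * mp"
  unfolding minor_defs by (simp only: expand mpol_char2_rules)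

text \<open>A power of \<open>F 0\<close> eliminates from any polynomial all coordinates of the second point except
  \<open>G 0\<close>, modulo the ideal \<open>L\<close>. If what remains vanishes on the diagonal, then its product with
  \<open>F 0 * G 0\<close> vanishes everywhere, because the second point can be replaced by a multiple of the
  first one.\<close>

definition slice :: "(4 + 4, 'k alg_closure) mpol \<Rightarrow> bool" where
  "slice r \<longleftrightarrow> (\<forall>u v v'. (rot ^^ (k + n)) v 0 = (rot ^^ (k + n)) v' 0 \<longrightarrow>
    peval r (case_sum u v) = peval r (case_sum u v'))"

lemma slice_intros:
  shows "slice (scalar a)" "slice (XX i)" "slice (F i)" "slice (G 0)"
    and slice_add: "slice r \<Longrightarrow> slice r' \<Longrightarrow> slice (r + r')"
    and slice_mult: "slice r \<Longrightarrow> slice r' \<Longrightarrow> slice (r * r')"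
    and slice_power: "slice r \<Longrightarrow> slice (r ^ m)"
proof -
  show "slice (scalar a)" "slice (XX i)" "slice (F i)" "slice (G 0)"
    unfolding slice_def XX_def peval_simps peval_FG by simp_all
  show "slice (r + r')" "slice (r * r')" if "slice r" "slice r'"
    using that unfolding slice_def peval_simps by metis+
  show "slice (r ^ m)" if "slice r"
    using that unfolding slice_def peval_simps by metis
qed

definition L where "L = ideal_gen ({mp, mq, mb} \<union> E)"

lemma is_ideal_L: "is_ideal L"
  unfolding L_def by (rule is_ideal_ideal_gen)

lemma L_gens: "mp \<in> L" "mq \<in> L" "mb \<in> L" "f \<in> E \<Longrightarrow> f \<in> L"
  unfolding L_def by (auto intro: ideal_gen_base)

lemma slice_form: "\<exists>m r. slice r \<and> F 0 ^ m * f + r \<in> L"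
proof (induction f rule: mpol_induct)
  case (scalar a)
  have "F 0 ^ 0 * scalar a + scalar a = 0" by (simp only: power_0 mult_1_left mpol_char2_rules)
  then show ?case using slice_intros(1) is_idealD(1)[OF is_ideal_L] by metis
next
  case (indet w)
  show ?case
  proof (cases w)
    case (Inl i)
    have "F 0 ^ 0 * XX i + XX i = 0" by (simp only: power_0 mult_1_left mpol_char2_rules)
    then show ?thesis using slice_intros(2) is_idealD(1)[OF is_ideal_L] Inl unfolding XX_def by metis
  next
    case (Inr i)
    have "\<exists>j. (YY :: 4 \<Rightarrow> (4 + 4, 'k alg_closure) mpol) i = G j"
      unfolding G_def by (rule rot_pow_surj)
    then obtain j where j: "YY i = G j" by blast
    have "F 0 * G j + F j * G 0 \<in> L"
    proof -
      have "\<forall>j. F 0 * G j + F j * G 0 \<in> L"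
        unfolding all4 using L_gens(1-3) is_idealD(1)[OF is_ideal_L] unfolding minor_defs
        by (simp add: mpol_char2_rules)
      then show ?thesis by blast
    qed
    then have "F 0 ^ 1 * indet w + F j * G 0 \<in> L" using j unfolding Inr YY_def by simp
    then show ?thesis using slice_intros(3,4,6) by metis
  qed
next
  case (add f g)
  then obtain m r m' r' where *: "slice r" "F 0 ^ m * f + r \<in> L" "slice r'" "F 0 ^ m' * g + r' \<in> L" by blast
  have "F 0 ^ (m + m') * (f + g) + (F 0 ^ m' * r + F 0 ^ m * r') =
      F 0 ^ m' * (F 0 ^ m * f + r) + F 0 ^ m * (F 0 ^ m' * g + r')"
    by (simp only: power_add expand)
  also have "\<dots> \<in> L" using * is_idealD(2,3)[OF is_ideal_L] by simp
  finally show ?case using * slice_intros by metis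
next
  case (mult f g)
  then obtain m r m' r' where *: "slice r" "F 0 ^ m * f + r \<in> L" "slice r'" "F 0 ^ m' * g + r' \<in> L" by blast
  have "F 0 ^ (m + m') * (f * g) + r * r' = (F 0 ^ m * f + r) * (F 0 ^ m' * g) + r * (F 0 ^ m' * g + r')"
    unfolding power_add by (simp only: expand mpol_char2_rules)
  also have "\<dots> \<in> L" using * is_idealD(2,3,4)[OF is_ideal_L] by simp
  finally show ?case using * slice_intros(6) by metis
qed

lemma D_germ_L:
  assumes f: "f \<in> D n"
  shows "f \<in> germ P L"
proof -
  obtain m r where r: "slice r" "F 0 ^ m * f + r \<in> L" using slice_form by blast
  have "L \<subseteq> D n" unfolding L_def using E_subset_D minors_D unfolding minor_defs
    by (intro ideal_gen_minimal is_ideal_D) auto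
  then have "(F 0 ^ m * f + r) - F 0 ^ m * f \<in> D n"
    using r(2) is_idealD(3)[OF is_ideal_D f] is_idealD(6)[OF is_ideal_D] by blast
  then have rD: "r \<in> D n" by simp
  have "F 0 * G 0 * r \<in> E"
    unfolding E_iff
  proof safe
    fix u v :: "4 \<Rightarrow> 'k alg_closure" assume u: "u \<in> cv (to_ac c)" and v: "v \<in> cv (to_ac c)"
    define l where "l = (rot ^^ (k + n)) v 0 / (rot ^^ k) u 0"
    show "peval (F 0 * G 0 * r) (case_sum u v) = 0"
    proof (cases "l = 0")
      case True
      then show ?thesis by (auto simp: l_def peval_simps peval_FG)
    next
      case False
      \<comment> \<open>v' is the point whose translate by n T has coordinates l u; 3 n rotations
        invert n of them. The factor l makes the coordinates \<open>G 0\<close> of v and v' agree,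
        and these are all that r sees of the second point.\<close>
      define v' where "v' = (\<lambda>i. l * (rot ^^ (3 * n)) u i)"
      have "(rot ^^ n) ((rot ^^ (3 * n)) u) = (rot ^^ (4 * n)) u"
        by (simp add: funpow_add[symmetric, THEN fun_cong, simplified])
      then have v'n: "(rot ^^ n) v' = (\<lambda>i. l * u i)" unfolding v'_def rot_pow_scale rot_pow_4 by simp
      then have v'k: "(rot ^^ (k + n)) v' = (\<lambda>i. l * (rot ^^ k) u i)"
        by (simp add: funpow_add rot_pow_scale)
      have "proj_eq ((rot ^^ (3 * n)) u) v'" using False by (auto simp: proj_eq_def v'_def)
      then have v'c: "v' \<in> cv (to_ac c)" using u cv_proj_eq by (metis cv_rot_pow)
      have "par u ((rot ^^ n) v')" unfolding v'n par_def by (simp add: mult_ac)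
      then have "peval r (case_sum u v') = 0" using rD u v'c by (simp add: D_iff)
      moreover have "(rot ^^ (k + n)) v 0 = (rot ^^ (k + n)) v' 0"
        unfolding v'k using False by (simp add: l_def)
      ultimately have "peval r (case_sum u v) = 0" using r(1) unfolding slice_def by metis
      then show ?thesis by (simp add: peval_simps)
    qed
  qed
  then have "F 0 * G 0 * (F 0 ^ m * f + r) + F 0 * G 0 * r \<in> L"
    using r(2) is_idealD(2,3)[OF is_ideal_L] L_gens(4) by blast
  moreover have "F 0 * G 0 * (F 0 ^ m * f + r) + F 0 * G 0 * r = (F 0 * G 0 * F 0 ^ m) * f"
    by (simp only: expand mpol_char2_rules)
  ultimately have "(F 0 * G 0 * F 0 ^ m) * f \<in> L" by (simp only:)
  then have "(F 0 * G 0 * F 0 ^ m) * f \<in> germ P L" by (rule subsetD[OF germ_superset])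
  moreover have "peval (F 0 * G 0 * F 0 ^ m) P \<noteq> 0" using F0_ne G0_ne by (simp add: peval_simps)
  ultimately show ?thesis using germ_cancel by blast
qed

text \<open>N represents an ideal of the local ring of E x E at the point. It is instantiated later
  by the two germs that are to be compared.\<close>

context
  fixes N assumes N: "is_ideal N" and EN: "E \<subseteq> N"
    and cancel: "\<And>h f. peval h P \<noteq> 0 \<Longrightarrow> h * f \<in> N \<Longrightarrow> f \<in> N"
begin

lemma transfer: "a + b \<in> N \<Longrightarrow> a \<in> N \<Longrightarrow> b \<in> N" for a b
  using is_idealD(6)[OF N, of "a + b" a] by simp

text \<open>The first relation puts p q into N. Multiplying F0 a = F1 q + F3 p by p and q then gives
  F3 p^2 and F1 q^2, and the second relation gives (F0 + F1)^2 q^2 + (F0 + F3)^2 p^2. One of F1, F3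
  is a unit at the point, which yields one of the squares, and the last element yields the
  other.\<close>

lemma squares_of_minors:
  assumes a: "ma \<in> N" and b: "mb \<in> N"
  shows "mp * mq \<in> N" "mp * mp \<in> N" "mq * mq \<in> N"
proof -
  note I = is_idealD[OF N]
  have "F 0 * G 0 * (ma + mb) \<in> N" using a b I(2,3) by blast
  moreover have "F 0 * G 0 * (ma + mb) + mp * mq \<in> N" using relations(1) EN by (auto simp: add.commute)
  ultimately show pq: "mp * mq \<in> N" using transfer by blast
  have "mq * (F 1 * mq + F 3 * mp) \<in> N" "mp * (F 1 * mq + F 3 * mp) \<in> N"
    unfolding F0_ma[symmetric] using a I(3) by blast+
  moreover have "mq * (F 1 * mq + F 3 * mp) = F 3 * (mp * mq) + F 1 * (mq * mq)"
    "mp * (F 1 * mq + F 3 * mp) = F 1 * (mp * mq) + F 3 * (mp * mp)"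
    by (simp_all only: expand)
  ultimately have F1: "F 1 * (mq * mq) \<in> N" and F3: "F 3 * (mp * mp) \<in> N"
    using transfer I(3)[OF pq] by metis+
  have "(mp * mq) * (mp * mq) + scalar (to_ac c) * (F 0 ^ 3 * G 0 ^ 3) * mb \<in> N"
    using I(2)[OF I(3)[OF pq] I(3)[OF b]] .
  moreover have "((mp * mq) * (mp * mq) + scalar (to_ac c) * (F 0 ^ 3 * G 0 ^ 3) * mb) +
      G 0 * G 0 * ((F 0 + F 1) * (F 0 + F 1) * (mq * mq) + (F 0 + F 3) * (F 0 + F 3) * (mp * mp)) \<in> N"
    using relations(2) EN by (auto simp: add_ac)
  ultimately have "G 0 * G 0 * ((F 0 + F 1) * (F 0 + F 1) * (mq * mq) + (F 0 + F 3) * (F 0 + F 3) * (mp * mp)) \<in> N"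
    using transfer by blast
  then have st: "(F 0 + F 1) * (F 0 + F 1) * (mq * mq) + (F 0 + F 3) * (F 0 + F 3) * (mp * mp) \<in> N"
    using cancel[of "G 0 * G 0"] G0_ne by (simp add: peval_simps)
  have sq: "F 0 * F 0 * w = (F 0 + H) * (F 0 + H) * w + H * (H * w)" for H w
    by (simp only: expand mpol_char2_rules)
  have c0: "peval (F 0 * F 0) P \<noteq> 0" using F0_ne by (simp add: peval_simps)
  have qp: "mp * mp \<in> N" if "mq * mq \<in> N"
  proof -
    have "(F 0 + F 3) * (F 0 + F 3) * (mp * mp) \<in> N" using transfer[OF st I(3)[OF that]] .
    then have "F 0 * F 0 * (mp * mp) \<in> N" unfolding sq[of _ "F 3"] using I(2,3) F3 by blast
    then show ?thesis by (rule cancel[OF c0])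
  qed
  have pq': "mq * mq \<in> N" if "mp * mp \<in> N"
  proof -
    have "(F 0 + F 1) * (F 0 + F 1) * (mq * mq) \<in> N"
      using transfer[OF st[unfolded add.commute[of "(F 0 + F 1) * _ * _"]] I(3)[OF that]] .
    then have "F 0 * F 0 * (mq * mq) \<in> N" unfolding sq[of _ "F 1"] using I(2,3) F1 by blast
    then show ?thesis by (rule cancel[OF c0])
  qed
  have "peval (F 1) P \<noteq> 0 \<or> peval (F 3) P \<noteq> 0"
  proof (rule ccontr)
    have rx: "(rot ^^ k) x \<in> cv (to_ac c)" using x by (simp add: cv_rot_pow)
    assume "\<not> ?thesis"
    then have "(rot ^^ k) x 1 = 0" "(rot ^^ k) x 3 = 0" by (simp_all add: P_def peval_FG)
    then show False using chart_equation[OF rx] cvD(2)[OF rx] x0 by auto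
  qed
  then show "mp * mp \<in> N" "mq * mq \<in> N" using cancel[OF _ F1] cancel[OF _ F3] qp pq' by blast+
qed

lemma D_square_subset:
  assumes "ma \<in> N" "mb \<in> N" and f: "f \<in> D n" and g: "g \<in> D n"
  shows "f * g \<in> N"
proof -
  note I = is_idealD[OF N]
  obtain h h' where h: "peval h P \<noteq> 0" "h * f \<in> L" "peval h' P \<noteq> 0" "h' * g \<in> L"
    using D_germ_L f g unfolding germ_def by blast
  have "(h * f) * (h' * g) \<in> N"
  proof (rule ideal_mult_gen[OF N _ h(2)[unfolded L_def] h(4)[unfolded L_def]])
    fix a b assume "a \<in> {mp, mq, mb} \<union> E" "b \<in> {mp, mq, mb} \<union> E"
    then show "a * b \<in> N"
      using squares_of_minors[OF assms(1,2)] I(3,4) assms(2) EN by (auto simp: mult.commute)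
  qed
  then have "(h * h') * (f * g) \<in> N" by (simp add: mult_ac)
  then show ?thesis using cancel[of "h * h'"] h by (simp add: peval_simps)
qed

text \<open>Conversely, the first relation puts a + b into N and the second one b, because F0, G0
  and c are units at the point.\<close>

lemma minors_in_D_square:
  assumes D2: "\<And>f g. f \<in> D n \<Longrightarrow> g \<in> D n \<Longrightarrow> f * g \<in> N"
  shows "ma \<in> N" "mb \<in> N"
proof -
  note I = is_idealD[OF N]
  have "mp \<in> D n" "mq \<in> D n" unfolding minor_defs by (rule minors_D)+
  then have pq: "mp * mq \<in> N" "mp * mp \<in> N" "mq * mq \<in> N" using D2 by blast+
  have "F 0 * G 0 * (ma + mb) \<in> N" using transfer[OF subsetD[OF EN relations(1)] pq(1)] .
  then have ab: "ma + mb \<in> N" using cancel[of "F 0 * G 0"] F0_ne G0_ne by (simp add: peval_simps)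
  have "scalar (to_ac c) * (F 0 ^ 3 * G 0 ^ 3) * mb \<in> N"
    by (rule transfer[OF subsetD[OF EN relations(2)]]) (rule pq I(2) I(3))+
  then show mb: "mb \<in> N"
    using cancel[of "scalar (to_ac c) * (F 0 ^ 3 * G 0 ^ 3)"] F0_ne G0_ne C0 by (simp add: peval_simps)
  then show "ma \<in> N" using transfer[of mb ma] ab by (simp add: add.commute)
qed

end

end

end

definition gens :: "(4 \<Rightarrow> 'r::comm_ring_1) \<Rightarrow> (4 \<Rightarrow> 'r) \<Rightarrow> 'r set" where
  "gens U V = {U 1 * V 3 + U 3 * V 1, U 0 * V 2 + U 2 * V 0}"

text \<open>Simultaneous rotation permutes the index pairs {1, 3} and {0, 2}, so the entries of a
  law look the same in every chart.\<close>

lemma gens_rot_pow: "gens ((rot ^^ k) U) ((rot ^^ k) V) = gens U V"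
  by (induction k) (auto simp: gens_def add.commute)

lemma ideal_power_2_iff:
  assumes "is_ideal N"
  shows "ideal_power J 2 \<subseteq> N \<longleftrightarrow> (\<forall>f\<in>J. \<forall>g\<in>J. f * g \<in> N)"
proof
  have 1: "J \<subseteq> ideal_power J (Suc 0)" using ideal_power_Suc_I[of _ J 1 0] by auto
  assume "ideal_power J 2 \<subseteq> N"
  then show "\<forall>f\<in>J. \<forall>g\<in>J. f * g \<in> N"
    using 1 ideal_power_Suc_I[of _ J _ "Suc 0"] unfolding numeral_2_eq_2 by blast
next
  assume *: "\<forall>f\<in>J. \<forall>g\<in>J. f * g \<in> N"
  have "f * g \<in> N" if f: "f \<in> J" and g: "g \<in> ideal_power J (Suc 0)" for f g
  proof -
    have "is_ideal {g. f * g \<in> N}"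
      using is_idealD[OF assms] by (auto simp: is_ideal_def distrib_left mult.left_commute)
    then have "ideal_power J (Suc 0) \<subseteq> {g. f * g \<in> N}"
      using * f is_idealD(4)[OF assms] by (intro ideal_power_Suc_minimal) (auto simp: mult.assoc[symmetric])
    then show ?thesis using g by blast
  qed
  then show "ideal_power J 2 \<subseteq> N"
    unfolding numeral_2_eq_2 by (intro ideal_power_Suc_minimal assms)
qed

lemma germ_eqI:
  fixes x :: "'v::finite \<Rightarrow> 'a::field"
  assumes "J \<subseteq> germ x K" "K \<subseteq> germ x J"
  shows "germ x J = germ x K"
  using germ_mono[OF assms(1), of x] germ_mono[OF assms(2), of x] by (simp add: germ_germ)

text \<open>On the translated diagonal both inclusions are proved in a chart. Off it both sides are
  the whole local ring: some entry of the law is nonzero by \<open>exceptional\<close>, and so is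
  the square of some minor that vanishes on the translate.\<close>

lemma germ_gens:
  assumes x: "x \<in> cv (to_ac c)" and y: "y \<in> cv (to_ac c)"
  shows "germ (case_sum x y) (ideal_gen (gens XX ((rot ^^ n) YY) \<union> E)) =
    germ (case_sum x y) (ideal_gen (ideal_power (D n) 2 \<union> E))"
    (is "germ ?P (ideal_gen ?A) = germ ?P (ideal_gen ?B)")
proof (cases "par x ((rot ^^ n) y)")
  case True
  obtain k where k: "(rot ^^ k) x 0 \<noteq> 0"
  proof -
    have "(rot ^^ 0) x 0 = x 0" "(rot ^^ 1) x 0 = x 3" "(rot ^^ 2) x 0 = x 2" "(rot ^^ 3) x 0 = x 1"
      by (simp_all add: eval_nat_numeral)
    then show ?thesis using that cvD(3)[OF x] by metis
  qed
  have gens: "gens XX ((rot ^^ n) YY) = {ma k n, mb k n}"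
    using gens_rot_pow[of k "XX :: 4 \<Rightarrow> (4 + 4, 'k alg_closure) mpol" "(rot ^^ n) YY"]
    unfolding gens_def ma_def mb_def F_def G_def by (simp add: funpow_add)
  have idl: "is_ideal (germ ?P (ideal_gen S))" for S
    by (rule is_ideal_germ[OF is_ideal_ideal_gen])
  have sup: "S \<subseteq> germ ?P (ideal_gen S)" for S
    using ideal_gen_superset germ_superset by (rule order_trans)
  have can: "f \<in> germ ?P (ideal_gen S)" if "peval h (P x y) \<noteq> 0" "h * f \<in> germ ?P (ideal_gen S)" for h f S
    using germ_cancel that unfolding P_def by blast
  have EN: "E \<subseteq> germ ?P (ideal_gen (S \<union> E))" for S using sup[of "S \<union> E"] by blast
  note hyps = x y True k
  have "ideal_power (D n) 2 \<subseteq> germ ?P (ideal_gen ?A)"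
    unfolding ideal_power_2_iff[OF idl]
  proof (intro ballI)
    fix f g assume fg: "f \<in> D n" "g \<in> D n"
    have m: "ma k n \<in> germ ?P (ideal_gen ?A)" "mb k n \<in> germ ?P (ideal_gen ?A)"
      using sup[of ?A] unfolding gens by blast+
    show "f * g \<in> germ ?P (ideal_gen ?A)"
      by (rule D_square_subset[OF hyps idl EN _ m fg]) (erule (1) can)
  qed
  moreover have "gens XX ((rot ^^ n) YY) \<subseteq> germ ?P (ideal_gen ?B)"
  proof -
    have *: "\<forall>f\<in>D n. \<forall>g\<in>D n. f * g \<in> germ ?P (ideal_gen ?B)"
      using sup[of ?B] by (subst ideal_power_2_iff[OF idl, symmetric]) blast
    have "ma k n \<in> germ ?P (ideal_gen ?B)"
      by (rule minors_in_D_square(1)[OF hyps idl EN]) (erule (1) can, use * in blast)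
    moreover have "mb k n \<in> germ ?P (ideal_gen ?B)"
      by (rule minors_in_D_square(2)[OF hyps idl EN]) (erule (1) can, use * in blast)
    ultimately show ?thesis unfolding gens by blast
  qed
  ultimately show ?thesis
    using sup[of ?A] sup[of ?B] by (intro germ_eqI ideal_gen_minimal idl) blast+
next
  case False
  define z where "z = (rot ^^ n) y"
  have z: "z \<in> cv (to_ac c)" using y by (simp add: z_def cv_rot_pow)
  have ev: "peval (XX i * (rot ^^ n) YY j + XX j * (rot ^^ n) YY i) ?P = x i * z j + x j * z i" for i j
    using peval_rot(1)[of 0 _ x y] by (simp add: peval_simps peval_rot z_def)
  have "x 1 * z 3 + x 3 * z 1 \<noteq> 0 \<or> x 0 * z 2 + x 2 * z 0 \<noteq> 0"
    using exceptional[OF x z] False by (auto simp: char2_sum0[OF two] z_def)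
  then have "\<exists>g\<in>gens XX ((rot ^^ n) YY). peval g ?P \<noteq> 0"
    by (simp add: gens_def ev)
  then have 1: "germ ?P (ideal_gen ?A) = UNIV"
    using germ_UNIV[OF is_ideal_ideal_gen] ideal_gen_base[of _ ?A] by blast
  obtain i j where ij: "x i * z j \<noteq> x j * z i" using False by (auto simp: par_def z_def)
  define f :: "(4 + 4, 'k alg_closure) mpol" where "f = XX i * (rot ^^ n) YY j + XX j * (rot ^^ n) YY i"
  have fP: "peval f ?P \<noteq> 0" using ij by (simp add: f_def ev char2_sum0[OF two])
  have fD: "f \<in> D n"
    unfolding D_iff
  proof (intro ballI impI)
    fix u v :: "4 \<Rightarrow> 'k alg_closure" assume "par u ((rot ^^ n) v)"
    then have "u i * (rot ^^ n) v j = u j * (rot ^^ n) v i" unfolding par_def by blast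
    then show "peval f (case_sum u v) = 0"
      unfolding f_def by (simp add: peval_simps peval_rot peval_rot(1)[of 0, simplified] char2)
  qed
  have "f * f \<in> ideal_power (D n) 2"
    using ideal_power_2_iff[OF is_ideal_ideal_power, of "D n" "D n" 2] fD by blast
  then have "germ ?P (ideal_gen ?B) = UNIV"
    using germ_UNIV[OF is_ideal_ideal_gen, of "f * f" ?B ?P] ideal_gen_base[of "f * f" ?B] fP
    by (simp add: peval_simps)
  then show ?thesis using 1 by simp
qed

section \<open>Translates of the diagonal by multiples of T\<close>

lemma isadd_times_T: "times_T c n \<in> curve c \<and> proj_eq (times_T c n) ((rot ^^ n) pt_O)"
proof (induction n)
  case 0
  show ?case using O_curve by (simp add: times_T_def proj_eq_refl)
next
  case (Suc n)
  have T: "pt_T \<in> curve c" using O_curve cv_rot[of pt_O] isadd_T[OF pt_O_cv] by (simp add: curve_eq isadd_def)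
  have e: "times_T c (Suc n) = mu c pt_T (times_T c n)" by (simp add: times_T_def)
  have "isadd (to_ac c) pt_T (times_T c n) (times_T c (Suc n))" using mu_isadd[OF T] Suc unfolding e by blast
  moreover have "isadd (to_ac c) pt_T (times_T c n) (rot (times_T c n))" using Suc isadd_T by (simp add: curve_eq)
  ultimately have "proj_eq (times_T c (Suc n)) (rot (times_T c n))" by (rule isadd_unique)
  moreover have "proj_eq (rot (times_T c n)) (rot ((rot ^^ n) pt_O))" using Suc proj_eq_rot by blast
  ultimately have "proj_eq (times_T c (Suc n)) ((rot ^^ Suc n) pt_O)" using proj_eq_trans by (metis funpow.simps(2) comp_apply)
  moreover have "times_T c (Suc n) \<in> curve c" unfolding e using mu_curve[OF T] Suc by blast
  ultimately show ?case by blast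
qed

lemma Delta_ideal_times_T: "Delta_ideal c (times_T c n) = D n"
proof -
  have "proj_eq x (mu c (times_T c n) y) \<longleftrightarrow> par x ((rot ^^ n) y)"
    if x: "x \<in> cv (to_ac c)" and y: "y \<in> cv (to_ac c)" for x y
  proof -
    have "isadd (to_ac c) ((rot ^^ n) pt_O) y ((rot ^^ n) y)"
      unfolding isadd_rot_pow by (rule isadd_commute[OF isadd_O[OF y]])
    then have "isadd (to_ac c) (times_T c n) y ((rot ^^ n) y)"
      using isadd_proj_eq proj_eq_refl proj_eq_sym isadd_times_T by blast
    moreover have "isadd (to_ac c) (times_T c n) y (mu c (times_T c n) y)"
      using mu_isadd isadd_times_T y by (simp add: curve_eq)
    ultimately have "proj_eq (mu c (times_T c n) y) ((rot ^^ n) y)" using isadd_unique by blast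
    then have "proj_eq x (mu c (times_T c n) y) \<longleftrightarrow> proj_eq x ((rot ^^ n) y)"
      using proj_eq_trans proj_eq_sym by blast
    then show ?thesis using par_iff_proj_eq[of x "(rot ^^ n) y"] x y cv_ne0 cv_rot_pow by blast
  qed
  then show ?thesis unfolding Delta_ideal_def diagonal_ideal_def curve_eq by (simp cong: conj_cong)
qed

lemma exceptional_divisor_gens:
  assumes "range (\<lambda>i. base_change (p i)) = gens XX ((rot ^^ n) YY)"
  shows "exceptional_divisor c p = multiple_Delta c 2 (times_T c n)"
  unfolding exceptional_divisor_def multiple_Delta_def subscheme_def assms Delta_ideal_times_T
  by (rule restrict_ext) (auto simp: curve_eq germ_gens)

text \<open>n is the number of rotations of y that turns the minors for the opposite index pairs
  into the entries of the law.\<close>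

lemma exceptional_divisor_law:
  "exceptional_divisor c (Ua XX YY) = multiple_Delta c 2 (times_T c 3)"
  "exceptional_divisor c (Ub XX YY) = multiple_Delta c 2 (times_T c 1)"
  "exceptional_divisor c (Va XX YY) = multiple_Delta c 2 (times_T c 2)"
  "exceptional_divisor c (Vb XX YY) = multiple_Delta c 2 (times_T c 0)"
proof -
  have b: "base_change (XX i) = XX i" "base_change (YY i) = YY i" for i
    by (simp_all add: XX_def YY_def base_change_simps)
  have r: "range f = {f 0, f 1}" for f :: "2 \<Rightarrow> 'z"
  proof -
    have "\<forall>i. f i \<in> {f 0, f 1}" unfolding all2 by simp
    then show ?thesis by blast
  qed
  note s = r law_defs gens_def b ring_hom_map_simps[OF ring_hom_map_base_change] eval_nat_numeral
  show "exceptional_divisor c (Ua XX YY) = multiple_Delta c 2 (times_T c 3)"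
    by (rule exceptional_divisor_gens) (auto simp: s add.commute)
  show "exceptional_divisor c (Ub XX YY) = multiple_Delta c 2 (times_T c 1)"
    by (rule exceptional_divisor_gens) (auto simp: s add.commute)
  show "exceptional_divisor c (Va XX YY) = multiple_Delta c 2 (times_T c 2)"
    by (rule exceptional_divisor_gens) (auto simp: s add.commute)
  show "exceptional_divisor c (Vb XX YY) = multiple_Delta c 2 (times_T c 0)"
    by (rule exceptional_divisor_gens) (auto simp: s add.commute)
qed

end

theorem theorem14:
  fixes c :: "'k::field"
  assumes "CHAR('k) = 2" and "elliptic c"
  shows
    "let B1 = [pair (XX 0 * YY 3 + XX 2 * YY 1) (XX 1 * YY 0 + XX 3 * YY 2),
               pair (XX 1 * YY 2 + XX 3 * YY 0) (XX 0 * YY 1 + XX 2 * YY 3)];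
         B2 = [pair (XX 0 * YY 0 + XX 2 * YY 2) (XX 1 * YY 1 + XX 3 * YY 3),
               pair (XX 1 * YY 3 + XX 3 * YY 1) (XX 0 * YY 2 + XX 2 * YY 0)];
         V1 = law_space c 1 (\<lambda>P Q. pi1 (mu c P Q));
         V2 = law_space c 1 (\<lambda>P Q. pi2 (mu c P Q))
     in basis_mod c V1 B1 \<and> basis_mod c V2 B2 \<and>
        (\<forall>p\<in>V1. \<forall>q\<in>V2. \<not> zero_tuple c p \<longrightarrow> \<not> zero_tuple c q \<longrightarrow>
           addition_law c 2 (mu c) (skew_segre p q)) \<and>
        spans_mod c (law_space c 2 (mu c)) [skew_segre b b'. b \<leftarrow> B1, b' \<leftarrow> B2] \<and>
        (\<forall>b\<in>set (B1 @ B2). \<exists>n\<le>3. exceptional_divisor c b = multiple_Delta c 2 (times_T c n))"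
proof -
  interpret z4_curve c
    using assms elliptic_nonzero by unfold_locales
  have U: "pair (XX 0 * YY 3 + XX 2 * YY 1) (XX 1 * YY 0 + XX 3 * YY 2) = Ulaw False XX YY"
    "pair (XX 1 * YY 2 + XX 3 * YY 0) (XX 0 * YY 1 + XX 2 * YY 3) = Ulaw True XX YY"
    and V: "pair (XX 0 * YY 0 + XX 2 * YY 2) (XX 1 * YY 1 + XX 3 * YY 3) = Vlaw False XX YY"
    "pair (XX 1 * YY 3 + XX 3 * YY 1) (XX 0 * YY 2 + XX 2 * YY 0) = Vlaw True XX YY"
    by (simp_all add: Ulaw_def Vlaw_def law_defs)
  have "\<exists>n\<le>3. exceptional_divisor c b = multiple_Delta c 2 (times_T c n)"
    if "b \<in> set (BU @ BV)" for b
  proof -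
    have "\<exists>n\<in>{0, 1, 2, 3}. exceptional_divisor c b = multiple_Delta c 2 (times_T c n)"
      using that exceptional_divisor_law by (auto simp: Ulaw_def Vlaw_def)
    moreover have "\<forall>n\<in>{0, 1, 2, 3::nat}. n \<le> 3" by simp
    ultimately show ?thesis by blast
  qed
  moreover have "[skew_segre b b'. b \<leftarrow> BU, b' \<leftarrow> BV]
    = [law False False XX YY, law False True XX YY, law True False XX YY, law True True XX YY]"
    by (simp add: law_def)
  ultimately show ?thesis
    unfolding Let_def U V using basis_U basis_V skew_segre_addition_law spans_law2 by (intro conjI ballI impI) (simp_all only:)
qed

end
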